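(* Assume that the transition density is bounded from above: $m(x,x')\le\sigma_+$ for all $(x,x')\in\mathbb X\times\mathbb X$. For $s\in\{0,\dots,T-1\}$, let $Z_s^N$ be the number of simulations (index proposals) required in the accept–reject procedure at time $s$ of the fast FFBSi algorithm in order to draw $J_s^1,\dots,J_s^N$. (i) For the bootstrap auxiliary filter, $Z_s^N/N$ converges in probability, as $N\to\infty$, to $$\alpha(s)=\sigma_+\,\phi_{s|s-1}(g_s)\,\frac{\int\cdots\int g_{s+1}(x_{s+1})\,dx_{s+1}\prod_{u=s+2}^TM(x_{u-1},dx_u)g_u(x_u)}{\int\cdots\int\phi_{s|s-1}(dx_s)\,g_s(x_s)\prod_{u=s+1}^TM(x_{u-1},dx_u)g_u(x_u)} .$$ (ii) In the fully adapted case, $Z_s^N/N$ converges in probability, as $N\to\infty$, to $$\beta(s)=\sigma_+\,\frac{\int\cdots\int g_{s+1}(x_{s+1})\,dx_{s+1}\prod_{u=s+2}^TM(x_{u-1},dx_u)g_u(x_u)}{\int\cdots\int\phi_s(dx_s)\prod_{u=s+1}^TM(x_{u-1},dx_u)g_u(x_u)} .$$ A sufficient condition ensuring finiteness of $\alpha(s)$ and $\beta(s)$ is that $\int g_u(x_u)\,dx_u<\infty$ for all $u\ge0$.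
   Context: Model. $\mathbb X$, $\mathbb Y$ are Polish spaces with Borel $\sigma$-algebras. $\chi$ is a probability measure on $\mathbb X$ (initial law), $M$ is a Markov kernel on $\mathbb X$ with transition density $m$ with respect to a $\sigma$-finite measure $\nu$: $M(x,dx')=m(x,x')\,dx'$, where $dx'$ stands for $\nu(dx')$. $g:\mathbb X\times\mathbb Y\to[0,\infty)$ is the likelihood; the observations $y_0,\dots,y_T$ are fixed and $g_t(x)=g(x,y_t)$. It is assumed that $\int\cdots\int\chi(dx_0)\prod_{u=1}^Tg_{u-1}(x_{u-1})M(x_{u-1},dx_u)g_T(x_T)>0$. The filter distribution is $\phi_t(f)=\frac{\int\cdots\int\chi(dx_0)\prod_{u=1}^tg_{u-1}(x_{u-1})M(x_{u-1},dx_u)g_t(x_t)f(x_t)}{\int\cdots\int\chi(dx_0)\prod_{u=1}^tg_{u-1}(x_{u-1})M(x_{u-1},dx_u)g_t(x_t)}$, and $\phi_{s|s-1}=\phi_{s-1}M$ is the one-step predictive distribution (with $\phi_{0|-1}=\chi$). Particle filter. Let $\rho_0$ be a probability measure with $\chi\ll\rho_0$; for $t\ge1$ let $\vartheta_t:\mathbb X\to(0,\infty)$ and let $P_t$ be a Markov kernel with density $p_t$ with respect to $\nu$. For each $N$: $\xi_0^1,\dots,\xi_0^N$ are i.i.d. with law $\rho_0$, with weights $\omega_0^i=\frac{d\chi}{d\rho_0}(\xi_0^i)g_0(\xi_0^i)$; for $t\ge1$, conditionally on the past, the pairs $(I_t^i,\xi_t^i)$, $1\le i\le N$, are i.i.d.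 with law proportional to $(j,dx)\mapsto\omega_{t-1}^j\vartheta_t(\xi_{t-1}^j)P_t(\xi_{t-1}^j,dx)$, with weights $\omega_t^i=\frac{m(\xi_{t-1}^{I_t^i},\xi_t^i)g_t(\xi_t^i)}{\vartheta_t(\xi_{t-1}^{I_t^i})p_t(\xi_{t-1}^{I_t^i},\xi_t^i)}$. The bootstrap filter is the choice $\vartheta_t\equiv1$, $p_t=m$ (so $\omega_t^i=g_t(\xi_t^i)$), with $\rho_0=\chi$. The fully adapted filter is the choice $\vartheta_t(x)=\int m(x,x')g_t(x')\,dx'$, $p_t(x,x')=m(x,x')g_t(x')/\vartheta_t(x)$ (so all weights at time $t$ are equal), with $\rho_0\propto\chi g_0$. Fast FFBSi algorithm. After the forward pass, draw $J_T^1,\dots,J_T^N$ i.i.d. from $\{1,\dots,N\}$ with probabilities proportional to $(\omega_T^i)_i$. Then for $s=T-1,\dots,0$ and each $\ell\in\{1,\dots,N\}$ independently: repeatedly propose an index $I\in\{1,\dots,N\}$ drawn with probability proportional to $(\omega_s^i)_i$ and an independent uniform $U$ on $[0,1]$, until $U\le m(\xi_s^I,\xi_{s+1}^{J_{s+1}^\ell})/\sigma_+$; then set $J_s^\ell=I$. $Z_s^N$ is the total number of proposals made at time $s$ over all $\ell=1,\dots,N$.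
   Formalization: For (i) and (ii) it is also assumed that φ_s(m(·,x_{s+1})) > 0 for almost every x_{s+1} at which the numerator's integrand is positive (e.g. m > 0), without which the limits can be wrong; the normalizing constants of φ_t, t ≤ T, are assumed finite. *)

theory Defs
  imports "HOL-Probability.Probability"
begin

section \<open>The hidden Markov model\<close>

definition obs_lik :: "('x \<Rightarrow> 'y \<Rightarrow> real) \<Rightarrow> (nat \<Rightarrow> 'y) \<Rightarrow> nat \<Rightarrow> 'x \<Rightarrow> real" where
  "obs_lik g y t x = g x (y t)"

definition trans_kernel :: "'x measure \<Rightarrow> ('x \<Rightarrow> 'x \<Rightarrow> real) \<Rightarrow> 'x \<Rightarrow> 'x measure" where
  "trans_kernel \<nu> m x = density \<nu> (\<lambda>x'. ennreal (m x x'))"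

text \<open>\<^term>\<open>path_int M G s n f\<close> maps $x_s$ to
  $\int\cdots\int \prod_{u=s+1}^{s+n} M(x_{u-1},dx_u)\, G_u(x_u)\, f(x_{s+n})$.\<close>

primrec path_int ::
    "('x \<Rightarrow> 'x measure) \<Rightarrow> (nat \<Rightarrow> 'x \<Rightarrow> real) \<Rightarrow> nat \<Rightarrow> nat \<Rightarrow> ('x \<Rightarrow> ennreal) \<Rightarrow> 'x \<Rightarrow> ennreal" where
  "path_int M G s 0 f x = f x"
| "path_int M G s (Suc n) f x =
     (\<integral>\<^sup>+ x'. ennreal (G (Suc s) x') * path_int M G (Suc s) n f x' \<partial>M x)"

definition unnorm_filter ::
    "'x measure \<Rightarrow> ('x \<Rightarrow> 'x measure) \<Rightarrow> (nat \<Rightarrow> 'x \<Rightarrow> real) \<Rightarrow> nat \<Rightarrow> ('x \<Rightarrow> ennreal) \<Rightarrow> ennreal" where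
  "unnorm_filter \<chi>0 M G t f = (\<integral>\<^sup>+ x. ennreal (G 0 x) * path_int M G 0 t f x \<partial>\<chi>0)"

text \<open>Filter and one-step predictor are given as functionals, $f \mapsto \phi_t(f)$ and
  $f \mapsto \phi_{t|t-1}(f)$, on nonnegative functions.\<close>

definition filter_dist ::
    "'x measure \<Rightarrow> ('x \<Rightarrow> 'x measure) \<Rightarrow> (nat \<Rightarrow> 'x \<Rightarrow> real) \<Rightarrow> nat \<Rightarrow> ('x \<Rightarrow> ennreal) \<Rightarrow> ennreal" where
  "filter_dist \<chi>0 M G t f = unnorm_filter \<chi>0 M G t f / unnorm_filter \<chi>0 M G t (\<lambda>_. 1)"

fun pred_dist ::
    "'x measure \<Rightarrow> ('x \<Rightarrow> 'x measure) \<Rightarrow> (nat \<Rightarrow> 'x \<Rightarrow> real) \<Rightarrow> nat \<Rightarrow> ('x \<Rightarrow> ennreal) \<Rightarrow> ennreal" where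
  "pred_dist \<chi>0 M G 0 f = (\<integral>\<^sup>+ x. f x \<partial>\<chi>0)"
| "pred_dist \<chi>0 M G (Suc t) f = filter_dist \<chi>0 M G t (\<lambda>x. \<integral>\<^sup>+ x'. f x' \<partial>M x)"

text \<open>\<open>evidence_finite\<close> is implicit in \<^const>\<open>filter_dist\<close> being a probability distribution.\<close>

locale hidden_markov_model =
  fixes \<chi>0 \<nu> :: "'x::polish_space measure"
    and m :: "'x \<Rightarrow> 'x \<Rightarrow> real"
    and g :: "'x \<Rightarrow> 'y::polish_space \<Rightarrow> real"
    and y :: "nat \<Rightarrow> 'y"
    and T :: nat
  assumes init_prob: "prob_space \<chi>0"
    and init_sets: "sets \<chi>0 = sets borel"
    and dom_sigma_finite: "sigma_finite_measure \<nu>"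
    and dom_sets: "sets \<nu> = sets borel"
    and trans_measurable: "(\<lambda>(x, x'). m x x') \<in> borel_measurable (borel \<Otimes>\<^sub>M borel)"
    and trans_nonneg: "\<And>x x'. 0 \<le> m x x'"
    and trans_mass: "\<And>x. (\<integral>\<^sup>+ x'. ennreal (m x x') \<partial>\<nu>) = 1"
    and lik_measurable: "(\<lambda>(x, z). g x z) \<in> borel_measurable (borel \<Otimes>\<^sub>M borel)"
    and lik_nonneg: "\<And>x z. 0 \<le> g x z"
    and evidence_pos: "0 < unnorm_filter \<chi>0 (trans_kernel \<nu> m) (obs_lik g y) T (\<lambda>_. 1)"
    and evidence_finite:
      "\<And>t. t \<le> T \<Longrightarrow> unnorm_filter \<chi>0 (trans_kernel \<nu> m) (obs_lik g y) t (\<lambda>_. 1) < \<infinity>"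

section \<open>Conditionally i.i.d. draws\<close>

definition law_prop_to :: "'b measure \<Rightarrow> ('b \<Rightarrow> ennreal) \<Rightarrow> 'b measure" where
  "law_prop_to \<mu> f = density \<mu> (\<lambda>z. f z / (\<integral>\<^sup>+ z'. f z' \<partial>\<mu>))"

text \<open>Conditionally on the $\sigma$-algebra \<open>F\<close>, the family $(X_i)_{i \in K}$ is i.i.d. with law
  proportional to the random measure \<open>f w \<cdot> \<mu>\<close>. Nothing is prescribed on the event that
  this measure is zero (all importance weights vanish), where no such law exists.\<close>

definition cond_iid_prop_to ::
    "'w measure \<Rightarrow> 'w measure \<Rightarrow> 'i set \<Rightarrow> ('i \<Rightarrow> 'w \<Rightarrow> 'b) \<Rightarrow> 'b measure \<Rightarrow> ('w \<Rightarrow> 'b \<Rightarrow> ennreal) \<Rightarrow> bool" where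
  "cond_iid_prop_to W F K X \<mu> f \<longleftrightarrow>
     (\<forall>i\<in>K. X i \<in> measurable W \<mu>) \<and>
     (\<forall>K' A. finite K' \<and> K' \<subseteq> K \<and> (\<forall>i\<in>K'. A i \<in> sets \<mu>) \<longrightarrow>
        (AE w in W. 0 < (\<integral>\<^sup>+ z. f w z \<partial>\<mu>) \<longrightarrow>
           real_cond_exp W F (indicat_real {v \<in> space W. \<forall>i\<in>K'. X i v \<in> A i}) w
             = (\<Prod>i\<in>K'. measure (law_prop_to \<mu> (f w)) (A i))))"

section \<open>The auxiliary particle filter\<close>

text \<open>Particles are indexed by \<open>{..<N}\<close>; \<open>\<xi> t i\<close> is the \<open>i\<close>-th particle at time \<open>t\<close> and
  \<open>I t i\<close> (used for \<open>t \<ge> 1\<close> only) the index of its ancestor at time \<open>t - 1\<close>.\<close>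

fun weight ::
    "'x measure \<Rightarrow> ('x \<Rightarrow> 'x \<Rightarrow> real) \<Rightarrow> (nat \<Rightarrow> 'x \<Rightarrow> real) \<Rightarrow>
     'x measure \<Rightarrow> (nat \<Rightarrow> 'x \<Rightarrow> real) \<Rightarrow> (nat \<Rightarrow> 'x \<Rightarrow> 'x \<Rightarrow> real) \<Rightarrow>
     (nat \<Rightarrow> nat \<Rightarrow> 'w \<Rightarrow> 'x) \<Rightarrow> (nat \<Rightarrow> nat \<Rightarrow> 'w \<Rightarrow> nat) \<Rightarrow> nat \<Rightarrow> nat \<Rightarrow> 'w \<Rightarrow> real" where
  "weight \<chi>0 m G \<rho>0 \<theta> p \<xi> I 0 i w = enn2real (RN_deriv \<rho>0 \<chi>0 (\<xi> 0 i w)) * G 0 (\<xi> 0 i w)"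
| "weight \<chi>0 m G \<rho>0 \<theta> p \<xi> I (Suc t) i w =
     (let x = \<xi> t (I (Suc t) i w) w; x' = \<xi> (Suc t) i w
      in m x x' * G (Suc t) x' / (\<theta> (Suc t) x * p (Suc t) x x'))"

text \<open>The $\sigma$-algebra generated by the particles at times \<open>< t\<close> and their ancestor indices.\<close>

definition forward_hist ::
    "nat \<Rightarrow> 'w measure \<Rightarrow> (nat \<Rightarrow> nat \<Rightarrow> 'w \<Rightarrow> 'x::topological_space) \<Rightarrow>
     (nat \<Rightarrow> nat \<Rightarrow> 'w \<Rightarrow> nat) \<Rightarrow> nat \<Rightarrow> 'w measure" where
  "forward_hist N W \<xi> I t = sigma (space W)
     ({\<xi> u i -` A \<inter> space W | u i A. u < t \<and> i < N \<and> A \<in> sets borel} \<union>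
      {I u i -` A \<inter> space W | u i A. 0 < u \<and> u < t \<and> i < N})"

locale auxiliary_particle_filter =
  hidden_markov_model \<chi>0 \<nu> m g y T + prob_space W
  for \<chi>0 \<nu> :: "'x::polish_space measure"
    and m :: "'x \<Rightarrow> 'x \<Rightarrow> real"
    and g :: "'x \<Rightarrow> 'y::polish_space \<Rightarrow> real"
    and y :: "nat \<Rightarrow> 'y"
    and T :: nat
    and \<rho>0 :: "'x measure"
    and \<theta> :: "nat \<Rightarrow> 'x \<Rightarrow> real"
    and p :: "nat \<Rightarrow> 'x \<Rightarrow> 'x \<Rightarrow> real"
    and N :: nat
    and W :: "'w measure"
    and \<xi> :: "nat \<Rightarrow> nat \<Rightarrow> 'w \<Rightarrow> 'x"
    and I :: "nat \<Rightarrow> nat \<Rightarrow> 'w \<Rightarrow> nat" +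
  assumes instr_prob: "prob_space \<rho>0"
    and instr_sets: "sets \<rho>0 = sets borel"
    and instr_dominates: "absolutely_continuous \<rho>0 \<chi>0"
    and adj_measurable: "\<And>t. \<lbrakk>1 \<le> t; t \<le> T\<rbrakk> \<Longrightarrow> \<theta> t \<in> borel_measurable borel"
    and adj_pos: "\<And>t x. \<lbrakk>1 \<le> t; t \<le> T\<rbrakk> \<Longrightarrow> 0 < \<theta> t x"
    and prop_measurable:
      "\<And>t. \<lbrakk>1 \<le> t; t \<le> T\<rbrakk> \<Longrightarrow> (\<lambda>(x, x'). p t x x') \<in> borel_measurable (borel \<Otimes>\<^sub>M borel)"
    and prop_nonneg: "\<And>t x x'. \<lbrakk>1 \<le> t; t \<le> T\<rbrakk> \<Longrightarrow> 0 \<le> p t x x'"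
    and prop_mass: "\<And>t x. \<lbrakk>1 \<le> t; t \<le> T\<rbrakk> \<Longrightarrow> (\<integral>\<^sup>+ x'. ennreal (p t x x') \<partial>\<nu>) = 1"
    and init_indep: "indep_vars (\<lambda>_. borel) (\<xi> 0) {..<N}"
    and init_law: "\<And>i. i < N \<Longrightarrow> distr W borel (\<xi> 0 i) = \<rho>0"
    and step: "\<And>t. \<lbrakk>1 \<le> t; t \<le> T\<rbrakk> \<Longrightarrow>
      cond_iid_prop_to W (forward_hist N W \<xi> I t) {..<N} (\<lambda>i w. (I t i w, \<xi> t i w))
        (count_space {..<N} \<Otimes>\<^sub>M \<nu>)
        (\<lambda>w (j, x). ennreal (weight \<chi>0 m (obs_lik g y) \<rho>0 \<theta> p \<xi> I (t - 1) j w
           * \<theta> t (\<xi> (t - 1) j w) * p t (\<xi> (t - 1) j w) x))"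

section \<open>The fast FFBSi algorithm\<close>

text \<open>\<open>J s l\<close> is the index drawn at time \<open>s\<close> for trajectory \<open>l < N\<close>; \<open>V s l k\<close> and \<open>U s l k\<close> are
  the \<open>k\<close>-th proposed index (counting from 0) and the \<open>k\<close>-th uniform variable used to draw it.
  For convenience the proposals form an infinite sequence, of which the algorithm only
  looks at the entries up to the first accepted one.\<close>

definition accepted ::
    "('x \<Rightarrow> 'x \<Rightarrow> real) \<Rightarrow> real \<Rightarrow> (nat \<Rightarrow> nat \<Rightarrow> 'w \<Rightarrow> 'x) \<Rightarrow> (nat \<Rightarrow> nat \<Rightarrow> 'w \<Rightarrow> nat) \<Rightarrow>
     (nat \<Rightarrow> nat \<Rightarrow> nat \<Rightarrow> 'w \<Rightarrow> nat) \<Rightarrow> (nat \<Rightarrow> nat \<Rightarrow> nat \<Rightarrow> 'w \<Rightarrow> real) \<Rightarrow> nat \<Rightarrow> nat \<Rightarrow> nat \<Rightarrow> 'w \<Rightarrow> bool" where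
  "accepted m \<sigma> \<xi> J V U s l k w \<longleftrightarrow>
     U s l k w \<le> m (\<xi> s (V s l k w) w) (\<xi> (Suc s) (J (Suc s) l w) w) / \<sigma>"

text \<open>The infimum is \<open>\<infinity>\<close> if no proposal is ever accepted.\<close>

definition trials ::
    "('x \<Rightarrow> 'x \<Rightarrow> real) \<Rightarrow> real \<Rightarrow> (nat \<Rightarrow> nat \<Rightarrow> 'w \<Rightarrow> 'x) \<Rightarrow> (nat \<Rightarrow> nat \<Rightarrow> 'w \<Rightarrow> nat) \<Rightarrow>
     (nat \<Rightarrow> nat \<Rightarrow> nat \<Rightarrow> 'w \<Rightarrow> nat) \<Rightarrow> (nat \<Rightarrow> nat \<Rightarrow> nat \<Rightarrow> 'w \<Rightarrow> real) \<Rightarrow> nat \<Rightarrow> nat \<Rightarrow> 'w \<Rightarrow> enat" where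
  "trials m \<sigma> \<xi> J V U s l w = (INF k \<in> {k. accepted m \<sigma> \<xi> J V U s l k w}. enat (Suc k))"

definition total_trials ::
    "nat \<Rightarrow> ('x \<Rightarrow> 'x \<Rightarrow> real) \<Rightarrow> real \<Rightarrow> (nat \<Rightarrow> nat \<Rightarrow> 'w \<Rightarrow> 'x) \<Rightarrow> (nat \<Rightarrow> nat \<Rightarrow> 'w \<Rightarrow> nat) \<Rightarrow>
     (nat \<Rightarrow> nat \<Rightarrow> nat \<Rightarrow> 'w \<Rightarrow> nat) \<Rightarrow> (nat \<Rightarrow> nat \<Rightarrow> nat \<Rightarrow> 'w \<Rightarrow> real) \<Rightarrow> nat \<Rightarrow> 'w \<Rightarrow> enat" where
  "total_trials N m \<sigma> \<xi> J V U s w = (\<Sum>l<N. trials m \<sigma> \<xi> J V U s l w)"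

text \<open>The $\sigma$-algebra of the forward pass and of everything drawn by the backward pass
  before it reaches time \<open>s\<close>.\<close>

definition backward_hist ::
    "nat \<Rightarrow> 'w measure \<Rightarrow> nat \<Rightarrow> (nat \<Rightarrow> nat \<Rightarrow> 'w \<Rightarrow> 'x::topological_space) \<Rightarrow>
     (nat \<Rightarrow> nat \<Rightarrow> 'w \<Rightarrow> nat) \<Rightarrow> (nat \<Rightarrow> nat \<Rightarrow> 'w \<Rightarrow> nat) \<Rightarrow>
     (nat \<Rightarrow> nat \<Rightarrow> nat \<Rightarrow> 'w \<Rightarrow> nat) \<Rightarrow> (nat \<Rightarrow> nat \<Rightarrow> nat \<Rightarrow> 'w \<Rightarrow> real) \<Rightarrow> nat \<Rightarrow> 'w measure" where
  "backward_hist N W T \<xi> I J V U s = sigma (space W)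
     (sets (forward_hist N W \<xi> I (Suc T)) \<union>
      {J u l -` A \<inter> space W | u l A. s < u \<and> u \<le> T \<and> l < N} \<union>
      {V u l k -` A \<inter> space W | u l k A. s < u \<and> u < T \<and> l < N} \<union>
      {U u l k -` A \<inter> space W | u l k A. s < u \<and> u < T \<and> l < N \<and> A \<in> sets borel})"

locale fast_ffbsi =
  auxiliary_particle_filter \<chi>0 \<nu> m g y T \<rho>0 \<theta> p N W \<xi> I
  for \<chi>0 \<nu> :: "'x::polish_space measure"
    and m :: "'x \<Rightarrow> 'x \<Rightarrow> real"
    and g :: "'x \<Rightarrow> 'y::polish_space \<Rightarrow> real"
    and y :: "nat \<Rightarrow> 'y"
    and T :: nat
    and \<sigma> :: real
    and \<rho>0 :: "'x measure"
    and \<theta> :: "nat \<Rightarrow> 'x \<Rightarrow> real"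
    and p :: "nat \<Rightarrow> 'x \<Rightarrow> 'x \<Rightarrow> real"
    and N :: nat
    and W :: "'w measure"
    and \<xi> :: "nat \<Rightarrow> nat \<Rightarrow> 'w \<Rightarrow> 'x"
    and I :: "nat \<Rightarrow> nat \<Rightarrow> 'w \<Rightarrow> nat"
    and J :: "nat \<Rightarrow> nat \<Rightarrow> 'w \<Rightarrow> nat"
    and V :: "nat \<Rightarrow> nat \<Rightarrow> nat \<Rightarrow> 'w \<Rightarrow> nat"
    and U :: "nat \<Rightarrow> nat \<Rightarrow> nat \<Rightarrow> 'w \<Rightarrow> real" +
  assumes terminal:
      "cond_iid_prop_to W (forward_hist N W \<xi> I (Suc T)) {..<N} (J T) (count_space {..<N})
         (\<lambda>w j. ennreal (weight \<chi>0 m (obs_lik g y) \<rho>0 \<theta> p \<xi> I T j w))"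
    and proposals: "\<And>s. s < T \<Longrightarrow>
      cond_iid_prop_to W (backward_hist N W T \<xi> I J V U s) ({..<N} \<times> UNIV)
         (\<lambda>(l, k) w. (V s l k w, U s l k w))
         (count_space {..<N} \<Otimes>\<^sub>M uniform_measure lborel {0..1})
         (\<lambda>w (j, _). ennreal (weight \<chi>0 m (obs_lik g y) \<rho>0 \<theta> p \<xi> I s j w))"
    and index_measurable: "\<And>s l. \<lbrakk>s < T; l < N\<rbrakk> \<Longrightarrow> J s l \<in> measurable W (count_space {..<N})"
    and index_accepted: "\<And>s l k w. \<lbrakk>s < T; l < N; w \<in> space W;
      trials m \<sigma> \<xi> J V U s l w = enat (Suc k)\<rbrakk> \<Longrightarrow> J s l w = V s l k w"

section \<open>The fully adapted choice\<close>

text \<open>If the integral diverges, the Bochner integral is 0 and \<open>adj_pos\<close> rules out the choice.\<close>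

definition fa_adj ::
    "'x measure \<Rightarrow> ('x \<Rightarrow> 'x \<Rightarrow> real) \<Rightarrow> (nat \<Rightarrow> 'x \<Rightarrow> real) \<Rightarrow> nat \<Rightarrow> 'x \<Rightarrow> real" where
  "fa_adj \<nu> m G t x = (\<integral> x'. m x x' * G t x' \<partial>\<nu>)"

definition fa_prop ::
    "'x measure \<Rightarrow> ('x \<Rightarrow> 'x \<Rightarrow> real) \<Rightarrow> (nat \<Rightarrow> 'x \<Rightarrow> real) \<Rightarrow> nat \<Rightarrow> 'x \<Rightarrow> 'x \<Rightarrow> real" where
  "fa_prop \<nu> m G t x x' = m x x' * G t x' / fa_adj \<nu> m G t x"

definition fa_init :: "'x measure \<Rightarrow> (nat \<Rightarrow> 'x \<Rightarrow> real) \<Rightarrow> 'x measure" where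
  "fa_init \<chi>0 G = law_prop_to \<chi>0 (\<lambda>x. ennreal (G 0 x))"

section \<open>Limits\<close>

definition conv_in_prob ::
    "(nat \<Rightarrow> 'w measure) \<Rightarrow> (nat \<Rightarrow> 'w \<Rightarrow> 'a::topological_space) \<Rightarrow> 'a \<Rightarrow> bool" where
  "conv_in_prob W X c \<longleftrightarrow>
     (\<forall>S. open S \<and> c \<in> S \<longrightarrow>
        (\<lambda>N. measure (W N) {w \<in> space (W N). X N w \<in> S}) \<longlonglongrightarrow> 1)"

text \<open>$\int\cdots\int g_{s+1}(x_{s+1})\,dx_{s+1} \prod_{u=s+2}^T M(x_{u-1},dx_u)\, g_u(x_u)$\<close>

definition backward_mass ::
    "'x measure \<Rightarrow> ('x \<Rightarrow> 'x \<Rightarrow> real) \<Rightarrow> (nat \<Rightarrow> 'x \<Rightarrow> real) \<Rightarrow> nat \<Rightarrow> nat \<Rightarrow> ennreal" where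
  "backward_mass \<nu> m G T s =
     (\<integral>\<^sup>+ x. ennreal (G (Suc s) x) *
        path_int (trans_kernel \<nu> m) G (Suc s) (T - Suc s) (\<lambda>_. 1) x \<partial>\<nu>)"

definition alpha ::
    "'x measure \<Rightarrow> 'x measure \<Rightarrow> ('x \<Rightarrow> 'x \<Rightarrow> real) \<Rightarrow> (nat \<Rightarrow> 'x \<Rightarrow> real) \<Rightarrow> nat \<Rightarrow> real \<Rightarrow> nat \<Rightarrow> ennreal" where
  "alpha \<chi>0 \<nu> m G T \<sigma> s =
     (let M = trans_kernel \<nu> m in
      ennreal \<sigma> * pred_dist \<chi>0 M G s (\<lambda>x. ennreal (G s x)) *
      (backward_mass \<nu> m G T s /
       pred_dist \<chi>0 M G s (\<lambda>x. ennreal (G s x) * path_int M G s (T - s) (\<lambda>_. 1) x)))"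

definition beta ::
    "'x measure \<Rightarrow> 'x measure \<Rightarrow> ('x \<Rightarrow> 'x \<Rightarrow> real) \<Rightarrow> (nat \<Rightarrow> 'x \<Rightarrow> real) \<Rightarrow> nat \<Rightarrow> real \<Rightarrow> nat \<Rightarrow> ennreal" where
  "beta \<chi>0 \<nu> m G T \<sigma> s =
     (let M = trans_kernel \<nu> m in
      ennreal \<sigma> *
      (backward_mass \<nu> m G T s /
       filter_dist \<chi>0 M G s (path_int M G s (T - s) (\<lambda>_. 1))))"

text \<open>Up to a \<open>\<nu>\<close>-null set, the predictive density $x' \mapsto \phi_s(m(\cdot,x'))$ of $\phi_{s+1|s}$ is
  positive wherever the integrand of \<^const>\<open>backward_mass\<close> is (for instance because \<open>m > 0\<close>).
  Points violating this contribute to \<^const>\<open>backward_mass\<close>, although they are reached neither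
  by the chain nor by the particles.\<close>

definition predictive_support ::
    "'x measure \<Rightarrow> 'x measure \<Rightarrow> ('x \<Rightarrow> 'x \<Rightarrow> real) \<Rightarrow> (nat \<Rightarrow> 'x \<Rightarrow> real) \<Rightarrow> nat \<Rightarrow> nat \<Rightarrow> bool" where
  "predictive_support \<chi>0 \<nu> m G T s \<longleftrightarrow>
     (AE x' in \<nu>.
        0 < ennreal (G (Suc s) x') *
            path_int (trans_kernel \<nu> m) G (Suc s) (T - Suc s) (\<lambda>_. 1) x' \<longrightarrow>
        0 < filter_dist \<chi>0 (trans_kernel \<nu> m) G s (\<lambda>x. ennreal (m x x')))"

end

(* Weight all expectations by the evidence estimate H of the particle filter, the product over time of the
   average proposal masses. Under this weighting the filter is exactly unbiased for the unnormalized
   filters, and the event that all weights vanish, on which nothing is known about the draws, has weight 0.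

   The number of trials of a trajectory is the sum over k of the indicators that its first k proposals are
   rejected. Given the particles, the probability of such an event is obtained from the k-th power of a
   rejection probability by averaging over backward kernels from time s + 1 up to time T. These backward
   averages telescope against the forward weights, so the weighted law of large numbers for the particles
   (truncation and a conditional variance bound) gives for every k the limit in L1 of the averaged
   indicators. Finitely many k bound the limit of the number of trials from below. From above it is bounded
   in mean: the exact weighted mean number of trials is at most the sum of all these limits. A nonnegative
   sequence that eventually exceeds every partial sum and whose means do not exceed the total sum converges
   to it, and this includes the case of an infinite limit, where the upper bound is void. *)
theory Submission
  imports Defs
begin

subsection \<open>Conditionally independent draws\<close>

text \<open>Normalization is the obstacle: particles and backward indices are drawn from ratios of
  random sums, and the denominators have no lower bound. Weighting by \<open>H\<close> makes each
  forward step linear, since the factor gained from \<open>H N t\<close> to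
  \<open>H N (Suc t)\<close> is exactly the normalization of the draw. Laws of large numbers then
  hold in L1 for merely integrable functions. This generality is required because the expected
  future likelihood may be unbounded, and infinite on a null set. At the end \<open>H\<close>
  converges in L1 to the positive evidence, which turns weighted limits into convergence in
  probability under the original measure.

  Only one ratio has to be passed to the limit, the acceptance probability, which depends on a whole
  generation of particles. It occurs multiplied by its own numerator, and expressions of this kind
  are Lipschitz in numerator and denominator.

  Both limits of the statement reduce to \<open>\<sigma>\<close> times the evidence at
  \<open>s\<close> times the backward mass, divided by the evidence at \<open>T\<close>.\<close>

lemma measurable_ident_subalgebra: "subalgebra M F \<Longrightarrow> (\<lambda>w. w) \<in> measurable M F"
  by (auto simp: measurable_def subalgebra_def intro!: sets.Int)

text \<open>The conditional law is known only where the mass of \<open>f\<close> is positive, so an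
  event \<open>E\<close> of \<open>F\<close> is fixed on which it is known, and integrands are later
  made to vanish off \<open>E\<close>. Joint measurability is required of the normalized density
  \<open>q\<close>; \<open>f\<close> enters only through its mass and the law it defines.\<close>

locale cond_draws =
  fixes W F :: "'w measure" and E :: "'w set" and K :: "'i set" and X :: "'i \<Rightarrow> 'w \<Rightarrow> 'b"
    and \<mu> :: "'b measure" and f q :: "'w \<Rightarrow> 'b \<Rightarrow> ennreal"
  assumes prob: "prob_space W" and sub: "subalgebra W F" and E: "E \<in> sets F"
    and sf: "sigma_finite_measure \<mu>"
    and q[measurable]: "case_prod q \<in> borel_measurable (F \<Otimes>\<^sub>M \<mu>)"
    and iid: "cond_iid_prop_to W F K X \<mu> f"
    and law: "AE w in W. w \<in> E \<longrightarrow> 0 < (\<integral>\<^sup>+ z. f w z \<partial>\<mu>) \<and>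
                law_prop_to \<mu> (f w) = density \<mu> (q w) \<and> (\<integral>\<^sup>+ z. q w z \<partial>\<mu>) = 1"
begin

lemma X_measurable: "i \<in> K \<Longrightarrow> X i \<in> measurable W \<mu>"
  using iid by (auto simp: cond_iid_prop_to_def)

lemma q_measurable[measurable]: "(\<lambda>p. q (fst p) (snd p)) \<in> borel_measurable (F \<Otimes>\<^sub>M \<mu>)"
  using q by (simp add: case_prod_beta')

lemma pair_X_measurable: "i \<in> K \<Longrightarrow> (\<lambda>w. (w, X i w)) \<in> measurable W (F \<Otimes>\<^sub>M \<mu>)"
  by (rule measurable_Pair[OF measurable_ident_subalgebra[OF sub] X_measurable])

text \<open>Since \<open>B\<close> lies in \<open>F\<close>, the indicator of the draws may be
  replaced by its conditional expectation, and inside \<open>E\<close> this is the product of the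
  integrals against \<open>q\<close>. The factors are at most 1, so passing between real and
  extended values loses nothing.\<close>

lemma rectangle:
  assumes L: "finite L" "L \<subseteq> K" "\<And>i. i \<in> L \<Longrightarrow> A i \<in> sets \<mu>"
    and B: "B \<in> sets F" "B \<subseteq> E"
  shows "(\<integral>\<^sup>+ w. indicator B w * (\<Prod>i\<in>L. indicator (A i) (X i w)) \<partial>W)
       = (\<integral>\<^sup>+ w. indicator B w * (\<Prod>i\<in>L. \<integral>\<^sup>+ z. indicator (A i) z * q w z \<partial>\<mu>) \<partial>W)"
proof -
  interpret prob_space W by (rule prob)
  interpret S: sigma_finite_measure \<mu> by (rule sf)
  have Xm: "\<And>i. i \<in> L \<Longrightarrow> X i \<in> measurable W \<mu>"
    using L by (intro X_measurable) auto
  define R where "R = {v \<in> space W. \<forall>i\<in>L. X i v \<in> A i}"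
  have Rm: "R \<in> sets W"
    unfolding R_def
  proof (rule sets.sets_Collect_finite_All[OF _ L(1)])
    fix i assume i: "i \<in> L"
    have "X i -` A i \<inter> space W \<in> sets W" using Xm[OF i] L(3)[OF i] by (rule measurable_sets)
    also have "X i -` A i \<inter> space W = {x \<in> space W. X i x \<in> A i}" by auto
    finally show "{x \<in> space W. X i x \<in> A i} \<in> sets W" .
  qed
  have FB: "B \<in> sets W" using sub B(1) by (auto simp: subalgebra_def)
  interpret FS: finite_measure_subalgebra W F
    by (rule finite_measure_subalgebra.intro) (auto simp: sub finite_measure_subalgebra_axioms_def finite_measure_axioms)
  define qq where "qq w = (\<Prod>i\<in>L. \<integral>\<^sup>+ z. indicator (A i) z * q w z \<partial>\<mu>)" for w
  have qqF[measurable]: "qq \<in> borel_measurable F"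
    unfolding qq_def
    by (intro borel_measurable_prod_ennreal S.borel_measurable_nn_integral) (use L in measurable)
  have qqW[measurable]: "qq \<in> borel_measurable W" using measurable_from_subalg[OF sub qqF] .
  have rc: "AE w in W. 0 < (\<integral>\<^sup>+ z. f w z \<partial>\<mu>) \<longrightarrow> real_cond_exp W F (indicat_real R) w
             = (\<Prod>i\<in>L. measure (law_prop_to \<mu> (f w)) (A i))"
    using iid L unfolding cond_iid_prop_to_def R_def by blast
  have ae: "AE w in W. w \<in> B \<longrightarrow> real_cond_exp W F (indicat_real R) w = enn2real (qq w) \<and> qq w \<le> 1"
    using rc law AE_space
  proof eventually_elim
    case (elim w)
    show ?case
    proof
      assume "w \<in> B"
      then have w: "w \<in> E" using B by auto
      have wF: "w \<in> space F" using elim(3) sub by (auto simp: subalgebra_def)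
      have qw[measurable]: "q w \<in> borel_measurable \<mu>"
        using measurable_compose[OF measurable_Pair1'[OF wF] q] by simp
      have e: "emeasure (density \<mu> (q w)) (A i) = (\<integral>\<^sup>+ z. indicator (A i) z * q w z \<partial>\<mu>)" if "i \<in> L" for i
        using L(3)[OF that] by (subst emeasure_density) (auto simp: mult.commute)
      have l1: "(\<integral>\<^sup>+ z. indicator (A i) z * q w z \<partial>\<mu>) \<le> 1" if "i \<in> L" for i
      proof -
        have "(\<integral>\<^sup>+ z. indicator (A i) z * q w z \<partial>\<mu>) \<le> (\<integral>\<^sup>+ z. q w z \<partial>\<mu>)"
          by (intro nn_integral_mono) (auto simp: indicator_def)
        then show ?thesis using elim(2) w by auto
      qed
      have "real_cond_exp W F (indicat_real R) w = (\<Prod>i\<in>L. measure (density \<mu> (q w)) (A i))"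
        using elim w by auto
      also have "\<dots> = (\<Prod>i\<in>L. enn2real (\<integral>\<^sup>+ z. indicator (A i) z * q w z \<partial>\<mu>))"
        by (intro prod.cong refl) (simp add: measure_def e)
      also have "\<dots> = enn2real (qq w)"
        unfolding qq_def using L(1) by (induction L rule: finite_induct) (auto simp: enn2real_mult)
      finally show "real_cond_exp W F (indicat_real R) w = enn2real (qq w) \<and> qq w \<le> 1"
        using l1 by (auto simp: qq_def intro!: prod_le_1)
    qed
  qed
  have "(\<integral>\<^sup>+ w. indicator B w * (\<Prod>i\<in>L. indicator (A i) (X i w)) \<partial>W) = (\<integral>\<^sup>+ w. indicator (B \<inter> R) w \<partial>W)"
  proof (rule nn_integral_cong)
    fix w assume w: "w \<in> space W"
    have "(\<Prod>i\<in>L. indicator (A i) (X i w)) = (indicator R w :: ennreal)"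
    proof (cases "w \<in> R")
      case True then show ?thesis by (auto simp: R_def intro!: prod.neutral)
    next
      case False
      then obtain i where "i \<in> L" "X i w \<notin> A i" using w by (auto simp: R_def)
      then show ?thesis using False L(1) by (auto simp: prod_zero_iff intro!: bexI[of _ i])
    qed
    then show "indicator B w * (\<Prod>i\<in>L. indicator (A i) (X i w)) = (indicator (B \<inter> R) w :: ennreal)"
      by (simp add: indicator_inter_arith)
  qed
  also have "\<dots> = ennreal (measure W (B \<inter> R))" using FB Rm by (simp add: emeasure_eq_measure)
  also have "measure W (B \<inter> R) = (\<integral> w. indicat_real B w * indicat_real R w \<partial>W)"
    using FB Rm by (simp add: indicator_inter_arith[symmetric])
  also have "\<dots> = (\<integral> w \<in> B. indicat_real R w \<partial>W)" by (simp add: set_lebesgue_integral_def)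
  also have "\<dots> = (\<integral> w \<in> B. real_cond_exp W F (indicat_real R) w \<partial>W)"
    by (rule FS.real_cond_exp_intA) (use B Rm in \<open>auto simp: integrable_real_indicator emeasure_eq_measure\<close>)
  also have "\<dots> = (\<integral> w. indicat_real B w * enn2real (qq w) \<partial>W)"
    unfolding set_lebesgue_integral_def
    by (rule integral_cong_AE) (use FB ae in \<open>auto simp: indicator_def elim!: eventually_mono\<close>)
  also have "ennreal \<dots> = (\<integral>\<^sup>+ w. ennreal (indicat_real B w * enn2real (qq w)) \<partial>W)"
  proof (rule nn_integral_eq_integral[symmetric])
    show "integrable W (\<lambda>w. indicat_real B w * enn2real (qq w))"
    proof (rule integrable_const_bound[where B=1])
      show "AE x in W. norm (indicat_real B x * enn2real (qq x)) \<le> 1"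
        using ae by eventually_elim (auto simp: indicator_def enn2real_leI)
      show "(\<lambda>w. indicat_real B w * enn2real (qq w)) \<in> borel_measurable W"
        using FB by measurable
    qed
  qed auto
  also have "\<dots> = (\<integral>\<^sup>+ w. indicator B w * qq w \<partial>W)"
  proof (rule nn_integral_cong_AE)
    show "AE w in W. ennreal (indicat_real B w * enn2real (qq w)) = indicator B w * qq w"
      using ae
    proof eventually_elim
      case (elim w)
      then have "w \<in> B \<Longrightarrow> qq w < top" using ennreal_one_less_top order.strict_trans1 by blast
      then show ?case by (auto simp: indicator_def)
    qed
  qed
  finally show ?thesis by (simp add: qq_def)
qed

text \<open>Indicators are exchanged for functions one index at a time. For a fixed index, two
  measures on pairs of history and draw, reweighted by the remaining factors, agree on rectangles
  and hence everywhere. The bounds on \<open>\<phi>\<close> make these measures finite, while the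
  function \<open>\<Phi>\<close> integrated last may be unbounded.\<close>

lemma nn_integral_bounded:
  assumes S: "finite S" "insert i0 S \<subseteq> K" "i0 \<notin> S"
    and \<phi>: "\<And>i. i \<in> S \<Longrightarrow> \<phi> i \<in> borel_measurable (F \<Otimes>\<^sub>M \<mu>)" "\<And>i p. i \<in> S \<Longrightarrow> \<phi> i p \<le> (1::ennreal)"
    and \<Phi>: "\<Phi> \<in> borel_measurable (F \<Otimes>\<^sub>M \<mu>)"
  shows "(\<integral>\<^sup>+ w. indicator E w * (\<Phi> (w, X i0 w) * (\<Prod>i\<in>S. \<phi> i (w, X i w))) \<partial>W)
       = (\<integral>\<^sup>+ w. indicator E w * ((\<integral>\<^sup>+ z. \<Phi> (w, z) * q w z \<partial>\<mu>) * (\<Prod>i\<in>S. \<integral>\<^sup>+ z. \<phi> i (w, z) * q w z \<partial>\<mu>)) \<partial>W)"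
proof -
  interpret prob_space W by (rule prob)
  interpret sigma_finite_measure \<mu> by (rule sf)
  note XW = X_measurable and pairm[measurable] = pair_X_measurable
  define r where "r S L A w = (\<Prod>i\<in>S. \<phi> i (w, X i w)) * (\<Prod>i\<in>L. indicator (A i) (X i w) :: ennreal)" for S L :: "'i set" and A w
  define c where "c S L A w = (\<Prod>i\<in>S. \<integral>\<^sup>+ z. \<phi> i (w, z) * q w z \<partial>\<mu>) * (\<Prod>i\<in>L. \<integral>\<^sup>+ z. indicator (A i) z * q w z \<partial>\<mu>)" for S L :: "'i set" and A w
  \<comment> \<open>The induction hypothesis keeps indicators on a further index set
    \<open>L\<close> and an arbitrary \<open>B\<close>: these are what a rectangle at the next index
    uses up.\<close>
  define P where "P S \<longleftrightarrow> (\<forall>L A B. finite L \<and> L \<subseteq> K \<and> L \<inter> S = {} \<and> (\<forall>i\<in>L. A i \<in> sets \<mu>) \<and> B \<in> sets F \<and> B \<subseteq> E \<longrightarrow>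
      (\<integral>\<^sup>+ w. indicator B w * r S L A w \<partial>W) = (\<integral>\<^sup>+ w. indicator B w * c S L A w \<partial>W))" for S
  have step: "(\<integral>\<^sup>+ w. indicator B w * (\<Phi> (w, X i w) * r S' L A w) \<partial>W)
      = (\<integral>\<^sup>+ w. indicator B w * ((\<integral>\<^sup>+ z. \<Phi> (w, z) * q w z \<partial>\<mu>) * c S' L A w) \<partial>W)"
    if PS: "P S'" and S': "finite S'" "S' \<subseteq> S" and i: "i \<notin> S'" "i \<in> K" and L: "finite L" "L \<subseteq> K" "L \<inter> insert i S' = {}"
      "\<forall>i\<in>L. A i \<in> sets \<mu>" and B: "B \<in> sets F" "B \<subseteq> E" and \<Phi>: "\<Phi> \<in> borel_measurable (F \<Otimes>\<^sub>M \<mu>)"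
    for S' i L A B \<Phi>
  proof -
    have BW: "B \<in> sets W" using sub B(1) by (auto simp: subalgebra_def)
    have \<phi>m: "\<phi> i \<in> borel_measurable (F \<Otimes>\<^sub>M \<mu>)" if "i \<in> S'" for i using that S' \<phi> by auto
    have rm[measurable]: "r S' L A \<in> borel_measurable W"
      unfolding r_def
    proof (intro borel_measurable_times_ennreal borel_measurable_prod_ennreal)
      fix j assume "j \<in> S'"
      then have "j \<in> K" using S' S by auto
      then show "(\<lambda>w. \<phi> j (w, X j w)) \<in> borel_measurable W"
        using measurable_compose[OF pairm \<phi>m[OF \<open>j \<in> S'\<close>]] by simp
    next
      fix j assume "j \<in> L"
      then show "(\<lambda>w. indicator (A j) (X j w) :: ennreal) \<in> borel_measurable W"
        using measurable_compose[OF XW, of j "indicator (A j) :: _ \<Rightarrow> ennreal"] L by auto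
    qed
    have cm[measurable]: "c S' L A \<in> borel_measurable F"
      unfolding c_def
      by (intro borel_measurable_times_ennreal borel_measurable_prod_ennreal borel_measurable_nn_integral)
        (use L \<phi>m in measurable)
    define m1 where "m1 = distr (density W (\<lambda>w. indicator B w * r S' L A w)) (F \<Otimes>\<^sub>M \<mu>) (\<lambda>w. (w, X i w))"
    \<comment> \<open>Both measures have to live on the product of \<open>F\<close> and
      \<open>\<mu>\<close>, so \<open>W\<close> is restricted to its subalgebra here.\<close>
    define m2 where "m2 = density (restr_to_subalg W F \<Otimes>\<^sub>M \<mu>) (\<lambda>(w, z). indicator B w * c S' L A w * q w z)"
    have sr: "sets (restr_to_subalg W F) = sets F" using sub by (rule sets_restr_to_subalg)
    have Fm: "measurable (F \<Otimes>\<^sub>M \<mu>) (borel :: ennreal measure) = measurable (restr_to_subalg W F \<Otimes>\<^sub>M \<mu>) borel"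
      by (intro measurable_cong_sets sets_pair_measure_cong) (auto simp: sr)
    have dm: "(\<lambda>(w, z). indicator B w * c S' L A w * q w z) \<in> borel_measurable (restr_to_subalg W F \<Otimes>\<^sub>M \<mu>)"
      unfolding Fm[symmetric] case_prod_beta' using B by measurable
    have nn1: "nn_integral m1 \<Psi> = (\<integral>\<^sup>+ w. indicator B w * (\<Psi> (w, X i w) * r S' L A w) \<partial>W)"
      if [measurable]: "\<Psi> \<in> borel_measurable (F \<Otimes>\<^sub>M \<mu>)" for \<Psi>
    proof -
      have [measurable]: "(\<lambda>w. \<Psi> (w, X i w)) \<in> borel_measurable W"
        using measurable_compose[OF pairm[OF i(2)] that] .
      show ?thesis unfolding m1_def
        using BW i by (subst nn_integral_distr) (auto simp: nn_integral_density mult_ac)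
    qed
    have nn2: "nn_integral m2 \<Psi> = (\<integral>\<^sup>+ w. indicator B w * ((\<integral>\<^sup>+ z. \<Psi> (w, z) * q w z \<partial>\<mu>) * c S' L A w) \<partial>W)"
      if \<Psi>[measurable]: "\<Psi> \<in> borel_measurable (F \<Otimes>\<^sub>M \<mu>)" for \<Psi>
    proof -
      have [measurable]: "\<Psi> \<in> borel_measurable (restr_to_subalg W F \<Otimes>\<^sub>M \<mu>)" using \<Psi> Fm by simp
      have "nn_integral m2 \<Psi> = (\<integral>\<^sup>+ p. (case p of (w, z) \<Rightarrow> indicator B w * c S' L A w * q w z) * \<Psi> p \<partial>(restr_to_subalg W F \<Otimes>\<^sub>M \<mu>))"
        unfolding m2_def using dm by (subst nn_integral_density) auto
      also have "\<dots> = (\<integral>\<^sup>+ w. \<integral>\<^sup>+ z. indicator B w * c S' L A w * q w z * \<Psi> (w, z) \<partial>\<mu> \<partial>restr_to_subalg W F)"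
        by (subst nn_integral_fst[symmetric]) (use dm in auto)
      also have "\<dots> = (\<integral>\<^sup>+ w. \<integral>\<^sup>+ z. indicator B w * c S' L A w * q w z * \<Psi> (w, z) \<partial>\<mu> \<partial>W)"
      proof (rule nn_integral_subalgebra2[OF sub])
        show "(\<lambda>w. \<integral>\<^sup>+ z. indicator B w * c S' L A w * q w z * \<Psi> (w, z) \<partial>\<mu>) \<in> borel_measurable F"
          using B by measurable
      qed
      also have "\<dots> = (\<integral>\<^sup>+ w. indicator B w * ((\<integral>\<^sup>+ z. \<Psi> (w, z) * q w z \<partial>\<mu>) * c S' L A w) \<partial>W)"
      proof (rule nn_integral_cong)
        fix w assume "w \<in> space W"
        then have wF: "w \<in> space F" using sub by (auto simp: subalgebra_def)
        have [measurable]: "q w \<in> borel_measurable \<mu>" "(\<lambda>z. \<Psi> (w, z)) \<in> borel_measurable \<mu>"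
          using measurable_compose[OF measurable_Pair1'[OF wF] q] measurable_compose[OF measurable_Pair1'[OF wF] \<Psi>] by auto
        show "(\<integral>\<^sup>+ z. indicator B w * c S' L A w * q w z * \<Psi> (w, z) \<partial>\<mu>) =
          indicator B w * ((\<integral>\<^sup>+ z. \<Psi> (w, z) * q w z \<partial>\<mu>) * c S' L A w)"
          by (subst mult.assoc, subst nn_integral_cmult) (auto simp: mult_ac)
      qed
      finally show ?thesis .
    qed
    have "m1 = m2"
    proof (rule measure_eqI_generator_eq[OF Int_stable_pair_measure_generator[of F \<mu>]])
      show "{a \<times> b |a b. a \<in> sets F \<and> b \<in> sets \<mu>} \<subseteq> Pow (space F \<times> space \<mu>)"
        using sets.space_closed by (blast dest: sets.sets_into_space)
      show "sets m1 = sigma_sets (space F \<times> space \<mu>) {a \<times> b |a b. a \<in> sets F \<and> b \<in> sets \<mu>}"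
        by (simp add: m1_def sets_pair_measure)
      show "sets m2 = sigma_sets (space F \<times> space \<mu>) {a \<times> b |a b. a \<in> sets F \<and> b \<in> sets \<mu>}"
        unfolding m2_def sets_density sets_pair_measure_cong[OF sr refl] by (simp add: sets_pair_measure)
      have s2: "sets m2 = sets (F \<Otimes>\<^sub>M \<mu>)" "sets m1 = sets (F \<Otimes>\<^sub>M \<mu>)"
        unfolding m2_def m1_def sets_density sets_pair_measure_cong[OF sr refl] by auto
      fix X' assume "X' \<in> {a \<times> b |a b. a \<in> sets F \<and> b \<in> sets \<mu>}"
      then obtain C D where X': "X' = C \<times> D" and C: "C \<in> sets F" and D: "D \<in> sets \<mu>" by auto
      have Xm: "(indicator X' :: _ \<Rightarrow> ennreal) \<in> borel_measurable (F \<Otimes>\<^sub>M \<mu>)" using C D X' by auto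
      \<comment> \<open>The side \<open>D\<close> of the rectangle becomes one more indicator, at
        index \<open>i\<close>; the side \<open>C\<close> is absorbed into \<open>B\<close>.\<close>
      let ?A = "A(i := D)"
      have pr: "finite (insert i L) \<and> insert i L \<subseteq> K \<and> insert i L \<inter> S' = {} \<and> (\<forall>j\<in>insert i L. ?A j \<in> sets \<mu>) \<and> B \<inter> C \<in> sets F \<and> B \<inter> C \<subseteq> E"
        using L i B C D by auto
      have iL: "i \<notin> L" using L by auto
      have r': "r S' (insert i L) ?A w = indicator D (X i w) * r S' L A w" for w
      proof -
        have "(\<Prod>j\<in>L. indicator (?A j) (X j w)) = (\<Prod>j\<in>L. indicator (A j) (X j w) :: ennreal)"
          by (intro prod.cong) (use iL in auto)
        then show ?thesis using L iL by (simp add: r_def mult_ac)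
      qed
      have c': "c S' (insert i L) ?A w = (\<integral>\<^sup>+ z. indicator D z * q w z \<partial>\<mu>) * c S' L A w" for w
      proof -
        have "(\<Prod>j\<in>L. \<integral>\<^sup>+ z. indicator (?A j) z * q w z \<partial>\<mu>) = (\<Prod>j\<in>L. \<integral>\<^sup>+ z. indicator (A j) z * q w z \<partial>\<mu>)"
          by (intro prod.cong) (use iL in auto)
        then show ?thesis using L iL by (simp add: c_def mult_ac)
      qed
      have "emeasure m1 X' = nn_integral m1 (indicator X')" using C D X' s2 by simp
      also have "\<dots> = (\<integral>\<^sup>+ w. indicator (B \<inter> C) w * r S' (insert i L) ?A w \<partial>W)"
        by (subst nn1[OF Xm]) (auto simp: r' X' indicator_def intro!: nn_integral_cong)
      also have "\<dots> = (\<integral>\<^sup>+ w. indicator (B \<inter> C) w * c S' (insert i L) ?A w \<partial>W)"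
        using PS[unfolded P_def, rule_format, OF pr] .
      also have "\<dots> = nn_integral m2 (indicator X')"
        by (subst nn2[OF Xm]) (auto simp: c' X' indicator_def intro!: nn_integral_cong)
      also have "\<dots> = emeasure m2 X'" using C D X' s2 by simp
      finally show "emeasure m1 X' = emeasure m2 X'" .
    next
      show "range (\<lambda>_::nat. space F \<times> space \<mu>) \<subseteq> {a \<times> b |a b. a \<in> sets F \<and> b \<in> sets \<mu>}" by auto
      have "emeasure m1 (space F \<times> space \<mu>) = nn_integral m1 (indicator (space F \<times> space \<mu>))"
        by (simp add: m1_def)
      also have "\<dots> = (\<integral>\<^sup>+ w. indicator B w * (indicator (space F \<times> space \<mu>) (w, X i w) * r S' L A w) \<partial>W)"
        by (rule nn1) auto
      also have "\<dots> \<le> (\<integral>\<^sup>+ w. 1 \<partial>W)"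
      proof (rule nn_integral_mono)
        fix w
        have "r S' L A w \<le> 1 * 1" unfolding r_def
          by (intro mult_mono prod_le_1) (use \<phi>(2) S' in \<open>auto simp: indicator_def\<close>)
        then show "indicator B w * (indicator (space F \<times> space \<mu>) (w, X i w) * r S' L A w) \<le> 1"
          by (auto simp: indicator_def)
      qed
      also have "\<dots> = 1" by (simp add: emeasure_space_1)
      finally show "emeasure m1 (space F \<times> space \<mu>) \<noteq> \<infinity>" using ennreal_one_less_top by (auto simp: top_unique)
    qed auto
    then show ?thesis using nn1[OF \<Phi>] nn2[OF \<Phi>] by simp
  qed
  have PP: "P S'" if "finite S'" "S' \<subseteq> S" for S'
    using that
  proof (induction S' rule: finite_induct)
    case empty
    show ?case unfolding P_def r_def c_def
      using rectangle by auto
  next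
    case (insert i S')
    show ?case unfolding P_def
    proof (intro allI impI, elim conjE)
      fix L A B assume L: "finite L" "L \<subseteq> K" "L \<inter> insert i S' = {}" "\<forall>i\<in>L. A i \<in> sets \<mu>" "B \<in> sets F" "B \<subseteq> E"
      have iS: "i \<in> K" "i \<in> S" using insert S by auto
      show "(\<integral>\<^sup>+ w. indicator B w * r (insert i S') L A w \<partial>W) = (\<integral>\<^sup>+ w. indicator B w * c (insert i S') L A w \<partial>W)"
        using step[OF insert.IH insert.hyps(1) _ insert.hyps(2) iS(1) L \<phi>(1)[OF iS(2)]] insert
        by (auto simp: r_def c_def mult_ac)
    qed
  qed
  show ?thesis
    using step[OF PP[OF S(1) order_refl] S(1) order_refl S(3) _ finite.emptyI, of "\<lambda>_. {}" E \<Phi>] S E \<Phi>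
    by (auto simp: r_def c_def)
qed

text \<open>The weight is fixed by the history, so it is merged into the one factor that may be
  unbounded; vanishing off \<open>E\<close>, it makes the restriction to \<open>E\<close> disappear
  from both sides.\<close>

lemma nn_integral_weighted:
  fixes H :: "'w \<Rightarrow> ennreal"
  assumes H: "H \<in> borel_measurable F" "\<And>w. w \<in> space W \<Longrightarrow> w \<notin> E \<Longrightarrow> H w = 0"
    and S: "finite S" "insert i0 S \<subseteq> K" "i0 \<notin> S"
    and \<phi>: "\<And>i. i \<in> S \<Longrightarrow> \<phi> i \<in> borel_measurable (F \<Otimes>\<^sub>M \<mu>)" "\<And>i p. i \<in> S \<Longrightarrow> \<phi> i p \<le> (1::ennreal)"
    and \<Phi>: "\<Phi> \<in> borel_measurable (F \<Otimes>\<^sub>M \<mu>)"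
  shows "(\<integral>\<^sup>+ w. H w * (\<Phi> (w, X i0 w) * (\<Prod>i\<in>S. \<phi> i (w, X i w))) \<partial>W)
       = (\<integral>\<^sup>+ w. H w * ((\<integral>\<^sup>+ z. \<Phi> (w, z) * q w z \<partial>\<mu>) * (\<Prod>i\<in>S. \<integral>\<^sup>+ z. \<phi> i (w, z) * q w z \<partial>\<mu>)) \<partial>W)"
proof -
  have m: "(\<lambda>p. H (fst p) * \<Phi> p) \<in> borel_measurable (F \<Otimes>\<^sub>M \<mu>)" using H(1) \<Phi> by measurable
  have e: "indicator E w * (H w * x) = H w * x" if "w \<in> space W" for w x
    using H(2)[OF that] by (cases "w \<in> E") auto
  have "(\<integral>\<^sup>+ w. H w * (\<Phi> (w, X i0 w) * (\<Prod>i\<in>S. \<phi> i (w, X i w))) \<partial>W)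
     = (\<integral>\<^sup>+ w. indicator E w * (H w * \<Phi> (w, X i0 w) * (\<Prod>i\<in>S. \<phi> i (w, X i w))) \<partial>W)"
    by (intro nn_integral_cong) (simp add: mult.assoc e)
  also have "\<dots> = (\<integral>\<^sup>+ w. indicator E w * ((\<integral>\<^sup>+ z. H w * \<Phi> (w, z) * q w z \<partial>\<mu>) * (\<Prod>i\<in>S. \<integral>\<^sup>+ z. \<phi> i (w, z) * q w z \<partial>\<mu>)) \<partial>W)"
    using nn_integral_bounded[OF S \<phi> m] by simp
  also have "\<dots> = (\<integral>\<^sup>+ w. H w * ((\<integral>\<^sup>+ z. \<Phi> (w, z) * q w z \<partial>\<mu>) * (\<Prod>i\<in>S. \<integral>\<^sup>+ z. \<phi> i (w, z) * q w z \<partial>\<mu>)) \<partial>W)"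
  proof (rule nn_integral_cong)
    fix w assume w: "w \<in> space W"
    then have wF: "w \<in> space F" using sub by (auto simp: subalgebra_def)
    have [measurable]: "q w \<in> borel_measurable \<mu>" "(\<lambda>z. \<Phi> (w, z)) \<in> borel_measurable \<mu>"
      using measurable_compose[OF measurable_Pair1'[OF wF] q] measurable_compose[OF measurable_Pair1'[OF wF] \<Phi>] by auto
    have "(\<integral>\<^sup>+ z. H w * \<Phi> (w, z) * q w z \<partial>\<mu>) = H w * (\<integral>\<^sup>+ z. \<Phi> (w, z) * q w z \<partial>\<mu>)"
      by (simp add: nn_integral_cmult mult.assoc)
    then show "indicator E w * ((\<integral>\<^sup>+ z. H w * \<Phi> (w, z) * q w z \<partial>\<mu>) * (\<Prod>i\<in>S. \<integral>\<^sup>+ z. \<phi> i (w, z) * q w z \<partial>\<mu>))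
       = H w * ((\<integral>\<^sup>+ z. \<Phi> (w, z) * q w z \<partial>\<mu>) * (\<Prod>i\<in>S. \<integral>\<^sup>+ z. \<phi> i (w, z) * q w z \<partial>\<mu>))"
      by (simp add: mult.assoc e[OF w])
  qed
  finally show ?thesis .
qed

lemma nn_integral_prod:
  fixes H :: "'w \<Rightarrow> ennreal"
  assumes H: "H \<in> borel_measurable F" "\<And>w. w \<in> space W \<Longrightarrow> w \<notin> E \<Longrightarrow> H w = 0"
    and S: "finite S" "S \<subseteq> K"
    and \<phi>: "\<And>i. i \<in> S \<Longrightarrow> \<phi> i \<in> borel_measurable (F \<Otimes>\<^sub>M \<mu>)" "\<And>i p. i \<in> S \<Longrightarrow> \<phi> i p \<le> (1::ennreal)"
  shows "(\<integral>\<^sup>+ w. H w * (\<Prod>i\<in>S. \<phi> i (w, X i w)) \<partial>W)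
       = (\<integral>\<^sup>+ w. H w * (\<Prod>i\<in>S. \<integral>\<^sup>+ z. \<phi> i (w, z) * q w z \<partial>\<mu>) \<partial>W)"
proof (cases "S = {}")
  case True then show ?thesis by simp
next
  case False
  then obtain i0 where i0: "i0 \<in> S" by auto
  have "finite (S - {i0})" "insert i0 (S - {i0}) \<subseteq> K" "i0 \<notin> S - {i0}" using S i0 by auto
  from nn_integral_weighted[OF H this, of \<phi> "\<phi> i0"] \<phi> i0
  show ?thesis by (simp add: prod.remove[OF S(1) i0])
qed

end

subsection \<open>Weak laws under a weighted measure\<close>

text \<open>A second moment computation under the weight \<open>H\<close>. The \<open>e i\<close>
  act as conditional means of the \<open>Y i\<close>, but only through the mixed moments
  \<open>YY\<close> and \<open>Ye\<close>, which make the off-diagonal covariances vanish. Bounds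
  are asked only where \<open>H\<close> is positive, since conditional means are controlled only
  there.\<close>

lemma weighted_weak_law:
  fixes H :: "'w \<Rightarrow> real" and Y e :: "nat \<Rightarrow> 'w \<Rightarrow> real"
  assumes n: "1 \<le> n" and B: "0 < B"
    and H[measurable]: "H \<in> borel_measurable M" and H0: "\<And>w. 0 \<le> H w"
    and Hfin: "(\<integral>\<^sup>+ w. ennreal (H w) \<partial>M) < \<infinity>"
    and Y[measurable]: "\<And>i. i < n \<Longrightarrow> Y i \<in> borel_measurable M"
    and e[measurable]: "\<And>i. i < n \<Longrightarrow> e i \<in> borel_measurable M"
    and Yb: "\<And>i. i < n \<Longrightarrow> AE w in M. 0 < H w \<longrightarrow> 0 \<le> Y i w \<and> Y i w \<le> B"
    and eb: "\<And>i. i < n \<Longrightarrow> AE w in M. 0 < H w \<longrightarrow> 0 \<le> e i w \<and> e i w \<le> B"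
    and YY: "\<And>i j. i < n \<Longrightarrow> j < n \<Longrightarrow> i \<noteq> j \<Longrightarrow>
      (\<integral>\<^sup>+ w. ennreal (H w) * (ennreal (Y i w) * ennreal (Y j w)) \<partial>M)
        = (\<integral>\<^sup>+ w. ennreal (H w) * (ennreal (e i w) * ennreal (e j w)) \<partial>M)"
    and Ye: "\<And>i j. i < n \<Longrightarrow> j < n \<Longrightarrow> i \<noteq> j \<Longrightarrow>
      (\<integral>\<^sup>+ w. ennreal (H w) * (ennreal (Y i w) * ennreal (e j w)) \<partial>M)
        = (\<integral>\<^sup>+ w. ennreal (H w) * (ennreal (e i w) * ennreal (e j w)) \<partial>M)"
  shows "(\<integral>\<^sup>+ w. ennreal (H w * \<bar>(\<Sum>i<n. Y i w) / n - (\<Sum>i<n. e i w) / n\<bar>) \<partial>M)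
    \<le> ennreal (B / sqrt n) * (\<integral>\<^sup>+ w. ennreal (H w) \<partial>M)"
proof -
  have Hint: "integrable M H" using Hfin H0 by (intro integrableI_nonneg) auto
  have bint: "integrable M (\<lambda>w. H w * (u w * v w))" 
    if [measurable]: "u \<in> borel_measurable M" "v \<in> borel_measurable M"
    and u: "AE w in M. 0 < H w \<longrightarrow> 0 \<le> u w \<and> u w \<le> B"
    and v: "AE w in M. 0 < H w \<longrightarrow> 0 \<le> v w \<and> v w \<le> B" for u v
  proof (rule Bochner_Integration.integrable_bound[where f="\<lambda>w. (B * B) * H w"])
    show "AE w in M. norm (H w * (u w * v w)) \<le> norm (B * B * H w)"
      using u v
    proof eventually_elim
      case (elim w)
      show ?case
      proof (cases "H w = 0")
        case False
        then have "0 < H w" using H0[of w] by simp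
        then have "u w * v w \<le> B * B" "0 \<le> u w * v w" using elim B by (auto intro!: mult_mono)
        then have "H w * (u w * v w) \<le> H w * (B * B)" using H0[of w] by (intro mult_left_mono) auto
        then show ?thesis using elim \<open>0 < H w\<close> B by (auto simp: abs_mult mult_ac)
      qed auto
    qed
  qed (use Hint in auto)
  have bl: "(\<integral>\<^sup>+ w. ennreal (H w) * (ennreal (u w) * ennreal (v w)) \<partial>M) = ennreal (\<integral>w. H w * (u w * v w) \<partial>M)"
    if [measurable]: "u \<in> borel_measurable M" "v \<in> borel_measurable M"
    and u: "AE w in M. 0 < H w \<longrightarrow> 0 \<le> u w \<and> u w \<le> B"
    and v: "AE w in M. 0 < H w \<longrightarrow> 0 \<le> v w \<and> v w \<le> B" for u v
  proof -
    have p: "AE w in M. 0 \<le> H w * (u w * v w)"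
      using u v by eventually_elim (metis H0 mult_nonneg_nonneg mult_zero_left order_le_less)
    have "(\<integral>\<^sup>+ w. ennreal (H w) * (ennreal (u w) * ennreal (v w)) \<partial>M) = (\<integral>\<^sup>+ w. ennreal (H w * (u w * v w)) \<partial>M)"
    proof (rule nn_integral_cong_AE)
      show "AE w in M. ennreal (H w) * (ennreal (u w) * ennreal (v w)) = ennreal (H w * (u w * v w))"
        using u v
      proof eventually_elim
        case (elim w)
        then show ?case by (cases "H w = 0") (use H0[of w] in \<open>auto simp: ennreal_mult\<close>)
      qed
    qed
    also have "\<dots> = ennreal (\<integral>w. H w * (u w * v w) \<partial>M)"
      by (rule nn_integral_eq_integral[OF bint p]) (use that in auto)
    finally show ?thesis .
  qed
  have pos: "0 \<le> (\<integral>w. H w * (u w * v w) \<partial>M)"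
    if u: "AE w in M. 0 < H w \<longrightarrow> 0 \<le> u w \<and> u w \<le> B"
    and v: "AE w in M. 0 < H w \<longrightarrow> 0 \<le> v w \<and> v w \<le> B" for u v
    by (intro integral_nonneg_AE) (use u v in eventually_elim, metis H0 mult_nonneg_nonneg mult_zero_left order_le_less)
  define D where "D i w = Y i w - e i w" for i w
  have [measurable]: "D i \<in> borel_measurable M" if "i < n" for i
    using borel_measurable_diff[OF Y[OF that] e[OF that]] by (simp add: D_def[abs_def])
  have DDint: "integrable M (\<lambda>w. H w * (D i w * D j w))" if "i < n" "j < n" for i j
  proof -
    have "integrable M (\<lambda>w. H w * (Y i w * Y j w) - H w * (Y i w * e j w) - H w * (e i w * Y j w) + H w * (e i w * e j w))"
      using that by (intro Bochner_Integration.integrable_diff Bochner_Integration.integrable_add bint) (auto intro: Yb eb)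
    then show ?thesis by (rule Bochner_Integration.integrable_cong[THEN iffD1, rotated 2]) (auto simp: D_def algebra_simps)
  qed
  have off: "(\<integral>w. H w * (D i w * D j w) \<partial>M) = 0" if ij: "i < n" "j < n" "i \<noteq> j" for i j
  proof -
    have 1: "(\<integral>w. H w * (Y i w * Y j w) \<partial>M) = (\<integral>w. H w * (e i w * e j w) \<partial>M)"
      using YY[OF ij] bl[of "Y i" "Y j"] bl[of "e i" "e j"] pos[of "Y i" "Y j"] pos[of "e i" "e j"] ij Yb eb by simp
    have 2: "(\<integral>w. H w * (Y i w * e j w) \<partial>M) = (\<integral>w. H w * (e i w * e j w) \<partial>M)"
      using Ye[OF ij] bl[of "Y i" "e j"] bl[of "e i" "e j"] pos[of "Y i" "e j"] pos[of "e i" "e j"] ij Yb eb by simp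
    have 3: "(\<integral>w. H w * (Y j w * e i w) \<partial>M) = (\<integral>w. H w * (e i w * e j w) \<partial>M)"
      using Ye[of j i] bl[of "Y j" "e i"] bl[of "e j" "e i"] pos[of "Y j" "e i"] pos[of "e j" "e i"] ij Yb eb by (simp add: mult.commute)
    have "(\<integral>w. H w * (D i w * D j w) \<partial>M) = (\<integral>w. H w * (Y i w * Y j w) - H w * (Y i w * e j w) - H w * (Y j w * e i w) + H w * (e i w * e j w) \<partial>M)"
      by (intro Bochner_Integration.integral_cong) (auto simp: D_def algebra_simps)
    also have "\<dots> = (\<integral>w. H w * (Y i w * Y j w) \<partial>M) - (\<integral>w. H w * (Y i w * e j w) \<partial>M) - (\<integral>w. H w * (Y j w * e i w) \<partial>M) + (\<integral>w. H w * (e i w * e j w) \<partial>M)"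
      using ij by (subst Bochner_Integration.integral_add Bochner_Integration.integral_diff,
          (intro Bochner_Integration.integrable_diff Bochner_Integration.integrable_add bint; auto intro: Yb eb)+)+ simp
    finally show ?thesis using 1 2 3 by simp
  qed
  have diag: "(\<integral>w. H w * (D i w * D i w) \<partial>M) \<le> B\<^sup>2 * (\<integral>w. H w \<partial>M)" if i: "i < n" for i
  proof -
    have "(\<integral>w. H w * (D i w * D i w) \<partial>M) \<le> (\<integral>w. B\<^sup>2 * H w \<partial>M)"
    proof (rule integral_mono_AE[OF DDint[OF i i]])
      show "AE w in M. H w * (D i w * D i w) \<le> B\<^sup>2 * H w"
        using Yb[OF i] eb[OF i]
      proof eventually_elim
        case (elim w)
        show ?case
        proof (cases "H w = 0")
          case False
          then have "\<bar>D i w\<bar> \<le> B" using elim H0[of w] by (auto simp: D_def abs_le_iff)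
          then have "\<bar>D i w\<bar>\<^sup>2 \<le> B\<^sup>2" by (intro power_mono) auto
          then show ?thesis using H0[of w] by (auto simp: power2_eq_square mult.commute[of _ "H w"] intro!: mult_left_mono)
        qed auto
      qed
    qed (use Hint in auto)
    then show ?thesis by simp
  qed
  define DD where "DD w = (\<Sum>i<n. D i w) / n" for w
  have [measurable]: "DD \<in> borel_measurable M" unfolding DD_def by measurable
  have HDD: "H w * (DD w)\<^sup>2 = (\<Sum>i<n. \<Sum>j<n. H w * (D i w * D j w)) / n\<^sup>2" for w
  proof -
    have "(\<Sum>i<n. D i w)\<^sup>2 = (\<Sum>i<n. \<Sum>j<n. D i w * D j w)"
      unfolding power2_eq_square by (rule sum_product)
    then show ?thesis by (simp add: DD_def power_divide sum_distrib_left)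
  qed
  have DD2int: "integrable M (\<lambda>w. H w * (DD w)\<^sup>2)" unfolding HDD
    by (intro integrable_divide_zero Bochner_Integration.integrable_sum) (use DDint in auto)
  have "(\<integral>w. H w * (DD w)\<^sup>2 \<partial>M) = (\<Sum>i<n. \<Sum>j<n. (\<integral>w. H w * (D i w * D j w) \<partial>M)) / n\<^sup>2"
    unfolding HDD integral_divide_zero
    by (subst Bochner_Integration.integral_sum) (use DDint in auto)
  also have "(\<Sum>i<n. \<Sum>j<n. (\<integral>w. H w * (D i w * D j w) \<partial>M)) = (\<Sum>i<n. \<integral>w. H w * (D i w * D i w) \<partial>M)"
  proof (rule sum.cong[OF refl])
    fix i assume i: "i \<in> {..<n}"
    have "(\<Sum>j<n. (\<integral>w. H w * (D i w * D j w) \<partial>M)) = (\<Sum>j<n. if j = i then (\<integral>w. H w * (D i w * D i w) \<partial>M) else 0)"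
      by (rule sum.cong) (use off i in auto)
    then show "(\<Sum>j<n. (\<integral>w. H w * (D i w * D j w) \<partial>M)) = (\<integral>w. H w * (D i w * D i w) \<partial>M)"
      using i by simp
  qed
  also have "\<dots> \<le> (\<Sum>i<n. B\<^sup>2 * (\<integral>w. H w \<partial>M))" by (rule sum_mono) (use diag in auto)
  also have "(\<Sum>i<n. B\<^sup>2 * (\<integral>w. H w \<partial>M)) / n\<^sup>2 = B\<^sup>2 * (\<integral>w. H w \<partial>M) / n"
    using n by (simp add: power2_eq_square)
  finally have var: "(\<integral>w. H w * (DD w)\<^sup>2 \<partial>M) \<le> B\<^sup>2 * (\<integral>w. H w \<partial>M) / n"
    using n by (simp add: divide_right_mono)
  \<comment> \<open>This value balances the two halves of the inequality \<open>am\<close> between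
    \<open>\<bar>DD w\<bar>\<close> and its square, which takes the place of Cauchy-Schwarz in
    passing from the second moment to the mean.\<close>
  define \<epsilon> where "\<epsilon> = B / sqrt n"
  have \<epsilon>: "0 < \<epsilon>" using B n by (simp add: \<epsilon>_def)
  have am: "\<bar>DD w\<bar> \<le> \<epsilon> / 2 + (DD w)\<^sup>2 / (2 * \<epsilon>)" for w
  proof -
    have "0 \<le> (\<bar>DD w\<bar> - \<epsilon>)\<^sup>2" by simp
    then have "2 * \<epsilon> * \<bar>DD w\<bar> \<le> \<epsilon>\<^sup>2 + (DD w)\<^sup>2" by (simp add: power2_eq_square algebra_simps)
    then show ?thesis using \<epsilon> by (simp add: field_simps power2_eq_square)
  qed
  have bint': "integrable M (\<lambda>w. \<epsilon> / 2 * H w + (H w * (DD w)\<^sup>2) / (2 * \<epsilon>))"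
    using Hint DD2int by auto
  have "(\<integral>\<^sup>+ w. ennreal (H w * \<bar>DD w\<bar>) \<partial>M) \<le> (\<integral>\<^sup>+ w. ennreal (\<epsilon> / 2 * H w + (H w * (DD w)\<^sup>2) / (2 * \<epsilon>)) \<partial>M)"
  proof (intro nn_integral_mono ennreal_leI)
    fix w
    have "H w * \<bar>DD w\<bar> \<le> H w * (\<epsilon> / 2 + (DD w)\<^sup>2 / (2 * \<epsilon>))" using am H0 by (intro mult_left_mono)
    then show "H w * \<bar>DD w\<bar> \<le> \<epsilon> / 2 * H w + (H w * (DD w)\<^sup>2) / (2 * \<epsilon>)" by (simp add: algebra_simps)
  qed
  also have "\<dots> = ennreal (\<integral>w. \<epsilon> / 2 * H w + (H w * (DD w)\<^sup>2) / (2 * \<epsilon>) \<partial>M)"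
    using bint' H0 \<epsilon> by (intro nn_integral_eq_integral) auto
  also have "(\<integral>w. \<epsilon> / 2 * H w + (H w * (DD w)\<^sup>2) / (2 * \<epsilon>) \<partial>M) = \<epsilon> / 2 * (\<integral>w. H w \<partial>M) + (\<integral>w. H w * (DD w)\<^sup>2 \<partial>M) / (2 * \<epsilon>)"
    using Hint DD2int by simp
  also have "ennreal \<dots> \<le> ennreal (\<epsilon> / 2 * (\<integral>w. H w \<partial>M) + (B\<^sup>2 * (\<integral>w. H w \<partial>M) / n) / (2 * \<epsilon>))"
    using var \<epsilon> by (intro ennreal_leI add_left_mono divide_right_mono) auto
  also have "(B\<^sup>2 * (\<integral>w. H w \<partial>M) / n) / (2 * \<epsilon>) = \<epsilon> / 2 * (\<integral>w. H w \<partial>M)"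
  proof -
    have "B\<^sup>2 / n = \<epsilon>\<^sup>2" by (simp add: \<epsilon>_def power_divide)
    then have "(B\<^sup>2 * (\<integral>w. H w \<partial>M) / n) / (2 * \<epsilon>) = \<epsilon>\<^sup>2 * (\<integral>w. H w \<partial>M) / (2 * \<epsilon>)"
      by (metis times_divide_eq_left)
    also have "\<dots> = \<epsilon> / 2 * (\<integral>w. H w \<partial>M)" using \<epsilon> by (simp add: power2_eq_square)
    finally show ?thesis .
  qed
  also have "ennreal (\<epsilon> / 2 * (\<integral>w. H w \<partial>M) + \<epsilon> / 2 * (\<integral>w. H w \<partial>M)) = ennreal \<epsilon> * ennreal (\<integral>w. H w \<partial>M)"
    using \<epsilon> H0 by (simp add: ennreal_mult''[symmetric])
  also have "ennreal (\<integral>w. H w \<partial>M) = (\<integral>\<^sup>+ w. ennreal (H w) \<partial>M)"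
    using Hint H0 by (intro nn_integral_eq_integral[symmetric]) auto
  finally show ?thesis
    by (simp add: DD_def D_def \<epsilon>_def sum_subtractf diff_divide_distrib)
qed

text \<open>The \<open>Y k\<close> are lower approximations of \<open>X\<close> whose weighted
  limits have supremum \<open>L\<close>. A value of \<open>X\<close> that is too small contradicts
  the limit of some \<open>Y k\<close>. Values that are too large on an event of noticeable
  probability would push the weighted mean above \<open>L\<close>, because off this event the mean
  is still nearly that of \<open>Y k\<close>.\<close>

lemma conv_in_prob_weighted:
  fixes H :: "nat \<Rightarrow> 'w \<Rightarrow> real" and X :: "nat \<Rightarrow> 'w \<Rightarrow> ennreal" and Y :: "nat \<Rightarrow> nat \<Rightarrow> 'w \<Rightarrow> real"
  assumes prob: "\<And>N. 1 \<le> N \<Longrightarrow> prob_space (W N)"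
    and H: "\<And>N. 1 \<le> N \<Longrightarrow> H N \<in> borel_measurable (W N)" "\<And>N w. 0 \<le> H N w"
    and X: "\<And>N. 1 \<le> N \<Longrightarrow> X N \<in> borel_measurable (W N)"
    and Y: "\<And>N k. 1 \<le> N \<Longrightarrow> Y k N \<in> borel_measurable (W N)" "\<And>N k w. 0 \<le> Y k N w"
    and YX: "\<And>N k w. 1 \<le> N \<Longrightarrow> w \<in> space (W N) \<Longrightarrow> ennreal (Y k N w) \<le> X N w"
    and Z: "0 < Z" "(\<lambda>N. \<integral>\<^sup>+ w. ennreal \<bar>H N w - Z\<bar> \<partial>W N) \<longlonglongrightarrow> 0"
    and l: "\<And>k. 0 \<le> l k" "\<And>k. (\<lambda>N. \<integral>\<^sup>+ w. ennreal \<bar>H N w * Y k N w - l k\<bar> \<partial>W N) \<longlonglongrightarrow> 0"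
    and L: "L = (SUP k. ennreal (l k))" "\<And>N. 1 \<le> N \<Longrightarrow> (\<integral>\<^sup>+ w. ennreal (H N w) * X N w \<partial>W N) \<le> L"
  shows "conv_in_prob W X (L / ennreal Z)"
proof -
  define d where "d \<eta> k N = ennreal \<eta> * (\<integral>\<^sup>+ w. ennreal \<bar>H N w - Z\<bar> \<partial>W N) + (\<integral>\<^sup>+ w. ennreal \<bar>H N w * Y k N w - l k\<bar> \<partial>W N)" for \<eta> k N
  have d0: "(\<lambda>N. d \<eta> k N) \<longlonglongrightarrow> 0" for \<eta> k
  proof -
    have "(\<lambda>N. d \<eta> k N) \<longlonglongrightarrow> ennreal \<eta> * 0 + 0" unfolding d_def
      by (intro tendsto_add ennreal_tendsto_cmult Z l) auto
    then show ?thesis by simp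
  qed
  have dn: "\<forall>\<^sub>F N in sequentially. 1 \<le> N \<and> d \<eta> k N \<le> ennreal \<epsilon>" if "0 < \<epsilon>" for \<eta> k \<epsilon>
  proof -
    have "\<forall>\<^sub>F N in sequentially. d \<eta> k N < ennreal \<epsilon>"
      using order_tendstoD(2)[OF d0] that by auto
    then show ?thesis using eventually_ge_at_top[of 1] by eventually_elim auto
  qed
  have dint: "(\<integral>\<^sup>+ w. ennreal \<eta> * ennreal \<bar>H N w - Z\<bar> + ennreal \<bar>H N w * Y k N w - l k\<bar> \<partial>W N) = d \<eta> k N" if "1 \<le> N" for \<eta> k N
  proof -
    note [measurable] = H(1)[OF that] Y(1)[OF that]
    show ?thesis unfolding d_def by (subst nn_integral_add) (auto simp: nn_integral_cmult)
  qed
  have Leq: "L = L / ennreal Z * ennreal Z" using Z by (simp add: ennreal_divide_times)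
  have lo: "(\<lambda>N. measure (W N) {w \<in> space (W N). X N w \<le> lo}) \<longlonglongrightarrow> 0" if lo: "lo < L / ennreal Z" for lo
  proof -
    have "lo < top" using lo top.not_eq_extremum by fastforce
    then obtain \<eta> where \<eta>: "lo = ennreal \<eta>" "0 \<le> \<eta>" by (cases lo) auto
    have "ennreal (\<eta> * Z) = lo * ennreal Z" using \<eta> Z by (simp add: ennreal_mult)
    also have "\<dots> < L"
      by (subst Leq, intro ennreal_mult_strict_right_mono lo) (use Z in auto)
    finally have "ennreal (\<eta> * Z) < (SUP k. ennreal (l k))" unfolding L .
    then obtain k where "ennreal (\<eta> * Z) < ennreal (l k)" by (auto simp: less_SUP_iff)
    then have k: "\<eta> * Z < l k" using \<eta> Z by (simp add: ennreal_less_iff)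
    \<comment> \<open>Where \<open>X\<close> is at most \<open>\<eta>\<close>, so is
      \<open>Y k\<close>, and the two error terms must add up to at least this gap. The event
      therefore has probability at most \<open>d \<eta> k N / \<delta>\<close>.\<close>
    define \<delta> where "\<delta> = l k - \<eta> * Z"
    have \<delta>: "0 < \<delta>" using k by (simp add: \<delta>_def)
    show ?thesis
    proof (rule LIMSEQ_I)
      fix \<epsilon> :: real assume \<epsilon>: "0 < \<epsilon>"
      have "\<forall>\<^sub>F N in sequentially. 1 \<le> N \<and> d \<eta> k N \<le> ennreal (\<epsilon> * \<delta> / 2)" using \<epsilon> \<delta> by (intro dn) auto
      then have "\<forall>\<^sub>F N in sequentially. norm (measure (W N) {w \<in> space (W N). X N w \<le> lo} - 0) < \<epsilon>"
      proof eventually_elim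
        case (elim N)
        then have N: "1 \<le> N" by simp
        then interpret prob_space "W N" using prob by auto
        note [measurable] = H(1)[OF N] Y(1)[OF N] X[OF N]
        let ?A = "{w \<in> space (W N). X N w \<le> lo}"
        have A: "?A \<in> events" by measurable
        have "ennreal \<delta> * emeasure (W N) ?A = (\<integral>\<^sup>+ w. ennreal \<delta> * indicator ?A w \<partial>W N)"
          using A by (simp add: nn_integral_cmult_indicator)
        also have "\<dots> \<le> (\<integral>\<^sup>+ w. ennreal \<eta> * ennreal \<bar>H N w - Z\<bar> + ennreal \<bar>H N w * Y k N w - l k\<bar> \<partial>W N)"
        proof (rule nn_integral_mono)
          fix w assume w: "w \<in> space (W N)"
          show "ennreal \<delta> * indicator ?A w \<le> ennreal \<eta> * ennreal \<bar>H N w - Z\<bar> + ennreal \<bar>H N w * Y k N w - l k\<bar>"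
          proof (cases "X N w \<le> lo")
            case True
            have "ennreal (Y k N w) \<le> ennreal \<eta>"
              using order_trans[OF YX[OF N w, of k] True] \<eta> by simp
            then have "Y k N w \<le> \<eta>" using \<eta>(2) by (simp only: ennreal_le_iff)
            then have "H N w * Y k N w \<le> H N w * \<eta>" using H(2) by (intro mult_left_mono)
            then have "\<delta> \<le> \<eta> * (H N w - Z) + \<bar>H N w * Y k N w - l k\<bar>" by (simp add: \<delta>_def algebra_simps)
            also have "\<dots> \<le> \<eta> * \<bar>H N w - Z\<bar> + \<bar>H N w * Y k N w - l k\<bar>" using \<eta> by (intro add_right_mono mult_left_mono) auto
            finally show ?thesis using \<eta> True w by (simp add: ennreal_mult[symmetric] ennreal_plus[symmetric] del: ennreal_plus)
          qed auto
        qed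
        also have "\<dots> = d \<eta> k N" using elim by (intro dint) auto
        also have "\<dots> \<le> ennreal (\<epsilon> * \<delta> / 2)" using elim by auto
        finally have "\<delta> * measure (W N) ?A \<le> \<epsilon> * \<delta> / 2"
          using \<delta> \<epsilon> by (simp add: emeasure_eq_measure ennreal_mult[symmetric] ennreal_le_iff)
        then have "measure (W N) ?A \<le> \<epsilon> / 2" using \<delta> by (simp add: field_simps)
        then show ?case using \<epsilon> by simp
      qed
      then show "\<exists>no. \<forall>N\<ge>no. norm (measure (W N) {w \<in> space (W N). X N w \<le> lo} - 0) < \<epsilon>"
        by (simp add: eventually_sequentially)
    qed
  qed
  have hi: "(\<lambda>N. measure (W N) {w \<in> space (W N). hi \<le> X N w}) \<longlonglongrightarrow> 0" if hi: "L / ennreal Z < hi" "hi < top" for hi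
  proof -
    obtain \<eta> where \<eta>: "hi = ennreal \<eta>" "0 \<le> \<eta>" using hi(2) by (cases hi) auto
    have "L < hi * ennreal Z"
      by (subst Leq, intro ennreal_mult_strict_right_mono hi) (use Z in auto)
    then have L1: "L < ennreal (\<eta> * Z)" using \<eta> Z by (simp add: ennreal_mult)
    then obtain L' where L': "L = ennreal L'" "0 \<le> L'" by (cases L) auto
    have L2: "L' < \<eta> * Z" using L1 L' by (simp add: ennreal_less_iff)
    have lL: "l k \<le> L'" for k
    proof -
      have "ennreal (l k) \<le> L" unfolding L by (rule SUP_upper) auto
      then show ?thesis using L' by (simp add: ennreal_le_iff)
    qed
    define \<delta> where "\<delta> = \<eta> * Z - L'"
    have \<delta>: "0 < \<delta>" using L2 by (simp add: \<delta>_def)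
    show ?thesis
    proof (rule LIMSEQ_I)
      fix \<epsilon> :: real assume \<epsilon>: "0 < \<epsilon>"
      \<comment> \<open>The limit \<open>l k\<close> is chosen within
        \<open>\<epsilon> * \<delta> / 4\<close> of the supremum, and another quarter is left to the
        error \<open>d\<close>; together they bound \<open>p * \<delta>\<close> by half of
        \<open>\<epsilon> * \<delta>\<close>.\<close>
      have "\<exists>k. L' - \<epsilon> * \<delta> / 4 < l k"
      proof (cases "L' - \<epsilon> * \<delta> / 4 < 0")
        case True then show ?thesis using l(1)[of 0] by (intro exI[of _ 0]) linarith
      next
        case False
        then have "ennreal (L' - \<epsilon> * \<delta> / 4) < L" using L' \<epsilon> \<delta> by (simp add: ennreal_less_iff)
        then obtain k where "ennreal (L' - \<epsilon> * \<delta> / 4) < ennreal (l k)" unfolding L by (auto simp: less_SUP_iff)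
        then show ?thesis using False by (auto simp: ennreal_less_iff)
      qed
      then obtain k where k: "L' - \<epsilon> * \<delta> / 4 < l k" by auto
      have "\<forall>\<^sub>F N in sequentially. 1 \<le> N \<and> d \<eta> k N \<le> ennreal (\<epsilon> * \<delta> / 4)" using \<epsilon> \<delta> by (intro dn) auto
      then have "\<forall>\<^sub>F N in sequentially. norm (measure (W N) {w \<in> space (W N). hi \<le> X N w} - 0) < \<epsilon>"
      proof eventually_elim
        case (elim N)
        then have N: "1 \<le> N" by simp
        then interpret prob_space "W N" using prob by auto
        note [measurable] = H(1)[OF N] Y(1)[OF N] X[OF N]
        let ?A = "{w \<in> space (W N). hi \<le> X N w}"
        have A[measurable]: "?A \<in> events" by measurable
        define p where "p = measure (W N) ?A"
        have p: "0 \<le> p" "p \<le> 1" by (auto simp: p_def)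
        \<comment> \<open>The two terms are lower bounds, up to the error, for what
          \<open>H * X\<close> contributes on the event and off it: \<open>\<eta> * Z\<close> on it
          by its definition, and \<open>l k\<close> off it because \<open>Y k\<close> lies below
          \<open>X\<close>.\<close>
        have "ennreal (\<eta> * Z) * ennreal p + ennreal (l k) * ennreal (1 - p)
           = (\<integral>\<^sup>+ w. ennreal (\<eta> * Z) * indicator ?A w + ennreal (l k) * indicator (space (W N) - ?A) w \<partial>W N)"
          using A by (subst nn_integral_add) (auto simp: nn_integral_cmult_indicator emeasure_eq_measure p_def prob_compl)
        also have "\<dots> \<le> (\<integral>\<^sup>+ w. ennreal (H N w) * X N w + (ennreal \<eta> * ennreal \<bar>H N w - Z\<bar> + ennreal \<bar>H N w * Y k N w - l k\<bar>) \<partial>W N)"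
        proof (rule nn_integral_mono)
          fix w assume w: "w \<in> space (W N)"
          show "ennreal (\<eta> * Z) * indicator ?A w + ennreal (l k) * indicator (space (W N) - ?A) w
             \<le> ennreal (H N w) * X N w + (ennreal \<eta> * ennreal \<bar>H N w - Z\<bar> + ennreal \<bar>H N w * Y k N w - l k\<bar>)"
          proof (cases "hi \<le> X N w")
            case True
            have "\<eta> * Z \<le> H N w * \<eta> + \<eta> * \<bar>H N w - Z\<bar>"
            proof -
              have "\<eta> * Z \<le> \<eta> * (H N w + \<bar>H N w - Z\<bar>)" using \<eta> by (intro mult_left_mono) auto
              then show ?thesis by (simp add: algebra_simps)
            qed
            then have "ennreal (\<eta> * Z) \<le> ennreal (H N w) * hi + ennreal \<eta> * ennreal \<bar>H N w - Z\<bar>"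
              using \<eta> H(2) by (simp add: ennreal_mult[symmetric] ennreal_plus[symmetric] ennreal_leI del: ennreal_plus)
            also have "\<dots> \<le> ennreal (H N w) * X N w + ennreal \<eta> * ennreal \<bar>H N w - Z\<bar>"
              using True by (intro add_right_mono mult_left_mono) auto
            finally show ?thesis using True w by (simp add: add.assoc[symmetric] add_increasing2)
          next
            case False
            have "l k \<le> H N w * Y k N w + \<bar>H N w * Y k N w - l k\<bar>" by auto
            then have "ennreal (l k) \<le> ennreal (H N w) * ennreal (Y k N w) + ennreal \<bar>H N w * Y k N w - l k\<bar>"
              using H(2) Y(2) by (simp add: ennreal_mult[symmetric] ennreal_plus[symmetric] ennreal_leI del: ennreal_plus)
            also have "\<dots> \<le> ennreal (H N w) * X N w + ennreal \<bar>H N w * Y k N w - l k\<bar>"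
              using YX elim w by (intro add_right_mono mult_left_mono) auto
            also have "\<dots> \<le> ennreal (H N w) * X N w + (ennreal \<eta> * ennreal \<bar>H N w - Z\<bar> + ennreal \<bar>H N w * Y k N w - l k\<bar>)"
              by (intro add_left_mono) (auto simp: add_increasing)
            finally show ?thesis using False w by simp
          qed
        qed
        also have "\<dots> = (\<integral>\<^sup>+ w. ennreal (H N w) * X N w \<partial>W N) + d \<eta> k N"
          using elim by (subst nn_integral_add) (auto simp: dint)
        also have "\<dots> \<le> ennreal L' + ennreal (\<epsilon> * \<delta> / 4)" using elim L(2) L'(1) by (intro add_mono) auto
        finally have "\<eta> * Z * p + l k * (1 - p) \<le> L' + \<epsilon> * \<delta> / 4"
          using \<eta> Z p l(1)[of k] L' \<epsilon> \<delta>
          by (simp add: ennreal_mult[symmetric] ennreal_plus[symmetric] ennreal_le_iff del: ennreal_plus)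
        then have "p * (\<eta> * Z - l k) \<le> L' - l k + \<epsilon> * \<delta> / 4" by (simp add: algebra_simps)
        also have "\<dots> \<le> \<epsilon> * \<delta> / 2" using k by linarith
        finally have "p * (\<eta> * Z - l k) \<le> \<epsilon> * \<delta> / 2" .
        moreover have "p * \<delta> \<le> p * (\<eta> * Z - l k)" using p lL[of k] by (intro mult_left_mono) (auto simp: \<delta>_def)
        ultimately have "p * \<delta> \<le> \<epsilon> * \<delta> / 2" by linarith
        then have "p \<le> \<epsilon> / 2" using \<delta> by (simp add: field_simps)
        then show ?case using \<epsilon> by (simp add: p_def)
      qed
      then show "\<exists>no. \<forall>N\<ge>no. norm (measure (W N) {w \<in> space (W N). hi \<le> X N w} - 0) < \<epsilon>"
        by (simp add: eventually_sequentially)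
    qed
  qed
  let ?c = "L / ennreal Z"
  show ?thesis unfolding conv_in_prob_def
  proof (intro allI impI, elim conjE)
    fix S :: "ennreal set" assume S: "open S" "?c \<in> S"
    \<comment> \<open>At an endpoint of the extended half-line one of the two one-sided conditions
      is void, hence the case distinctions here and in \<open>high\<close>.\<close>
    have low: "\<exists>A. (\<forall>x\<in>A. x \<le> ?c \<longrightarrow> x \<in> S) \<and> (\<forall>N\<ge>1. {w \<in> space (W N). X N w \<notin> A} \<in> sets (W N)) \<and> (\<lambda>N. measure (W N) {w \<in> space (W N). X N w \<notin> A}) \<longlonglongrightarrow> 0"
    proof (cases "?c = 0")
      case True then show ?thesis using S by (intro exI[of _ UNIV]) auto
    next
      case False
      then have "0 < ?c" by (simp add: zero_less_iff_neq_zero)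
      from open_left[OF S this] obtain lo where lo': "lo < ?c" "{lo<..?c} \<subseteq> S" by auto
      show ?thesis
      proof (intro exI[of _ "{lo<..}"] conjI allI impI)
        fix N :: nat assume "1 \<le> N"
        note [measurable] = X[OF this]
        show "{w \<in> space (W N). X N w \<notin> {lo<..}} \<in> sets (W N)" by measurable
      qed (use lo' lo[OF lo'(1)] in \<open>auto simp: not_less\<close>)
    qed
    have high: "\<exists>A. (\<forall>x\<in>A. x \<ge> ?c \<longrightarrow> x \<in> S) \<and> (\<forall>N\<ge>1. {w \<in> space (W N). X N w \<notin> A} \<in> sets (W N)) \<and> (\<lambda>N. measure (W N) {w \<in> space (W N). X N w \<notin> A}) \<longlonglongrightarrow> 0"
    proof (cases "?c = top")
      case True then show ?thesis using S by (intro exI[of _ UNIV]) (auto simp: top_unique)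
    next
      case False
      then have "?c < top" by (simp add: less_top)
      from open_right[OF S this] obtain h where h: "?c < h" "{?c..<h} \<subseteq> S" by auto
      then obtain hi' where hi': "?c < hi'" "hi' < h" using dense by blast
      show ?thesis
      proof (intro exI[of _ "{..<hi'}"] conjI allI impI)
        fix N :: nat assume "1 \<le> N"
        note [measurable] = X[OF this]
        show "{w \<in> space (W N). X N w \<notin> {..<hi'}} \<in> sets (W N)" by measurable
      next
        have "hi' < top" using hi'(2) top.not_eq_extremum by fastforce
        then show "(\<lambda>N. measure (W N) {w \<in> space (W N). X N w \<notin> {..<hi'}}) \<longlonglongrightarrow> 0"
          using hi[OF hi'(1)] by (simp add: not_less)
      qed (use hi' h in auto)
    qed
    obtain A where A: "\<And>x. x \<in> A \<Longrightarrow> x \<le> ?c \<Longrightarrow> x \<in> S" "\<And>N. N \<ge> 1 \<Longrightarrow> {w \<in> space (W N). X N w \<notin> A} \<in> sets (W N)"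
      "(\<lambda>N. measure (W N) {w \<in> space (W N). X N w \<notin> A}) \<longlonglongrightarrow> 0" using low by blast
    obtain A' where A': "\<And>x. x \<in> A' \<Longrightarrow> x \<ge> ?c \<Longrightarrow> x \<in> S" "\<And>N. N \<ge> 1 \<Longrightarrow> {w \<in> space (W N). X N w \<notin> A'} \<in> sets (W N)"
      "(\<lambda>N. measure (W N) {w \<in> space (W N). X N w \<notin> A'}) \<longlonglongrightarrow> 0" using high by blast
    have lim: "(\<lambda>N. 1 - (measure (W N) {w \<in> space (W N). X N w \<notin> A} + measure (W N) {w \<in> space (W N). X N w \<notin> A'})) \<longlonglongrightarrow> 1"
      using tendsto_diff[OF tendsto_const tendsto_add[OF A(3) A'(3)]] by simp
    have bnd: "1 - (measure (W N) {w \<in> space (W N). X N w \<notin> A} + measure (W N) {w \<in> space (W N). X N w \<notin> A'})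
         \<le> measure (W N) {w \<in> space (W N). X N w \<in> S} \<and> measure (W N) {w \<in> space (W N). X N w \<in> S} \<le> 1" if N: "1 \<le> N" for N
      proof -
        interpret prob_space "W N" using prob N by auto
        note [measurable] = X[OF N]
        let ?S = "{w \<in> space (W N). X N w \<in> S}"
        have m: "?S \<in> events"
          using measurable_sets[OF X[OF N], of S] S(1) by (simp add: vimage_def Int_def conj_commute)
        have "space (W N) \<subseteq> ?S \<union> ({w \<in> space (W N). X N w \<notin> A} \<union> {w \<in> space (W N). X N w \<notin> A'})"
          using A(1) A'(1) linear by blast
        then have "1 \<le> prob (?S \<union> ({w \<in> space (W N). X N w \<notin> A} \<union> {w \<in> space (W N). X N w \<notin> A'}))"
          using m A(2)[OF N] A'(2)[OF N] finite_measure_mono[of "space (W N)"] prob_space by fastforce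
        also have "\<dots> \<le> prob ?S + (prob {w \<in> space (W N). X N w \<notin> A} + prob {w \<in> space (W N). X N w \<notin> A'})"
          using m A(2)[OF N] A'(2)[OF N]
          by (meson add_left_mono measure_Un_le order_trans sets.Un)
        finally show ?thesis by auto
      qed
    show "(\<lambda>N. measure (W N) {w \<in> space (W N). X N w \<in> S}) \<longlonglongrightarrow> 1"
      by (rule tendsto_sandwich[OF _ _ lim tendsto_const]; rule eventually_sequentiallyI[of 1]) (use bnd in blast)+
  qed
qed

text \<open>The ratio \<open>X / (c * Y)\<close> has no continuous extension to
  \<open>Y = 0\<close>, but the prefactor repairs this: \<open>x\<close> times a difference of
  ratios is controlled by the differences of numerators and denominators, because
  \<open>x / y\<close> is at most \<open>c\<close>. Division by zero yields the ratio 0, consistent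
  with \<open>X = 0\<close> there.\<close>

lemma thinned_lipschitz:
  fixes X x Y y c :: real
  assumes "0 \<le> X" "X \<le> c * Y" "0 \<le> x" "x \<le> c * y" "0 < c" "0 \<le> Y" "0 < y"
  shows "\<bar>X * (1 - X / (c * Y)) ^ k - x * (1 - x / (c * y)) ^ k\<bar> \<le> (1 + real k) * \<bar>X - x\<bar> + real k * c * \<bar>Y - y\<bar>"
proof -
  define R \<rho> where "R = X / (c * Y)" and "\<rho> = x / (c * y)"
  have \<rho>: "0 \<le> \<rho>" "\<rho> \<le> 1" using assms by (auto simp: \<rho>_def divide_le_eq)
  have R: "0 \<le> R" "R \<le> 1" using assms by (auto simp: R_def divide_le_eq)
  have lip: "\<bar>(1 - R) ^ k - (1 - \<rho>) ^ k\<bar> \<le> k * \<bar>R - \<rho>\<bar>" for k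
  proof (induction k)
    case (Suc k)
    have "(1 - R) ^ Suc k - (1 - \<rho>) ^ Suc k = (1 - R) * ((1 - R) ^ k - (1 - \<rho>) ^ k) + (\<rho> - R) * (1 - \<rho>) ^ k"
      by (simp add: algebra_simps)
    also have "\<bar>\<dots>\<bar> \<le> 1 * (k * \<bar>R - \<rho>\<bar>) + \<bar>R - \<rho>\<bar> * 1"
    proof (rule order_trans[OF abs_triangle_ineq], rule add_mono)
      show "\<bar>(1 - R) * ((1 - R) ^ k - (1 - \<rho>) ^ k)\<bar> \<le> 1 * (k * \<bar>R - \<rho>\<bar>)"
        unfolding abs_mult by (rule mult_mono) (use R Suc in auto)
      have "(1 - \<rho>) ^ k \<le> 1" using \<rho> by (intro power_le_one) auto
      then show "\<bar>(\<rho> - R) * (1 - \<rho>) ^ k\<bar> \<le> \<bar>R - \<rho>\<bar> * 1"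
        unfolding abs_mult using \<rho> by (intro mult_mono) (auto simp: abs_minus_commute)
    qed
    finally show ?case by (simp add: algebra_simps)
  qed simp
  have xr: "x * \<bar>R - \<rho>\<bar> \<le> \<bar>X - x\<bar> + c * \<bar>Y - y\<bar>"
  proof (cases "Y = 0")
    case True
    then have "X = 0" "R = 0" using assms by (auto simp: R_def)
    then show ?thesis using assms \<rho> mult_left_mono[of \<rho> 1 x] True
      by (auto simp: add_increasing2)
  next
    case False
    then have Y: "0 < Y" using assms by auto
    have "R - \<rho> = (X - x) / (c * y) + R * (y - Y) / y"
      using assms Y by (simp add: R_def \<rho>_def field_simps)
    then have "\<bar>R - \<rho>\<bar> \<le> \<bar>(X - x) / (c * y)\<bar> + \<bar>R * (y - Y) / y\<bar>" by (metis abs_triangle_ineq)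
    then have "x * \<bar>R - \<rho>\<bar> \<le> x * (\<bar>(X - x) / (c * y)\<bar> + \<bar>R * (y - Y) / y\<bar>)"
      using assms(3) by (rule mult_left_mono)
    also have "\<dots> = \<rho> * \<bar>X - x\<bar> + R * (x / y) * \<bar>Y - y\<bar>"
    proof -
      have "\<bar>(X - x) / (c * y)\<bar> = \<bar>X - x\<bar> / (c * y)" using assms by (simp add: abs_divide abs_mult)
      moreover have "\<bar>R * (y - Y) / y\<bar> = R * \<bar>Y - y\<bar> / y"
        using assms R by (simp add: abs_divide abs_mult abs_minus_commute)
      ultimately show ?thesis by (simp add: \<rho>_def algebra_simps)
    qed
    also have "\<dots> \<le> 1 * \<bar>X - x\<bar> + (1 * c) * \<bar>Y - y\<bar>"
      using assms R \<rho> by (intro add_mono mult_right_mono mult_mono) (auto simp: divide_le_eq)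
    finally show ?thesis by simp
  qed
  have "X * (1 - R) ^ k - x * (1 - \<rho>) ^ k = (X - x) * (1 - R) ^ k + x * ((1 - R) ^ k - (1 - \<rho>) ^ k)"
    by (simp add: algebra_simps)
  also have "\<bar>\<dots>\<bar> \<le> \<bar>X - x\<bar> * 1 + x * (k * \<bar>R - \<rho>\<bar>)"
  proof (rule order_trans[OF abs_triangle_ineq], rule add_mono)
    have "(1 - R) ^ k \<le> 1" using R by (intro power_le_one) auto
    then show "\<bar>(X - x) * (1 - R) ^ k\<bar> \<le> \<bar>X - x\<bar> * 1"
      unfolding abs_mult using R by (intro mult_mono) auto
    show "\<bar>x * ((1 - R) ^ k - (1 - \<rho>) ^ k)\<bar> \<le> x * (k * \<bar>R - \<rho>\<bar>)"
      unfolding abs_mult using lip assms by (intro mult_mono) auto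
  qed
  also have "x * (k * \<bar>R - \<rho>\<bar>) = k * (x * \<bar>R - \<rho>\<bar>)" by simp
  also have "\<dots> \<le> k * (\<bar>X - x\<bar> + c * \<bar>Y - y\<bar>)" using xr by (intro mult_left_mono) auto
  finally show ?thesis by (simp add: R_def \<rho>_def algebra_simps)
qed

text \<open>All draws share one law and one function, so a single conditional mean centers every
  term. It is at most 1 where \<open>H\<close> is positive, so its real version loses nothing
  there.\<close>

lemma cond_draws_weak_law:
  fixes X :: "nat \<Rightarrow> 'w \<Rightarrow> 'b" and H :: "'w \<Rightarrow> real" and \<phi> :: "'w \<times> 'b \<Rightarrow> real"
  assumes draws: "cond_draws W F E {..<N} X \<mu> f q"
    and H: "H \<in> borel_measurable F" "\<And>w. 0 \<le> H w" "\<And>w. w \<in> space W \<Longrightarrow> w \<notin> E \<Longrightarrow> H w = 0"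
      "(\<integral>\<^sup>+ w. ennreal (H w) \<partial>W) < \<infinity>"
    and N: "1 \<le> N"
    and \<phi>: "\<phi> \<in> borel_measurable (F \<Otimes>\<^sub>M \<mu>)" "\<And>p. 0 \<le> \<phi> p" "\<And>p. \<phi> p \<le> 1"
  shows "(\<integral>\<^sup>+ w. ennreal (H w * \<bar>(\<Sum>i<N. \<phi> (w, X i w)) / N - enn2real (\<integral>\<^sup>+ z. ennreal (\<phi> (w, z)) * q w z \<partial>\<mu>)\<bar>) \<partial>W)
     \<le> ennreal (1 / sqrt N) * (\<integral>\<^sup>+ w. ennreal (H w) \<partial>W)"
proof -
  interpret cond_draws W F E "{..<N}" X \<mu> f q by (rule draws)
  interpret prob_space W by (rule prob)
  interpret sigma_finite_measure \<mu> by (rule sf)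
  note [measurable] = \<phi>(1)
  define e where "e w = (\<integral>\<^sup>+ z. ennreal (\<phi> (w, z)) * q w z \<partial>\<mu>)" for w
  have eF[measurable]: "e \<in> borel_measurable F" unfolding e_def by measurable
  have HW[measurable]: "H \<in> borel_measurable W" and eW[measurable]: "e \<in> borel_measurable W"
    using measurable_from_subalg[OF sub H(1)] measurable_from_subalg[OF sub eF] by auto
  have YW: "(\<lambda>w. \<phi> (w, X i w)) \<in> borel_measurable W" if "i < N" for i
    using measurable_compose[OF pair_X_measurable \<phi>(1)] that by simp
  have e1: "AE w in W. 0 < H w \<longrightarrow> e w \<le> 1"
    using law AE_space
  proof eventually_elim
    case (elim w)
    show ?case
    proof
      assume "0 < H w"
      then have "w \<in> E" using H(3)[of w] elim by force
      have "e w \<le> (\<integral>\<^sup>+ z. 1 * q w z \<partial>\<mu>)" unfolding e_def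
        by (intro nn_integral_mono mult_right_mono) (use \<phi> in \<open>auto simp: ennreal_leI\<close>)
      then show "e w \<le> 1" using elim \<open>w \<in> E\<close> by simp
    qed
  qed
  have ee: "AE w in W. 0 < H w \<longrightarrow> ennreal (enn2real (e w)) = e w"
    using e1
  proof eventually_elim
    case (elim w)
    then show ?case by (metis ennreal_enn2real ennreal_one_less_top order_le_less_trans)
  qed
  have "(\<integral>\<^sup>+ w. ennreal (H w * \<bar>(\<Sum>i<N. \<phi> (w, X i w)) / N - (\<Sum>i<N. enn2real (e w)) / N\<bar>) \<partial>W)
     \<le> ennreal (1 / sqrt N) * (\<integral>\<^sup>+ w. ennreal (H w) \<partial>W)"
  proof (rule weighted_weak_law[OF N zero_less_one HW H(2) H(4)])
    fix i j assume ij: "i < N" "j < N" "i \<noteq> j"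
    have 1: "(\<integral>\<^sup>+ w. ennreal (H w) * (ennreal (enn2real (e w)) * ennreal (enn2real (e w))) \<partial>W) = (\<integral>\<^sup>+ w. ennreal (H w) * (e w * e w) \<partial>W)"
      by (rule nn_integral_cong_AE) (use ee in \<open>eventually_elim, metis H(2) ennreal_0 less_eq_real_def mult_zero_left\<close>)
    have "(\<integral>\<^sup>+ w. ennreal (H w) * (ennreal (\<phi> (w, X i w)) * (\<Prod>k\<in>{j}. ennreal (\<phi> (w, X k w)))) \<partial>W)
      = (\<integral>\<^sup>+ w. ennreal (H w) * (e w * (\<Prod>k\<in>{j}. e w)) \<partial>W)"
      unfolding e_def
      by (rule nn_integral_weighted[of "\<lambda>w. ennreal (H w)" "{j}" i "\<lambda>_ p. ennreal (\<phi> p)" "\<lambda>p. ennreal (\<phi> p)"])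
        (use H ij \<phi> in auto)
    then show "(\<integral>\<^sup>+ w. ennreal (H w) * (ennreal (\<phi> (w, X i w)) * ennreal (\<phi> (w, X j w))) \<partial>W)
      = (\<integral>\<^sup>+ w. ennreal (H w) * (ennreal (enn2real (e w)) * ennreal (enn2real (e w))) \<partial>W)"
      by (simp add: 1)
    \<comment> \<open>The mixed moment follows from the same identity with the weight
      \<open>H * e\<close>, which is again measurable in the history and vanishes off
      \<open>E\<close>.\<close>
    have "(\<integral>\<^sup>+ w. (ennreal (H w) * e w) * ennreal (\<phi> (w, X i w)) \<partial>W)
      = (\<integral>\<^sup>+ w. (ennreal (H w) * e w) * e w \<partial>W)"
      using nn_integral_weighted[of "\<lambda>w. ennreal (H w) * e w" "{}" i "\<lambda>_ p. 0" "\<lambda>p. ennreal (\<phi> p)"]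
        H ij \<phi> by (simp add: e_def[symmetric])
    then have 2: "(\<integral>\<^sup>+ w. ennreal (H w) * (ennreal (\<phi> (w, X i w)) * e w) \<partial>W) = (\<integral>\<^sup>+ w. ennreal (H w) * (e w * e w) \<partial>W)"
      by (simp add: mult_ac)
    have "(\<integral>\<^sup>+ w. ennreal (H w) * (ennreal (\<phi> (w, X i w)) * ennreal (enn2real (e w))) \<partial>W) = (\<integral>\<^sup>+ w. ennreal (H w) * (ennreal (\<phi> (w, X i w)) * e w) \<partial>W)"
      by (rule nn_integral_cong_AE) (use ee in \<open>eventually_elim, metis H(2) ennreal_0 less_eq_real_def mult_zero_left\<close>)
    then show "(\<integral>\<^sup>+ w. ennreal (H w) * (ennreal (\<phi> (w, X i w)) * ennreal (enn2real (e w))) \<partial>W)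
      = (\<integral>\<^sup>+ w. ennreal (H w) * (ennreal (enn2real (e w)) * ennreal (enn2real (e w))) \<partial>W)"
      by (simp add: 1 2)
  next
    show "AE w in W. 0 < H w \<longrightarrow> 0 \<le> enn2real (e w) \<and> enn2real (e w) \<le> 1"
      using e1 by eventually_elim (auto simp: enn2real_leI)
  qed (use \<phi> YW in auto)
  then show ?thesis using N by (simp add: e_def)
qed

text \<open>Infinite values are harmless: if \<open>x\<close> is infinite and \<open>d\<close> is
  not, then \<open>y\<close> is infinite as well and both real versions are 0.\<close>

lemma ennreal_abs_enn2real_diff_le:
  assumes "x \<le> y + d" "y \<le> x + (d::ennreal)"
  shows "ennreal \<bar>enn2real x - enn2real y\<bar> \<le> d"
proof (cases "d = \<infinity> \<or> x = \<infinity>")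
  case True
  then show ?thesis using assms by (auto simp: top_unique ennreal_add_eq_top)
next
  case False
  then obtain x' d' where x': "x = ennreal x'" "0 \<le> x'" "d = ennreal d'" "0 \<le> d'"
    by (cases x; cases d) auto
  have "y < \<infinity>" using assms(2) x' by (metis ennreal_less_top ennreal_plus infinity_ennreal_def order_le_less_trans)
  then obtain y' where y': "y = ennreal y'" "0 \<le> y'" by (cases y) auto
  have "x' \<le> y' + d'" "y' \<le> x' + d'"
    using assms x' y' by (auto simp: ennreal_plus[symmetric] simp del: ennreal_plus)
  then show ?thesis using x' y' by (auto intro!: ennreal_leI)
qed

lemma nn_integral_count_pair:
  assumes "sigma_finite_measure \<nu>" "f \<in> borel_measurable (count_space {..<N::nat} \<Otimes>\<^sub>M \<nu>)"
  shows "(\<integral>\<^sup>+ z. f z \<partial>(count_space {..<N} \<Otimes>\<^sub>M \<nu>)) = (\<Sum>j<N. \<integral>\<^sup>+ x. f (j, x) \<partial>\<nu>)"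
  using assms by (simp add: sigma_finite_measure.nn_integral_fst[symmetric] nn_integral_count_space_finite)

text \<open>This is how a particle is read off at a random index, be it an ancestor, a proposal or a
  backward index.\<close>

lemma measurable_pick:
  assumes "\<And>j. j < N \<Longrightarrow> h j \<in> measurable M L" "g \<in> measurable M (count_space {..<N::nat})"
  shows "(\<lambda>p. h (g p) p) \<in> measurable M L"
  by (rule measurable_compose_countable'[OF _ assms(2)]) (use assms(1) in auto)

subsection \<open>Unnormalized filters\<close>

lemma space_forward_hist: "space (forward_hist N W \<xi> I t) = space W"
  unfolding forward_hist_def by (rule space_measure_of) auto

lemma sets_forward_hist: "sets (forward_hist N W \<xi> I t) = sigma_sets (space W)
     ({\<xi> u i -` A \<inter> space W | u i A. u < t \<and> i < N \<and> A \<in> sets borel} \<union>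
      {I u i -` A \<inter> space W | u i A. 0 < u \<and> u < t \<and> i < N})"
  unfolding forward_hist_def by (rule sets_measure_of) auto

lemma forward_hist_mono: "t \<le> t' \<Longrightarrow> sets (forward_hist N W \<xi> I t) \<subseteq> sets (forward_hist N W \<xi> I t')"
  unfolding sets_forward_hist by (rule sigma_sets_mono', rule Un_mono) (blast intro: order.strict_trans2)+

lemma measurable_forward_hist: "u < t \<Longrightarrow> i < N \<Longrightarrow> \<xi> u i \<in> measurable (forward_hist N W \<xi> I t) borel"
  by (rule measurableI) (auto simp: space_forward_hist sets_forward_hist intro!: sigma_sets.Basic)

context hidden_markov_model begin

sublocale nu: sigma_finite_measure \<nu> by (rule dom_sigma_finite)

abbreviation "G \<equiv> obs_lik g y"
abbreviation "Mk \<equiv> trans_kernel \<nu> m"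

lemma sets_nu[measurable_cong]: "sets \<nu> = sets borel" by (rule dom_sets)
lemma sets_chi[measurable_cong]: "sets \<chi>0 = sets borel" by (rule init_sets)

lemma m_measurable[measurable (raw)]:
  "f \<in> measurable L borel \<Longrightarrow> h \<in> measurable L borel \<Longrightarrow> (\<lambda>w. m (f w) (h w)) \<in> borel_measurable L"
  using measurable_compose[OF measurable_Pair trans_measurable] by simp

lemma G_measurable[measurable]: "G t \<in> borel_measurable borel"
  unfolding obs_lik_def[abs_def]
  using measurable_compose[OF measurable_Pair[OF measurable_ident measurable_const, of "y t"] lik_measurable] by simp

lemma G_nonneg: "0 \<le> G t x" by (simp add: obs_lik_def lik_nonneg)

lemma nn_integral_Mk: "f \<in> borel_measurable borel \<Longrightarrow> (\<integral>\<^sup>+ x'. f x' \<partial>Mk x) = (\<integral>\<^sup>+ x'. ennreal (m x x') * f x' \<partial>\<nu>)"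
  unfolding trans_kernel_def by (subst nn_integral_density) auto

lemma path_int_measurable[measurable]:
  "f \<in> borel_measurable borel \<Longrightarrow> path_int Mk G s n f \<in> borel_measurable borel"
proof (induction n arbitrary: s)
  case 0 then show ?case by (simp add: measurable_cong[of _ "path_int Mk G s 0 f" f])
next
  case (Suc n)
  note [measurable] = Suc.IH[OF Suc.prems]
  have "(\<lambda>x. \<integral>\<^sup>+ x'. ennreal (m x x') * (ennreal (G (Suc s) x') * path_int Mk G (Suc s) n f x') \<partial>\<nu>) \<in> borel_measurable borel"
    by measurable
  then show ?case
    by (rule measurable_cong[THEN iffD1, rotated]) (simp add: nn_integral_Mk)
qed


lemma path_int_cmult:
  "f \<in> borel_measurable borel \<Longrightarrow> path_int Mk G s n (\<lambda>x. c * f x) x = c * path_int Mk G s n f x"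
proof (induction n arbitrary: s x)
  case (Suc n)
  note [measurable] = path_int_measurable[OF Suc.prems]
  show ?case using Suc by (simp add: nn_integral_Mk mult.left_commute[of _ c] nn_integral_cmult)
qed simp

lemma path_int_mono: "(\<And>x. f x \<le> h x) \<Longrightarrow> path_int Mk G s n f x \<le> path_int Mk G s n h x"
  by (induction n arbitrary: s x) (auto intro!: nn_integral_mono mult_left_mono)

lemma path_int_path_int: "path_int Mk G s n (path_int Mk G (s + n) k f) x = path_int Mk G s (n + k) f x"
proof (induction n arbitrary: s x)
  case (Suc n)
  show ?case using Suc.IH[of "Suc s"] by simp
qed simp

lemma unnorm_filter_path: "t \<le> u \<Longrightarrow> unnorm_filter \<chi>0 Mk G t (path_int Mk G t (u - t) f) = unnorm_filter \<chi>0 Mk G u f"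
  using path_int_path_int[of 0 t "u - t" f] by (simp add: unnorm_filter_def)

text \<open>If the mass at time \<open>t\<close> vanished, so would the one at time
  \<open>T\<close>: the remaining path integral is bounded by the constant \<open>top\<close>, and
  in extended arithmetic \<open>top * 0 = 0\<close>.\<close>

lemma evidence_pos': assumes "t \<le> T" shows "0 < unnorm_filter \<chi>0 Mk G t (\<lambda>_. 1)"
proof (rule ccontr)
  assume "\<not> 0 < unnorm_filter \<chi>0 Mk G t (\<lambda>_. 1)"
  then have z: "unnorm_filter \<chi>0 Mk G t (\<lambda>_. 1) = 0" by simp
  have m: "path_int Mk G 0 t (\<lambda>_. 1) \<in> borel_measurable borel" by (rule path_int_measurable) simp
  have "unnorm_filter \<chi>0 Mk G T (\<lambda>_. 1) = unnorm_filter \<chi>0 Mk G t (path_int Mk G t (T - t) (\<lambda>_. 1))"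
    using unnorm_filter_path[OF assms, of "\<lambda>_. 1"] by simp
  also have "\<dots> \<le> unnorm_filter \<chi>0 Mk G t (\<lambda>_. top * 1)"
    unfolding unnorm_filter_def by (intro nn_integral_mono mult_left_mono path_int_mono) auto
  also have "\<dots> = top * unnorm_filter \<chi>0 Mk G t (\<lambda>_. 1)"
  proof -
    have "path_int Mk G 0 t (\<lambda>_. top * 1) x = top * path_int Mk G 0 t (\<lambda>_. 1) x" for x
      by (rule path_int_cmult) simp
    then show ?thesis unfolding unnorm_filter_def using m
      by (simp only: mult.left_commute[of _ top]) (rule nn_integral_cmult, measurable)
  qed
  finally show False using z evidence_pos by simp
qed

end

text \<open>Both filters split the likelihood as \<open>a t * b t\<close>, where \<open>b t\<close> enters the proposal and \<open>a t\<close> is left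
  as the importance weight: \<open>b = 1\<close> for the bootstrap filter, \<open>a t = 1\<close> for the fully adapted one (except at
  time 0, where \<open>a 0\<close> is the normalizing constant of \<open>\<rho>0\<close>).\<close>

locale adapted_ffbsi = hidden_markov_model \<chi>0 \<nu> m g y T
  for \<chi>0 \<nu> :: "'x::polish_space measure"
    and m :: "'x \<Rightarrow> 'x \<Rightarrow> real"
    and g :: "'x \<Rightarrow> 'y::polish_space \<Rightarrow> real"
    and y :: "nat \<Rightarrow> 'y"
    and T :: nat +
  fixes \<sigma> :: real
    and \<rho>0 :: "'x measure"
    and \<theta> :: "nat \<Rightarrow> 'x \<Rightarrow> real"
    and p :: "nat \<Rightarrow> 'x \<Rightarrow> 'x \<Rightarrow> real"
    and a b :: "nat \<Rightarrow> 'x \<Rightarrow> real"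
    and W :: "nat \<Rightarrow> 'w measure"
    and \<xi> :: "nat \<Rightarrow> nat \<Rightarrow> nat \<Rightarrow> 'w \<Rightarrow> 'x"
    and I J :: "nat \<Rightarrow> nat \<Rightarrow> nat \<Rightarrow> 'w \<Rightarrow> nat"
    and V :: "nat \<Rightarrow> nat \<Rightarrow> nat \<Rightarrow> nat \<Rightarrow> 'w \<Rightarrow> nat"
    and U :: "nat \<Rightarrow> nat \<Rightarrow> nat \<Rightarrow> nat \<Rightarrow> 'w \<Rightarrow> real"
  assumes systems: "\<And>N. 1 \<le> N \<Longrightarrow> fast_ffbsi \<chi>0 \<nu> m g y T \<sigma> \<rho>0 \<theta> p N (W N) (\<xi> N) (I N) (J N) (V N) (U N)"
    and bounded: "\<And>x x'. m x x' \<le> \<sigma>"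
    and a_measurable[measurable]: "\<And>t. a t \<in> borel_measurable borel"
    and b_measurable[measurable]: "\<And>t. b t \<in> borel_measurable borel"
    and a_nonneg: "\<And>t x. 0 \<le> a t x"
    and b_nonneg: "\<And>t x. 0 \<le> b t x"
    and lik_factor: "\<And>t x. t \<le> T \<Longrightarrow> obs_lik g y t x = a t x * b t x"
    and adj_factor: "\<And>t x x'. \<lbrakk>1 \<le> t; t \<le> T\<rbrakk> \<Longrightarrow> \<theta> t x * p t x x' = m x x' * b t x'"
    and boot_or_adapted: "\<And>t. \<lbrakk>1 \<le> t; t \<le> T\<rbrakk> \<Longrightarrow> (\<forall>x. b t x = 1) \<or> (\<forall>x. a t x = 1)"
    and init_factor: "\<rho>0 = density \<chi>0 (\<lambda>x. ennreal (b 0 x))"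
    and init_weight: "AE x in \<rho>0. enn2real (RN_deriv \<rho>0 \<chi>0 x) * obs_lik g y 0 x = a 0 x"
begin

lemma sigma_pos: "0 < \<sigma>"
proof (rule ccontr)
  assume "\<not> 0 < \<sigma>"
  then have "m x x' = 0" for x x' using bounded[of x x'] trans_nonneg[of x x'] by linarith
  then show False using trans_mass[of undefined] by simp
qed

text \<open>The unnormalized law targeted by the particles at time \<open>t\<close>, before weighting by \<open>a t\<close>.\<close>

primrec target :: "nat \<Rightarrow> 'x measure" where
  "target 0 = \<rho>0"
| "target (Suc t) = density \<nu> (\<lambda>x'. ennreal (b (Suc t) x') * (\<integral>\<^sup>+ x. ennreal (a t x * m x x') \<partial>target t))"

text \<open>The one-step Feynman-Kac operator of the factored model, weighting the departure point
  by \<open>a\<close> and the arrival point by \<open>b\<close>. Its adjoint carries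
  \<open>target t\<close> to \<open>target (Suc t)\<close>.\<close>

definition Q :: "nat \<Rightarrow> ('x \<Rightarrow> ennreal) \<Rightarrow> 'x \<Rightarrow> ennreal" where
  "Q t f x = (\<integral>\<^sup>+ x'. ennreal (a t x * m x x' * b (Suc t) x') * f x' \<partial>\<nu>)"

lemma target_0: "target 0 = density \<chi>0 (\<lambda>x. ennreal (b 0 x))"
  by (rule trans[OF target.simps(1) init_factor])

lemma sets_target[measurable_cong]: "sets (target t) = sets borel"
proof (cases t)
  case 0
  then show ?thesis using target_0 by (simp add: init_sets del: target.simps)
next
  case (Suc u)
  then show ?thesis by (simp add: dom_sets)
qed

lemma Q_measurable[measurable]: assumes [measurable]: "f \<in> borel_measurable borel" shows "Q t f \<in> borel_measurable borel"
  unfolding Q_def[abs_def] by measurable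

lemma nn_integral_target_Suc:
  assumes "finite_measure (target t)" and f[measurable]: "f \<in> borel_measurable borel"
  shows "(\<integral>\<^sup>+ x. f x \<partial>target (Suc t)) = (\<integral>\<^sup>+ x. Q t f x \<partial>target t)"
proof -
  interpret tg: finite_measure "target t" by fact
  interpret pair_sigma_finite "target t" \<nu> ..
  have "(\<integral>\<^sup>+ x. f x \<partial>target (Suc t)) = (\<integral>\<^sup>+ x'. ennreal (b (Suc t) x') * (\<integral>\<^sup>+ x. ennreal (a t x * m x x') \<partial>target t) * f x' \<partial>\<nu>)"
    by (simp add: nn_integral_density)
  also have "\<dots> = (\<integral>\<^sup>+ x'. \<integral>\<^sup>+ x. ennreal (a t x * m x x' * b (Suc t) x') * f x' \<partial>target t \<partial>\<nu>)"
    by (intro nn_integral_cong)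
      (simp add: nn_integral_multc[symmetric] nn_integral_cmult[symmetric] ennreal_mult a_nonneg trans_nonneg b_nonneg mult_ac)
  also have "\<dots> = (\<integral>\<^sup>+ x. \<integral>\<^sup>+ x'. ennreal (a t x * m x x' * b (Suc t) x') * f x' \<partial>\<nu> \<partial>target t)"
    by (rule Fubini') measurable
  finally show ?thesis by (simp add: Q_def)
qed

lemma Q_path:
  assumes "s < T" and [measurable]: "f \<in> borel_measurable borel"
  shows "Q s (\<lambda>x. ennreal (a (Suc s) x) * path_int Mk G (Suc s) n f x) x = ennreal (a s x) * path_int Mk G s (Suc n) f x"
proof -
  have "ennreal (a s x) * path_int Mk G s (Suc n) f x
    = (\<integral>\<^sup>+ x'. ennreal (a s x) * (ennreal (m x x') * (ennreal (G (Suc s) x') * path_int Mk G (Suc s) n f x')) \<partial>\<nu>)"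
    by (simp add: nn_integral_Mk nn_integral_cmult)
  also have "\<dots> = Q s (\<lambda>x. ennreal (a (Suc s) x) * path_int Mk G (Suc s) n f x) x"
    unfolding Q_def using assms
    by (intro nn_integral_cong) (simp add: lik_factor ennreal_mult a_nonneg b_nonneg trans_nonneg mult_ac)
  finally show ?thesis by simp
qed

text \<open>By adjointness one step of the path integral can be moved into the target, so the
  pairing is invariant in \<open>s\<close>. Finiteness of the earlier targets, needed for Fubini, is
  a hypothesis because \<open>finite_target\<close> obtains it inductively from this very
  lemma.\<close>

lemma unnorm_filter_eq_path:
  assumes "\<And>u. u < s \<Longrightarrow> finite_measure (target u)" and "s \<le> t" "t \<le> T" and f[measurable]: "f \<in> borel_measurable borel"
  shows "unnorm_filter \<chi>0 Mk G t f = (\<integral>\<^sup>+ x. ennreal (a s x) * path_int Mk G s (t - s) f x \<partial>target s)"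
  using assms(1,2)
proof (induction s)
  case 0
  have "ennreal (G 0 x) = ennreal (b 0 x) * ennreal (a 0 x)" for x
    by (simp add: lik_factor ennreal_mult a_nonneg b_nonneg mult.commute)
  then show ?case
    by (simp add: unnorm_filter_def target_0 nn_integral_density mult.assoc del: target.simps)
next
  case (Suc s)
  have "t - s = Suc (t - Suc s)" using Suc.prems by auto
  then have "unnorm_filter \<chi>0 Mk G t f = (\<integral>\<^sup>+ x. ennreal (a s x) * path_int Mk G s (Suc (t - Suc s)) f x \<partial>target s)"
    using Suc by simp
  also have "\<dots> = (\<integral>\<^sup>+ x. Q s (\<lambda>x. ennreal (a (Suc s) x) * path_int Mk G (Suc s) (t - Suc s) f x) x \<partial>target s)"
    using Suc.prems assms by (simp add: Q_path del: path_int.simps)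
  also have "\<dots> = (\<integral>\<^sup>+ x. ennreal (a (Suc s) x) * path_int Mk G (Suc s) (t - Suc s) f x \<partial>target (Suc s))"
    using Suc.prems by (intro nn_integral_target_Suc[symmetric]) auto
  finally show ?case .
qed

lemma Q_one: 
  assumes "t < T" shows "Q t (\<lambda>_. 1) x = ennreal (a t x * \<theta> (Suc t) x)"
proof -
  have "0 < \<theta> (Suc t) x"
    using auxiliary_particle_filter.adj_pos[OF fast_ffbsi.axioms(1)[OF systems[OF order_refl]], of "Suc t" x] assms by simp
  have pm: "(\<integral>\<^sup>+ x'. ennreal (p (Suc t) x x') \<partial>\<nu>) = 1" "\<And>x'. 0 \<le> p (Suc t) x x'" "(\<lambda>(x, x'). p (Suc t) x x') \<in> borel_measurable (borel \<Otimes>\<^sub>M borel)"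
    using auxiliary_particle_filter.prop_mass[OF fast_ffbsi.axioms(1)[OF systems[OF order_refl]], of "Suc t" x] 
     auxiliary_particle_filter.prop_nonneg[OF fast_ffbsi.axioms(1)[OF systems[OF order_refl]], of "Suc t" x]
     auxiliary_particle_filter.prop_measurable[OF fast_ffbsi.axioms(1)[OF systems[OF order_refl]], of "Suc t"]
    assms by auto
  have [measurable]: "p (Suc t) x \<in> borel_measurable borel"
    using measurable_compose[OF measurable_Pair1'[of x borel borel] pm(3)] by simp
  have "Q t (\<lambda>_. 1) x = (\<integral>\<^sup>+ x'. ennreal (a t x * \<theta> (Suc t) x) * ennreal (p (Suc t) x x') \<partial>\<nu>)"
    unfolding Q_def using assms \<open>0 < \<theta> (Suc t) x\<close>
    by (intro nn_integral_cong) (simp add: ennreal_mult[symmetric] a_nonneg pm mult.assoc adj_factor[symmetric])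
  also have "\<dots> = ennreal (a t x * \<theta> (Suc t) x)" by (simp add: nn_integral_cmult pm)
  finally show ?thesis .
qed

text \<open>Two sources of finiteness. If \<open>b t = 1\<close>, the kernel preserves mass and the
  target has the mass of the weighted target one step earlier. If \<open>a t = 1\<close>, the target
  is its own weighted version. In both cases the mass is a finite evidence.\<close>

lemma finite_target: "t \<le> T \<Longrightarrow> finite_measure (target t)"
proof (induction t rule: less_induct)
  case (less t)
  have fin: "finite_measure (target u)" if "u < t" for u using less that by auto
  have ev: "(\<integral>\<^sup>+ x. ennreal (a u x) \<partial>target u) < \<infinity>" if "u \<le> t" for u
    using unnorm_filter_eq_path[of u u "\<lambda>_. 1"] fin that less.prems evidence_finite[of u] by simp
  show ?case
  proof (cases t)
    case 0
    have "prob_space \<rho>0"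
      using auxiliary_particle_filter.instr_prob[OF fast_ffbsi.axioms(1)[OF systems[OF order_refl]]] .
    then show ?thesis using 0 by (simp add: prob_space.finite_measure)
  next
    case (Suc u)
    have "emeasure (target t) (space (target t)) = (\<integral>\<^sup>+ x. 1 \<partial>target t)" by simp
    also have "\<dots> < \<infinity>"
    proof (cases "\<forall>x. b t x = 1")
      case True
      have "(\<integral>\<^sup>+ x. 1 \<partial>target t) = (\<integral>\<^sup>+ x. Q u (\<lambda>_. 1) x \<partial>target u)"
        unfolding Suc using fin[of u] Suc by (intro nn_integral_target_Suc) auto
      also have "\<dots> = (\<integral>\<^sup>+ x. ennreal (a u x) \<partial>target u)"
        using True Suc by (intro nn_integral_cong)
          (simp add: Q_def ennreal_mult a_nonneg trans_nonneg nn_integral_cmult trans_mass)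
      finally show ?thesis using ev[of u] Suc by simp
    next
      case False
      then have "\<forall>x. a t x = 1" using boot_or_adapted[of t] less.prems Suc by auto
      then show ?thesis using ev[of t] by simp
    qed
    finally show ?thesis by (intro finite_measureI) auto
  qed
qed

definition evid :: "nat \<Rightarrow> ennreal" where "evid t = (\<integral>\<^sup>+ x. ennreal (a t x) \<partial>target t)"

lemma unnorm_filter_target:
  "s \<le> t \<Longrightarrow> t \<le> T \<Longrightarrow> f \<in> borel_measurable borel \<Longrightarrow>
   unnorm_filter \<chi>0 Mk G t f = (\<integral>\<^sup>+ x. ennreal (a s x) * path_int Mk G s (t - s) f x \<partial>target s)"
  by (rule unnorm_filter_eq_path) (auto intro: finite_target)

lemma evid_eq: "t \<le> T \<Longrightarrow> unnorm_filter \<chi>0 Mk G t (\<lambda>_. 1) = evid t"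
  by (subst unnorm_filter_target[of t t]) (auto simp: evid_def)

lemma evid_finite: "t \<le> T \<Longrightarrow> evid t < \<infinity>"
  using evidence_finite evid_eq by metis

lemma evid_pos: "t \<le> T \<Longrightarrow> 0 < evid t"
  using evidence_pos' evid_eq by metis

subsection \<open>The particle system\<close>

abbreviation "F N t \<equiv> forward_hist N (W N) (\<xi> N) (I N) t"
abbreviation "wt N t i w \<equiv> weight \<chi>0 m G \<rho>0 \<theta> p (\<xi> N) (I N) t i w"

text \<open>The adjustment is continued by 1 beyond time \<open>T\<close>, so that
  \<open>S N T\<close> becomes the plain mean of the terminal weights and one product formula for
  \<open>H\<close> reaches up to \<open>Suc T\<close>.\<close>

definition \<theta>' :: "nat \<Rightarrow> 'x \<Rightarrow> real" where "\<theta>' t x = (if 1 \<le> t \<and> t \<le> T then \<theta> t x else 1)"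

text \<open>\<open>H N t\<close> is the usual unbiased estimate of the evidence, made of the average masses \<open>S N u\<close> of the
  proposals; the expectations below are weighted by it.\<close>

definition S :: "nat \<Rightarrow> nat \<Rightarrow> 'w \<Rightarrow> real" where
  "S N t w = (\<Sum>j<N. a t (\<xi> N t j w) * \<theta>' (Suc t) (\<xi> N t j w)) / N"

definition H :: "nat \<Rightarrow> nat \<Rightarrow> 'w \<Rightarrow> real" where "H N t w = (\<Prod>u<t. S N u w)"

lemma particle_filter: "1 \<le> N \<Longrightarrow> auxiliary_particle_filter \<chi>0 \<nu> m g y T \<rho>0 \<theta> p N (W N) (\<xi> N) (I N)"
  using fast_ffbsi.axioms(1)[OF systems] .

lemma prob_W: "1 \<le> N \<Longrightarrow> prob_space (W N)"
  using auxiliary_particle_filter.axioms(2)[OF particle_filter] .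

lemma theta_measurable[measurable]: "\<theta>' t \<in> borel_measurable borel"
proof -
  have "\<theta> t \<in> borel_measurable borel" if "1 \<le> t \<and> t \<le> T"
    using auxiliary_particle_filter.adj_measurable[OF particle_filter[OF order_refl]] that by auto
  then show ?thesis unfolding \<theta>'_def[abs_def] by (cases "1 \<le> t \<and> t \<le> T") auto
qed

lemma theta_pos: "0 < \<theta>' t x"
  using auxiliary_particle_filter.adj_pos[OF particle_filter[OF order_refl]] by (auto simp: \<theta>'_def)

lemma step: "1 \<le> N \<Longrightarrow> t < T \<Longrightarrow>
      cond_iid_prop_to (W N) (F N (Suc t)) {..<N} (\<lambda>i w. (I N (Suc t) i w, \<xi> N (Suc t) i w))
        (count_space {..<N} \<Otimes>\<^sub>M \<nu>)
        (\<lambda>w (j, x). ennreal (wt N t j w * \<theta> (Suc t) (\<xi> N t j w) * p (Suc t) (\<xi> N t j w) x))"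
  using auxiliary_particle_filter.step[OF particle_filter, of N "Suc t"] by simp

lemma pair_measurable: "1 \<le> N \<Longrightarrow> t < T \<Longrightarrow> i < N \<Longrightarrow>
  (\<lambda>w. (I N (Suc t) i w, \<xi> N (Suc t) i w)) \<in> measurable (W N) (count_space {..<N} \<Otimes>\<^sub>M \<nu>)"
  using step unfolding cond_iid_prop_to_def by auto

lemma xi_measurable: assumes "1 \<le> N" "t \<le> T" "i < N" shows "\<xi> N t i \<in> measurable (W N) borel"
proof (cases t)
  case 0
  then show ?thesis
    using auxiliary_particle_filter.init_indep[OF particle_filter, of N] assms prob_W[of N]
    by (auto simp: prob_space.indep_vars_def2)
next
  case (Suc u)
  have "\<xi> N (Suc u) i \<in> measurable (W N) \<nu>"
    using measurable_compose[OF pair_measurable measurable_snd, of N u i] assms Suc by simp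
  then show ?thesis using Suc measurable_cong_sets[OF refl sets_nu, of "W N"] by simp
qed

lemma I_measurable: assumes "1 \<le> N" "t < T" "i < N" shows "I N (Suc t) i \<in> measurable (W N) (count_space {..<N})"
  using measurable_compose[OF pair_measurable measurable_fst, of N t i] assms by simp

lemma space_F: "space (F N t) = space (W N)" by (rule space_forward_hist)

lemma subalgebra_F: assumes "1 \<le> N" "t \<le> Suc T" shows "subalgebra (W N) (F N t)"
  unfolding subalgebra_def space_F
proof
  show "sets (F N t) \<subseteq> sets (W N)" unfolding sets_forward_hist
  proof (rule sets.sigma_sets_subset, safe)
    fix u i A assume "u < t" "i < N" "A \<in> sets (borel :: 'x measure)"
    then show "\<xi> N u i -` A \<inter> space (W N) \<in> sets (W N)"
      using assms by (intro measurable_sets[OF xi_measurable]) auto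
  next
    fix u i A assume u: "0 < u" "u < t" "i < N"
    have "I N u i -` A \<inter> space (W N) = I N u i -` (A \<inter> {..<N}) \<inter> space (W N)"
      using measurable_space[OF I_measurable[of N "u - 1" i]] u assms by auto
    also have "\<dots> \<in> sets (W N)"
      using measurable_sets[OF I_measurable[of N "u - 1" i], of "A \<inter> {..<N}"] u assms by auto
    finally show "I N u i -` A \<inter> space (W N) \<in> sets (W N)" .
  qed
qed auto

lemma xi_F[measurable]: "u < t \<Longrightarrow> i < N \<Longrightarrow> \<xi> N u i \<in> measurable (F N t) borel"
  by (rule measurable_forward_hist)

lemma S_F: "u < t \<Longrightarrow> S N u \<in> borel_measurable (F N t)"
  unfolding S_def[abs_def] by measurable

lemma H_F: "u \<le> t \<Longrightarrow> H N u \<in> borel_measurable (F N t)"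
  unfolding H_def[abs_def] by (intro borel_measurable_prod S_F) auto

lemma S_nonneg: "0 \<le> S N t w"
  unfolding S_def by (intro divide_nonneg_nonneg sum_nonneg mult_nonneg_nonneg a_nonneg less_imp_le[OF theta_pos]) auto

lemma H_nonneg: "0 \<le> H N t w"
  unfolding H_def by (intro prod_nonneg S_nonneg)

lemma H_Suc: "H N (Suc t) w = H N t w * S N t w" by (simp add: H_def)

lemma H_0[simp]: "H N 0 w = 1" by (simp add: H_def)

lemma H_pos_mono: "0 < H N (Suc t) w \<Longrightarrow> 0 < H N t w \<and> 0 < S N t w"
  using H_nonneg[of N t w] S_nonneg[of N t w] by (auto simp: H_Suc zero_less_mult_iff)

lemma H_pos_le: "0 < H N t w \<Longrightarrow> u \<le> t \<Longrightarrow> 0 < H N u w"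
  by (induction t) (auto simp: le_Suc_eq dest: H_pos_mono)

text \<open>With \<open>\<theta> * p\<close> rewritten as \<open>m * b\<close>, this is the density
  of ancestor and particle once the importance weights are known to be \<open>a\<close>. Its values
  where \<open>S\<close> is 0 are always met with the weight \<open>H N (Suc t) = 0\<close>.\<close>

definition q :: "nat \<Rightarrow> nat \<Rightarrow> 'w \<Rightarrow> nat \<times> 'x \<Rightarrow> ennreal" where
  "q N t w = (\<lambda>(j, x). ennreal (a t (\<xi> N t j w) * m (\<xi> N t j w) x * b (Suc t) x) / ennreal (N * S N t w))"

lemma q_measurable: "(\<lambda>(w, z). q N t w z) \<in> borel_measurable (F N (Suc t) \<Otimes>\<^sub>M (count_space {..<N} \<Otimes>\<^sub>M \<nu>))"
proof -
  have [measurable]: "(\<lambda>p :: 'w \<times> nat \<times> 'x. \<xi> N t (fst (snd p)) (fst p)) \<in> measurable (F N (Suc t) \<Otimes>\<^sub>M (count_space {..<N} \<Otimes>\<^sub>M \<nu>)) borel"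
    by (rule measurable_pick[where h="\<lambda>j p. \<xi> N t j (fst p)"])
      (rule measurable_compose[OF measurable_fst xi_F] measurable_compose[OF measurable_snd measurable_fst] lessI | assumption)+
  have [measurable]: "S N t \<in> borel_measurable (F N (Suc t))" by (rule S_F) simp
  show ?thesis unfolding q_def case_prod_beta' by measurable
qed

abbreviation "E N t \<equiv> {w \<in> space (W N). 0 < H N t w}"

lemma E_F: "u \<le> t \<Longrightarrow> E N u \<in> sets (F N t)"
proof -
  assume "u \<le> t"
  then have [measurable]: "H N u \<in> borel_measurable (F N t)" by (rule H_F)
  have "{w \<in> space (F N t). 0 < H N u w} \<in> sets (F N t)" by measurable
  then show ?thesis by (simp add: space_F)
qed

lemma count_nu: "sigma_finite_measure (count_space {..<N::nat} \<Otimes>\<^sub>M \<nu>)"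
proof -
  interpret sigma_finite_measure "count_space {..<N}" by (rule sigma_finite_measure_count_space_finite) simp
  interpret pair_sigma_finite "count_space {..<N}" \<nu> ..
  show ?thesis by unfold_locales
qed

lemma S_mass: assumes "1 \<le> N" "t < T" shows "(\<Sum>j<N. Q t (\<lambda>_. 1) (\<xi> N t j w)) = ennreal (N * S N t w)"
proof -
  have "0 \<le> \<theta> (Suc t) x" for x using theta_pos[of "Suc t" x] assms by (simp add: \<theta>'_def)
  then have "(\<Sum>j<N. ennreal (a t (\<xi> N t j w) * \<theta> (Suc t) (\<xi> N t j w))) = ennreal (\<Sum>j<N. a t (\<xi> N t j w) * \<theta> (Suc t) (\<xi> N t j w))"
    by (intro sum_ennreal mult_nonneg_nonneg a_nonneg)
  then show ?thesis using assms by (simp add: Q_one S_def \<theta>'_def)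
qed

text \<open>The identification of the weights with \<open>a\<close> is a hypothesis, because it is
  obtained alternately with the law of the draws: weights at time \<open>t\<close> give the law at
  \<open>Suc t\<close>, which gives the weights at \<open>Suc t\<close>.\<close>

lemma step_law:
  assumes N: "1 \<le> N" and t: "t < T"
    and wt: "AE w in W N. 0 < H N t w \<longrightarrow> (\<forall>i<N. wt N t i w = a t (\<xi> N t i w))"
  shows "AE w in W N. w \<in> E N (Suc t) \<longrightarrow>
     0 < (\<integral>\<^sup>+ z. (case z of (j, x) \<Rightarrow> ennreal (wt N t j w * \<theta> (Suc t) (\<xi> N t j w) * p (Suc t) (\<xi> N t j w) x)) \<partial>(count_space {..<N} \<Otimes>\<^sub>M \<nu>)) \<and>
     law_prop_to (count_space {..<N} \<Otimes>\<^sub>M \<nu>) (\<lambda>(j, x). ennreal (wt N t j w * \<theta> (Suc t) (\<xi> N t j w) * p (Suc t) (\<xi> N t j w) x))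
       = density (count_space {..<N} \<Otimes>\<^sub>M \<nu>) (q N t w) \<and>
     (\<integral>\<^sup>+ z. q N t w z \<partial>(count_space {..<N} \<Otimes>\<^sub>M \<nu>)) = 1"
  using wt
proof eventually_elim
  case (elim w)
  show ?case
  proof
    assume "w \<in> E N (Suc t)"
    then have HS: "0 < H N t w" "0 < S N t w" and ws: "w \<in> space (W N)" using H_pos_mono[of N t w] by auto
    let ?\<mu> = "count_space {..<N} \<Otimes>\<^sub>M \<nu>"
    let ?f = "\<lambda>(j, x). ennreal (wt N t j w * \<theta> (Suc t) (\<xi> N t j w) * p (Suc t) (\<xi> N t j w) x)"
    let ?k = "\<lambda>(j, x). ennreal (a t (\<xi> N t j w) * m (\<xi> N t j w) x * b (Suc t) x)"
    have [measurable]: "(\<lambda>z. \<xi> N t (fst z) w) \<in> measurable ?\<mu> borel"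
      by (rule measurable_pick[where h="\<lambda>j _. \<xi> N t j w"]) auto
    have k[measurable]: "?k \<in> borel_measurable ?\<mu>" unfolding case_prod_beta' by measurable
    have kf: "?f z = ?k z" if "z \<in> space ?\<mu>" for z
    proof -
      obtain j x where jx: "z = (j, x)" by (cases z)
      then have z: "z = (j, x)" "j < N" using that by (auto simp: space_pair_measure)
      have "wt N t j w = a t (\<xi> N t j w)" using elim HS z by auto
      then have "wt N t j w * \<theta> (Suc t) (\<xi> N t j w) * p (Suc t) (\<xi> N t j w) x = a t (\<xi> N t j w) * m (\<xi> N t j w) x * b (Suc t) x"
        using adj_factor[of "Suc t" "\<xi> N t j w" x] t by (simp add: mult.assoc)
      then show ?thesis using z by simp
    qed
    have ki: "(\<integral>\<^sup>+ z. ?k z \<partial>?\<mu>) = ennreal (N * S N t w)"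
      by (subst nn_integral_count_pair[OF dom_sigma_finite k]) (simp add: S_mass[OF N t, symmetric] Q_def)
    have fi: "(\<integral>\<^sup>+ z. ?f z \<partial>?\<mu>) = ennreal (N * S N t w)"
      unfolding ki[symmetric] by (rule nn_integral_cong) (rule kf)
    have pos: "0 < real N * S N t w" using HS N by simp
    have f: "?f \<in> borel_measurable ?\<mu>" using k measurable_cong[of ?\<mu> ?f ?k borel, OF kf] by simp
    have l: "law_prop_to ?\<mu> ?f = density ?\<mu> (q N t w)"
      unfolding law_prop_to_def fi
    proof (rule density_cong)
      show "(\<lambda>z. ?f z / ennreal (N * S N t w)) \<in> borel_measurable ?\<mu>" using f by measurable
      show "q N t w \<in> borel_measurable ?\<mu>" unfolding q_def case_prod_beta' by measurable
      show "AE z in ?\<mu>. ?f z / ennreal (N * S N t w) = q N t w z"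
        by (rule AE_I2, drule kf) (auto simp: q_def split: prod.splits)
    qed
    have "(\<integral>\<^sup>+ z. q N t w z \<partial>?\<mu>) = (\<integral>\<^sup>+ z. ?k z / ennreal (N * S N t w) \<partial>?\<mu>)"
      by (rule nn_integral_cong) (simp add: q_def split: prod.splits)
    also have "\<dots> = 1" using HS N divide_ennreal[OF less_imp_le[OF pos] pos] by (simp add: nn_integral_divide ki)
    finally show "0 < (\<integral>\<^sup>+ z. ?f z \<partial>?\<mu>) \<and> law_prop_to ?\<mu> ?f = density ?\<mu> (q N t w) \<and> (\<integral>\<^sup>+ z. q N t w z \<partial>?\<mu>) = 1"
      using l fi pos by simp
  qed
qed

end

section \<open>Weighted averages and the truncation of unbounded functions\<close>

lemma nn_integral_weighted_avg:
  fixes h :: "'w \<Rightarrow> real" and \<phi> :: "nat \<Rightarrow> 'w \<Rightarrow> real"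
  assumes N: "1 \<le> (N::nat)" and h[measurable]: "h \<in> borel_measurable M"
    and \<phi>: "\<And>i. i < N \<Longrightarrow> \<phi> i \<in> borel_measurable M"
    and nn: "\<And>w. 0 \<le> h w" "\<And>i w. 0 \<le> \<phi> i w"
  shows "(\<integral>\<^sup>+ w. ennreal (h w * ((\<Sum>i<N. \<phi> i w) / N)) \<partial>M) = (\<Sum>i<N. \<integral>\<^sup>+ w. ennreal (h w) * ennreal (\<phi> i w) \<partial>M) / of_nat N"
proof -
  have m: "(\<lambda>w. ennreal (h w) * ennreal (\<phi> i w)) \<in> borel_measurable M" if "i \<in> {..<N}" for i
  proof -
    have [measurable]: "\<phi> i \<in> borel_measurable M" using \<phi> that by simp
    show ?thesis by measurable
  qed
  have "ennreal (h w * ((\<Sum>i<N. \<phi> i w) / N)) = (\<Sum>i<N. ennreal (h w) * ennreal (\<phi> i w)) / of_nat N" for w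
  proof -
    have "(\<Sum>i<N. ennreal (h w) * ennreal (\<phi> i w)) = ennreal (h w * (\<Sum>i<N. \<phi> i w))"
      using nn by (simp add: sum_distrib_left[symmetric] sum_ennreal ennreal_mult')
    also have "\<dots> / of_nat N = ennreal (h w * ((\<Sum>i<N. \<phi> i w) / N))"
      using nn N by (simp add: ennreal_of_nat_eq_real_of_nat divide_ennreal sum_nonneg)
    finally show ?thesis by simp
  qed
  then show ?thesis
    using m by (simp only:) (subst nn_integral_divide; (subst nn_integral_sum)?; auto intro!: borel_measurable_sum)
qed

lemma nn_integral_weighted_avg_const:
  fixes h :: "'w \<Rightarrow> real" and \<phi> :: "nat \<Rightarrow> 'w \<Rightarrow> real"
  assumes N: "1 \<le> (N::nat)" and h: "h \<in> borel_measurable M"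
    and \<phi>: "\<And>i. i < N \<Longrightarrow> \<phi> i \<in> borel_measurable M"
    and nn: "\<And>w. 0 \<le> h w" "\<And>i w. 0 \<le> \<phi> i w"
    and each: "\<And>i. i < N \<Longrightarrow> (\<integral>\<^sup>+ w. ennreal (h w) * ennreal (\<phi> i w) \<partial>M) = c"
  shows "(\<integral>\<^sup>+ w. ennreal (h w * ((\<Sum>i<N. \<phi> i w) / N)) \<partial>M) = c"
proof -
  have "(\<Sum>i<N. c) / of_nat N = c * of_nat N / of_nat N" by (simp add: mult.commute)
  also have "\<dots> = c"
    using N by (intro ennreal_mult_divide_eq) (auto simp: of_nat_less_top[THEN less_imp_neq] simp del: of_nat_less_top)
  finally show ?thesis by (subst nn_integral_weighted_avg[OF N h \<phi> nn]) (simp_all add: each)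
qed

text \<open>Truncating \<open>f\<close> changes the empirical mean and its centering, each by at
  most the tail integral in weighted mean, hence the factor 2. The functional \<open>L\<close> and
  its weight \<open>Hc\<close> are kept abstract to cover both the initial draws, centered at a
  constant, and the transitions, centered at a conditional mean.\<close>

lemma truncation_bound:
  fixes H Hc :: "'w \<Rightarrow> real" and X :: "nat \<Rightarrow> 'w \<Rightarrow> 'x" and f :: "'x \<Rightarrow> real"
    and \<theta> :: "'w \<Rightarrow> 'x \<Rightarrow> real" and L :: "'w \<Rightarrow> ('x \<Rightarrow> ennreal) \<Rightarrow> ennreal"
  assumes n: "1 \<le> n" and C: "0 < C"
    and H: "\<And>w. 0 \<le> H w" "\<And>w. 0 \<le> Hc w"
    and f[measurable]: "f \<in> borel_measurable B" and f0: "\<And>x. 0 \<le> f x"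
    and \<theta>m: "\<And>w. w \<in> space M \<Longrightarrow> \<theta> w \<in> borel_measurable B" and \<theta>: "\<And>w x. 0 \<le> \<theta> w x" "\<And>w x. \<theta> w x \<le> 1"
    and Ladd: "\<And>w u v. w \<in> space M \<Longrightarrow> u \<in> borel_measurable B \<Longrightarrow> v \<in> borel_measurable B \<Longrightarrow> L w (\<lambda>x. u x + v x) = L w u + L w v"
    and Lmono: "\<And>w u v. w \<in> space M \<Longrightarrow> (\<And>x. u x \<le> v x) \<Longrightarrow> L w u \<le> L w v"
    and Lmeas: "\<And>u. u \<in> borel_measurable B \<Longrightarrow> (\<lambda>w. ennreal (Hc w) * L w u) \<in> borel_measurable M"
    and Lmean: "\<And>u. u \<in> borel_measurable B \<Longrightarrow> (\<integral>\<^sup>+ w. ennreal (Hc w) * L w u \<partial>M) = (\<integral>\<^sup>+ x. u x \<partial>\<mu>)"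
    and Hmeas: "\<And>u i. i < n \<Longrightarrow> u \<in> borel_measurable B \<Longrightarrow> (\<lambda>w. ennreal (H w) * u (X i w)) \<in> borel_measurable M"
    and Hmean: "\<And>u i. i < n \<Longrightarrow> u \<in> borel_measurable B \<Longrightarrow> (\<integral>\<^sup>+ w. ennreal (H w) * u (X i w) \<partial>M) = (\<integral>\<^sup>+ x. u x \<partial>\<mu>)"
    and meas: "(\<lambda>w. H w * ((\<Sum>i<n. min (f (X i w)) C * \<theta> w (X i w)) / n) - Hc w * enn2real (L w (\<lambda>x. ennreal (min (f x) C * \<theta> w x)))) \<in> borel_measurable M"
    and wl: "(\<integral>\<^sup>+ w. ennreal \<bar>H w * ((\<Sum>i<n. min (f (X i w)) C * \<theta> w (X i w)) / n) - Hc w * enn2real (L w (\<lambda>x. ennreal (min (f x) C * \<theta> w x)))\<bar> \<partial>M) \<le> R"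
  shows "(\<integral>\<^sup>+ w. ennreal \<bar>H w * ((\<Sum>i<n. f (X i w) * \<theta> w (X i w)) / n) - Hc w * enn2real (L w (\<lambda>x. ennreal (f x * \<theta> w x)))\<bar> \<partial>M)
     \<le> 2 * (\<integral>\<^sup>+ x. ennreal (f x - min (f x) C) \<partial>\<mu>) + R"
proof -
  define A where "A w = ennreal \<bar>H w * ((\<Sum>i<n. min (f (X i w)) C * \<theta> w (X i w)) / n) - Hc w * enn2real (L w (\<lambda>x. ennreal (min (f x) C * \<theta> w x)))\<bar>" for w
  define tl where "tl x = ennreal (f x - min (f x) C)" for x
  have tlm[measurable]: "tl \<in> borel_measurable B" unfolding tl_def[abs_def] by measurable
  have le: "ennreal \<bar>H w * ((\<Sum>i<n. f (X i w) * \<theta> w (X i w)) / n) - Hc w * enn2real (L w (\<lambda>x. ennreal (f x * \<theta> w x)))\<bar>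
      \<le> ((\<Sum>i<n. ennreal (H w) * tl (X i w)) / of_nat n + ennreal (Hc w) * L w tl) + A w" if w: "w \<in> space M" for w
  proof -
    note [measurable] = \<theta>m[OF w]
    have minc: "0 \<le> min (f x) C" for x using f0[of x] C by auto
    let ?fs = "\<Sum>i<n. f (X i w) * \<theta> w (X i w)" and ?ms = "\<Sum>i<n. min (f (X i w)) C * \<theta> w (X i w)"
    let ?lf = "L w (\<lambda>x. ennreal (f x * \<theta> w x))" and ?lm = "L w (\<lambda>x. ennreal (min (f x) C * \<theta> w x))"
    have 1: "ennreal \<bar>enn2real ?lf - enn2real ?lm\<bar> \<le> L w tl"
    proof (rule ennreal_abs_enn2real_diff_le)
      have "ennreal (f x * \<theta> w x) \<le> ennreal (min (f x) C * \<theta> w x) + tl x" for x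
      proof -
        have "f x * \<theta> w x = min (f x) C * \<theta> w x + (f x - min (f x) C) * \<theta> w x" by (simp add: algebra_simps)
        also have "\<dots> \<le> min (f x) C * \<theta> w x + (f x - min (f x) C) * 1"
          using \<theta> by (intro add_left_mono mult_left_mono) auto
        finally have "ennreal (f x * \<theta> w x) \<le> ennreal (min (f x) C * \<theta> w x + (f x - min (f x) C))"
          by (intro ennreal_leI) simp
        also have "\<dots> = ennreal (min (f x) C * \<theta> w x) + ennreal (f x - min (f x) C)"
          by (rule ennreal_plus[OF mult_nonneg_nonneg[OF minc \<theta>(1)]]) simp
        finally show ?thesis unfolding tl_def .
      qed
      then have "?lf \<le> L w (\<lambda>x. ennreal (min (f x) C * \<theta> w x) + tl x)" using w by (intro Lmono)
      also have "\<dots> = ?lm + L w tl" using w by (intro Ladd) measurable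
      finally show "?lf \<le> ?lm + L w tl" .
      have "?lm \<le> ?lf" using w \<theta> by (intro Lmono ennreal_leI mult_right_mono) auto
      then show "?lm \<le> ?lf + L w tl" by (simp add: add_increasing2)
    qed
    have 2: "ennreal \<bar>H w * (?fs / n) - H w * (?ms / n)\<bar> \<le> (\<Sum>i<n. ennreal (H w) * tl (X i w)) / of_nat n"
    proof -
      have "?fs - ?ms = (\<Sum>i<n. (f (X i w) - min (f (X i w)) C) * \<theta> w (X i w))"
        by (simp add: sum_subtractf[symmetric] left_diff_distrib)
      moreover have "(\<Sum>i<n. (f (X i w) - min (f (X i w)) C) * \<theta> w (X i w)) \<le> (\<Sum>i<n. (f (X i w) - min (f (X i w)) C) * 1)"
        using \<theta> by (intro sum_mono mult_left_mono) auto
      moreover have "0 \<le> (\<Sum>i<n. (f (X i w) - min (f (X i w)) C) * \<theta> w (X i w))"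
        using \<theta> by (intro sum_nonneg) auto
      ultimately have "\<bar>?fs - ?ms\<bar> \<le> (\<Sum>i<n. (f (X i w) - min (f (X i w)) C))" by simp
      then have "H w * \<bar>?fs - ?ms\<bar> / n \<le> H w * (\<Sum>i<n. (f (X i w) - min (f (X i w)) C)) / n"
        using H by (intro divide_right_mono mult_left_mono) auto
      moreover have "\<bar>H w * (?fs / n) - H w * (?ms / n)\<bar> = H w * \<bar>?fs - ?ms\<bar> / n"
        using H(1)[of w] by (simp add: right_diff_distrib[symmetric] diff_divide_distrib[symmetric] abs_mult)
      ultimately have "ennreal \<bar>H w * (?fs / n) - H w * (?ms / n)\<bar> \<le> ennreal (H w * (\<Sum>i<n. (f (X i w) - min (f (X i w)) C)) / n)"
        by (simp add: ennreal_leI)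
      also have "\<dots> = ennreal (H w * (\<Sum>i<n. (f (X i w) - min (f (X i w)) C))) / of_nat n"
        using n H by (subst divide_ennreal[symmetric]) (auto intro!: mult_nonneg_nonneg sum_nonneg simp: ennreal_of_nat_eq_real_of_nat)
      also have "ennreal (H w * (\<Sum>i<n. (f (X i w) - min (f (X i w)) C))) = (\<Sum>i<n. ennreal (H w) * tl (X i w))"
        unfolding tl_def using H by (simp add: ennreal_mult sum_nonneg sum_distrib_left[symmetric])
      finally show ?thesis .
    qed
    have 3: "ennreal \<bar>Hc w * enn2real ?lm - Hc w * enn2real ?lf\<bar> \<le> ennreal (Hc w) * L w tl"
    proof -
      have "\<bar>Hc w * enn2real ?lm - Hc w * enn2real ?lf\<bar> = Hc w * \<bar>enn2real ?lf - enn2real ?lm\<bar>"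
        using H(2)[of w] by (simp add: right_diff_distrib[symmetric] abs_mult abs_minus_commute)
      then show ?thesis using 1 H by (simp add: ennreal_mult mult_left_mono)
    qed
    have "\<bar>H w * (?fs / n) - Hc w * enn2real ?lf\<bar> \<le> \<bar>H w * (?fs / n) - H w * (?ms / n)\<bar> + \<bar>Hc w * enn2real ?lm - Hc w * enn2real ?lf\<bar>
       + \<bar>H w * (?ms / n) - Hc w * enn2real ?lm\<bar>" by linarith
    then have "ennreal \<bar>H w * (?fs / n) - Hc w * enn2real ?lf\<bar> \<le> ennreal \<bar>H w * (?fs / n) - H w * (?ms / n)\<bar> + ennreal \<bar>Hc w * enn2real ?lm - Hc w * enn2real ?lf\<bar> + A w"
      unfolding A_def by (simp add: ennreal_plus[symmetric] ennreal_leI del: ennreal_plus)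
    also have "\<dots> \<le> ((\<Sum>i<n. ennreal (H w) * tl (X i w)) / of_nat n + ennreal (Hc w) * L w tl) + A w"
      by (intro add_mono 2 3 order_refl)
    finally show ?thesis .
  qed
  have tm: "(\<lambda>w. ennreal (H w) * tl (X i w)) \<in> borel_measurable M" if "i < n" for i
    using Hmeas that by simp
  have tms: "(\<lambda>w. \<Sum>i<n. ennreal (H w) * tl (X i w)) \<in> borel_measurable M"
    using tm by (intro borel_measurable_sum) auto
  have ts: "(\<integral>\<^sup>+ w. (\<Sum>i<n. ennreal (H w) * tl (X i w)) \<partial>M) = (\<Sum>i<n. \<integral>\<^sup>+ w. ennreal (H w) * tl (X i w) \<partial>M)"
    using tm by (intro nn_integral_sum) auto
  note [measurable] = tms
  have [measurable]: "(\<lambda>w. ennreal (Hc w) * L w tl) \<in> borel_measurable M" using Lmeas by simp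
  have [measurable]: "A \<in> borel_measurable M" unfolding A_def using meas by measurable
  have "(\<integral>\<^sup>+ w. ennreal \<bar>H w * ((\<Sum>i<n. f (X i w) * \<theta> w (X i w)) / n) - Hc w * enn2real (L w (\<lambda>x. ennreal (f x * \<theta> w x)))\<bar> \<partial>M)
    \<le> (\<integral>\<^sup>+ w. ((\<Sum>i<n. ennreal (H w) * tl (X i w)) / of_nat n + ennreal (Hc w) * L w tl) + A w \<partial>M)"
    by (rule nn_integral_mono) (rule le)
  also have "\<dots> = (\<Sum>i<n. \<integral>\<^sup>+ w. ennreal (H w) * tl (X i w) \<partial>M) / of_nat n + (\<integral>\<^sup>+ w. ennreal (Hc w) * L w tl \<partial>M) + (\<integral>\<^sup>+ w. A w \<partial>M)"
    by (simp add: nn_integral_add nn_integral_divide ts)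
  also have "\<dots> = (\<integral>\<^sup>+ x. tl x \<partial>\<mu>) * of_nat n / of_nat n + (\<integral>\<^sup>+ x. tl x \<partial>\<mu>) + (\<integral>\<^sup>+ w. A w \<partial>M)"
    by (simp add: Hmean Lmean mult.commute)
  also have "(\<integral>\<^sup>+ x. tl x \<partial>\<mu>) * of_nat n / of_nat n = (\<integral>\<^sup>+ x. tl x \<partial>\<mu>)"
    using n by (intro ennreal_mult_divide_eq) (auto simp: of_nat_less_top[THEN less_imp_neq] simp del: of_nat_less_top)
  also have "(\<integral>\<^sup>+ x. tl x \<partial>\<mu>) + (\<integral>\<^sup>+ x. tl x \<partial>\<mu>) + (\<integral>\<^sup>+ w. A w \<partial>M) \<le> 2 * (\<integral>\<^sup>+ x. tl x \<partial>\<mu>) + R"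
    using wl by (intro add_mono) (auto simp: A_def mult_2)
  finally show ?thesis by (simp add: tl_def)
qed

section \<open>Identification of the importance weights and unbiasedness\<close>

context adapted_ffbsi begin

lemma weights_init: assumes "1 \<le> N" shows "AE w in W N. \<forall>i<N. wt N 0 i w = a 0 (\<xi> N 0 i w)"
  unfolding AE_all_countable
proof
  fix i
  show "AE w in W N. i < N \<longrightarrow> wt N 0 i w = a 0 (\<xi> N 0 i w)"
  proof (cases "i < N")
    case True
    have "distr (W N) borel (\<xi> N 0 i) = \<rho>0"
      using auxiliary_particle_filter.init_law[OF particle_filter] assms True by auto
    then have "AE x in distr (W N) borel (\<xi> N 0 i). enn2real (RN_deriv \<rho>0 \<chi>0 x) * G 0 x = a 0 x"
      by (rule ssubst) (rule init_weight)
    from AE_distrD[OF xi_measurable this] show ?thesis using assms True by auto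
  qed auto
qed

text \<open>The random normalization \<open>N * S N t w\<close> in \<open>q\<close> is, up to
  \<open>N\<close>, the factor by which \<open>H N (Suc t)\<close> exceeds \<open>H N t\<close>. The
  product therefore no longer contains a random denominator.\<close>

lemma H_q:
  assumes N: "1 \<le> N" and t: "t < T" and w: "w \<in> space (W N)" and \<phi>[measurable]: "\<phi> \<in> borel_measurable (count_space {..<N} \<Otimes>\<^sub>M \<nu>)"
  shows "ennreal (H N (Suc t) w) * (\<integral>\<^sup>+ z. \<phi> z * q N t w z \<partial>(count_space {..<N} \<Otimes>\<^sub>M \<nu>))
    = ennreal (H N t w) * ((\<Sum>j<N. Q t (\<lambda>x. \<phi> (j, x)) (\<xi> N t j w)) / of_nat N)"
proof -
  let ?\<mu> = "count_space {..<N} \<Otimes>\<^sub>M \<nu>"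
  let ?k = "\<lambda>(j, x). ennreal (a t (\<xi> N t j w) * m (\<xi> N t j w) x * b (Suc t) x)"
  have [measurable]: "(\<lambda>z. \<xi> N t (fst z) w) \<in> measurable ?\<mu> borel"
    by (rule measurable_pick[where h="\<lambda>j _. \<xi> N t j w"]) auto
  have k[measurable]: "?k \<in> borel_measurable ?\<mu>" unfolding case_prod_beta' by measurable
  have kQ: "(\<integral>\<^sup>+ z. \<phi> z * ?k z \<partial>?\<mu>) = (\<Sum>j<N. Q t (\<lambda>x. \<phi> (j, x)) (\<xi> N t j w))" if "\<phi> \<in> borel_measurable ?\<mu>" for \<phi>
    by (subst nn_integral_count_pair[OF dom_sigma_finite]) (use that k in \<open>auto simp: Q_def mult.commute\<close>)
  show ?thesis
  proof (cases "S N t w = 0")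
    \<comment> \<open>If the normalization is 0, all unnormalized masses are 0, so the right-hand
      side vanishes too, whatever values the quotient in \<open>q\<close> takes.\<close>
    case True
    have "(\<integral>\<^sup>+ z. 1 * ?k z \<partial>?\<mu>) = 0" using kQ[of "\<lambda>_. 1"] True by (simp add: S_mass[OF N t])
    then have "AE z in ?\<mu>. ?k z = 0" using k by (subst (asm) nn_integral_0_iff_AE) auto
    then have "(\<integral>\<^sup>+ z. \<phi> z * ?k z \<partial>?\<mu>) = 0"
      by (subst nn_integral_0_iff_AE) (auto elim!: eventually_mono)
    then show ?thesis using True kQ[OF \<phi>] by (simp add: H_Suc)
  next
    case False
    then have pos: "0 < S N t w" using S_nonneg[of N t w] by simp
    have "(\<integral>\<^sup>+ z. \<phi> z * q N t w z \<partial>?\<mu>) = (\<integral>\<^sup>+ z. \<phi> z * ?k z / ennreal (N * S N t w) \<partial>?\<mu>)"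
      by (intro nn_integral_cong) (auto simp: q_def ennreal_times_divide split: prod.splits)
    also have "\<dots> = (\<Sum>j<N. Q t (\<lambda>x. \<phi> (j, x)) (\<xi> N t j w)) / ennreal (N * S N t w)"
      by (simp add: nn_integral_divide kQ[OF \<phi>, simplified])
    finally have e: "(\<integral>\<^sup>+ z. \<phi> z * q N t w z \<partial>?\<mu>) = (\<Sum>j<N. Q t (\<lambda>x. \<phi> (j, x)) (\<xi> N t j w)) / ennreal (N * S N t w)" .
    have c: "ennreal (h * s) * (u / ennreal (n * s)) = ennreal h * (u / ennreal n)" if "0 < s" "0 < n" "0 \<le> h" for h s n :: real and u
    proof -
      have "ennreal (h * s) * (u / ennreal (n * s)) = u * (ennreal (h * s) / ennreal (n * s))"
        by (simp add: ennreal_times_divide mult.commute)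
      also have "ennreal (h * s) / ennreal (n * s) = ennreal h / ennreal n"
        using that by (simp add: divide_ennreal)
      finally show ?thesis by (simp add: ennreal_times_divide mult.commute)
    qed
    show ?thesis unfolding e H_Suc using c[OF pos, of "real N" "H N t w"] H_nonneg N
      by (simp add: ennreal_of_nat_eq_real_of_nat)
  qed
qed

lemma H_F'[measurable]: "H N t \<in> borel_measurable (F N t)" by (rule H_F) simp

lemma H_zero: "w \<in> space (W N) \<Longrightarrow> w \<notin> E N t \<Longrightarrow> ennreal (H N t w) = 0"
  by (simp add: ennreal_eq_0_iff not_less)

lemma step_draws_if:
  assumes N: "1 \<le> N" and t: "t < T"
    and wt: "AE w in W N. 0 < H N t w \<longrightarrow> (\<forall>i<N. wt N t i w = a t (\<xi> N t i w))"
  shows "cond_draws (W N) (F N (Suc t)) (E N (Suc t)) {..<N}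
    (\<lambda>i w. (I N (Suc t) i w, \<xi> N (Suc t) i w)) (count_space {..<N} \<Otimes>\<^sub>M \<nu>)
    (\<lambda>w (j, x). ennreal (wt N t j w * \<theta> (Suc t) (\<xi> N t j w) * p (Suc t) (\<xi> N t j w) x)) (q N t)"
  using t by (intro cond_draws.intro prob_W[OF N] subalgebra_F[OF N] E_F[OF order_refl] count_nu q_measurable step[OF N] step_law[OF N] wt) auto

text \<open>The quotient defining a weight has numerator \<open>m * a * b\<close> and denominator
  \<open>m * b\<close>, so it equals \<open>a\<close> unless \<open>m * b\<close> vanishes. The law
  \<open>q\<close> of the draws has \<open>m * b\<close> as a factor and gives no mass to such
  pairs.\<close>

lemma weights_AE: "1 \<le> N \<Longrightarrow> t \<le> T \<Longrightarrow> AE w in W N. 0 < H N t w \<longrightarrow> (\<forall>i<N. wt N t i w = a t (\<xi> N t i w))"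
proof (induction t)
  case 0
  then show ?case using weights_init[of N] by auto
next
  case (Suc t)
  then have t: "t < T" "1 \<le> N" by auto
  note wt = Suc.IH[OF t(2) less_imp_le[OF t(1)]]
  have sub: "subalgebra (W N) (F N (Suc t))" using t by (intro subalgebra_F) auto
  have "AE w in W N. \<forall>i. i < N \<longrightarrow> 0 < H N (Suc t) w \<longrightarrow> wt N (Suc t) i w = a (Suc t) (\<xi> N (Suc t) i w)"
    unfolding AE_all_countable
  proof
    fix i
    show "AE w in W N. i < N \<longrightarrow> 0 < H N (Suc t) w \<longrightarrow> wt N (Suc t) i w = a (Suc t) (\<xi> N (Suc t) i w)"
    proof (cases "i < N")
      case True
      let ?\<mu> = "count_space {..<N} \<Otimes>\<^sub>M \<nu>" and ?F = "F N (Suc t)"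
      let ?X = "\<lambda>i w. (I N (Suc t) i w, \<xi> N (Suc t) i w)"
      \<comment> \<open>Indicator of the pairs at which the weight is a division by zero.\<close>
      define \<Phi> where "\<Phi> = (\<lambda>(w, j, x). if m (\<xi> N t j w) x * b (Suc t) x = 0 then 1 else 0 :: ennreal)"
      have [measurable]: "(\<lambda>p :: 'w \<times> nat \<times> 'x. \<xi> N t (fst (snd p)) (fst p)) \<in> measurable (?F \<Otimes>\<^sub>M ?\<mu>) borel"
        by (rule measurable_pick[where h="\<lambda>j p. \<xi> N t j (fst p)"])
          (rule measurable_compose[OF measurable_fst xi_F] measurable_compose[OF measurable_snd measurable_fst] lessI | assumption)+
      have \<Phi>m: "\<Phi> \<in> borel_measurable (?F \<Otimes>\<^sub>M ?\<mu>)" unfolding \<Phi>_def case_prod_beta' by measurable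
      have Hm: "(\<lambda>w. ennreal (H N (Suc t) w)) \<in> borel_measurable ?F" by measurable
      have "(\<integral>\<^sup>+ w. ennreal (H N (Suc t) w) * \<Phi> (w, ?X i w) \<partial>W N) = (\<integral>\<^sup>+ w. ennreal (H N (Suc t) w) * (\<integral>\<^sup>+ z. \<Phi> (w, z) * q N t w z \<partial>?\<mu>) \<partial>W N)"
        using cond_draws.nn_integral_weighted[OF step_draws_if[OF t(2,1) wt] Hm H_zero, of "{}" i "\<lambda>_ _. 0" \<Phi>] \<Phi>m True
        by simp
      also have "\<dots> = 0"
      proof -
        have "(\<integral>\<^sup>+ z. \<Phi> (w, z) * q N t w z \<partial>?\<mu>) = (\<integral>\<^sup>+ z. 0 \<partial>?\<mu>)" for w
          by (intro nn_integral_cong) (auto simp: \<Phi>_def q_def mult.assoc split: prod.splits)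
        then show ?thesis by simp
      qed
      finally have z: "(\<integral>\<^sup>+ w. ennreal (H N (Suc t) w) * \<Phi> (w, ?X i w) \<partial>W N) = 0" .
      have "(\<lambda>w. ennreal (H N (Suc t) w) * \<Phi> (w, ?X i w)) \<in> borel_measurable (W N)"
      proof (intro borel_measurable_times_ennreal)
        show "(\<lambda>w. ennreal (H N (Suc t) w)) \<in> borel_measurable (W N)" by (rule measurable_from_subalg[OF sub Hm])
        have "(\<lambda>w. w) \<in> measurable (W N) ?F"
          using sub by (auto simp: measurable_def subalgebra_def intro!: sets.Int)
        from measurable_compose[OF measurable_Pair[OF this pair_measurable[OF t(2,1) True]] \<Phi>m]
        show "(\<lambda>w. \<Phi> (w, ?X i w)) \<in> borel_measurable (W N)" .
      qed
      then have "AE w in W N. ennreal (H N (Suc t) w) * \<Phi> (w, ?X i w) = 0"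
        using z by (simp add: nn_integral_0_iff_AE)
      then show ?thesis
      proof eventually_elim
        case (elim w)
        show ?case
        proof (intro impI)
          assume "0 < H N (Suc t) w"
          then have "\<Phi> (w, ?X i w) = 0" using elim by (simp add: ennreal_eq_0_iff)
          then have nz: "m (\<xi> N t (I N (Suc t) i w) w) (\<xi> N (Suc t) i w) * b (Suc t) (\<xi> N (Suc t) i w) \<noteq> 0"
            by (auto simp: \<Phi>_def split: if_splits)
          have "Suc t \<le> T" using t by simp
          with nz show "wt N (Suc t) i w = a (Suc t) (\<xi> N (Suc t) i w)"
            by (simp add: Let_def adj_factor lik_factor)
        qed
      qed
    qed auto
  qed
  then show ?case by eventually_elim auto
qed

lemma step_draws: "1 \<le> N \<Longrightarrow> t < T \<Longrightarrow> cond_draws (W N) (F N (Suc t)) (E N (Suc t)) {..<N}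
    (\<lambda>i w. (I N (Suc t) i w, \<xi> N (Suc t) i w)) (count_space {..<N} \<Otimes>\<^sub>M \<nu>)
    (\<lambda>w (j, x). ennreal (wt N t j w * \<theta> (Suc t) (\<xi> N t j w) * p (Suc t) (\<xi> N t j w) x)) (q N t)"
  by (rule step_draws_if, assumption+, rule weights_AE) auto

text \<open>The ancestor is integrated out together with the new particle, so the right-hand side is
  the same for every \<open>i\<close>. The function may depend on all earlier particles.\<close>

lemma step_mean:
  assumes N: "1 \<le> N" and t: "t < T" and i: "i < N"
    and \<phi>[measurable]: "\<phi> \<in> borel_measurable (F N (Suc t) \<Otimes>\<^sub>M borel)"
  shows "(\<integral>\<^sup>+ w. ennreal (H N (Suc t) w) * \<phi> (w, \<xi> N (Suc t) i w) \<partial>W N)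
    = (\<integral>\<^sup>+ w. ennreal (H N t w) * ((\<Sum>j<N. Q t (\<lambda>x. \<phi> (w, x)) (\<xi> N t j w)) / of_nat N) \<partial>W N)"
proof -
  let ?\<mu> = "count_space {..<N} \<Otimes>\<^sub>M \<nu>" and ?F = "F N (Suc t)"
  have sub: "subalgebra (W N) (F N (Suc t))" using t N by (intro subalgebra_F) auto
  have Hm: "(\<lambda>w. ennreal (H N (Suc t) w)) \<in> borel_measurable ?F" by measurable
  have \<Phi>m: "(\<lambda>p. \<phi> (fst p, snd (snd p))) \<in> borel_measurable (?F \<Otimes>\<^sub>M ?\<mu>)" by measurable
  have "(\<integral>\<^sup>+ w. ennreal (H N (Suc t) w) * \<phi> (w, \<xi> N (Suc t) i w) \<partial>W N)
     = (\<integral>\<^sup>+ w. ennreal (H N (Suc t) w) * (\<integral>\<^sup>+ z. \<phi> (w, snd z) * q N t w z \<partial>?\<mu>) \<partial>W N)"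
    using cond_draws.nn_integral_weighted[OF step_draws[OF N t] Hm H_zero, of "{}" i "\<lambda>_ _. 0" "\<lambda>p. \<phi> (fst p, snd (snd p))"] \<Phi>m i
    by simp
  also have "\<dots> = (\<integral>\<^sup>+ w. ennreal (H N t w) * ((\<Sum>j<N. Q t (\<lambda>x. \<phi> (w, x)) (\<xi> N t j w)) / of_nat N) \<partial>W N)"
  proof (rule nn_integral_cong)
    fix w assume w: "w \<in> space (W N)"
    then have "w \<in> space ?F" by (simp add: space_F)
    then have [measurable]: "(\<lambda>x. \<phi> (w, x)) \<in> borel_measurable borel"
      using measurable_compose[OF measurable_Pair1' \<phi>] by simp
    have "(\<lambda>z. \<phi> (w, snd z)) \<in> borel_measurable ?\<mu>" by measurable
    from H_q[OF N t w this] show "ennreal (H N (Suc t) w) * (\<integral>\<^sup>+ z. \<phi> (w, snd z) * q N t w z \<partial>?\<mu>)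
      = ennreal (H N t w) * ((\<Sum>j<N. Q t (\<lambda>x. \<phi> (w, x)) (\<xi> N t j w)) / of_nat N)" by simp
  qed
  finally show ?thesis .
qed

lemma unbiased: "1 \<le> N \<Longrightarrow> t \<le> T \<Longrightarrow> i < N \<Longrightarrow> f \<in> borel_measurable borel \<Longrightarrow>
  (\<integral>\<^sup>+ w. ennreal (H N t w) * f (\<xi> N t i w) \<partial>W N) = (\<integral>\<^sup>+ x. f x \<partial>target t)"
proof (induction t arbitrary: f i)
  case 0
  note [measurable] = 0(4)
  have "distr (W N) borel (\<xi> N 0 i) = \<rho>0"
    using auxiliary_particle_filter.init_law[OF particle_filter] 0 by auto
  then have "(\<integral>\<^sup>+ x. f x \<partial>target 0) = (\<integral>\<^sup>+ x. f x \<partial>distr (W N) borel (\<xi> N 0 i))" by simp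
  also have "\<dots> = (\<integral>\<^sup>+ w. f (\<xi> N 0 i w) \<partial>W N)" using 0 xi_measurable by (intro nn_integral_distr) auto
  finally show ?case by simp
next
  case (Suc t)
  note [measurable] = Suc.prems(4)
  have t: "t < T" using Suc.prems by simp
  have sub: "subalgebra (W N) (F N (Suc t))" using t Suc by (intro subalgebra_F) auto
  have xim: "(\<lambda>w. ennreal (H N t w) * Q t f (\<xi> N t j w)) \<in> borel_measurable (W N)" if "j < N" for j
  proof (rule measurable_from_subalg[OF sub])
    have [measurable]: "H N t \<in> borel_measurable (F N (Suc t))" "\<xi> N t j \<in> measurable (F N (Suc t)) borel"
      using that by (auto intro!: H_F xi_F)
    show "(\<lambda>w. ennreal (H N t w) * Q t f (\<xi> N t j w)) \<in> borel_measurable (F N (Suc t))" by measurable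
  qed
  have "(\<integral>\<^sup>+ w. ennreal (H N (Suc t) w) * f (\<xi> N (Suc t) i w) \<partial>W N)
     = (\<integral>\<^sup>+ w. ennreal (H N t w) * ((\<Sum>j<N. Q t f (\<xi> N t j w)) / of_nat N) \<partial>W N)"
    using step_mean[OF Suc.prems(1) t Suc.prems(3), of "\<lambda>p. f (snd p)"] by simp
  also have "\<dots> = (\<integral>\<^sup>+ w. (\<Sum>j<N. ennreal (H N t w) * Q t f (\<xi> N t j w)) / of_nat N \<partial>W N)"
    by (simp add: ennreal_times_divide sum_distrib_left)
  also have "\<dots> = (\<Sum>j<N. \<integral>\<^sup>+ w. ennreal (H N t w) * Q t f (\<xi> N t j w) \<partial>W N) / of_nat N"
    using xim by (subst nn_integral_divide; (subst nn_integral_sum)?) (auto intro!: borel_measurable_sum)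
  also have "\<dots> = (\<integral>\<^sup>+ x. Q t f x \<partial>target t) * of_nat N / of_nat N"
    using Suc.IH[OF Suc.prems(1) less_imp_le[OF t], of _ "Q t f"] by (simp add: mult.commute)
  also have "\<dots> = (\<integral>\<^sup>+ x. Q t f x \<partial>target t)"
    using Suc.prems by (intro ennreal_mult_divide_eq) (auto simp: of_nat_less_top[THEN less_imp_neq] simp del: of_nat_less_top)
  also have "\<dots> = (\<integral>\<^sup>+ x. f x \<partial>target (Suc t))"
    using finite_target t by (intro nn_integral_target_Suc[symmetric]) auto
  finally show ?case .
qed

end

section \<open>Letting the truncation level grow\<close>

lemma truncation_tail_tendsto:
  assumes [measurable]: "f \<in> borel_measurable \<mu>" and f: "\<And>x. 0 \<le> f x" "(\<integral>\<^sup>+ x. ennreal (f x) \<partial>\<mu>) < \<infinity>"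
  shows "(\<lambda>n. \<integral>\<^sup>+ x. ennreal (f x - min (f x) (sqrt (sqrt (real n)))) \<partial>\<mu>) \<longlonglongrightarrow> 0"
proof -
  have "(\<lambda>n. \<integral>\<^sup>+ x. ennreal (f x - min (f x) (sqrt (sqrt (real n)))) \<partial>\<mu>) \<longlonglongrightarrow> (\<integral>\<^sup>+ x. 0 \<partial>\<mu>)"
  proof (rule nn_integral_dominated_convergence[where w="\<lambda>x. ennreal (f x)"])
    have "(\<lambda>n. ennreal (f x - min (f x) (sqrt (sqrt (real n))))) \<longlonglongrightarrow> 0" for x
    proof (rule tendsto_eventually)
      have "filterlim (\<lambda>n. sqrt (sqrt (real n))) at_top sequentially"
        by (intro filterlim_compose[OF sqrt_at_top] filterlim_real_sequentially)
      then have "\<forall>\<^sub>F n in sequentially. f x \<le> sqrt (sqrt (real n))"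
        by (auto simp: filterlim_at_top)
      then show "\<forall>\<^sub>F n in sequentially. ennreal (f x - min (f x) (sqrt (sqrt (real n)))) = 0"
        by eventually_elim auto
    qed
    then show "AE x in \<mu>. (\<lambda>n. ennreal (f x - min (f x) (sqrt (sqrt (real n))))) \<longlonglongrightarrow> 0" by auto
    show "AE x in \<mu>. ennreal (f x - min (f x) (sqrt (sqrt (real n)))) \<le> ennreal (f x)" for n
      using f by (auto intro!: ennreal_leI)
  qed (use f in auto)
  then show ?thesis by simp
qed

text \<open>The level is the fourth root of \<open>n\<close>: it tends to infinity, so the tail
  integral vanishes, yet it is negligible against \<open>sqrt n\<close>, so the fluctuation term
  vanishes too.\<close>

lemma truncation_limit:
  assumes f[measurable]: "f \<in> borel_measurable \<mu>" and f0: "\<And>x. 0 \<le> f x" "(\<integral>\<^sup>+ x. ennreal (f x) \<partial>\<mu>) < \<infinity>"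
    and R: "R < \<infinity>" and D: "D \<longlonglongrightarrow> (0::ennreal)"
    and le: "\<And>n C. 1 \<le> n \<Longrightarrow> 0 < C \<Longrightarrow> A n \<le> 2 * (\<integral>\<^sup>+ x. ennreal (f x - min (f x) C) \<partial>\<mu>) + ennreal (C / sqrt (real n)) * R + D n"
  shows "A \<longlonglongrightarrow> 0"
proof (rule tendsto_sandwich[of "\<lambda>_. 0", OF _ _ tendsto_const])
  let ?C = "\<lambda>n. sqrt (sqrt (real n))"
  let ?B = "\<lambda>n. 2 * (\<integral>\<^sup>+ x. ennreal (f x - min (f x) (?C n)) \<partial>\<mu>) + ennreal (?C n / sqrt (real n)) * R + D n"
  show "\<forall>\<^sub>F n in sequentially. A n \<le> ?B n"
    by (rule eventually_sequentiallyI[of 1]) (rule le, auto)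
  have c: "(\<lambda>n. ennreal (?C n / sqrt (real n))) \<longlonglongrightarrow> ennreal 0"
  proof (rule tendsto_ennrealI)
    have "(\<lambda>n. inverse (?C n)) \<longlonglongrightarrow> 0"
      by (rule tendsto_inverse_0_at_top, intro filterlim_compose[OF sqrt_at_top] filterlim_real_sequentially)
    then show "(\<lambda>n. ?C n / sqrt (real n)) \<longlonglongrightarrow> 0"
    proof (rule Lim_transform_eventually)
      show "\<forall>\<^sub>F n in sequentially. inverse (?C n) = ?C n / sqrt (real n)"
      proof (rule eventually_sequentiallyI[of 1])
        fix n :: nat assume "1 \<le> n"
        then have "0 < ?C n" "sqrt (real n) = ?C n * ?C n" by auto
        then show "inverse (?C n) = ?C n / sqrt (real n)" by (simp add: field_simps)
      qed
    qed
  qed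
  have "?B \<longlonglongrightarrow> 2 * 0 + 0 * R + 0"
    by (intro tendsto_add D ennreal_tendsto_cmult truncation_tail_tendsto[OF f f0] tendsto_mult_ennreal tendsto_const c[unfolded ennreal_0])
      (use R in auto)
  then show "?B \<longlonglongrightarrow> 0" by simp
qed auto

section \<open>Laws of large numbers for the particles\<close>

context adapted_ffbsi begin

text \<open>The unnormalized one-step prediction: by \<open>H_q\<close>, \<open>H N t\<close> times
  \<open>K\<close> is \<open>H N (Suc t)\<close> times the conditional mean of the function at a new
  particle. As a functional it can be applied to functions that themselves depend on the outcome
  \<open>w\<close>.\<close>

definition K :: "nat \<Rightarrow> nat \<Rightarrow> 'w \<Rightarrow> ('x \<Rightarrow> ennreal) \<Rightarrow> ennreal" where
  "K N t w u = (\<Sum>j<N. Q t u (\<xi> N t j w)) / of_nat N"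

definition avg :: "nat \<Rightarrow> nat \<Rightarrow> ('x \<Rightarrow> real) \<Rightarrow> ('w \<Rightarrow> 'x \<Rightarrow> real) \<Rightarrow> 'w \<Rightarrow> real" where
  "avg N t f \<psi> w = H N t w * ((\<Sum>i<N. f (\<xi> N t i w) * \<psi> w (\<xi> N t i w)) / N)"

lemma H_measurable_W: "1 \<le> N \<Longrightarrow> t \<le> Suc T \<Longrightarrow> H N t \<in> borel_measurable (W N)"
  using measurable_from_subalg[OF subalgebra_F H_F'] .

lemma K_measurable:
  assumes [measurable]: "\<psi> \<in> borel_measurable (F N (Suc t) \<Otimes>\<^sub>M borel)"
  shows "(\<lambda>w. K N t w (\<lambda>x. \<psi> (w, x))) \<in> borel_measurable (F N (Suc t))"
proof -
  have "(\<lambda>w. Q t (\<lambda>x. \<psi> (w, x)) (\<xi> N t j w)) \<in> borel_measurable (F N (Suc t))" if "j < N" for j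
  proof -
    have [measurable]: "\<xi> N t j \<in> measurable (F N (Suc t)) borel" using that by (intro xi_F) auto
    show ?thesis unfolding Q_def by measurable
  qed
  then show ?thesis unfolding K_def by (intro borel_measurable_divide_ennreal borel_measurable_sum) auto
qed

lemma K_add: "u \<in> borel_measurable borel \<Longrightarrow> v \<in> borel_measurable borel \<Longrightarrow> K N t w (\<lambda>x. u x + v x) = K N t w u + K N t w v"
  by (simp add: K_def Q_def distrib_left nn_integral_add sum.distrib add_divide_distrib_ennreal)

lemma K_mono: "(\<And>x. u x \<le> v x) \<Longrightarrow> K N t w u \<le> K N t w v"
  unfolding K_def Q_def by (intro divide_right_mono_ennreal sum_mono nn_integral_mono mult_left_mono) auto

lemma K_cmult: "u \<in> borel_measurable borel \<Longrightarrow> K N t w (\<lambda>x. c * u x) = c * K N t w u"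
  by (simp add: K_def Q_def mult.left_commute[of _ c] nn_integral_cmult sum_distrib_left[symmetric] ennreal_times_divide)

lemma K_mean: assumes "1 \<le> N" "t < T" and u[measurable]: "u \<in> borel_measurable borel"
  shows "(\<integral>\<^sup>+ w. ennreal (H N t w) * K N t w u \<partial>W N) = (\<integral>\<^sup>+ x. u x \<partial>target (Suc t))"
  using step_mean[OF assms(1,2), of 0 "\<lambda>p. u (snd p)"] unbiased[of N "Suc t" 0 u] assms by (simp add: K_def)

lemma nn_integral_H: "1 \<le> N \<Longrightarrow> t \<le> T \<Longrightarrow> (\<integral>\<^sup>+ w. ennreal (H N t w) \<partial>W N) = emeasure (target t) (space (target t))"
  using unbiased[of N t 0 "\<lambda>_. 1"] by simp

lemma emeasure_target: "t \<le> T \<Longrightarrow> emeasure (target t) (space (target t)) < \<infinity>"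
  using finite_measure.emeasure_finite[OF finite_target] by (simp add: less_top)

lemma section_measurable:
  assumes "(\<lambda>p. \<psi> (fst p) (snd p)) \<in> borel_measurable (F N t \<Otimes>\<^sub>M borel)" "w \<in> space (W N)"
  shows "\<psi> w \<in> borel_measurable borel"
  using measurable_compose[OF measurable_Pair1'[of w "F N t"] assms(1)] assms(2) by (simp add: space_F)

text \<open>Division by \<open>C\<close> brings the function into the unit interval, where the weak
  law for draws applies. \<open>H_q\<close> then replaces the conditional mean weighted by
  \<open>H N (Suc t)\<close> with \<open>K\<close> weighted by \<open>H N t\<close>.\<close>

lemma step_weak_law:
  fixes \<phi> :: "'w \<times> 'x \<Rightarrow> real"
  assumes N: "1 \<le> N" and t: "t < T" and C: "0 < C"
    and \<phi>[measurable]: "\<phi> \<in> borel_measurable (F N (Suc t) \<Otimes>\<^sub>M borel)" and \<phi>0: "\<And>p. 0 \<le> \<phi> p" "\<And>p. \<phi> p \<le> C"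
  shows "(\<integral>\<^sup>+ w. ennreal \<bar>H N (Suc t) w * ((\<Sum>i<N. \<phi> (w, \<xi> N (Suc t) i w)) / N) - H N t w * enn2real (K N t w (\<lambda>x. ennreal (\<phi> (w, x))))\<bar> \<partial>W N)
    \<le> ennreal (C / sqrt N) * emeasure (target (Suc t)) (space (target (Suc t)))"
proof -
  let ?\<mu> = "count_space {..<N} \<Otimes>\<^sub>M \<nu>" and ?F = "F N (Suc t)"
  have sub: "subalgebra (W N) (F N (Suc t))" using t N by (intro subalgebra_F) auto
  define \<phi>' where "\<phi>' p = \<phi> (fst p, snd (snd p)) / C" for p :: "'w \<times> nat \<times> 'x"
  have \<phi>'m[measurable]: "\<phi>' \<in> borel_measurable (?F \<Otimes>\<^sub>M ?\<mu>)" unfolding \<phi>'_def by measurable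
  have \<phi>'0: "0 \<le> \<phi>' p" "\<phi>' p \<le> 1" for p using \<phi>0 C by (auto simp: \<phi>'_def divide_le_eq)
  have fin: "(\<integral>\<^sup>+ w. ennreal (H N (Suc t) w) \<partial>W N) < \<infinity>"
    using nn_integral_H[OF N, of "Suc t"] emeasure_target[of "Suc t"] t by simp
  have Hz: "H N (Suc t) w = 0" if "w \<in> space (W N)" "w \<notin> E N (Suc t)" for w
    using H_nonneg[of N "Suc t" w] that by simp
  have "(\<integral>\<^sup>+ w. ennreal \<bar>H N (Suc t) w * ((\<Sum>i<N. \<phi> (w, \<xi> N (Suc t) i w)) / N) - H N t w * enn2real (K N t w (\<lambda>x. ennreal (\<phi> (w, x))))\<bar> \<partial>W N)
    = (\<integral>\<^sup>+ w. ennreal C * ennreal (H N (Suc t) w * \<bar>(\<Sum>i<N. \<phi>' (w, (I N (Suc t) i w, \<xi> N (Suc t) i w))) / N - enn2real (\<integral>\<^sup>+ z. ennreal (\<phi>' (w, z)) * q N t w z \<partial>?\<mu>)\<bar>) \<partial>W N)"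
  proof (rule nn_integral_cong)
    fix w assume w: "w \<in> space (W N)"
    then have wF: "w \<in> space ?F" by (simp add: space_F)
    have [measurable]: "(\<lambda>x. \<phi> (w, x)) \<in> borel_measurable borel"
      using measurable_compose[OF measurable_Pair1'[OF wF] \<phi>] by simp
    have "(\<lambda>x. ennreal (\<phi> (w, x) / C)) \<in> borel_measurable \<nu>" by simp
    from measurable_compose[OF measurable_snd this]
    have m: "(\<lambda>z. ennreal (\<phi>' (w, z))) \<in> borel_measurable ?\<mu>" unfolding \<phi>'_def by simp
    have Cphi: "ennreal (\<phi> (w, x)) = ennreal C * ennreal (\<phi> (w, x) / C)" for x
      using C by (simp add: ennreal_mult'[symmetric])
    have "ennreal (H N (Suc t) w) * (\<integral>\<^sup>+ z. ennreal (\<phi>' (w, z)) * q N t w z \<partial>?\<mu>)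
        = ennreal (H N t w) * K N t w (\<lambda>x. ennreal (\<phi> (w, x) / C))"
      using H_q[OF N t w m] by (simp add: K_def \<phi>'_def)
    then have "ennreal C * (ennreal (H N (Suc t) w) * (\<integral>\<^sup>+ z. ennreal (\<phi>' (w, z)) * q N t w z \<partial>?\<mu>))
       = ennreal (H N t w) * K N t w (\<lambda>x. ennreal (\<phi> (w, x)))"
      unfolding Cphi by (subst K_cmult) (auto simp: mult_ac)
    from arg_cong[OF this, of enn2real]
    have e: "C * (H N (Suc t) w * enn2real (\<integral>\<^sup>+ z. ennreal (\<phi>' (w, z)) * q N t w z \<partial>?\<mu>)) = H N t w * enn2real (K N t w (\<lambda>x. ennreal (\<phi> (w, x))))"
      using C H_nonneg by (simp add: enn2real_mult)
    have s: "(\<Sum>i<N. \<phi> (w, \<xi> N (Suc t) i w)) = C * (\<Sum>i<N. \<phi>' (w, (I N (Suc t) i w, \<xi> N (Suc t) i w)))"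
      using C by (simp add: \<phi>'_def sum_distrib_left)
    show "ennreal \<bar>H N (Suc t) w * ((\<Sum>i<N. \<phi> (w, \<xi> N (Suc t) i w)) / N) - H N t w * enn2real (K N t w (\<lambda>x. ennreal (\<phi> (w, x))))\<bar>
      = ennreal C * ennreal (H N (Suc t) w * \<bar>(\<Sum>i<N. \<phi>' (w, (I N (Suc t) i w, \<xi> N (Suc t) i w))) / N - enn2real (\<integral>\<^sup>+ z. ennreal (\<phi>' (w, z)) * q N t w z \<partial>?\<mu>)\<bar>)"
    proof -
      have "H * (C * s / n) - C * (H * e) = (C * H) * (s / n - e)" for H s n e :: real by (simp add: algebra_simps)
      then have "\<bar>H * (C * s / n) - C * (H * e)\<bar> = C * (H * \<bar>s / n - e\<bar>)" if "0 \<le> H" for H s n e :: real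
        using that C by (simp only: abs_mult mult.assoc)
      then show ?thesis unfolding e[symmetric] s using C H_nonneg[of N "Suc t" w] by (simp add: ennreal_mult')
    qed
  qed
  also have "\<dots> \<le> ennreal C * (ennreal (1 / sqrt N) * (\<integral>\<^sup>+ w. ennreal (H N (Suc t) w) \<partial>W N))"
  proof (subst nn_integral_cmult)
    have idm: "(\<lambda>w. w) \<in> measurable (W N) ?F" using sub by (rule measurable_ident_subalgebra)
    have [measurable]: "(\<lambda>w. \<phi>' (w, (I N (Suc t) i w, \<xi> N (Suc t) i w))) \<in> borel_measurable (W N)" if "i \<in> {..<N}" for i
      using measurable_compose[OF measurable_Pair[OF idm pair_measurable[OF N t]] \<phi>'m] that by auto
    have q': "(\<lambda>p. q N t (fst p) (snd p)) \<in> borel_measurable (?F \<Otimes>\<^sub>M ?\<mu>)"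
      using q_measurable by (simp add: case_prod_beta')
    interpret cn: sigma_finite_measure ?\<mu> by (rule count_nu)
    have "(\<lambda>w. \<integral>\<^sup>+ z. ennreal (\<phi>' (w, z)) * q N t w z \<partial>?\<mu>) \<in> borel_measurable ?F"
      by (rule cn.borel_measurable_nn_integral) (use q' in measurable)
    note [measurable] = measurable_from_subalg[OF sub this] H_measurable_W[OF N Suc_leI[OF less_SucI[OF t]]]
    show "(\<lambda>w. ennreal (H N (Suc t) w * \<bar>(\<Sum>i<N. \<phi>' (w, (I N (Suc t) i w, \<xi> N (Suc t) i w))) / N - enn2real (\<integral>\<^sup>+ z. ennreal (\<phi>' (w, z)) * q N t w z \<partial>?\<mu>)\<bar>)) \<in> borel_measurable (W N)"
      by measurable
    show "ennreal C * (\<integral>\<^sup>+ w. ennreal (H N (Suc t) w * \<bar>(\<Sum>i<N. \<phi>' (w, (I N (Suc t) i w, \<xi> N (Suc t) i w))) / N - enn2real (\<integral>\<^sup>+ z. ennreal (\<phi>' (w, z)) * q N t w z \<partial>?\<mu>)\<bar>) \<partial>W N)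
       \<le> ennreal C * (ennreal (1 / sqrt N) * (\<integral>\<^sup>+ w. ennreal (H N (Suc t) w) \<partial>W N))"
      by (intro mult_left_mono cond_draws_weak_law[OF step_draws[OF N t] H_F' H_nonneg Hz fin N \<phi>'m \<phi>'0])
        auto
  qed
  also have "\<dots> = ennreal (C / sqrt N) * emeasure (target (Suc t)) (space (target (Suc t)))"
    using nn_integral_H[OF N, of "Suc t"] t C by (simp add: mult.assoc[symmetric] ennreal_mult[symmetric])
  finally show ?thesis .
qed

lemma step_truncation_bound:
  fixes f :: "'x \<Rightarrow> real" and \<psi> :: "'w \<Rightarrow> 'x \<Rightarrow> real"
  assumes N: "1 \<le> N" and t: "t < T" and C: "0 < C"
    and f[measurable]: "f \<in> borel_measurable borel" and f0: "\<And>x. 0 \<le> f x"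
    and \<psi>[measurable]: "(\<lambda>p. \<psi> (fst p) (snd p)) \<in> borel_measurable (F N (Suc t) \<Otimes>\<^sub>M borel)"
    and \<psi>0: "\<And>w x. 0 \<le> \<psi> w x" "\<And>w x. \<psi> w x \<le> 1"
  shows "(\<integral>\<^sup>+ w. ennreal \<bar>avg N (Suc t) f \<psi> w - H N t w * enn2real (K N t w (\<lambda>x. ennreal (f x * \<psi> w x)))\<bar> \<partial>W N)
    \<le> 2 * (\<integral>\<^sup>+ x. ennreal (f x - min (f x) C) \<partial>target (Suc t)) + ennreal (C / sqrt N) * emeasure (target (Suc t)) (space (target (Suc t)))"
  unfolding avg_def
proof (rule truncation_bound[where B=borel and Hc="H N t" and L="K N t", OF N C H_nonneg H_nonneg f f0 _ \<psi>0])
  have sub: "subalgebra (W N) (F N (Suc t))" using t N by (intro subalgebra_F) auto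
  note HW[measurable] = H_measurable_W[OF N, of "Suc t"] H_measurable_W[OF N, of t]
  have t': "Suc t \<le> T" "Suc t \<le> Suc T" "t \<le> Suc T" using t by auto
  note [measurable] = HW(1)[OF t'(2)] HW(2)[OF t'(3)]
  have xi: "\<xi> N (Suc t) i \<in> measurable (W N) borel" if "i < N" for i
    using that t' N by (intro xi_measurable)
  show "\<psi> w \<in> borel_measurable borel" if "w \<in> space (W N)" for w
    using section_measurable[OF \<psi> that] .
  show "K N t w (\<lambda>x. u x + v x) = K N t w u + K N t w v"
    if "u \<in> borel_measurable borel" "v \<in> borel_measurable borel" for w u v
    using that by (rule K_add)
  show "K N t w u \<le> K N t w v" if "\<And>x. u x \<le> v x" for w u v using that by (rule K_mono)
  show "(\<lambda>w. ennreal (H N t w) * K N t w u) \<in> borel_measurable (W N)" if [measurable]: "u \<in> borel_measurable borel" for u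
  proof -
    have [measurable]: "(\<lambda>w. K N t w u) \<in> borel_measurable (W N)"
      using measurable_from_subalg[OF sub K_measurable[of "\<lambda>p. u (snd p)"]] by simp
    show ?thesis by measurable
  qed
  show "(\<integral>\<^sup>+ w. ennreal (H N t w) * K N t w u \<partial>W N) = (\<integral>\<^sup>+ x. u x \<partial>target (Suc t))" if "u \<in> borel_measurable borel" for u
    using that N t by (intro K_mean)
  show "(\<lambda>w. ennreal (H N (Suc t) w) * u (\<xi> N (Suc t) i w)) \<in> borel_measurable (W N)"
    if "i < N" and [measurable]: "u \<in> borel_measurable borel" for u i
  proof -
    note [measurable] = xi[OF that(1)]
    show ?thesis by measurable
  qed
  show "(\<integral>\<^sup>+ w. ennreal (H N (Suc t) w) * u (\<xi> N (Suc t) i w) \<partial>W N) = (\<integral>\<^sup>+ x. u x \<partial>target (Suc t))"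
    if "i < N" "u \<in> borel_measurable borel" for u i
    using that N t' by (intro unbiased)
  let ?\<phi> = "\<lambda>p. min (f (snd p)) C * \<psi> (fst p) (snd p)"
  have \<phi>m: "?\<phi> \<in> borel_measurable (F N (Suc t) \<Otimes>\<^sub>M borel)" by measurable
  show "(\<lambda>w. H N (Suc t) w * ((\<Sum>i<N. min (f (\<xi> N (Suc t) i w)) C * \<psi> w (\<xi> N (Suc t) i w)) / N) - H N t w * enn2real (K N t w (\<lambda>x. ennreal (min (f x) C * \<psi> w x)))) \<in> borel_measurable (W N)"
  proof -
    have [measurable]: "(\<lambda>w. K N t w (\<lambda>x. ennreal (min (f x) C * \<psi> w x))) \<in> borel_measurable (W N)"
      using measurable_from_subalg[OF sub K_measurable[of "\<lambda>p. ennreal (?\<phi> p)"]] by simp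
    have [measurable]: "(\<lambda>w. min (f (\<xi> N (Suc t) i w)) C * \<psi> w (\<xi> N (Suc t) i w)) \<in> borel_measurable (W N)" if "i \<in> {..<N}" for i
      using measurable_compose[OF measurable_Pair[OF measurable_ident_subalgebra[OF sub] xi] \<phi>m, of i] that by simp
    show ?thesis by measurable
  qed
  show "(\<integral>\<^sup>+ w. ennreal \<bar>H N (Suc t) w * ((\<Sum>i<N. min (f (\<xi> N (Suc t) i w)) C * \<psi> w (\<xi> N (Suc t) i w)) / N) - H N t w * enn2real (K N t w (\<lambda>x. ennreal (min (f x) C * \<psi> w x)))\<bar> \<partial>W N)
    \<le> ennreal (C / sqrt N) * emeasure (target (Suc t)) (space (target (Suc t)))"
  proof -
    have "0 \<le> ?\<phi> p" for p using f0[of "snd p"] \<psi>0(1) C by (intro mult_nonneg_nonneg) auto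
    moreover have "?\<phi> p \<le> C" for p
    proof -
      have "?\<phi> p \<le> C * 1" using \<psi>0 C by (intro mult_mono) auto
      then show ?thesis by simp
    qed
    ultimately show ?thesis using step_weak_law[OF N t C \<phi>m] by simp
  qed
qed

lemma avg_measurable:
  assumes N: "1 \<le> N" and t: "t \<le> T" and f[measurable]: "f \<in> borel_measurable borel"
    and \<psi>[measurable]: "(\<lambda>p. \<psi> (fst p) (snd p)) \<in> borel_measurable (F N t \<Otimes>\<^sub>M borel)"
  shows "avg N t f \<psi> \<in> borel_measurable (W N)"
proof -
  have sub: "subalgebra (W N) (F N t)" using t N by (intro subalgebra_F) auto
  have [measurable]: "H N t \<in> borel_measurable (W N)" using t N by (intro H_measurable_W) auto
  have xi: "\<xi> N t i \<in> measurable (W N) borel" if "i < N" for i using that t N by (intro xi_measurable)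
  have [measurable]: "(\<lambda>w. f (\<xi> N t i w) * \<psi> w (\<xi> N t i w)) \<in> borel_measurable (W N)" if "i \<in> {..<N}" for i
    using measurable_compose[OF measurable_Pair[OF measurable_ident_subalgebra[OF sub] xi], of i "\<lambda>p. f (snd p) * \<psi> (fst p) (snd p)"] that by simp
  show ?thesis unfolding avg_def[abs_def] by measurable
qed

text \<open>Only the centerings have to converge: their distance to the averages is removed by
  truncation, uniformly in the bounded factor \<open>\<psi>\<close>, which may depend on all
  particles up to time \<open>t\<close>.\<close>

lemma step_limit:
  fixes f :: "'x \<Rightarrow> real" and \<psi> :: "nat \<Rightarrow> 'w \<Rightarrow> 'x \<Rightarrow> real"
  assumes t: "t < T"
    and f[measurable]: "f \<in> borel_measurable borel" and f0: "\<And>x. 0 \<le> f x" and fi: "(\<integral>\<^sup>+ x. ennreal (f x) \<partial>target (Suc t)) < \<infinity>"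
    and \<psi>: "\<And>N. 1 \<le> N \<Longrightarrow> (\<lambda>p. \<psi> N (fst p) (snd p)) \<in> borel_measurable (F N (Suc t) \<Otimes>\<^sub>M borel)"
    and \<psi>0: "\<And>N w x. 0 \<le> \<psi> N w x" "\<And>N w x. \<psi> N w x \<le> 1"
    and lim: "(\<lambda>N. \<integral>\<^sup>+ w. ennreal \<bar>H N t w * enn2real (K N t w (\<lambda>x. ennreal (f x * \<psi> N w x))) - l\<bar> \<partial>W N) \<longlonglongrightarrow> 0"
  shows "(\<lambda>N. \<integral>\<^sup>+ w. ennreal \<bar>avg N (Suc t) f (\<psi> N) w - l\<bar> \<partial>W N) \<longlonglongrightarrow> 0"
proof (rule truncation_limit[where f=f and \<mu>="target (Suc t)" and R="emeasure (target (Suc t)) (space (target (Suc t)))", OF _ f0 fi _ lim])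
  show "f \<in> borel_measurable (target (Suc t))" using f by simp
  show "emeasure (target (Suc t)) (space (target (Suc t))) < \<infinity>" using emeasure_target[of "Suc t"] t by simp
  fix N :: nat and C :: real assume N: "1 \<le> N" and C: "0 < C"
  have sub: "subalgebra (W N) (F N (Suc t))" using t N by (intro subalgebra_F) auto
  note [measurable] = avg_measurable[OF N Suc_leI[OF t] f \<psi>[OF N]] \<psi>[OF N]
  have [measurable]: "H N t \<in> borel_measurable (W N)" using t N by (intro H_measurable_W) auto
  have [measurable]: "(\<lambda>w. K N t w (\<lambda>x. ennreal (f x * \<psi> N w x))) \<in> borel_measurable (W N)"
      using measurable_from_subalg[OF sub K_measurable[of "\<lambda>p. ennreal (f (snd p) * \<psi> N (fst p) (snd p))"]] by simp
  let ?c = "\<lambda>w. H N t w * enn2real (K N t w (\<lambda>x. ennreal (f x * \<psi> N w x)))"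
  have "(\<integral>\<^sup>+ w. ennreal \<bar>avg N (Suc t) f (\<psi> N) w - l\<bar> \<partial>W N) \<le> (\<integral>\<^sup>+ w. ennreal \<bar>avg N (Suc t) f (\<psi> N) w - ?c w\<bar> + ennreal \<bar>?c w - l\<bar> \<partial>W N)"
    by (intro nn_integral_mono) (auto simp: ennreal_plus[symmetric] simp del: ennreal_plus intro!: ennreal_leI)
  also have "\<dots> = (\<integral>\<^sup>+ w. ennreal \<bar>avg N (Suc t) f (\<psi> N) w - ?c w\<bar> \<partial>W N) + (\<integral>\<^sup>+ w. ennreal \<bar>?c w - l\<bar> \<partial>W N)"
    by (intro nn_integral_add) measurable
  also have "\<dots> \<le> (2 * (\<integral>\<^sup>+ x. ennreal (f x - min (f x) C) \<partial>target (Suc t)) + ennreal (C / sqrt N) * emeasure (target (Suc t)) (space (target (Suc t)))) + (\<integral>\<^sup>+ w. ennreal \<bar>?c w - l\<bar> \<partial>W N)"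
    by (intro add_right_mono step_truncation_bound[OF N t C f f0 \<psi>[OF N] \<psi>0])
  finally show "(\<integral>\<^sup>+ w. ennreal \<bar>avg N (Suc t) f (\<psi> N) w - l\<bar> \<partial>W N) \<le> 2 * (\<integral>\<^sup>+ x. ennreal (f x - min (f x) C) \<partial>target (Suc t)) + ennreal (C / sqrt N) * emeasure (target (Suc t)) (space (target (Suc t))) + (\<integral>\<^sup>+ w. ennreal \<bar>?c w - l\<bar> \<partial>W N)" .
qed

text \<open>The initial draws are independent in the ordinary sense and carry the weight
  \<open>H = 1\<close>, so the centering is a constant and the mixed moments come from
  \<open>indep_vars\<close>.\<close>

lemma init_limit:
  fixes f :: "'x \<Rightarrow> real"
  assumes f[measurable]: "f \<in> borel_measurable borel" and f0: "\<And>x. 0 \<le> f x" and fi: "(\<integral>\<^sup>+ x. ennreal (f x) \<partial>target 0) < \<infinity>"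
  shows "(\<lambda>N. \<integral>\<^sup>+ w. ennreal \<bar>avg N 0 f (\<lambda>_ _. 1) w - enn2real (\<integral>\<^sup>+ x. ennreal (f x) \<partial>target 0)\<bar> \<partial>W N) \<longlonglongrightarrow> 0"
proof (rule truncation_limit[where f=f and \<mu>="target 0" and R=1 and D="\<lambda>_. 0", OF _ f0 fi])
  show "f \<in> borel_measurable (target 0)" using f sets_target[of 0] measurable_cong_sets[of "target 0" borel] by blast
  have sr[measurable_cong]: "sets \<rho>0 = sets borel" using sets_target[of 0] by simp
  fix N :: nat and C :: real assume N: "1 \<le> N" and C: "0 < C"
  interpret prob_space "W N" by (rule prob_W[OF N])
  have [simp]: "prob_space \<rho>0" using auxiliary_particle_filter.instr_prob[OF particle_filter[OF N]] .
  have xi: "\<xi> N 0 i \<in> measurable (W N) borel" if "i < N" for i using that N by (intro xi_measurable) auto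
  have mean: "(\<integral>\<^sup>+ w. u (\<xi> N 0 i w) \<partial>W N) = (\<integral>\<^sup>+ x. u x \<partial>\<rho>0)" if "i < N" "u \<in> borel_measurable borel" for u i
    using unbiased[of N 0 i u] that N by simp
  have "(\<integral>\<^sup>+ w. ennreal \<bar>H N 0 w * ((\<Sum>i<N. f (\<xi> N 0 i w) * 1) / N) - 1 * enn2real (\<integral>\<^sup>+ x. ennreal (f x * 1) \<partial>\<rho>0)\<bar> \<partial>W N)
      \<le> 2 * (\<integral>\<^sup>+ x. ennreal (f x - min (f x) C) \<partial>\<rho>0) + ennreal (C / sqrt N)"
  proof (rule truncation_bound[where B=borel and \<theta>="\<lambda>_ _. 1" and Hc="\<lambda>_. 1" and L="\<lambda>w u. \<integral>\<^sup>+ x. u x \<partial>\<rho>0" and H="H N 0", OF N C _ _ f f0])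
    define e where "e = enn2real (\<integral>\<^sup>+ x. ennreal (min (f x) C) \<partial>\<rho>0)"
    have "(\<integral>\<^sup>+ x. ennreal (min (f x) C) \<partial>\<rho>0) \<le> (\<integral>\<^sup>+ x. ennreal C \<partial>\<rho>0)"
      by (intro nn_integral_mono ennreal_leI) auto
    also have "\<dots> = ennreal C" by (simp add: prob_space.emeasure_space_1)
    finally have eC: "(\<integral>\<^sup>+ x. ennreal (min (f x) C) \<partial>\<rho>0) \<le> ennreal C" .
    have "(\<integral>\<^sup>+ x. ennreal (min (f x) C) \<partial>\<rho>0) = ennreal e"
      unfolding e_def using order_le_less_trans[OF eC ennreal_less_top] by (rule ennreal_enn2real[symmetric])
    moreover have "0 \<le> e" "e \<le> C" using eC C by (simp_all add: e_def enn2real_leI)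
    ultimately have e: "(\<integral>\<^sup>+ x. ennreal (min (f x) C) \<partial>\<rho>0) = ennreal e" "0 \<le> e" "e \<le> C" by simp_all
    have "(\<integral>\<^sup>+ w. ennreal (1 * \<bar>(\<Sum>i<N. min (f (\<xi> N 0 i w)) C) / N - (\<Sum>i<N. e) / N\<bar>) \<partial>W N) \<le> ennreal (C / sqrt N) * (\<integral>\<^sup>+ w. ennreal 1 \<partial>W N)"
    proof (rule weighted_weak_law[where Y="\<lambda>i w. min (f (\<xi> N 0 i w)) C" and e="\<lambda>_ _. e", OF N C])
      show "(\<lambda>w. min (f (\<xi> N 0 i w)) C) \<in> borel_measurable (W N)" if "i < N" for i
        using xi[OF that] by measurable
      show "AE w in W N. 0 < (1::real) \<longrightarrow> 0 \<le> min (f (\<xi> N 0 i w)) C \<and> min (f (\<xi> N 0 i w)) C \<le> C" for i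
        using f0 C by auto
      show "(\<integral>\<^sup>+ w. ennreal 1 * (ennreal (min (f (\<xi> N 0 i w)) C) * ennreal (min (f (\<xi> N 0 j w)) C)) \<partial>W N) = (\<integral>\<^sup>+ w. ennreal 1 * (ennreal e * ennreal e) \<partial>W N)"
        if ij: "i < N" "j < N" "i \<noteq> j" for i j
      proof -
        have "indep_vars (\<lambda>_. borel) (\<xi> N 0) {i, j}"
          using auxiliary_particle_filter.init_indep[OF particle_filter[OF N]] ij by (rule_tac indep_vars_subset[of _ _ "{..<N}"]) auto
        then have "indep_vars (\<lambda>_. borel) (\<lambda>i w. ennreal (min (f (\<xi> N 0 i w)) C)) {i, j}"
          by (rule indep_vars_compose2[where Y="\<lambda>_ x. ennreal (min (f x) C)"]) measurable
        from indep_vars_nn_integral[OF _ this]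
        have "(\<integral>\<^sup>+ w. ennreal (min (f (\<xi> N 0 i w)) C) * ennreal (min (f (\<xi> N 0 j w)) C) \<partial>W N)
          = (\<integral>\<^sup>+ w. ennreal (min (f (\<xi> N 0 i w)) C) \<partial>W N) * (\<integral>\<^sup>+ w. ennreal (min (f (\<xi> N 0 j w)) C) \<partial>W N)"
          using ij by simp
        also have "\<dots> = ennreal e * ennreal e"
          using mean[of i "\<lambda>x. ennreal (min (f x) C)"] mean[of j "\<lambda>x. ennreal (min (f x) C)"] ij e by simp
        finally show ?thesis by (simp add: emeasure_space_1)
      qed
      show "(\<integral>\<^sup>+ w. ennreal 1 * (ennreal (min (f (\<xi> N 0 i w)) C) * ennreal e) \<partial>W N) = (\<integral>\<^sup>+ w. ennreal 1 * (ennreal e * ennreal e) \<partial>W N)"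
        if ij: "i < N" "j < N" "i \<noteq> j" for i j
        using mean[of i "\<lambda>x. ennreal (min (f x) C)"] ij e xi[of i]
        by (simp add: nn_integral_multc emeasure_space_1)
    qed (use e in \<open>auto simp: emeasure_space_1\<close>)
    then show "(\<integral>\<^sup>+ w. ennreal \<bar>H N 0 w * ((\<Sum>i<N. min (f (\<xi> N 0 i w)) C * 1) / N) - 1 * enn2real (\<integral>\<^sup>+ x. ennreal (min (f x) C * 1) \<partial>\<rho>0)\<bar> \<partial>W N) \<le> ennreal (C / sqrt N)"
      using N by (simp add: emeasure_space_1 e_def)
    show "(\<lambda>w. ennreal (H N 0 w) * u (\<xi> N 0 i w)) \<in> borel_measurable (W N)" if "i < N" "u \<in> borel_measurable borel" for u i
      using xi[OF that(1)] that(2) by simp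
    show "(\<integral>\<^sup>+ w. ennreal (H N 0 w) * u (\<xi> N 0 i w) \<partial>W N) = (\<integral>\<^sup>+ x. u x \<partial>\<rho>0)" if "i < N" "u \<in> borel_measurable borel" for u i
      using mean that by simp
    have [measurable]: "(\<lambda>w. min (f (\<xi> N 0 i w)) C) \<in> borel_measurable (W N)" if "i \<in> {..<N}" for i
      using xi[of i] that by auto
    show "(\<lambda>w. H N 0 w * ((\<Sum>i<N. min (f (\<xi> N 0 i w)) C * 1) / N) - 1 * enn2real (\<integral>\<^sup>+ x. ennreal (min (f x) C * 1) \<partial>\<rho>0)) \<in> borel_measurable (W N)"
      by simp
    show "(\<integral>\<^sup>+ x. u x + v x \<partial>\<rho>0) = (\<integral>\<^sup>+ x. u x \<partial>\<rho>0) + (\<integral>\<^sup>+ x. v x \<partial>\<rho>0)"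
      if "u \<in> borel_measurable borel" "v \<in> borel_measurable borel" for u v
      using that by (intro nn_integral_add) simp_all
    show "(\<integral>\<^sup>+ x. u x \<partial>\<rho>0) \<le> (\<integral>\<^sup>+ x. v x \<partial>\<rho>0)" if "\<And>x. u x \<le> v x" for u v
      using that by (intro nn_integral_mono) simp
  qed (simp_all add: emeasure_space_1 H_nonneg)
  then show "(\<integral>\<^sup>+ w. ennreal \<bar>avg N 0 f (\<lambda>_ _. 1) w - enn2real (\<integral>\<^sup>+ x. ennreal (f x) \<partial>target 0)\<bar> \<partial>W N)
    \<le> 2 * (\<integral>\<^sup>+ x. ennreal (f x - min (f x) C) \<partial>target 0) + ennreal (C / sqrt N) * 1 + 0"
    by (simp add: avg_def)
qed auto


text \<open>Unbiasedness for the indicator of a null set shows that no particle lies in it where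
  \<open>H\<close> is positive. Identities that hold only almost everywhere can thus be evaluated at
  the particles.\<close>

lemma AE_particles:
  assumes N: "1 \<le> N" and t: "t \<le> T" and P: "AE x in target t. P x"
  shows "AE w in W N. 0 < H N t w \<longrightarrow> (\<forall>j<N. P (\<xi> N t j w))"
proof -
  obtain A where A: "{x \<in> space (target t). \<not> P x} \<subseteq> A" "emeasure (target t) A = 0" "A \<in> sets (target t)"
    using AE_E[OF P] by metis
  have sp: "space (target t) = UNIV" using sets_eq_imp_space_eq[OF sets_target, of t] by simp
  have [measurable]: "A \<in> sets borel" using A(3) sets_target by simp
  have "AE w in W N. \<forall>j. j < N \<longrightarrow> 0 < H N t w \<longrightarrow> P (\<xi> N t j w)"
    unfolding AE_all_countable
  proof
    fix j
    show "AE w in W N. j < N \<longrightarrow> 0 < H N t w \<longrightarrow> P (\<xi> N t j w)"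
    proof (cases "j < N")
      case True
      note [measurable] = xi_measurable[OF N t True] H_measurable_W[OF N le_SucI[OF t]]
      have "(\<integral>\<^sup>+ w. ennreal (H N t w) * indicator A (\<xi> N t j w) \<partial>W N) = (\<integral>\<^sup>+ x. indicator A x \<partial>target t)"
        using unbiased[OF N t True, of "indicator A"] by simp
      also have "\<dots> = 0" using A by simp
      finally have "AE w in W N. ennreal (H N t w) * indicator A (\<xi> N t j w) = 0"
        by (subst (asm) nn_integral_0_iff_AE) auto
      then show ?thesis
      proof eventually_elim
        case (elim w)
        show ?case
        proof (intro impI)
          assume "0 < H N t w"
          then have "\<xi> N t j w \<notin> A" using elim by (auto simp: indicator_def split: if_splits)
          then show "P (\<xi> N t j w)" using A(1) sp by auto
        qed
      qed
    qed auto
  qed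
  then show ?thesis by eventually_elim auto
qed

text \<open>The relation \<open>rel\<close> says that \<open>\<psi>'\<close> is the average of
  \<open>c\<close> under the backward kernel, multiplied through by its normalization. The same
  kernel sum arises when the operators \<open>Q\<close> of all particles are added up, so the
  normalization cancels and each particle at time \<open>t\<close> keeps its own value
  \<open>c j\<close>.\<close>

lemma K_backward:
  fixes \<psi>' :: "'x \<Rightarrow> real" and c :: "nat \<Rightarrow> real"
  assumes [measurable]: "f \<in> borel_measurable borel" "\<psi>' \<in> borel_measurable borel"
    and f0: "\<And>x. 0 \<le> f x" and \<psi>0: "\<And>x. 0 \<le> \<psi>' x" "\<And>j. 0 \<le> c j"
    and rel: "\<And>x. (\<Sum>j<N. a t (\<xi> N t j w) * m (\<xi> N t j w) x * \<psi>' x) = (\<Sum>j<N. a t (\<xi> N t j w) * m (\<xi> N t j w) x * c j)"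
  shows "K N t w (\<lambda>x. ennreal (f x * \<psi>' x)) = (\<Sum>j<N. ennreal (c j) * Q t (\<lambda>x. ennreal (f x)) (\<xi> N t j w)) / of_nat N"
proof -
  let ?am = "\<lambda>j x. a t (\<xi> N t j w) * m (\<xi> N t j w) x"
  have "(\<Sum>j<N. Q t (\<lambda>x. ennreal (f x * \<psi>' x)) (\<xi> N t j w))
     = (\<integral>\<^sup>+ x. (\<Sum>j<N. ennreal (?am j x * b (Suc t) x) * ennreal (f x * \<psi>' x)) \<partial>\<nu>)"
    unfolding Q_def by (subst nn_integral_sum) auto
  also have "\<dots> = (\<integral>\<^sup>+ x. (\<Sum>j<N. ennreal (c j) * (ennreal (?am j x * b (Suc t) x) * ennreal (f x))) \<partial>\<nu>)"
  proof (rule nn_integral_cong)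
    fix x
    have nn: "0 \<le> ?am j x * b (Suc t) x * (f x * \<psi>' x)" "0 \<le> c j * (?am j x * b (Suc t) x * f x)" for j
      by (intro mult_nonneg_nonneg a_nonneg b_nonneg trans_nonneg f0 \<psi>0)+
    have "(\<Sum>j<N. ennreal (?am j x * b (Suc t) x) * ennreal (f x * \<psi>' x)) = ennreal (\<Sum>j<N. ?am j x * b (Suc t) x * (f x * \<psi>' x))"
      using nn f0 \<psi>0 by (subst sum_ennreal[symmetric]) (auto simp: ennreal_mult a_nonneg b_nonneg trans_nonneg)
    also have "(\<Sum>j<N. ?am j x * b (Suc t) x * (f x * \<psi>' x)) = b (Suc t) x * f x * (\<Sum>j<N. ?am j x * \<psi>' x)"
      by (simp add: sum_distrib_left mult_ac)
    also have "\<dots> = b (Suc t) x * f x * (\<Sum>j<N. ?am j x * c j)" unfolding rel ..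
    also have "\<dots> = (\<Sum>j<N. c j * (?am j x * b (Suc t) x * f x))" by (simp add: sum_distrib_left mult_ac)
    also have "ennreal \<dots> = (\<Sum>j<N. ennreal (c j) * (ennreal (?am j x * b (Suc t) x) * ennreal (f x)))"
      using nn f0 \<psi>0 by (subst sum_ennreal[symmetric]) (auto simp: ennreal_mult a_nonneg b_nonneg trans_nonneg)
    finally show "(\<Sum>j<N. ennreal (?am j x * b (Suc t) x) * ennreal (f x * \<psi>' x)) = (\<Sum>j<N. ennreal (c j) * (ennreal (?am j x * b (Suc t) x) * ennreal (f x)))" .
  qed
  also have "\<dots> = (\<Sum>j<N. ennreal (c j) * Q t (\<lambda>x. ennreal (f x)) (\<xi> N t j w))"
    unfolding Q_def by (simp add: nn_integral_sum nn_integral_cmult)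
  finally show ?thesis by (simp add: K_def)
qed

text \<open>The telescoping of the backward averages against the forward step: predicting with
  \<open>\<psi>'\<close> at time \<open>Suc t\<close> is averaging with \<open>\<psi>\<close> at
  time \<open>t\<close>. The identity of \<open>Q f\<close> and \<open>f'\<close> is only known off
  a null set of the target, which the particles avoid.\<close>

lemma condmean_eq_avg:
  fixes f f' :: "'x \<Rightarrow> real"
  assumes N: "1 \<le> N" and t: "t < T"
    and f[measurable]: "f \<in> borel_measurable borel" and f0: "\<And>x. 0 \<le> f x" "\<And>x. 0 \<le> f' x"
    and ff': "AE x in target t. Q t (\<lambda>x. ennreal (f x)) x = ennreal (f' x)"
    and \<psi>': "(\<lambda>p. \<psi>' (fst p) (snd p)) \<in> borel_measurable (F N (Suc t) \<Otimes>\<^sub>M borel)"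
    and \<psi>0: "\<And>w x. 0 \<le> \<psi> w x" "\<And>w x. 0 \<le> \<psi>' w x"
    and rel: "\<And>w x. w \<in> space (W N) \<Longrightarrow> (\<Sum>j<N. a t (\<xi> N t j w) * m (\<xi> N t j w) x * \<psi>' w x) = (\<Sum>j<N. a t (\<xi> N t j w) * m (\<xi> N t j w) x * \<psi> w (\<xi> N t j w))"
  shows "AE w in W N. ennreal (H N t w) * K N t w (\<lambda>x. ennreal (f x * \<psi>' w x)) = ennreal (avg N t f' \<psi> w)"
  using AE_particles[OF N less_imp_le[OF t] ff'] AE_space
proof eventually_elim
  case (elim w)
  show ?case
  proof (cases "H N t w = 0")
    case True then show ?thesis by (simp add: avg_def)
  next
    case False
    then have pos: "0 < H N t w" using H_nonneg[of N t w] by simp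
    have "K N t w (\<lambda>x. ennreal (f x * \<psi>' w x)) = (\<Sum>j<N. ennreal (\<psi> w (\<xi> N t j w)) * Q t (\<lambda>x. ennreal (f x)) (\<xi> N t j w)) / of_nat N"
      using section_measurable[OF \<psi>' elim(2)] f0 \<psi>0 rel[OF elim(2)] by (intro K_backward) auto
    also have "\<dots> = (\<Sum>j<N. ennreal (\<psi> w (\<xi> N t j w)) * ennreal (f' (\<xi> N t j w))) / of_nat N"
      using elim(1) pos by (intro arg_cong[where f="\<lambda>x. x / _"] sum.cong) auto
    also have "\<dots> = ennreal ((\<Sum>j<N. f' (\<xi> N t j w) * \<psi> w (\<xi> N t j w)) / N)"
    proof -
      have "(\<Sum>j<N. ennreal (\<psi> w (\<xi> N t j w)) * ennreal (f' (\<xi> N t j w))) = ennreal (\<Sum>j<N. f' (\<xi> N t j w) * \<psi> w (\<xi> N t j w))"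
        using f0 \<psi>0 by (subst sum_ennreal[symmetric]) (auto simp: ennreal_mult mult.commute)
      then show ?thesis using N f0 \<psi>0
        by (simp add: ennreal_of_nat_eq_real_of_nat divide_ennreal sum_nonneg)
    qed
    finally show ?thesis unfolding avg_def by (simp only: ennreal_mult'[OF H_nonneg])
  qed
qed

lemma avg_nonneg: "(\<And>x. 0 \<le> f x) \<Longrightarrow> (\<And>w x. 0 \<le> \<psi> w x) \<Longrightarrow> 0 \<le> avg N t f \<psi> w"
  unfolding avg_def by (intro mult_nonneg_nonneg H_nonneg divide_nonneg_nonneg sum_nonneg) auto

lemma avg_limit_Suc:
  fixes f f' :: "'x \<Rightarrow> real"
  assumes t: "t < T"
    and f[measurable]: "f \<in> borel_measurable borel" and f0: "\<And>x. 0 \<le> f x" "\<And>x. 0 \<le> f' x"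
    and fi: "(\<integral>\<^sup>+ x. ennreal (f x) \<partial>target (Suc t)) < \<infinity>"
    and ff': "AE x in target t. Q t (\<lambda>x. ennreal (f x)) x = ennreal (f' x)"
    and \<psi>': "\<And>N. 1 \<le> N \<Longrightarrow> (\<lambda>p. \<psi>' N (fst p) (snd p)) \<in> borel_measurable (F N (Suc t) \<Otimes>\<^sub>M borel)"
    and \<psi>0: "\<And>N w x. 0 \<le> \<psi> N w x" "\<And>N w x. 0 \<le> \<psi>' N w x" "\<And>N w x. \<psi>' N w x \<le> 1"
    and rel: "\<And>N w x. 1 \<le> N \<Longrightarrow> w \<in> space (W N) \<Longrightarrow> (\<Sum>j<N. a t (\<xi> N t j w) * m (\<xi> N t j w) x * \<psi>' N w x) = (\<Sum>j<N. a t (\<xi> N t j w) * m (\<xi> N t j w) x * \<psi> N w (\<xi> N t j w))"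
    and lim: "(\<lambda>N. \<integral>\<^sup>+ w. ennreal \<bar>avg N t f' (\<psi> N) w - l\<bar> \<partial>W N) \<longlonglongrightarrow> 0"
  shows "(\<lambda>N. \<integral>\<^sup>+ w. ennreal \<bar>avg N (Suc t) f (\<psi>' N) w - l\<bar> \<partial>W N) \<longlonglongrightarrow> 0"
proof (rule step_limit[OF t f f0(1) fi \<psi>' \<psi>0(2,3)])
  show "(\<lambda>N. \<integral>\<^sup>+ w. ennreal \<bar>H N t w * enn2real (K N t w (\<lambda>x. ennreal (f x * \<psi>' N w x))) - l\<bar> \<partial>W N) \<longlonglongrightarrow> 0"
  proof (rule Lim_transform_eventually[OF lim], rule eventually_sequentiallyI[of 1])
    fix N :: nat assume N: "1 \<le> N"
    have cm: "AE w in W N. ennreal (H N t w) * K N t w (\<lambda>x. ennreal (f x * \<psi>' N w x)) = ennreal (avg N t f' (\<psi> N) w)"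
      by (rule condmean_eq_avg[OF N t f f0 ff' \<psi>'[OF N] \<psi>0(1,2)]) (rule rel[OF N])
    show "(\<integral>\<^sup>+ w. ennreal \<bar>avg N t f' (\<psi> N) w - l\<bar> \<partial>W N) = (\<integral>\<^sup>+ w. ennreal \<bar>H N t w * enn2real (K N t w (\<lambda>x. ennreal (f x * \<psi>' N w x))) - l\<bar> \<partial>W N)"
    proof (rule nn_integral_cong_AE)
      show "AE w in W N. ennreal \<bar>avg N t f' (\<psi> N) w - l\<bar> = ennreal \<bar>H N t w * enn2real (K N t w (\<lambda>x. ennreal (f x * \<psi>' N w x))) - l\<bar>"
        using cm
      proof eventually_elim
        case (elim w)
        from arg_cong[OF elim, of enn2real] show ?case
          using avg_nonneg[of f' "\<psi> N" N t w] f0 \<psi>0 H_nonneg by (simp add: enn2real_mult)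
      qed
    qed
  qed
qed

lemma avg_mean_Suc:
  fixes f f' :: "'x \<Rightarrow> real"
  assumes N: "1 \<le> N" and t: "t < T"
    and f[measurable]: "f \<in> borel_measurable borel" and f0: "\<And>x. 0 \<le> f x"
    and \<psi>'[measurable]: "(\<lambda>p. \<psi>' (fst p) (snd p)) \<in> borel_measurable (F N (Suc t) \<Otimes>\<^sub>M borel)"
    and \<psi>0: "\<And>w x. 0 \<le> \<psi>' w x"
  shows "(\<integral>\<^sup>+ w. ennreal (avg N (Suc t) f \<psi>' w) \<partial>W N) = (\<integral>\<^sup>+ w. ennreal (H N t w) * K N t w (\<lambda>x. ennreal (f x * \<psi>' w x)) \<partial>W N)"
proof -
  let ?\<phi> = "\<lambda>p. ennreal (f (snd p) * \<psi>' (fst p) (snd p))"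
  have \<phi>m[measurable]: "?\<phi> \<in> borel_measurable (F N (Suc t) \<Otimes>\<^sub>M borel)" by measurable
  have sub: "subalgebra (W N) (F N (Suc t))" using t N by (intro subalgebra_F) auto
  have t': "Suc t \<le> T" "Suc t \<le> Suc T" using t by auto
  note [measurable] = H_measurable_W[OF N t'(2)]
  have xi: "\<xi> N (Suc t) i \<in> measurable (W N) borel" if "i < N" for i
    using that t' N by (intro xi_measurable)
  show ?thesis unfolding avg_def
  proof (rule nn_integral_weighted_avg_const[OF N])
    show "(\<lambda>w. f (\<xi> N (Suc t) i w) * \<psi>' w (\<xi> N (Suc t) i w)) \<in> borel_measurable (W N)" if "i < N" for i
      using measurable_compose[OF measurable_Pair[OF measurable_ident_subalgebra[OF sub] xi[OF that]], of "\<lambda>p. f (snd p) * \<psi>' (fst p) (snd p)"] by simp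
    show "(\<integral>\<^sup>+ w. ennreal (H N (Suc t) w) * ennreal (f (\<xi> N (Suc t) i w) * \<psi>' w (\<xi> N (Suc t) i w)) \<partial>W N)
      = (\<integral>\<^sup>+ w. ennreal (H N t w) * K N t w (\<lambda>x. ennreal (f x * \<psi>' w x)) \<partial>W N)" if "i < N" for i
      using step_mean[OF N t that \<phi>m] by (simp add: K_def)
  qed (use f0 \<psi>0 in \<open>auto intro: H_nonneg\<close>)
qed

text \<open>With \<open>\<psi> = 1\<close> the centering is an average of \<open>Q f\<close> one
  step earlier, and \<open>Q f\<close> has the same integral as \<open>f\<close>. Since it may be
  infinite on a null set, the induction continues with its real version.\<close>

lemma particle_lln:
  fixes f :: "'x \<Rightarrow> real"
  assumes "t \<le> T" "f \<in> borel_measurable borel" "\<And>x. 0 \<le> f x" "(\<integral>\<^sup>+ x. ennreal (f x) \<partial>target t) < \<infinity>"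
  shows "(\<lambda>N. \<integral>\<^sup>+ w. ennreal \<bar>avg N t f (\<lambda>_ _. 1) w - enn2real (\<integral>\<^sup>+ x. ennreal (f x) \<partial>target t)\<bar> \<partial>W N) \<longlonglongrightarrow> 0"
  using assms
proof (induction t arbitrary: f)
  case 0 then show ?case using init_limit[of f] by simp
next
  case (Suc t)
  note [measurable] = Suc.prems(2)
  have t: "t < T" using Suc.prems by simp
  let ?f' = "\<lambda>x. enn2real (Q t (\<lambda>x. ennreal (f x)) x)"
  have eq: "(\<integral>\<^sup>+ x. Q t (\<lambda>x. ennreal (f x)) x \<partial>target t) = (\<integral>\<^sup>+ x. ennreal (f x) \<partial>target (Suc t))"
    using finite_target t by (intro nn_integral_target_Suc[symmetric]) auto
  have "AE x in target t. Q t (\<lambda>x. ennreal (f x)) x \<noteq> \<infinity>"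
    using Suc.prems(4) by (intro nn_integral_PInf_AE) (auto simp: eq)
  then have ae: "AE x in target t. Q t (\<lambda>x. ennreal (f x)) x = ennreal (?f' x)"
    by eventually_elim (auto simp: less_top)
  have i: "(\<integral>\<^sup>+ x. ennreal (?f' x) \<partial>target t) = (\<integral>\<^sup>+ x. ennreal (f x) \<partial>target (Suc t))"
    unfolding eq[symmetric] using ae by (intro nn_integral_cong_AE) (auto elim!: eventually_mono)
  show ?case
  proof (rule avg_limit_Suc[OF t Suc.prems(2,3) _ Suc.prems(4) ae, where \<psi>="\<lambda>_ _ _. 1"])
    show "(\<lambda>N. \<integral>\<^sup>+ w. ennreal \<bar>avg N t ?f' (\<lambda>_ _. 1) w - enn2real (\<integral>\<^sup>+ x. ennreal (f x) \<partial>target (Suc t))\<bar> \<partial>W N) \<longlonglongrightarrow> 0"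
      using Suc.IH[of ?f'] t Suc.prems(4) by (simp only: i) simp
  qed auto
qed

subsection \<open>The backward smoothing functions\<close>

definition kern_sum :: "nat \<Rightarrow> nat \<Rightarrow> 'w \<Rightarrow> 'x \<Rightarrow> real" where
  "kern_sum N t w x = (\<Sum>j<N. a t (\<xi> N t j w) * m (\<xi> N t j w) x)"

definition weight_sum :: "nat \<Rightarrow> nat \<Rightarrow> 'w \<Rightarrow> real" where
  "weight_sum N t w = (\<Sum>j<N. a t (\<xi> N t j w))"

text \<open>For a successor in \<open>x\<close>, the conditional probability that one proposal is
  rejected, as the weighted mean of \<open>1 - m / \<sigma>\<close>. If all weights are 0, the
  quotient is 0 and the value 1 still lies in the unit interval.\<close>

definition reject :: "nat \<Rightarrow> nat \<Rightarrow> 'w \<Rightarrow> 'x \<Rightarrow> real" where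
  "reject N s w x = 1 - kern_sum N s w x / (\<sigma> * weight_sum N s w)"

text \<open>The backward kernel, that is, the law of the index accepted at time \<open>t\<close>
  when the successor is \<open>x\<close>, applied to \<open>\<psi>\<close>. Where the kernel sum is
  0, so is the value.\<close>

definition back_mean :: "nat \<Rightarrow> nat \<Rightarrow> ('w \<Rightarrow> 'x \<Rightarrow> real) \<Rightarrow> 'w \<Rightarrow> 'x \<Rightarrow> real" where
  "back_mean N t \<psi> w x = (\<Sum>j<N. a t (\<xi> N t j w) * m (\<xi> N t j w) x * \<psi> w (\<xi> N t j w)) / kern_sum N t w x"

text \<open>\<open>smooth N s k n w x\<close> is the conditional probability, given the particles, that the first \<open>k\<close> proposals at
  time \<open>s\<close> are rejected along a backward trajectory that is in \<open>x\<close> at time \<open>s + n + 1\<close>.\<close>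

primrec smooth :: "nat \<Rightarrow> nat \<Rightarrow> nat \<Rightarrow> nat \<Rightarrow> 'w \<Rightarrow> 'x \<Rightarrow> real" where
  "smooth N s k 0 = (\<lambda>w x. reject N s w x ^ k)"
| "smooth N s k (Suc n) = back_mean N (Suc s + n) (smooth N s k n)"

lemma kern_sum_nonneg: "0 \<le> kern_sum N t w x"
  unfolding kern_sum_def by (intro sum_nonneg mult_nonneg_nonneg a_nonneg trans_nonneg)

lemma weight_sum_nonneg: "0 \<le> weight_sum N t w"
  unfolding weight_sum_def by (intro sum_nonneg a_nonneg)

lemma kern_sum_le: "kern_sum N t w x \<le> \<sigma> * weight_sum N t w"
  unfolding kern_sum_def weight_sum_def sum_distrib_left
  by (intro sum_mono) (simp add: mult.commute[of \<sigma>] bounded mult_left_mono a_nonneg)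

lemma reject_bounds: "0 \<le> reject N s w x" "reject N s w x \<le> 1"
proof -
  have "kern_sum N s w x / (\<sigma> * weight_sum N s w) \<le> 1"
    using kern_sum_le[of N s w x] kern_sum_nonneg[of N s w x] by (cases "\<sigma> * weight_sum N s w = 0") (auto simp: divide_le_eq)
  then show "0 \<le> reject N s w x" by (simp add: reject_def)
  show "reject N s w x \<le> 1" using kern_sum_nonneg[of N s w x] weight_sum_nonneg[of N s w] sigma_pos by (simp add: reject_def)
qed

lemma kern_sum_measurable[measurable]: "u < t \<Longrightarrow> (\<lambda>p. kern_sum N u (fst p) (snd p)) \<in> borel_measurable (F N t \<Otimes>\<^sub>M borel)"
proof -
  assume u: "u < t"
  have [measurable]: "\<xi> N u j \<in> measurable (F N t) borel" if "j \<in> {..<N}" for j using that u by (intro xi_F) auto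
  show ?thesis unfolding kern_sum_def by measurable
qed

lemma weight_sum_measurable: "u < t \<Longrightarrow> weight_sum N u \<in> borel_measurable (F N t)"
  unfolding weight_sum_def[abs_def] by (intro borel_measurable_sum measurable_compose[OF xi_F a_measurable]) auto

lemma reject_measurable: "u < t \<Longrightarrow> (\<lambda>p. reject N u (fst p) (snd p)) \<in> borel_measurable (F N t \<Otimes>\<^sub>M borel)"
proof -
  assume u: "u < t"
  note [measurable] = kern_sum_measurable[OF u] weight_sum_measurable[OF u]
  show ?thesis unfolding reject_def by measurable
qed

lemma F_pair_mono:
  fixes f :: "'w \<times> 'x \<Rightarrow> real"
  assumes "t \<le> t'" "f \<in> borel_measurable (F N t \<Otimes>\<^sub>M borel)" shows "f \<in> borel_measurable (F N t' \<Otimes>\<^sub>M borel)"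
proof -
  have "(\<lambda>w. w) \<in> measurable (F N t') (F N t)"
    using forward_hist_mono[OF assms(1), of N "W N" "\<xi> N" "I N"]
    by (intro measurable_ident_subalgebra) (simp add: subalgebra_def space_F)
  then have "(\<lambda>p. (fst p, snd p)) \<in> measurable (F N t' \<Otimes>\<^sub>M borel) (F N t \<Otimes>\<^sub>M (borel :: 'x measure))"
    by (intro measurable_Pair measurable_compose[OF measurable_fst]) auto
  from measurable_compose[OF this assms(2)] show ?thesis by simp
qed

lemma back_mean_bounds:
  assumes "\<And>x. 0 \<le> \<psi> w x" "\<And>x. \<psi> w x \<le> 1"
  shows "0 \<le> back_mean N t \<psi> w x" "back_mean N t \<psi> w x \<le> 1"
proof -
  show "0 \<le> back_mean N t \<psi> w x" unfolding back_mean_def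
    by (intro divide_nonneg_nonneg sum_nonneg mult_nonneg_nonneg a_nonneg trans_nonneg kern_sum_nonneg assms)
  have "(\<Sum>j<N. a t (\<xi> N t j w) * m (\<xi> N t j w) x * \<psi> w (\<xi> N t j w)) \<le> (\<Sum>j<N. a t (\<xi> N t j w) * m (\<xi> N t j w) x * 1)"
    by (intro sum_mono mult_left_mono assms mult_nonneg_nonneg a_nonneg trans_nonneg)
  then show "back_mean N t \<psi> w x \<le> 1" using kern_sum_nonneg[of N t w x]
    by (cases "kern_sum N t w x = 0") (auto simp: back_mean_def divide_le_eq kern_sum_def)
qed

text \<open>If the kernel sum is 0, all its nonnegative summands are, so the relation survives
  division by zero and can be used at every \<open>x\<close>.\<close>

lemma back_mean_rel:
  "(\<Sum>j<N. a t (\<xi> N t j w) * m (\<xi> N t j w) x * back_mean N t \<psi> w x) = (\<Sum>j<N. a t (\<xi> N t j w) * m (\<xi> N t j w) x * \<psi> w (\<xi> N t j w))"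
proof (cases "kern_sum N t w x = 0")
  case True
  then have "a t (\<xi> N t j w) * m (\<xi> N t j w) x = 0" if "j < N" for j
    using that by (auto simp: kern_sum_def sum_nonneg_eq_0_iff a_nonneg trans_nonneg)
  then show ?thesis by (intro sum.cong refl) (simp only: lessThan_iff mult_zero_left)
next
  case False
  have "(\<Sum>j<N. a t (\<xi> N t j w) * m (\<xi> N t j w) x * back_mean N t \<psi> w x) = kern_sum N t w x * back_mean N t \<psi> w x"
    by (simp only: sum_distrib_right[symmetric] kern_sum_def)
  then show ?thesis using False by (simp add: back_mean_def)
qed

lemma back_mean_measurable:
  assumes "(\<lambda>p. \<psi> (fst p) (snd p)) \<in> borel_measurable (F N t \<Otimes>\<^sub>M borel)"
  shows "(\<lambda>p. back_mean N t \<psi> (fst p) (snd p)) \<in> borel_measurable (F N (Suc t) \<Otimes>\<^sub>M borel)"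
proof -
  note \<psi> = F_pair_mono[OF le_SucI[OF order_refl] assms]
  have [measurable]: "\<xi> N t j \<in> measurable (F N (Suc t)) borel" if "j \<in> {..<N}" for j using that by (intro xi_F) auto
  have "(\<lambda>p. (fst p, \<xi> N t j (fst p))) \<in> measurable (F N (Suc t) \<Otimes>\<^sub>M (borel :: 'x measure)) (F N (Suc t) \<Otimes>\<^sub>M borel)" if "j \<in> {..<N}" for j
    using that by measurable
  from measurable_compose[OF this \<psi>]
  have [measurable]: "(\<lambda>p. \<psi> (fst p) (\<xi> N t j (fst p))) \<in> borel_measurable (F N (Suc t) \<Otimes>\<^sub>M (borel :: 'x measure))" if "j \<in> {..<N}" for j
    using that by simp
  note [measurable] = kern_sum_measurable[OF lessI]
  show ?thesis unfolding back_mean_def by measurable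
qed

lemma smooth_bounds: "0 \<le> smooth N s k n w x \<and> smooth N s k n w x \<le> 1"
proof (induction n arbitrary: x)
  case 0 then show ?case using reject_bounds[of N s w x] by (simp add: power_le_one)
next
  case (Suc n) then show ?case using back_mean_bounds[of "smooth N s k n" w] by simp
qed

lemma smooth_measurable: "(\<lambda>p. smooth N s k n (fst p) (snd p)) \<in> borel_measurable (F N (Suc s + n) \<Otimes>\<^sub>M borel)"
proof (induction n)
  case 0
  note [measurable] = reject_measurable[of s "Suc s" N, OF lessI]
  show ?case by simp
next
  case (Suc n) then show ?case using back_mean_measurable[of "smooth N s k n"] by simp
qed


section \<open>Expected future likelihood and the limits of the rejection probabilities\<close>

definition future :: "nat \<Rightarrow> 'x \<Rightarrow> ennreal" where
  "future t x = ennreal (a t x) * path_int Mk G t (T - t) (\<lambda>_. 1) x"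

text \<open>\<open>future\<close> can be infinite on a null set of the target, while truncation and
  the limits in L1 deal with real functions; infinite values become 0.\<close>

definition future_real :: "nat \<Rightarrow> 'x \<Rightarrow> real" where "future_real t x = enn2real (future t x)"

lemma future_measurable[measurable]: "future t \<in> borel_measurable borel"
  unfolding future_def[abs_def] by measurable

lemma future_real_measurable[measurable]: "future_real t \<in> borel_measurable borel"
  unfolding future_real_def[abs_def] by measurable

lemma future_real_nonneg: "0 \<le> future_real t x" by (simp add: future_real_def)

lemma future_target: "t \<le> T \<Longrightarrow> (\<integral>\<^sup>+ x. future t x \<partial>target t) = evid T"
  using unnorm_filter_target[of t T "\<lambda>_. 1"] evid_eq[of T] by (simp add: future_def)

lemma Q_future: "t < T \<Longrightarrow> Q t (future (Suc t)) x = future t x"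
  using Q_path[of t "\<lambda>_. 1" "T - Suc t" x] unfolding future_def[abs_def] by (simp add: Suc_diff_Suc del: path_int.simps)

lemma future_finite: "t \<le> T \<Longrightarrow> AE x in target t. future t x \<noteq> \<infinity>"
  using future_target[of t] evid_finite[of T] by (intro nn_integral_PInf_AE) auto

lemma nn_integral_future_real: "t \<le> T \<Longrightarrow> (\<integral>\<^sup>+ x. ennreal (future_real t x) \<partial>target t) = evid T"
proof -
  assume t: "t \<le> T"
  have "(\<integral>\<^sup>+ x. ennreal (future_real t x) \<partial>target t) = (\<integral>\<^sup>+ x. future t x \<partial>target t)"
    by (rule nn_integral_cong_AE) (use future_finite[OF t] in eventually_elim, simp add: future_real_def less_top)
  then show ?thesis by (simp add: future_target[OF t])
qed

text \<open>The points where \<open>future (Suc t)\<close> is infinite form a null set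
  \<open>?D\<close> of the next target. By adjointness \<open>Q t\<close> of its indicator vanishes
  almost everywhere, so the change to real values is invisible to \<open>Q t\<close>.\<close>

lemma Q_future_real:
  assumes t: "t < T"
  shows "AE x in target t. Q t (\<lambda>x. ennreal (future_real (Suc t) x)) x = ennreal (future_real t x)"
proof -
  let ?D = "{x. future (Suc t) x = \<infinity>}"
  have [measurable]: "?D \<in> sets borel" by measurable
  have "(\<integral>\<^sup>+ x. Q t (indicator ?D) x \<partial>target t) = (\<integral>\<^sup>+ x. indicator ?D x \<partial>target (Suc t))"
    using finite_target t by (intro nn_integral_target_Suc[symmetric]) auto
  also have "\<dots> = 0"
    by (subst nn_integral_0_iff_AE) (use future_finite[of "Suc t"] t in \<open>auto elim!: eventually_mono\<close>)
  finally have "AE x in target t. Q t (indicator ?D) x = 0" by (subst (asm) nn_integral_0_iff_AE) auto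
  then show ?thesis using future_finite[OF less_imp_le[OF t]]
  proof eventually_elim
    case (elim x)
    have "AE x' in \<nu>. ennreal (a t x * m x x' * b (Suc t) x') * indicator ?D x' = 0"
      using elim(1) unfolding Q_def by (subst (asm) nn_integral_0_iff_AE) auto
    then have "Q t (\<lambda>x. ennreal (future_real (Suc t) x)) x = Q t (future (Suc t)) x"
      unfolding Q_def
    proof (intro nn_integral_cong_AE, eventually_elim)
      case (elim x')
      then show ?case
        by (cases "future (Suc t) x' = \<infinity>") (auto simp: future_real_def less_top)
    qed
    then show ?case using elim(2) by (simp add: Q_future[OF t]) (simp add: future_real_def less_top)
  qed
qed

lemma future_real_T: "future_real T x = a T x"
  by (simp add: future_real_def future_def a_nonneg)

definition Z :: "nat \<Rightarrow> real" where "Z t = enn2real (evid t)"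

lemma ennreal_Z: "t \<le> T \<Longrightarrow> ennreal (Z t) = evid t"
  using evid_finite[of t] by (simp add: Z_def less_top)

lemma Z_pos: "t \<le> T \<Longrightarrow> 0 < Z t"
  using evid_finite[of t] evid_pos[of t] by (simp add: Z_def enn2real_positive_iff less_top)

text \<open>The limit of \<open>kern_avg\<close>. Multiplied by \<open>b (Suc s)\<close> it is the
  density of the next target; the factor \<open>b\<close> is left out because it plays no part in
  accepting a proposal.\<close>

definition lim_kern :: "nat \<Rightarrow> 'x \<Rightarrow> real" where
  "lim_kern s x = enn2real (\<integral>\<^sup>+ z. ennreal (a s z * m z x) \<partial>target s)"

lemma lim_kern_le:
  assumes "s \<le> T" shows "(\<integral>\<^sup>+ z. ennreal (a s z * m z x) \<partial>target s) \<le> ennreal (\<sigma> * Z s)"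
proof -
  have "(\<integral>\<^sup>+ z. ennreal (a s z * m z x) \<partial>target s) \<le> (\<integral>\<^sup>+ z. ennreal \<sigma> * ennreal (a s z) \<partial>target s)"
    by (intro nn_integral_mono)
      (simp add: ennreal_mult'[symmetric] less_imp_le[OF sigma_pos] mult.commute[of \<sigma>] ennreal_leI mult_left_mono bounded a_nonneg)
  also have "\<dots> = ennreal \<sigma> * evid s" by (simp add: nn_integral_cmult evid_def)
  finally show ?thesis using ennreal_Z[OF assms] sigma_pos by (simp add: ennreal_mult')
qed

lemma ennreal_lim_kern: "s \<le> T \<Longrightarrow> ennreal (lim_kern s x) = (\<integral>\<^sup>+ z. ennreal (a s z * m z x) \<partial>target s)"
  unfolding lim_kern_def using order_le_less_trans[OF lim_kern_le ennreal_less_top] by (intro ennreal_enn2real)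

lemma lim_kern_bounds: "0 \<le> lim_kern s x" "s \<le> T \<Longrightarrow> lim_kern s x \<le> \<sigma> * Z s"
  using lim_kern_le[of s x] Z_pos[of s] sigma_pos by (auto simp: lim_kern_def intro!: enn2real_leI)

lemma lim_kern_measurable[measurable]: assumes "s \<le> T" shows "lim_kern s \<in> borel_measurable borel"
proof -
  interpret finite_measure "target s" by (rule finite_target[OF assms])
  show ?thesis unfolding lim_kern_def[abs_def] by measurable
qed

definition rej_lim :: "nat \<Rightarrow> 'x \<Rightarrow> real" where "rej_lim s x = 1 - lim_kern s x / (\<sigma> * Z s)"

lemma rej_lim_bounds: assumes "s \<le> T" shows "0 \<le> rej_lim s x" "rej_lim s x \<le> 1"
  using lim_kern_bounds[of s x] assms Z_pos[of s] sigma_pos by (auto simp: rej_lim_def divide_le_eq)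

definition kern_avg :: "nat \<Rightarrow> nat \<Rightarrow> 'w \<Rightarrow> 'x \<Rightarrow> real" where
  "kern_avg N s w x = H N s w * (kern_sum N s w x / N)"

definition weight_avg :: "nat \<Rightarrow> nat \<Rightarrow> 'w \<Rightarrow> real" where
  "weight_avg N s w = H N s w * (weight_sum N s w / N)"

lemma kern_avg_avg: "kern_avg N s w x = avg N s (\<lambda>z. a s z * m z x) (\<lambda>_ _. 1) w"
  by (simp add: kern_avg_def avg_def kern_sum_def)

lemma weight_avg_avg: "weight_avg N s w = avg N s (a s) (\<lambda>_ _. 1) w"
  by (simp add: weight_avg_def avg_def weight_sum_def)

lemma kern_avg_nonneg: "0 \<le> kern_avg N s w x"
  unfolding kern_avg_def by (intro mult_nonneg_nonneg H_nonneg divide_nonneg_nonneg kern_sum_nonneg) simp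

lemma weight_avg_nonneg: "0 \<le> weight_avg N s w"
  unfolding weight_avg_def by (intro mult_nonneg_nonneg H_nonneg divide_nonneg_nonneg weight_sum_nonneg) simp

lemma kern_avg_le: "kern_avg N s w x \<le> \<sigma> * weight_avg N s w"
proof -
  have "kern_sum N s w x / N \<le> \<sigma> * weight_sum N s w / N" by (intro divide_right_mono kern_sum_le) simp
  then have "H N s w * (kern_sum N s w x / N) \<le> H N s w * (\<sigma> * weight_sum N s w / N)" by (intro mult_left_mono H_nonneg)
  then show ?thesis by (simp add: kern_avg_def weight_avg_def mult_ac)
qed

text \<open>The weight \<open>H\<close> and the factor \<open>1 / N\<close> cancel in the ratio, and
  where they vanish so does the prefactor. The result has the form treated in
  \<open>thinned_lipschitz\<close>.\<close>

lemma kern_avg_reject: "kern_avg N s w x * reject N s w x ^ k = kern_avg N s w x * (1 - kern_avg N s w x / (\<sigma> * weight_avg N s w)) ^ k"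
proof (cases "H N s w = 0 \<or> N = 0")
  case True then show ?thesis by (auto simp: kern_avg_def)
next
  case False then show ?thesis by (simp add: kern_avg_def weight_avg_def reject_def)
qed

lemma avg_mean:
  assumes "1 \<le> N" "s \<le> T" and f[measurable]: "f \<in> borel_measurable borel" and f0: "\<And>x. 0 \<le> f x"
  shows "(\<integral>\<^sup>+ w. ennreal (avg N s f (\<lambda>_ _. 1) w) \<partial>W N) = (\<integral>\<^sup>+ z. ennreal (f z) \<partial>target s)"
  unfolding avg_def mult_1_right
proof (rule nn_integral_weighted_avg_const[OF assms(1)])
  show "(\<lambda>w. f (\<xi> N s i w)) \<in> borel_measurable (W N)" if "i < N" for i
    using measurable_compose[OF xi_measurable f] assms that by simp
  show "(\<integral>\<^sup>+ w. ennreal (H N s w) * ennreal (f (\<xi> N s i w)) \<partial>W N) = (\<integral>\<^sup>+ z. ennreal (f z) \<partial>target s)" if "i < N" for i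
    using unbiased[OF assms(1,2) that, of "\<lambda>x. ennreal (f x)"] by simp
qed (use assms in \<open>auto intro: H_measurable_W H_nonneg\<close>)

text \<open>Exchanging the sum over the particles with the integral over \<open>x\<close> leaves one
  kernel average in front of the rejection power, so that limits can be taken for each fixed
  \<open>x\<close>.\<close>

lemma H_K: assumes N: "1 \<le> N" and w: "w \<in> space (W N)"
  and [measurable]: "f \<in> borel_measurable borel" and f0: "\<And>x. 0 \<le> f x"
  shows "ennreal (H N s w) * K N s w (\<lambda>x. ennreal (f x * reject N s w x ^ k))
    = (\<integral>\<^sup>+ x. ennreal (b (Suc s) x * f x) * ennreal (kern_avg N s w x * reject N s w x ^ k) \<partial>\<nu>)"
proof -
  have [measurable]: "reject N s w \<in> borel_measurable borel"
    using section_measurable[OF reject_measurable[OF lessI] w] .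
  let ?am = "\<lambda>j x. a s (\<xi> N s j w) * m (\<xi> N s j w) x"
  have "ennreal (H N s w) * K N s w (\<lambda>x. ennreal (f x * reject N s w x ^ k))
    = ennreal (H N s w) * ((\<integral>\<^sup>+ x. (\<Sum>j<N. ennreal (?am j x * b (Suc s) x) * ennreal (f x * reject N s w x ^ k)) \<partial>\<nu>) / of_nat N)"
    unfolding K_def Q_def by (subst nn_integral_sum) auto
  also have "\<dots> = (\<integral>\<^sup>+ x. ennreal (H N s w) * ((\<Sum>j<N. ennreal (?am j x * b (Suc s) x) * ennreal (f x * reject N s w x ^ k)) / of_nat N) \<partial>\<nu>)"
    by (subst nn_integral_cmult; (subst nn_integral_divide)?; simp)
  also have "\<dots> = (\<integral>\<^sup>+ x. ennreal (b (Suc s) x * f x) * ennreal (kern_avg N s w x * reject N s w x ^ k) \<partial>\<nu>)"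
  proof (rule nn_integral_cong)
    fix x
    have r: "0 \<le> f x * reject N s w x ^ k" using f0 reject_bounds by (intro mult_nonneg_nonneg zero_le_power)
    define R where "R = f x * reject N s w x ^ k"
    define c where "c j = ?am j x * b (Suc s) x" for j
    have c: "0 \<le> c j" for j unfolding c_def by (intro mult_nonneg_nonneg a_nonneg b_nonneg trans_nonneg)
    have cs: "(\<Sum>j<N. c j) = kern_sum N s w x * b (Suc s) x"
      by (simp add: kern_sum_def sum_distrib_right c_def)
    have "(\<Sum>j<N. ennreal (c j) * ennreal R) = ennreal (\<Sum>j<N. c j) * ennreal R"
      using c by (simp add: sum_distrib_right[symmetric] sum_ennreal)
    then have "ennreal (H N s w) * ((\<Sum>j<N. ennreal (c j) * ennreal R) / of_nat N) = ennreal (H N s w * ((\<Sum>j<N. c j) * R / N))"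
      using c r N H_nonneg[of N s w] R_def
      by (simp add: ennreal_mult''[symmetric] ennreal_of_nat_eq_real_of_nat divide_ennreal sum_nonneg)
    also have "H N s w * ((\<Sum>j<N. c j) * R / N) = (b (Suc s) x * f x) * (kern_avg N s w x * reject N s w x ^ k)"
      by (simp add: kern_avg_def cs R_def)
    also have "ennreal \<dots> = ennreal (b (Suc s) x * f x) * ennreal (kern_avg N s w x * reject N s w x ^ k)"
      by (rule ennreal_mult'[OF mult_nonneg_nonneg[OF b_nonneg f0]])
    finally have "ennreal (H N s w) * ((\<Sum>j<N. ennreal (c j) * ennreal R) / of_nat N) = ennreal (b (Suc s) x * f x) * ennreal (kern_avg N s w x * reject N s w x ^ k)" .
    then show "ennreal (H N s w) * ((\<Sum>j<N. ennreal (?am j x * b (Suc s) x) * ennreal (f x * reject N s w x ^ k)) / of_nat N)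
      = ennreal (b (Suc s) x * f x) * ennreal (kern_avg N s w x * reject N s w x ^ k)" unfolding c_def R_def .
  qed
  finally show ?thesis .
qed

lemma kern_avg_measurable_W:
  assumes "1 \<le> N" "s \<le> T"
  shows "(\<lambda>p. kern_avg N s (fst p) (snd p)) \<in> borel_measurable (W N \<Otimes>\<^sub>M borel)" "(\<lambda>p. reject N s (fst p) (snd p)) \<in> borel_measurable (W N \<Otimes>\<^sub>M borel)"
   "weight_avg N s \<in> borel_measurable (W N)"
proof -
  have [measurable]: "H N s \<in> borel_measurable (W N)" using assms by (auto intro!: H_measurable_W)
  have [measurable]: "\<xi> N s i \<in> measurable (W N) borel" if "i \<in> {..<N}" for i
    using assms that by (auto intro!: xi_measurable)
  show "(\<lambda>p. kern_avg N s (fst p) (snd p)) \<in> borel_measurable (W N \<Otimes>\<^sub>M borel)"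
    unfolding kern_avg_def kern_sum_def by measurable
  show "(\<lambda>p. reject N s (fst p) (snd p)) \<in> borel_measurable (W N \<Otimes>\<^sub>M borel)"
    unfolding reject_def kern_sum_def weight_sum_def by measurable
  show "weight_avg N s \<in> borel_measurable (W N)"
    unfolding weight_avg_def[abs_def] weight_sum_def by measurable
qed

text \<open>For fixed \<open>x\<close>, \<open>kern_avg\<close> and \<open>weight_avg\<close> are
  particle averages of \<open>a * m\<close> and of \<open>a\<close>, and boundedness of
  \<open>m\<close> makes the first integrable like the second. The Lipschitz bound carries both
  limits over to the thinned kernel.\<close>

lemma kern_avg_pointwise_limit:
  assumes s: "s \<le> T"
  shows "(\<lambda>N. \<integral>\<^sup>+ w. ennreal \<bar>kern_avg N s w x * reject N s w x ^ k - lim_kern s x * rej_lim s x ^ k\<bar> \<partial>W N) \<longlonglongrightarrow> 0"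
proof -
  let ?A = "\<lambda>N. \<integral>\<^sup>+ w. ennreal \<bar>kern_avg N s w x - lim_kern s x\<bar> \<partial>W N"
  let ?B = "\<lambda>N. \<integral>\<^sup>+ w. ennreal \<bar>weight_avg N s w - Z s\<bar> \<partial>W N"
  have "(\<integral>\<^sup>+ z. ennreal (a s z * m z x) \<partial>target s) < \<infinity>"
    using order_le_less_trans[OF lim_kern_le[OF s] ennreal_less_top] by simp
  from particle_lln[OF s _ _ this] have A: "?A \<longlonglongrightarrow> 0"
    by (simp add: kern_avg_avg lim_kern_def a_nonneg trans_nonneg)
  have "(\<integral>\<^sup>+ z. ennreal (a s z) \<partial>target s) < \<infinity>" using evid_finite[OF s] by (simp add: evid_def)
  from particle_lln[OF s _ _ this] have B: "?B \<longlonglongrightarrow> 0"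
    by (simp add: weight_avg_avg Z_def evid_def a_nonneg)
  have lim: "(\<lambda>N. ennreal (1 + real k) * ?A N + ennreal (real k * \<sigma>) * ?B N) \<longlonglongrightarrow> 0"
    using tendsto_add[OF ennreal_tendsto_cmult[OF _ A, of "ennreal (1 + real k)"] ennreal_tendsto_cmult[OF _ B, of "ennreal (real k * \<sigma>)"]] by simp
  show ?thesis
  proof (rule tendsto_sandwich[OF _ _ tendsto_const lim])
    show "\<forall>\<^sub>F N in sequentially. (\<integral>\<^sup>+ w. ennreal \<bar>kern_avg N s w x * reject N s w x ^ k - lim_kern s x * rej_lim s x ^ k\<bar> \<partial>W N) \<le> ennreal (1 + real k) * ?A N + ennreal (real k * \<sigma>) * ?B N"
    proof (rule eventually_sequentiallyI[of 1])
      fix N :: nat assume N: "1 \<le> N"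
      note um = kern_avg_measurable_W[OF N s]
      note [measurable] = um(3)
      have [measurable]: "(\<lambda>w. kern_avg N s w x) \<in> borel_measurable (W N)"
        using measurable_compose[OF measurable_Pair2'[of x borel] um(1)] by simp
      have "(\<integral>\<^sup>+ w. ennreal \<bar>kern_avg N s w x * reject N s w x ^ k - lim_kern s x * rej_lim s x ^ k\<bar> \<partial>W N)
        \<le> (\<integral>\<^sup>+ w. ennreal (1 + real k) * ennreal \<bar>kern_avg N s w x - lim_kern s x\<bar> + ennreal (real k * \<sigma>) * ennreal \<bar>weight_avg N s w - Z s\<bar> \<partial>W N)"
      proof (rule nn_integral_mono)
        fix w
        have "\<bar>kern_avg N s w x * reject N s w x ^ k - lim_kern s x * rej_lim s x ^ k\<bar> \<le> (1 + real k) * \<bar>kern_avg N s w x - lim_kern s x\<bar> + real k * \<sigma> * \<bar>weight_avg N s w - Z s\<bar>"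
          unfolding kern_avg_reject rej_lim_def
          by (intro thinned_lipschitz kern_avg_nonneg kern_avg_le weight_avg_nonneg lim_kern_bounds s sigma_pos Z_pos)
        then show "ennreal \<bar>kern_avg N s w x * reject N s w x ^ k - lim_kern s x * rej_lim s x ^ k\<bar> \<le> ennreal (1 + real k) * ennreal \<bar>kern_avg N s w x - lim_kern s x\<bar> + ennreal (real k * \<sigma>) * ennreal \<bar>weight_avg N s w - Z s\<bar>"
          using sigma_pos by (simp add: ennreal_mult'[symmetric] ennreal_plus[symmetric] ennreal_leI del: ennreal_plus)
      qed
      also have "\<dots> = ennreal (1 + real k) * ?A N + ennreal (real k * \<sigma>) * ?B N"
        by (simp add: nn_integral_add nn_integral_cmult del: ennreal_plus)
      finally show "(\<integral>\<^sup>+ w. ennreal \<bar>kern_avg N s w x * reject N s w x ^ k - lim_kern s x * rej_lim s x ^ k\<bar> \<partial>W N) \<le> ennreal (1 + real k) * ?A N + ennreal (real k * \<sigma>) * ?B N" .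
    qed
  qed auto
qed

text \<open>The limit of the \<open>HT\<close>-weighted fraction of trajectories whose first
  \<open>k\<close> proposals at time \<open>s\<close> are all rejected.\<close>

definition lim_survival :: "nat \<Rightarrow> nat \<Rightarrow> ennreal" where
  "lim_survival s k = (\<integral>\<^sup>+ x. ennreal (b (Suc s) x * future_real (Suc s) x) * ennreal (lim_kern s x * rej_lim s x ^ k) \<partial>\<nu>)"

lemma nn_integral_target_Suc_density:
  assumes s: "s < T" and [measurable]: "f \<in> borel_measurable borel"
  shows "(\<integral>\<^sup>+ x. f x \<partial>target (Suc s)) = (\<integral>\<^sup>+ x. ennreal (b (Suc s) x) * f x * ennreal (lim_kern s x) \<partial>\<nu>)"
proof -
  interpret finite_measure "target s" using s by (intro finite_target) auto
  have "(\<integral>\<^sup>+ x. f x \<partial>target (Suc s)) = (\<integral>\<^sup>+ x. ennreal (b (Suc s) x) * (\<integral>\<^sup>+ z. ennreal (a s z * m z x) \<partial>target s) * f x \<partial>\<nu>)"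
    by (simp add: nn_integral_density)
  then show ?thesis using s by (simp add: ennreal_lim_kern mult_ac)
qed

lemma nn_integral_future_lim_kern:
  assumes "s < T"
  shows "(\<integral>\<^sup>+ x. ennreal (b (Suc s) x * future_real (Suc s) x) * ennreal (lim_kern s x) \<partial>\<nu>) = evid T"
proof -
  have "(\<integral>\<^sup>+ x. ennreal (b (Suc s) x * future_real (Suc s) x) * ennreal (lim_kern s x) \<partial>\<nu>)
    = (\<integral>\<^sup>+ x. ennreal (b (Suc s) x) * ennreal (future_real (Suc s) x) * ennreal (lim_kern s x) \<partial>\<nu>)"
    by (intro nn_integral_cong) (simp add: ennreal_mult b_nonneg future_real_nonneg)
  then show ?thesis
    using nn_integral_target_Suc_density[OF assms, of "\<lambda>x. ennreal (future_real (Suc s) x)"] nn_integral_future_real[of "Suc s"] assms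
    by simp
qed

lemma lim_survival_finite: assumes "s < T" shows "lim_survival s k < \<infinity>"
proof -
  have "lim_survival s k \<le> evid T"
    unfolding lim_survival_def nn_integral_future_lim_kern[OF assms, symmetric]
  proof (intro nn_integral_mono mult_left_mono ennreal_leI)
    fix x
    have "lim_kern s x * rej_lim s x ^ k \<le> lim_kern s x * 1"
      using rej_lim_bounds[of s x] lim_kern_bounds(1) assms by (intro mult_left_mono power_le_one) auto
    then show "lim_kern s x * rej_lim s x ^ k \<le> lim_kern s x" by simp
  qed auto
  then show ?thesis using evid_finite[of T] by (simp add: order_le_less_trans)
qed

text \<open>The function averaged here contains the rejection probability and so depends on all
  particles at time \<open>s\<close>; the law of large numbers for fixed functions does not apply to
  the centering. Instead the centering is written as an integral over \<open>x\<close>, and the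
  pointwise limits are integrated by Fubini and dominated convergence.\<close>

lemma first_limit:
  assumes s: "s < T"
  shows "(\<lambda>N. \<integral>\<^sup>+ w. ennreal \<bar>avg N (Suc s) (future_real (Suc s)) (smooth N s k 0) w - enn2real (lim_survival s k)\<bar> \<partial>W N) \<longlonglongrightarrow> 0"
proof (rule step_limit[OF s future_real_measurable future_real_nonneg])
  let ?f = "future_real (Suc s)" and ?bf = "\<lambda>x. ennreal (b (Suc s) x * future_real (Suc s) x)"
  have s': "s \<le> T" "Suc s \<le> T" using s by auto
  show "(\<integral>\<^sup>+ x. ennreal (?f x) \<partial>target (Suc s)) < \<infinity>"
    using nn_integral_future_real[OF s'(2)] evid_finite[of T] by simp
  show "(\<lambda>p. smooth N s k 0 (fst p) (snd p)) \<in> borel_measurable (F N (Suc s) \<Otimes>\<^sub>M borel)" for N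
    using smooth_measurable[of N s k 0] by simp
  show "0 \<le> smooth N s k 0 w x" "smooth N s k 0 w x \<le> 1" for N w x using smooth_bounds by blast+
  note [measurable] = lim_kern_measurable[OF s'(1)]
  have [measurable]: "rej_lim s \<in> borel_measurable borel" unfolding rej_lim_def[abs_def] by measurable
  let ?d = "\<lambda>N w x. ennreal \<bar>kern_avg N s w x * reject N s w x ^ k - lim_kern s x * rej_lim s x ^ k\<bar>"
  let ?e = "\<lambda>N x. \<integral>\<^sup>+ w. ?d N w x \<partial>W N"
  have ulim: "(\<integral>\<^sup>+ x. ?bf x * ennreal (2 * lim_kern s x) \<partial>\<nu>) < \<infinity>"
  proof -
    have "(\<integral>\<^sup>+ x. ?bf x * ennreal (2 * lim_kern s x) \<partial>\<nu>) = (\<integral>\<^sup>+ x. 2 * (?bf x * ennreal (lim_kern s x)) \<partial>\<nu>)"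
      by (intro nn_integral_cong) (simp add: ennreal_mult lim_kern_bounds mult_ac)
    also have "\<dots> = 2 * evid T"
      by (simp add: nn_integral_cmult nn_integral_future_lim_kern[OF s])
    finally show ?thesis using evid_finite[of T] by (simp add: ennreal_mult_less_top)
  qed
  have em: "(\<lambda>p. ?d N (fst p) (snd p)) \<in> borel_measurable (W N \<Otimes>\<^sub>M borel)" if N: "1 \<le> N" for N
  proof -
    note [measurable] = kern_avg_measurable_W[OF N s'(1)]
    show ?thesis by measurable
  qed
  \<comment> \<open>The dominating function comes from unbiasedness: the mean of the kernel average
    is exactly \<open>lim_kern\<close>, for every \<open>N\<close>, and the rejection powers are at
    most 1.\<close>
  have e_le: "?e N x \<le> ennreal (2 * lim_kern s x)" if N: "1 \<le> N" for N x
  proof -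
    note um = kern_avg_measurable_W[OF N s'(1)]
    have [measurable]: "(\<lambda>w. kern_avg N s w x) \<in> borel_measurable (W N)"
      using measurable_compose[OF measurable_Pair2'[of x borel] um(1)] by simp
    interpret prob_space "W N" by (rule prob_W[OF N])
    have "?e N x \<le> (\<integral>\<^sup>+ w. ennreal (kern_avg N s w x) + ennreal (lim_kern s x) \<partial>W N)"
    proof (rule nn_integral_mono)
      fix w
      have r: "0 \<le> reject N s w x ^ k" "reject N s w x ^ k \<le> 1" "0 \<le> rej_lim s x ^ k" "rej_lim s x ^ k \<le> 1"
        using reject_bounds[of N s w x] rej_lim_bounds[OF s'(1), of x] by (auto intro: power_le_one)
      have "kern_avg N s w x * reject N s w x ^ k \<le> kern_avg N s w x * 1" "lim_kern s x * rej_lim s x ^ k \<le> lim_kern s x * 1"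
        by (rule mult_left_mono[OF r(2) kern_avg_nonneg] mult_left_mono[OF r(4) lim_kern_bounds(1)])+
      moreover have "0 \<le> kern_avg N s w x * reject N s w x ^ k" "0 \<le> lim_kern s x * rej_lim s x ^ k"
        by (rule mult_nonneg_nonneg[OF kern_avg_nonneg r(1)] mult_nonneg_nonneg[OF lim_kern_bounds(1) r(3)])+
      ultimately have "\<bar>kern_avg N s w x * reject N s w x ^ k - lim_kern s x * rej_lim s x ^ k\<bar> \<le> kern_avg N s w x + lim_kern s x" by linarith
      then show "?d N w x \<le> ennreal (kern_avg N s w x) + ennreal (lim_kern s x)"
        using kern_avg_nonneg lim_kern_bounds(1) by (simp add: ennreal_plus[symmetric] ennreal_leI del: ennreal_plus)
    qed
    also have "\<dots> = (\<integral>\<^sup>+ w. ennreal (kern_avg N s w x) \<partial>W N) + ennreal (lim_kern s x)"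
      by (subst nn_integral_add) (auto simp: emeasure_space_1)
    also have "(\<integral>\<^sup>+ w. ennreal (kern_avg N s w x) \<partial>W N) = ennreal (lim_kern s x)"
      unfolding kern_avg_avg using N s' by (subst avg_mean) (auto simp: ennreal_lim_kern a_nonneg trans_nonneg)
    also have "ennreal (lim_kern s x) + ennreal (lim_kern s x) = ennreal (2 * lim_kern s x)"
      using lim_kern_bounds(1) by (simp add: ennreal_plus[symmetric] del: ennreal_plus)
    finally show ?thesis .
  qed
  have emx: "?e N \<in> borel_measurable borel" if N: "1 \<le> N" for N
  proof -
    interpret prob_space "W N" by (rule prob_W[OF N])
    have "(\<lambda>p. ?d N (snd p) (fst p)) \<in> borel_measurable (borel \<Otimes>\<^sub>M W N)"
      using measurable_compose[OF measurable_pair_swap' em[OF N]] by (simp add: case_prod_beta')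
    then show ?thesis by (intro borel_measurable_nn_integral) (simp add: case_prod_beta')
  qed
  \<comment> \<open>The index is shifted by one because measurability and the bound are available
    only from \<open>N = 1\<close> on.\<close>
  have "(\<lambda>n. \<integral>\<^sup>+ x. ?bf x * ?e (Suc n) x \<partial>\<nu>) \<longlonglongrightarrow> (\<integral>\<^sup>+ x. 0 \<partial>\<nu>)"
  proof (rule nn_integral_dominated_convergence[where w="\<lambda>x. ?bf x * ennreal (2 * lim_kern s x)"])
    show "(\<lambda>x. ?bf x * ?e (Suc n) x) \<in> borel_measurable \<nu>" for n
      using emx[of "Suc n"] by simp
    show "AE x in \<nu>. ?bf x * ?e (Suc n) x \<le> ?bf x * ennreal (2 * lim_kern s x)" for n
      using e_le[of "Suc n"] by (auto intro!: mult_left_mono)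
    have "(\<lambda>n. ?bf x * ?e (Suc n) x) \<longlonglongrightarrow> ?bf x * 0" for x
      by (intro ennreal_tendsto_cmult LIMSEQ_Suc[OF kern_avg_pointwise_limit[OF s'(1)]]) simp
    then show "AE x in \<nu>. (\<lambda>n. ?bf x * ?e (Suc n) x) \<longlonglongrightarrow> 0" by simp
  qed (use ulim in auto)
  then have lim0: "(\<lambda>N. \<integral>\<^sup>+ x. ?bf x * ?e N x \<partial>\<nu>) \<longlonglongrightarrow> 0"
    by (subst filterlim_sequentially_Suc[symmetric]) simp
  show "(\<lambda>N. \<integral>\<^sup>+ w. ennreal \<bar>H N s w * enn2real (K N s w (\<lambda>x. ennreal (?f x * smooth N s k 0 w x))) - enn2real (lim_survival s k)\<bar> \<partial>W N) \<longlonglongrightarrow> 0"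
  proof (rule tendsto_sandwich[OF _ _ tendsto_const lim0])
    show "\<forall>\<^sub>F N in sequentially. (\<integral>\<^sup>+ w. ennreal \<bar>H N s w * enn2real (K N s w (\<lambda>x. ennreal (?f x * smooth N s k 0 w x))) - enn2real (lim_survival s k)\<bar> \<partial>W N) \<le> (\<integral>\<^sup>+ x. ?bf x * ?e N x \<partial>\<nu>)"
    proof (rule eventually_sequentiallyI[of 1])
      fix N :: nat assume N: "1 \<le> N"
      interpret prob_space "W N" by (rule prob_W[OF N])
      interpret pair_sigma_finite "W N" \<nu> ..
      note um[measurable] = kern_avg_measurable_W[OF N s'(1)]
      have "(\<integral>\<^sup>+ w. ennreal \<bar>H N s w * enn2real (K N s w (\<lambda>x. ennreal (?f x * smooth N s k 0 w x))) - enn2real (lim_survival s k)\<bar> \<partial>W N)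
         \<le> (\<integral>\<^sup>+ w. \<integral>\<^sup>+ x. ?bf x * ?d N w x \<partial>\<nu> \<partial>W N)"
      proof (rule nn_integral_mono)
        fix w assume w: "w \<in> space (W N)"
        have [measurable]: "reject N s w \<in> borel_measurable borel" "kern_avg N s w \<in> borel_measurable borel"
          using measurable_compose[OF measurable_Pair1'[OF w] um(1)] measurable_compose[OF measurable_Pair1'[OF w] um(2)] by simp_all
        let ?X = "\<integral>\<^sup>+ x. ?bf x * ennreal (kern_avg N s w x * reject N s w x ^ k) \<partial>\<nu>"
        have "H N s w * enn2real (K N s w (\<lambda>x. ennreal (?f x * smooth N s k 0 w x))) = enn2real ?X"
          using arg_cong[OF H_K[OF N w future_real_measurable future_real_nonneg, of s "Suc s" k], of enn2real] H_nonneg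
          by (simp add: enn2real_mult)
        moreover have "ennreal \<bar>enn2real ?X - enn2real (lim_survival s k)\<bar> \<le> (\<integral>\<^sup>+ x. ?bf x * ?d N w x \<partial>\<nu>)"
        proof (rule ennreal_abs_enn2real_diff_le)
          have nn: "0 \<le> kern_avg N s w x * reject N s w x ^ k" "0 \<le> lim_kern s x * rej_lim s x ^ k" for x
            using kern_avg_nonneg lim_kern_bounds(1) reject_bounds rej_lim_bounds[OF s'(1)] by (intro mult_nonneg_nonneg zero_le_power; simp)+
          have pt: "c * ennreal A \<le> c * ennreal B + c * ennreal \<bar>A - B\<bar>" if "0 \<le> B" for c :: ennreal and A B :: real
          proof -
            have "ennreal A \<le> ennreal (B + \<bar>A - B\<bar>)" by (rule ennreal_leI) simp
            then show ?thesis unfolding distrib_left[symmetric] ennreal_plus[OF that abs_ge_zero] by (rule mult_left_mono) simp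
          qed
          have "?X \<le> (\<integral>\<^sup>+ x. ?bf x * ennreal (lim_kern s x * rej_lim s x ^ k) + ?bf x * ?d N w x \<partial>\<nu>)"
            by (intro nn_integral_mono pt nn)
          also have "\<dots> = lim_survival s k + (\<integral>\<^sup>+ x. ?bf x * ?d N w x \<partial>\<nu>)"
            unfolding lim_survival_def by (rule nn_integral_add) measurable
          finally show "?X \<le> lim_survival s k + (\<integral>\<^sup>+ x. ?bf x * ?d N w x \<partial>\<nu>)" .
          have "lim_survival s k \<le> (\<integral>\<^sup>+ x. ?bf x * ennreal (kern_avg N s w x * reject N s w x ^ k) + ?bf x * ?d N w x \<partial>\<nu>)"
            unfolding lim_survival_def by (subst abs_minus_commute, intro nn_integral_mono pt nn)
          also have "\<dots> = ?X + (\<integral>\<^sup>+ x. ?bf x * ?d N w x \<partial>\<nu>)"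
            by (rule nn_integral_add) measurable
          finally show "lim_survival s k \<le> ?X + (\<integral>\<^sup>+ x. ?bf x * ?d N w x \<partial>\<nu>)" .
        qed
        ultimately show "ennreal \<bar>H N s w * enn2real (K N s w (\<lambda>x. ennreal (?f x * smooth N s k 0 w x))) - enn2real (lim_survival s k)\<bar> \<le> (\<integral>\<^sup>+ x. ?bf x * ?d N w x \<partial>\<nu>)"
          by simp
      qed
      also have "\<dots> = (\<integral>\<^sup>+ x. \<integral>\<^sup>+ w. ?bf x * ?d N w x \<partial>W N \<partial>\<nu>)"
        by (rule Fubini'[symmetric]) measurable
      also have "\<dots> = (\<integral>\<^sup>+ x. ?bf x * ?e N x \<partial>\<nu>)"
      proof (rule nn_integral_cong)
        fix x
        have [measurable]: "(\<lambda>w. kern_avg N s w x) \<in> borel_measurable (W N)" "(\<lambda>w. reject N s w x) \<in> borel_measurable (W N)"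
          using measurable_compose[OF measurable_Pair2'[of x borel] um(1)] measurable_compose[OF measurable_Pair2'[of x borel] um(2)] by simp_all
        show "(\<integral>\<^sup>+ w. ?bf x * ?d N w x \<partial>W N) = ?bf x * ?e N x"
          by (rule nn_integral_cmult) measurable
      qed
      finally show "(\<integral>\<^sup>+ w. ennreal \<bar>H N s w * enn2real (K N s w (\<lambda>x. ennreal (?f x * smooth N s k 0 w x))) - enn2real (lim_survival s k)\<bar> \<partial>W N) \<le> (\<integral>\<^sup>+ x. ?bf x * ?e N x \<partial>\<nu>)" .
    qed
  qed auto
qed


text \<open>Each further backward average satisfies the relation demanded by
  \<open>avg_limit_Suc\<close>, and \<open>future_real\<close> is reproduced by \<open>Q\<close>, so
  the limit found at time \<open>s + 1\<close> is carried unchanged to every later time.\<close>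

lemma smooth_limit:
  assumes "s < T" "Suc s + n \<le> T"
  shows "(\<lambda>N. \<integral>\<^sup>+ w. ennreal \<bar>avg N (Suc s + n) (future_real (Suc s + n)) (smooth N s k n) w - enn2real (lim_survival s k)\<bar> \<partial>W N) \<longlonglongrightarrow> 0"
  using assms(2)
proof (induction n)
  case 0 then show ?case using first_limit[OF assms(1), of k] by simp
next
  case (Suc n)
  have t: "Suc s + n < T" "Suc (Suc s + n) \<le> T" using Suc.prems by auto
  have "(\<lambda>N. \<integral>\<^sup>+ w. ennreal \<bar>avg N (Suc (Suc s + n)) (future_real (Suc (Suc s + n))) (smooth N s k (Suc n)) w - enn2real (lim_survival s k)\<bar> \<partial>W N) \<longlonglongrightarrow> 0"
  proof (rule avg_limit_Suc[OF t(1) future_real_measurable future_real_nonneg future_real_nonneg _ Q_future_real[OF t(1)], where \<psi>="\<lambda>N. smooth N s k n"])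
    show "(\<integral>\<^sup>+ x. ennreal (future_real (Suc (Suc s + n)) x) \<partial>target (Suc (Suc s + n))) < \<infinity>"
      using nn_integral_future_real[OF t(2)] evid_finite[of T] by simp
    show "(\<lambda>p. smooth N s k (Suc n) (fst p) (snd p)) \<in> borel_measurable (F N (Suc (Suc s + n)) \<Otimes>\<^sub>M borel)" for N
      using smooth_measurable[of N s k "Suc n"] by simp
    show "0 \<le> smooth N s k n w x" "0 \<le> smooth N s k (Suc n) w x" "smooth N s k (Suc n) w x \<le> 1" for N w x
      using smooth_bounds by blast+
    show "(\<Sum>j<N. a (Suc s + n) (\<xi> N (Suc s + n) j w) * m (\<xi> N (Suc s + n) j w) x * smooth N s k (Suc n) w x) =
       (\<Sum>j<N. a (Suc s + n) (\<xi> N (Suc s + n) j w) * m (\<xi> N (Suc s + n) j w) x * smooth N s k n w (\<xi> N (Suc s + n) j w))" for N w x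
      by (simp only: smooth.simps back_mean_rel)
    show "(\<lambda>N. \<integral>\<^sup>+ w. ennreal \<bar>avg N (Suc s + n) (future_real (Suc s + n)) (smooth N s k n) w - enn2real (lim_survival s k)\<bar> \<partial>W N) \<longlonglongrightarrow> 0"
      using Suc by simp
  qed
  then show ?case by simp
qed

section \<open>Means of the rejection events and their sums\<close>

definition cond_reject :: "nat \<Rightarrow> nat \<Rightarrow> nat \<Rightarrow> ennreal" where
  "cond_reject N s k = (\<integral>\<^sup>+ w. ennreal (H N s w) * K N s w (\<lambda>x. ennreal (future_real (Suc s) x * reject N s w x ^ k)) \<partial>W N)"

text \<open>The counterpart of \<open>smooth_limit\<close> for fixed \<open>N\<close>: the
  telescoping preserves the weighted mean exactly, so no error term enters the upper bound on the
  number of trials.\<close>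

lemma smooth_mean:
  assumes N: "1 \<le> N" and "s < T" "Suc s + n \<le> T"
  shows "(\<integral>\<^sup>+ w. ennreal (avg N (Suc s + n) (future_real (Suc s + n)) (smooth N s k n) w) \<partial>W N) = cond_reject N s k"
  using assms(3)
proof (induction n)
  case 0
  have "(\<lambda>p. smooth N s k 0 (fst p) (snd p)) \<in> borel_measurable (F N (Suc s) \<Otimes>\<^sub>M borel)"
    using smooth_measurable[of N s k 0] by simp
  from avg_mean_Suc[OF N assms(2) future_real_measurable future_real_nonneg this, of "Suc s"]
  show ?case using smooth_bounds[of N s k 0] by (simp add: cond_reject_def)
next
  case (Suc n)
  have t: "Suc s + n < T" "Suc (Suc s + n) \<le> T" using Suc.prems by auto
  have sm: "(\<lambda>p. smooth N s k (Suc n) (fst p) (snd p)) \<in> borel_measurable (F N (Suc (Suc s + n)) \<Otimes>\<^sub>M borel)"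
    using smooth_measurable[of N s k "Suc n"] by simp
  have b: "0 \<le> smooth N s k n w x" for n w x using smooth_bounds by blast
  have r: "(\<Sum>j<N. a (Suc s + n) (\<xi> N (Suc s + n) j w) * m (\<xi> N (Suc s + n) j w) x * smooth N s k (Suc n) w x) =
       (\<Sum>j<N. a (Suc s + n) (\<xi> N (Suc s + n) j w) * m (\<xi> N (Suc s + n) j w) x * smooth N s k n w (\<xi> N (Suc s + n) j w))" for w x
    by (simp only: smooth.simps back_mean_rel)
  have "(\<integral>\<^sup>+ w. ennreal (avg N (Suc (Suc s + n)) (future_real (Suc (Suc s + n))) (smooth N s k (Suc n)) w) \<partial>W N)
    = (\<integral>\<^sup>+ w. ennreal (H N (Suc s + n) w) * K N (Suc s + n) w (\<lambda>x. ennreal (future_real (Suc (Suc s + n)) x * smooth N s k (Suc n) w x)) \<partial>W N)"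
    by (rule avg_mean_Suc[OF N t(1) future_real_measurable future_real_nonneg sm b])
  also have "\<dots> = (\<integral>\<^sup>+ w. ennreal (avg N (Suc s + n) (future_real (Suc s + n)) (smooth N s k n) w) \<partial>W N)"
    by (rule nn_integral_cong_AE)
      (rule condmean_eq_avg[OF N t(1) future_real_measurable future_real_nonneg future_real_nonneg Q_future_real[OF t(1)] sm b b r])
  finally show ?case using Suc by simp
qed

lemma backward_mass_future: "s < T \<Longrightarrow> backward_mass \<nu> m G T s = (\<integral>\<^sup>+ x. ennreal (b (Suc s) x) * future (Suc s) x \<partial>\<nu>)"
  unfolding backward_mass_def future_def
  by (intro nn_integral_cong) (simp add: lik_factor ennreal_mult a_nonneg b_nonneg mult_ac)

text \<open>With \<pi> the acceptance probability, the sum of \<open>\<pi> * (1 - \<pi>) ^ k\<close>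
  telescopes to at most 1. This also covers \<pi> = 0, where the trials would never end, since the
  kernel average in front is then 0.\<close>

lemma kern_avg_reject_sum_le: "(\<Sum>k<n. kern_avg N s w x * reject N s w x ^ k) \<le> \<sigma> * weight_avg N s w"
proof -
  define \<pi> where "\<pi> = kern_avg N s w x / (\<sigma> * weight_avg N s w)"
  have sw: "0 \<le> \<sigma> * weight_avg N s w" using sigma_pos weight_avg_nonneg by simp
  have u: "kern_avg N s w x = \<pi> * (\<sigma> * weight_avg N s w)"
    using kern_avg_le[of N s w x] kern_avg_nonneg[of N s w x] by (cases "\<sigma> * weight_avg N s w = 0") (auto simp: \<pi>_def)
  have p: "\<pi> \<le> 1" unfolding \<pi>_def using kern_avg_le[of N s w x] sw by (cases "\<sigma> * weight_avg N s w = 0") (auto simp: divide_le_eq)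
  have "(\<Sum>k<n. kern_avg N s w x * reject N s w x ^ k) = (\<Sum>k<n. kern_avg N s w x * (1 - \<pi>) ^ k)"
    by (simp add: kern_avg_reject \<pi>_def)
  also have "\<dots> = (\<sigma> * weight_avg N s w) * (\<pi> * (\<Sum>k<n. (1 - \<pi>) ^ k))"
    by (subst u) (simp add: sum_distrib_left mult_ac)
  also have "\<pi> * (\<Sum>k<n. (1 - \<pi>) ^ k) = 1 - (1 - \<pi>) ^ n" by (simp add: one_diff_power_eq)
  also have "(\<sigma> * weight_avg N s w) * (1 - (1 - \<pi>) ^ n) \<le> (\<sigma> * weight_avg N s w) * 1"
    using p sw by (intro mult_left_mono) auto
  finally show ?thesis by simp
qed

text \<open>Under the integral over \<open>x\<close> the geometric sum is at most
  \<open>\<sigma>\<close> times the weight average, whose weighted mean is exactly the evidence at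
  time \<open>s\<close>. Points where the kernel average is 0 only add to the bound, which may be
  infinite.\<close>

lemma cond_reject_sum_le:
  assumes N: "1 \<le> N" and s: "s < T"
  shows "(\<Sum>k<n. cond_reject N s k) \<le> ennreal \<sigma> * evid s * backward_mass \<nu> m G T s"
proof -
  let ?bf = "\<lambda>x. ennreal (b (Suc s) x * future_real (Suc s) x)"
  have s': "s \<le> T" using s by simp
  interpret prob_space "W N" by (rule prob_W[OF N])
  have sub: "subalgebra (W N) (F N (Suc s))" using N s by (intro subalgebra_F) auto
  have [measurable]: "H N s \<in> borel_measurable (W N)" using N s by (intro H_measurable_W) auto
  have km: "(\<lambda>w. ennreal (H N s w) * K N s w (\<lambda>x. ennreal (future_real (Suc s) x * reject N s w x ^ k))) \<in> borel_measurable (W N)" for k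
  proof -
    note [measurable] = reject_measurable[OF lessI]
    have "(\<lambda>p. ennreal (future_real (Suc s) (snd p) * reject N s (fst p) (snd p) ^ k)) \<in> borel_measurable (F N (Suc s) \<Otimes>\<^sub>M borel)"
      by measurable
    from measurable_from_subalg[OF sub K_measurable[OF this]]
    have [measurable]: "(\<lambda>w. K N s w (\<lambda>x. ennreal (future_real (Suc s) x * reject N s w x ^ k))) \<in> borel_measurable (W N)" by simp
    show ?thesis by measurable
  qed
  have "(\<Sum>k<n. cond_reject N s k) = (\<integral>\<^sup>+ w. (\<Sum>k<n. ennreal (H N s w) * K N s w (\<lambda>x. ennreal (future_real (Suc s) x * reject N s w x ^ k))) \<partial>W N)"
    unfolding cond_reject_def by (rule nn_integral_sum[symmetric]) (rule km)
  also have "\<dots> \<le> (\<integral>\<^sup>+ w. ennreal \<sigma> * ennreal (weight_avg N s w) * backward_mass \<nu> m G T s \<partial>W N)"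
  proof (rule nn_integral_mono)
    fix w assume w: "w \<in> space (W N)"
    have [measurable]: "reject N s w \<in> borel_measurable borel" "kern_avg N s w \<in> borel_measurable borel"
      using measurable_compose[OF measurable_Pair1'[OF w] kern_avg_measurable_W(1)[OF N s']] measurable_compose[OF measurable_Pair1'[OF w] kern_avg_measurable_W(2)[OF N s']] by simp_all
    have nn: "0 \<le> kern_avg N s w x * reject N s w x ^ k" for x k
      by (intro mult_nonneg_nonneg zero_le_power kern_avg_nonneg reject_bounds)
    have "(\<Sum>k<n. ennreal (H N s w) * K N s w (\<lambda>x. ennreal (future_real (Suc s) x * reject N s w x ^ k)))
      = (\<Sum>k<n. \<integral>\<^sup>+ x. ?bf x * ennreal (kern_avg N s w x * reject N s w x ^ k) \<partial>\<nu>)"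
      by (simp add: H_K[OF N w future_real_measurable future_real_nonneg])
    also have "\<dots> = (\<integral>\<^sup>+ x. (\<Sum>k<n. ?bf x * ennreal (kern_avg N s w x * reject N s w x ^ k)) \<partial>\<nu>)"
      by (rule nn_integral_sum[symmetric]) measurable
    also have "\<dots> \<le> (\<integral>\<^sup>+ x. ennreal (\<sigma> * weight_avg N s w) * (ennreal (b (Suc s) x) * future (Suc s) x) \<partial>\<nu>)"
    proof (rule nn_integral_mono)
      fix x
      have "(\<Sum>k<n. ?bf x * ennreal (kern_avg N s w x * reject N s w x ^ k)) = ?bf x * ennreal (\<Sum>k<n. kern_avg N s w x * reject N s w x ^ k)"
        by (subst sum_ennreal[OF nn, symmetric]) (rule sum_distrib_left[symmetric])
      also have "\<dots> \<le> ?bf x * ennreal (\<sigma> * weight_avg N s w)"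
        by (intro mult_left_mono ennreal_leI kern_avg_reject_sum_le) simp
      also have "?bf x \<le> ennreal (b (Suc s) x) * future (Suc s) x"
        unfolding future_real_def ennreal_mult'[OF b_nonneg]
        by (intro mult_left_mono) (cases "future (Suc s) x", auto)
      finally show "(\<Sum>k<n. ?bf x * ennreal (kern_avg N s w x * reject N s w x ^ k)) \<le> ennreal (\<sigma> * weight_avg N s w) * (ennreal (b (Suc s) x) * future (Suc s) x)"
        by (simp add: mult_right_mono mult.commute)
    qed
    also have "\<dots> = ennreal \<sigma> * ennreal (weight_avg N s w) * backward_mass \<nu> m G T s"
      using sigma_pos by (simp add: nn_integral_cmult backward_mass_future[OF s] ennreal_mult')
    finally show "(\<Sum>k<n. ennreal (H N s w) * K N s w (\<lambda>x. ennreal (future_real (Suc s) x * reject N s w x ^ k))) \<le> ennreal \<sigma> * ennreal (weight_avg N s w) * backward_mass \<nu> m G T s" .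
  qed
  also have "\<dots> = ennreal \<sigma> * evid s * backward_mass \<nu> m G T s"
  proof -
    have "(\<integral>\<^sup>+ w. ennreal (weight_avg N s w) \<partial>W N) = evid s"
      unfolding weight_avg_avg evid_def by (rule avg_mean[OF N s']) (auto simp: a_nonneg)
    then show ?thesis using kern_avg_measurable_W(3)[OF N s'] by (simp add: nn_integral_multc nn_integral_cmult)
  qed
  finally show ?thesis .
qed

text \<open>Where \<open>lim_kern\<close> is positive it cancels against the sum of the geometric
  series and leaves the constant \<open>\<sigma> * Z s\<close>; where it is 0 the series is 0.
  Predictive support ensures that the backward mass does not charge the second set.\<close>

lemma lim_survival_SUP:
  assumes s: "s < T" and supp: "predictive_support \<chi>0 \<nu> m G T s"
  shows "(SUP n. \<Sum>k<n. lim_survival s k) = ennreal \<sigma> * evid s * backward_mass \<nu> m G T s"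
proof -
  let ?bf = "\<lambda>x. ennreal (b (Suc s) x * future_real (Suc s) x)"
  have s': "s \<le> T" "Suc s \<le> T" using s by auto
  note [measurable] = lim_kern_measurable[OF s'(1)]
  have [measurable]: "rej_lim s \<in> borel_measurable borel" unfolding rej_lim_def[abs_def] by measurable
  have 1: "AE x in \<nu>. 0 < ennreal (b (Suc s) x) * future (Suc s) x \<longrightarrow> 0 < lim_kern s x"
    using supp unfolding predictive_support_def
  proof eventually_elim
    case (elim x)
    show ?case
    proof
      assume "0 < ennreal (b (Suc s) x) * future (Suc s) x"
      then have "0 < ennreal (G (Suc s) x) * path_int Mk G (Suc s) (T - Suc s) (\<lambda>_. 1) x"
        using s by (simp add: future_def lik_factor ennreal_mult a_nonneg b_nonneg mult_ac)
      then have "0 < filter_dist \<chi>0 Mk G s (\<lambda>z. ennreal (m z x))" using elim by auto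
      then have "0 < unnorm_filter \<chi>0 Mk G s (\<lambda>z. ennreal (m z x))"
        by (auto simp: filter_dist_def zero_less_iff_neq_zero ennreal_divide_eq_0_iff)
      also have "\<dots> = (\<integral>\<^sup>+ z. ennreal (a s z * m z x) \<partial>target s)"
        using s by (subst unnorm_filter_target[of s]) (auto simp: ennreal_mult a_nonneg trans_nonneg)
      finally show "0 < lim_kern s x" using ennreal_lim_kern[OF s'(1), of x] by (metis ennreal_less_zero_iff)
    qed
  qed
  \<comment> \<open>Infinite values of \<open>future\<close> are null for the target at time
    \<open>Suc s\<close>. In terms of \<open>\<nu>\<close> this speaks about points of positive
    density only, and by \<open>1\<close> these are the only ones that count.\<close>
  have 2: "AE x in \<nu>. 0 < ennreal (b (Suc s) x) * (\<integral>\<^sup>+ z. ennreal (a s z * m z x) \<partial>target s) \<longrightarrow> future (Suc s) x \<noteq> \<infinity>"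
  proof -
    interpret finite_measure "target s" by (rule finite_target[OF s'(1)])
    have dm: "(\<lambda>x'. ennreal (b (Suc s) x') * (\<integral>\<^sup>+ x. ennreal (a s x * m x x') \<partial>target s)) \<in> borel_measurable \<nu>"
      by measurable
    show ?thesis using future_finite[OF s'(2)] unfolding target.simps(2) AE_density[OF dm] .
  qed
  have sm: "(\<Sum>k. ?bf x * ennreal (lim_kern s x * rej_lim s x ^ k)) = ?bf x * ennreal (\<sigma> * Z s)" if "0 < lim_kern s x" for x
  proof -
    have sz: "0 < \<sigma> * Z s" using sigma_pos Z_pos[OF s'(1)] by simp
    have r1: "1 - rej_lim s x = lim_kern s x / (\<sigma> * Z s)" by (simp add: rej_lim_def)
    have "0 < lim_kern s x / (\<sigma> * Z s)" using that sz by simp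
    then have "rej_lim s x < 1" using r1 by linarith
    then have "(\<lambda>k. rej_lim s x ^ k) sums (1 / (1 - rej_lim s x))"
      using rej_lim_bounds(1)[OF s'(1), of x] by (intro geometric_sums) simp
    from sums_mult[OF this, of "lim_kern s x"] have "(\<lambda>k. lim_kern s x * rej_lim s x ^ k) sums (\<sigma> * Z s)"
      unfolding r1 using that sz by simp
    moreover have "0 \<le> lim_kern s x * rej_lim s x ^ k" for k
      by (intro mult_nonneg_nonneg zero_le_power lim_kern_bounds(1) rej_lim_bounds(1)[OF s'(1)])
    ultimately have "(\<Sum>k. ennreal (lim_kern s x * rej_lim s x ^ k)) = ennreal (\<sigma> * Z s)" by (rule suminf_ennreal_eq[rotated])
    then show ?thesis by (simp only: ennreal_suminf_cmult)
  qed
  have "(SUP n. \<Sum>k<n. lim_survival s k) = (\<Sum>k. lim_survival s k)" by (rule suminf_eq_SUP[symmetric])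
  also have "\<dots> = (\<integral>\<^sup>+ x. (\<Sum>k. ?bf x * ennreal (lim_kern s x * rej_lim s x ^ k)) \<partial>\<nu>)"
    unfolding lim_survival_def by (rule nn_integral_suminf[symmetric]) measurable
  also have "\<dots> = (\<integral>\<^sup>+ x. ennreal (\<sigma> * Z s) * (ennreal (b (Suc s) x) * future (Suc s) x) \<partial>\<nu>)"
  proof (rule nn_integral_cong_AE)
    show "AE x in \<nu>. (\<Sum>k. ?bf x * ennreal (lim_kern s x * rej_lim s x ^ k)) = ennreal (\<sigma> * Z s) * (ennreal (b (Suc s) x) * future (Suc s) x)"
      using 1 2
    proof eventually_elim
      case (elim x)
      show ?case
      proof (cases "ennreal (b (Suc s) x) * future (Suc s) x = 0")
        case True
        then have z: "b (Suc s) x * future_real (Suc s) x = 0" using b_nonneg[of "Suc s" x]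
          by (auto simp: future_real_def ennreal_eq_0_iff)
        show ?thesis unfolding True z by simp
      next
        case False
        then have pos: "0 < ennreal (b (Suc s) x) * future (Suc s) x" by (simp add: zero_less_iff_neq_zero)
        then have u: "0 < lim_kern s x" using elim by simp
        have "0 < ennreal (b (Suc s) x) * (\<integral>\<^sup>+ z. ennreal (a s z * m z x) \<partial>target s)"
          using False u unfolding ennreal_lim_kern[OF s'(1), symmetric] by (auto simp: zero_less_iff_neq_zero ennreal_eq_0_iff)
        then have "future (Suc s) x \<noteq> \<infinity>" using elim by simp
        then have "?bf x = ennreal (b (Suc s) x) * future (Suc s) x"
          by (simp add: ennreal_mult' b_nonneg future_real_def less_top)
        then show ?thesis using sm[OF u] by (simp add: mult.commute)
      qed
    qed
  qed
  also have "\<dots> = ennreal \<sigma> * evid s * backward_mass \<nu> m G T s"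
    using sigma_pos by (simp add: nn_integral_cmult backward_mass_future[OF s] ennreal_mult' ennreal_Z[OF s'(1)])
  finally show ?thesis .
qed

end

subsection \<open>Drawing until acceptance\<close>

text \<open>Along each trajectory \<open>l\<close> the draws \<open>X (l, k)\<close> are made until one is not rejected; \<open>\<zeta> l n\<close> is the
  value collected if the \<open>n\<close>-th draw is the last one.\<close>

lemma cond_draws_stopped:
  fixes X :: "nat \<times> nat \<Rightarrow> 'w \<Rightarrow> 'b" and H :: "'w \<Rightarrow> ennreal"
  assumes draws: "cond_draws W F E ({..<N} \<times> UNIV) X \<mu> f q"
    and H: "H \<in> borel_measurable F" "\<And>w. w \<in> space W \<Longrightarrow> w \<notin> E \<Longrightarrow> H w = 0"
    and \<phi>: "\<And>l. l < N \<Longrightarrow> \<phi> l \<in> borel_measurable (F \<Otimes>\<^sub>M \<mu>)" "\<And>l p. \<phi> l p \<le> (1::ennreal)"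
    and \<zeta>: "\<And>l n. l < N \<Longrightarrow> \<zeta> l n \<in> borel_measurable (F \<Otimes>\<^sub>M \<mu>)" "\<And>l n p. \<zeta> l n p \<le> (1::ennreal)"
    and Y: "\<And>l w. Y l w = (\<Sum>n. (\<Prod>k<n. \<phi> l (w, X (l, k) w)) * \<zeta> l n (w, X (l, n) w))"
    and e: "\<And>l w. e l w = (\<Sum>n. (\<integral>\<^sup>+ z. \<phi> l (w, z) * q w z \<partial>\<mu>) ^ n * (\<integral>\<^sup>+ z. \<zeta> l n (w, z) * q w z \<partial>\<mu>))"
  shows "l < N \<Longrightarrow> (\<integral>\<^sup>+ w. H w * Y l w \<partial>W) = (\<integral>\<^sup>+ w. H w * e l w \<partial>W)"
    and "l < N \<Longrightarrow> l' < N \<Longrightarrow> l \<noteq> l' \<Longrightarrow> (\<integral>\<^sup>+ w. H w * (Y l w * Y l' w) \<partial>W) = (\<integral>\<^sup>+ w. H w * (e l w * e l' w) \<partial>W)"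
proof -
  interpret cond_draws W F E "{..<N} \<times> UNIV" X \<mu> f q by (rule draws)
  interpret sigma_finite_measure \<mu> by (rule sf)
  have pX: "(\<lambda>w. (w, X (l, k) w)) \<in> measurable W (F \<Otimes>\<^sub>M \<mu>)" if "l < N" for l k
    using that by (intro pair_X_measurable) simp
  define y where "y l n w = (\<Prod>k<n. \<phi> l (w, X (l, k) w)) * \<zeta> l n (w, X (l, n) w)" for l n w
  define r where "r l n w = (\<integral>\<^sup>+ z. \<phi> l (w, z) * q w z \<partial>\<mu>) ^ n * (\<integral>\<^sup>+ z. \<zeta> l n (w, z) * q w z \<partial>\<mu>)" for l n w
  have HW[measurable]: "H \<in> borel_measurable W" by (rule measurable_from_subalg[OF sub H(1)])
  have ym: "y l n \<in> borel_measurable W" if l: "l < N" for l n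
  proof -
    have [measurable]: "(\<lambda>w. \<phi> l (w, X (l, k) w)) \<in> borel_measurable W" "(\<lambda>w. \<zeta> l n (w, X (l, k) w)) \<in> borel_measurable W" for k n
      using measurable_compose[OF pX[OF l] \<phi>(1)[OF l]] measurable_compose[OF pX[OF l] \<zeta>(1)[OF l]] by auto
    show ?thesis unfolding y_def[abs_def] by measurable
  qed
  have rm: "r l n \<in> borel_measurable W" if l: "l < N" for l n
  proof (rule measurable_from_subalg[OF sub])
    note [measurable] = \<phi>(1)[OF l] \<zeta>(1)[OF l]
    show "r l n \<in> borel_measurable F" unfolding r_def[abs_def] by measurable
  qed
  \<comment> \<open>Trajectory \<open>l\<close>, stopped at \<open>n l\<close>, uses the draws from
    0 to \<open>n l\<close>: \<open>\<phi>\<close> at all but the last, \<open>\<zeta>\<close> at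
    the last. Different trajectories use disjoint sets of draws, so the conditional means
    multiply.\<close>
  have prod: "(\<integral>\<^sup>+ w. H w * (\<Prod>l\<in>L. y l (n l) w) \<partial>W) = (\<integral>\<^sup>+ w. H w * (\<Prod>l\<in>L. r l (n l) w) \<partial>W)"
    if L: "finite L" "L \<subseteq> {..<N}" for L and n :: "nat \<Rightarrow> nat"
  proof -
    define S where "S = Sigma L (\<lambda>l. {..n l})"
    define \<psi> where "\<psi> i = (if snd i < n (fst i) then \<phi> (fst i) else \<zeta> (fst i) (n (fst i)))" for i :: "nat \<times> nat"
    have S: "finite S" "S \<subseteq> {..<N} \<times> UNIV" using L by (auto simp: S_def)
    have "(\<integral>\<^sup>+ w. H w * (\<Prod>i\<in>S. \<psi> i (w, X i w)) \<partial>W) = (\<integral>\<^sup>+ w. H w * (\<Prod>i\<in>S. \<integral>\<^sup>+ z. \<psi> i (w, z) * q w z \<partial>\<mu>) \<partial>W)"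
      by (rule nn_integral_prod[OF H S])
        (use \<phi> \<zeta> L in \<open>auto simp: \<psi>_def S_def\<close>)
    moreover have "(\<Prod>i\<in>S. \<psi> i (w, X i w)) = (\<Prod>l\<in>L. y l (n l) w)" for w
    proof -
      have "(\<Prod>i\<in>S. \<psi> i (w, X i w)) = (\<Prod>l\<in>L. \<Prod>k\<le>n l. \<psi> (l, k) (w, X (l, k) w))"
        unfolding S_def using L by (subst prod.Sigma) (auto intro!: prod.cong)
      also have "\<dots> = (\<Prod>l\<in>L. y l (n l) w)"
        by (intro prod.cong refl) (simp add: y_def \<psi>_def lessThan_Suc_atMost[symmetric])
      finally show ?thesis .
    qed
    moreover have "(\<Prod>i\<in>S. \<integral>\<^sup>+ z. \<psi> i (w, z) * q w z \<partial>\<mu>) = (\<Prod>l\<in>L. r l (n l) w)" for w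
    proof -
      have "(\<Prod>i\<in>S. \<integral>\<^sup>+ z. \<psi> i (w, z) * q w z \<partial>\<mu>) = (\<Prod>l\<in>L. \<Prod>k\<le>n l. \<integral>\<^sup>+ z. \<psi> (l, k) (w, z) * q w z \<partial>\<mu>)"
        unfolding S_def using L by (subst prod.Sigma) (auto intro!: prod.cong)
      also have "\<dots> = (\<Prod>l\<in>L. r l (n l) w)"
        by (intro prod.cong refl) (simp add: r_def \<psi>_def lessThan_Suc_atMost[symmetric])
      finally show ?thesis .
    qed
    ultimately show ?thesis by simp
  qed
  have Yy: "Y l w = (\<Sum>n. y l n w)" and er: "e l w = (\<Sum>n. r l n w)" for l w
    by (simp_all add: Y e y_def r_def)
  show "(\<integral>\<^sup>+ w. H w * Y l w \<partial>W) = (\<integral>\<^sup>+ w. H w * e l w \<partial>W)" if l: "l < N"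
  proof -
    have "(\<integral>\<^sup>+ w. H w * Y l w \<partial>W) = (\<Sum>n. \<integral>\<^sup>+ w. H w * y l n w \<partial>W)"
      unfolding Yy ennreal_suminf_cmult[symmetric] using ym[OF l] by (intro nn_integral_suminf) measurable
    also have "\<dots> = (\<Sum>n. \<integral>\<^sup>+ w. H w * r l n w \<partial>W)"
      using prod[of "{l}" "\<lambda>_. n" for n] l by simp
    also have "\<dots> = (\<integral>\<^sup>+ w. H w * e l w \<partial>W)"
      unfolding er ennreal_suminf_cmult[symmetric] using rm[OF l] by (intro nn_integral_suminf[symmetric]) measurable
    finally show ?thesis .
  qed
  have dbl: "(\<integral>\<^sup>+ w. H w * ((\<Sum>n. u n w) * (\<Sum>n. v n w)) \<partial>W) = (\<Sum>n. \<Sum>n'. \<integral>\<^sup>+ w. H w * (u n w * v n' w) \<partial>W)"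
    if u: "\<And>n. u n \<in> borel_measurable W" and v: "\<And>n. v n \<in> borel_measurable W" for u v :: "nat \<Rightarrow> 'w \<Rightarrow> ennreal"
  proof -
    note [measurable] = u v
    have "(\<integral>\<^sup>+ w. H w * ((\<Sum>n. u n w) * (\<Sum>n. v n w)) \<partial>W) = (\<integral>\<^sup>+ w. (\<Sum>n. \<Sum>n'. H w * (u n w * v n' w)) \<partial>W)"
      by (simp only: ennreal_suminf_cmult ennreal_suminf_multc)
    also have "\<dots> = (\<Sum>n. \<integral>\<^sup>+ w. (\<Sum>n'. H w * (u n w * v n' w)) \<partial>W)" by (rule nn_integral_suminf) measurable
    also have "\<dots> = (\<Sum>n. \<Sum>n'. \<integral>\<^sup>+ w. H w * (u n w * v n' w) \<partial>W)"
    proof -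
      have "(\<integral>\<^sup>+ w. (\<Sum>n'. H w * (u n w * v n' w)) \<partial>W) = (\<Sum>n'. \<integral>\<^sup>+ w. H w * (u n w * v n' w) \<partial>W)" for n
        by (rule nn_integral_suminf) measurable
      then show ?thesis by simp
    qed
    finally show ?thesis .
  qed
  show "(\<integral>\<^sup>+ w. H w * (Y l w * Y l' w) \<partial>W) = (\<integral>\<^sup>+ w. H w * (e l w * e l' w) \<partial>W)" if l: "l < N" "l' < N" "l \<noteq> l'"
  proof -
    have "(\<integral>\<^sup>+ w. H w * (y l n w * y l' n' w) \<partial>W) = (\<integral>\<^sup>+ w. H w * (r l n w * r l' n' w) \<partial>W)" for n n'
      using prod[of "{l, l'}" "\<lambda>i. if i = l then n else n'"] l by simp
    then show ?thesis
      unfolding Yy er dbl[OF ym[OF l(1)] ym[OF l(2)]] dbl[OF rm[OF l(1)] rm[OF l(2)]] by simp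
  qed
qed

text \<open>Given the history, stopped values of different trajectories are uncorrelated, so
  \<open>weighted_weak_law\<close> applies although each of them involves an unbounded number of
  draws. The real functions \<open>y\<close> and \<open>\<epsilon>\<close> stand for the two series,
  with which they agree almost surely where \<open>H\<close> is positive.\<close>

lemma cond_draws_stopped_weak_law:
  fixes X :: "nat \<times> nat \<Rightarrow> 'w \<Rightarrow> 'b" and H :: "'w \<Rightarrow> real" and y \<epsilon> :: "nat \<Rightarrow> 'w \<Rightarrow> real"
  assumes draws: "cond_draws W F E ({..<N} \<times> UNIV) X \<mu> f q"
    and H: "H \<in> borel_measurable F" "\<And>w. 0 \<le> H w" "\<And>w. w \<in> space W \<Longrightarrow> w \<notin> E \<Longrightarrow> H w = 0"
      "(\<integral>\<^sup>+ w. ennreal (H w) \<partial>W) < \<infinity>"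
    and N: "1 \<le> N"
    and \<phi>: "\<And>l. l < N \<Longrightarrow> \<phi> l \<in> borel_measurable (F \<Otimes>\<^sub>M \<mu>)" "\<And>l p. \<phi> l p \<le> (1::ennreal)"
    and \<zeta>: "\<And>l n. l < N \<Longrightarrow> \<zeta> l n \<in> borel_measurable (F \<Otimes>\<^sub>M \<mu>)" "\<And>l n p. \<zeta> l n p \<le> (1::ennreal)"
    and y: "\<And>l. l < N \<Longrightarrow> y l \<in> borel_measurable W" "\<And>l w. 0 \<le> y l w" "\<And>l w. y l w \<le> 1"
      "\<And>l. l < N \<Longrightarrow> AE w in W. 0 < H w \<longrightarrow> ennreal (y l w) = (\<Sum>n. (\<Prod>k<n. \<phi> l (w, X (l, k) w)) * \<zeta> l n (w, X (l, n) w))"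
    and \<epsilon>: "\<And>l. l < N \<Longrightarrow> \<epsilon> l \<in> borel_measurable F" "\<And>l w. 0 \<le> \<epsilon> l w" "\<And>l w. \<epsilon> l w \<le> 1"
      "\<And>l. l < N \<Longrightarrow> AE w in W. 0 < H w \<longrightarrow> ennreal (\<epsilon> l w) = (\<Sum>n. (\<integral>\<^sup>+ z. \<phi> l (w, z) * q w z \<partial>\<mu>) ^ n * (\<integral>\<^sup>+ z. \<zeta> l n (w, z) * q w z \<partial>\<mu>))"
  shows "(\<integral>\<^sup>+ w. ennreal (H w * \<bar>(\<Sum>l<N. y l w) / N - (\<Sum>l<N. \<epsilon> l w) / N\<bar>) \<partial>W)
     \<le> ennreal (1 / sqrt N) * (\<integral>\<^sup>+ w. ennreal (H w) \<partial>W)" (is ?A)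
    and "\<And>l. l < N \<Longrightarrow> (\<integral>\<^sup>+ w. ennreal (H w) * ennreal (y l w) \<partial>W) = (\<integral>\<^sup>+ w. ennreal (H w) * ennreal (\<epsilon> l w) \<partial>W)"
proof -
  interpret cond_draws W F E "{..<N} \<times> UNIV" X \<mu> f q by (rule draws)
  define Y where "Y l w = (\<Sum>n. (\<Prod>k<n. \<phi> l (w, X (l, k) w)) * \<zeta> l n (w, X (l, n) w))" for l w
  define e where "e l w = (\<Sum>n. (\<integral>\<^sup>+ z. \<phi> l (w, z) * q w z \<partial>\<mu>) ^ n * (\<integral>\<^sup>+ z. \<zeta> l n (w, z) * q w z \<partial>\<mu>))" for l w
  have Hn: "ennreal (H w) = 0 \<or> 0 < H w" for w using H(2)[of w] by (cases "H w = 0") auto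
  have HF: "(\<lambda>w. ennreal (H w)) \<in> borel_measurable F" using H(1) by measurable
  have HW: "H \<in> borel_measurable W" by (rule measurable_from_subalg[OF sub H(1)])
  note st = cond_draws_stopped[OF draws _ _ \<phi> \<zeta> Y_def e_def]
  have Hz: "w \<in> space W \<Longrightarrow> w \<notin> E \<Longrightarrow> ennreal (H w) * R w = 0" for w R using H(3) by simp
  have cy: "(\<integral>\<^sup>+ w. ennreal (H w) * (ennreal (y l w) * R w) \<partial>W) = (\<integral>\<^sup>+ w. ennreal (H w) * (Y l w * R w) \<partial>W)" if "l < N" for l R
  proof (rule nn_integral_cong_AE)
    show "AE w in W. ennreal (H w) * (ennreal (y l w) * R w) = ennreal (H w) * (Y l w * R w)"
      using y(4)[OF that] unfolding Y_def[symmetric] by eventually_elim (metis Hn mult_zero_left)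
  qed
  have ce: "(\<integral>\<^sup>+ w. ennreal (H w) * (ennreal (\<epsilon> l w) * R w) \<partial>W) = (\<integral>\<^sup>+ w. ennreal (H w) * (e l w * R w) \<partial>W)" if "l < N" for l R
  proof (rule nn_integral_cong_AE)
    show "AE w in W. ennreal (H w) * (ennreal (\<epsilon> l w) * R w) = ennreal (H w) * (e l w * R w)"
      using \<epsilon>(4)[OF that] unfolding e_def[symmetric] by eventually_elim (metis Hn mult_zero_left)
  qed
  \<comment> \<open>A factor measurable in the history joins the weight. This supplies the moments
    that mix a stopped value with a conditional mean.\<close>
  have m1: "(\<integral>\<^sup>+ w. ennreal (H w) * (ennreal (y l w) * R w) \<partial>W) = (\<integral>\<^sup>+ w. ennreal (H w) * (ennreal (\<epsilon> l w) * R w) \<partial>W)"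
    if l: "l < N" and R: "R \<in> borel_measurable F" for l R
  proof -
    have "(\<lambda>w. ennreal (H w) * R w) \<in> borel_measurable F" using HF R by measurable
    then have "(\<integral>\<^sup>+ w. ennreal (H w) * R w * Y l w \<partial>W) = (\<integral>\<^sup>+ w. ennreal (H w) * R w * e l w \<partial>W)"
      by (rule st(1)) (use Hz l in auto)
    then show ?thesis unfolding cy[OF l] ce[OF l] by (simp add: mult_ac)
  qed
  have m2: "(\<integral>\<^sup>+ w. ennreal (H w) * (ennreal (y l w) * ennreal (y l' w)) \<partial>W) = (\<integral>\<^sup>+ w. ennreal (H w) * (ennreal (\<epsilon> l w) * ennreal (\<epsilon> l' w)) \<partial>W)"
    if l: "l < N" "l' < N" "l \<noteq> l'" for l l'
  proof -
    have "(\<integral>\<^sup>+ w. ennreal (H w) * (ennreal (y l w) * ennreal (y l' w)) \<partial>W) = (\<integral>\<^sup>+ w. ennreal (H w) * (Y l w * Y l' w) \<partial>W)"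
      unfolding cy[OF l(1)] using cy[OF l(2), of "Y l"] by (simp add: mult_ac)
    also have "\<dots> = (\<integral>\<^sup>+ w. ennreal (H w) * (e l w * e l' w) \<partial>W)"
      by (rule st(2)[OF HF]) (use H(3) l in auto)
    also have "\<dots> = (\<integral>\<^sup>+ w. ennreal (H w) * (ennreal (\<epsilon> l w) * ennreal (\<epsilon> l' w)) \<partial>W)"
      unfolding ce[OF l(1)] using ce[OF l(2), of "e l"] by (simp add: mult_ac)
    finally show ?thesis .
  qed
  have \<epsilon>W: "\<epsilon> l \<in> borel_measurable W" if "l < N" for l by (rule measurable_from_subalg[OF sub \<epsilon>(1)[OF that]])
  show ?A
  proof (rule weighted_weak_law[OF N zero_less_one HW H(2) H(4)])
    show "(\<integral>\<^sup>+ w. ennreal (H w) * (ennreal (y i w) * ennreal (\<epsilon> j w)) \<partial>W) = (\<integral>\<^sup>+ w. ennreal (H w) * (ennreal (\<epsilon> i w) * ennreal (\<epsilon> j w)) \<partial>W)"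
      if "i < N" "j < N" for i j
      using \<epsilon>(1)[OF that(2)] by (intro m1[OF that(1)]) measurable
  qed (use y \<epsilon> \<epsilon>W m2 in auto)
  show "(\<integral>\<^sup>+ w. ennreal (H w) * ennreal (y l w) \<partial>W) = (\<integral>\<^sup>+ w. ennreal (H w) * ennreal (\<epsilon> l w) \<partial>W)" if "l < N" for l
    using m1[OF that, of "\<lambda>_. 1"] by simp
qed

lemma stopped_sum:
  fixes c :: "nat \<Rightarrow> ennreal"
  assumes "P n0" "\<And>k. k < n0 \<Longrightarrow> \<not> P k"
  shows "(\<Sum>n. (\<Prod>k<n. if P k then 0 else 1) * (if P n then c n else 0)) = c n0"
proof -
  have "(\<Prod>k<n. if P k then 0 else 1) * (if P n then c n else 0) = 0" if "n \<notin> {n0}" for n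
  proof (cases "n < n0")
    case True then show ?thesis using assms by simp
  next
    case False
    then have "(\<Prod>k<n. if P k then 0 else 1 :: ennreal) = 0" using assms that by (intro prod_zero) auto
    then show ?thesis by simp
  qed
  then have "(\<Sum>n. (\<Prod>k<n. if P k then 0 else 1) * (if P n then c n else 0)) = (\<Sum>n\<in>{n0}. (\<Prod>k<n. if P k then 0 else 1) * (if P n then c n else 0))"
    by (intro suminf_finite) auto
  also have "\<dots> = c n0" using assms by (simp add: prod.neutral)
  finally show ?thesis .
qed

abbreviation "Unif \<equiv> uniform_measure lborel {0..1::real}"

lemma prob_space_Unif: "prob_space Unif"
  by (rule prob_space_uniform_measure) auto

lemma nn_integral_Unif_le:
  assumes "0 \<le> c" "c \<le> 1"
  shows "(\<integral>\<^sup>+ u. (if u \<le> c then 1 else 0) \<partial>Unif) = ennreal c"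
    "(\<integral>\<^sup>+ u. (if u \<le> c then 0 else 1) \<partial>Unif) = ennreal (1 - c)"
proof -
  have "(\<integral>\<^sup>+ u. (if u \<le> c then 1 else 0) \<partial>Unif) = (\<integral>\<^sup>+ u. indicator {..c} u \<partial>Unif)"
    by (intro nn_integral_cong) (auto simp: indicator_def)
  also have "\<dots> = emeasure lborel ({0..1} \<inter> {..c})" by (simp add: divide_ennreal_def)
  also have "{0..1} \<inter> {..c} = {0..c}" using assms by auto
  finally show "(\<integral>\<^sup>+ u. (if u \<le> c then 1 else 0) \<partial>Unif) = ennreal c" using assms by simp
  have "(\<integral>\<^sup>+ u. (if u \<le> c then 0 else 1) \<partial>Unif) = (\<integral>\<^sup>+ u. indicator {c<..} u \<partial>Unif)"
    by (intro nn_integral_cong) (auto simp: indicator_def)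
  also have "\<dots> = emeasure lborel ({0..1} \<inter> {c<..})" by (simp add: divide_ennreal_def)
  also have "{0..1} \<inter> {c<..} = {c<..1}" using assms by auto
  finally show "(\<integral>\<^sup>+ u. (if u \<le> c then 0 else 1) \<partial>Unif) = ennreal (1 - c)" using assms by simp
qed

subsection \<open>The backward pass\<close>

context adapted_ffbsi begin

abbreviation "bh N s \<equiv> backward_hist N (W N) T (\<xi> N) (I N) (J N) (V N) (U N) s"
abbreviation "HT N \<equiv> H N (Suc T)"

lemma terminal: "1 \<le> N \<Longrightarrow> cond_iid_prop_to (W N) (F N (Suc T)) {..<N} (J N T) (count_space {..<N}) (\<lambda>w j. ennreal (wt N T j w))"
  using fast_ffbsi.terminal[OF systems] .

lemma proposals: "1 \<le> N \<Longrightarrow> s < T \<Longrightarrow> cond_iid_prop_to (W N) (bh N s) ({..<N} \<times> UNIV)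
   (\<lambda>(l, k) w. (V N s l k w, U N s l k w)) (count_space {..<N} \<Otimes>\<^sub>M Unif) (\<lambda>w (j, _). ennreal (wt N s j w))"
  using fast_ffbsi.proposals[OF systems] .

lemma J_measurable: assumes "1 \<le> N" "t \<le> T" "l < N" shows "J N t l \<in> measurable (W N) (count_space {..<N})"
proof (cases "t = T")
  case True then show ?thesis using terminal[OF assms(1)] assms by (auto simp: cond_iid_prop_to_def)
next
  case False then show ?thesis using fast_ffbsi.index_measurable[OF systems[OF assms(1)], of t l] assms by auto
qed

lemma VU_measurable: assumes "1 \<le> N" "s < T" "l < N" shows "(\<lambda>w. (V N s l k w, U N s l k w)) \<in> measurable (W N) (count_space {..<N} \<Otimes>\<^sub>M Unif)"
  using bspec[OF conjunct1[OF proposals[OF assms(1,2), unfolded cond_iid_prop_to_def]], of "(l, k)"] assms by simp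

lemma space_bh: "space (bh N s) = space (W N)"
  unfolding backward_hist_def
  by (rule space_measure_of) (use sets.space_closed[of "F N (Suc T)"] in \<open>auto simp: space_F\<close>)

lemma sets_bh: "sets (bh N s) = sigma_sets (space (W N))
     (sets (F N (Suc T)) \<union>
      {J N u l -` A \<inter> space (W N) | u l A. s < u \<and> u \<le> T \<and> l < N} \<union>
      {V N u l k -` A \<inter> space (W N) | u l k A. s < u \<and> u < T \<and> l < N} \<union>
      {U N u l k -` A \<inter> space (W N) | u l k A. s < u \<and> u < T \<and> l < N \<and> A \<in> sets borel})"
  unfolding backward_hist_def
  by (rule sets_measure_of) (use sets.space_closed[of "F N (Suc T)"] in \<open>auto simp: space_F\<close>)

lemma vimage_count_space: "f \<in> measurable M (count_space {..<N::nat}) \<Longrightarrow> f -` A \<inter> space M \<in> sets M"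
proof -
  assume f: "f \<in> measurable M (count_space {..<N})"
  have "f -` A \<inter> space M = f -` (A \<inter> {..<N}) \<inter> space M" using measurable_space[OF f] by auto
  also have "\<dots> \<in> sets M" using measurable_sets[OF f, of "A \<inter> {..<N}"] by auto
  finally show ?thesis .
qed

lemma subalgebra_bh: assumes N: "1 \<le> N" shows "subalgebra (W N) (bh N s)"
  unfolding subalgebra_def space_bh
proof
  show "sets (bh N s) \<subseteq> sets (W N)" unfolding sets_bh
  proof (rule sets.sigma_sets_subset, intro Un_least)
    show "sets (F N (Suc T)) \<subseteq> sets (W N)" using subalgebra_F[OF N order_refl] by (simp add: subalgebra_def)
    show "{J N u l -` A \<inter> space (W N) | u l A. s < u \<and> u \<le> T \<and> l < N} \<subseteq> sets (W N)"
      by (clarify, rule vimage_count_space, rule J_measurable[OF N])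
    have "V N u l k \<in> measurable (W N) (count_space {..<N})" if "u < T" "l < N" for u l k
      using measurable_compose[OF VU_measurable[OF N that] measurable_fst] by simp
    then show "{V N u l k -` A \<inter> space (W N) | u l k A. s < u \<and> u < T \<and> l < N} \<subseteq> sets (W N)"
      by (clarify, intro vimage_count_space)
    have "U N u l k \<in> measurable (W N) borel" if "u < T" "l < N" for u l k
      using measurable_compose[OF VU_measurable[OF N that] measurable_snd]
        measurable_cong_sets[of "W N" "W N" Unif borel] by simp
    then show "{U N u l k -` A \<inter> space (W N) | u l k A. s < u \<and> u < T \<and> l < N \<and> A \<in> sets borel} \<subseteq> sets (W N)"
      by (clarify, intro measurable_sets)
  qed
qed simp

lemma F_sub_bh: "subalgebra (bh N s) (F N (Suc T))"
  unfolding subalgebra_def space_bh space_F sets_bh by (intro conjI refl subsetI sigma_sets.Basic) simp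

lemma F_bh: "t \<le> Suc T \<Longrightarrow> f \<in> measurable (F N t) L \<Longrightarrow> f \<in> measurable (bh N s) L"
proof -
  assume t: "t \<le> Suc T" and f: "f \<in> measurable (F N t) L"
  have "subalgebra (F N (Suc T)) (F N t)" using forward_hist_mono[OF t] by (simp add: subalgebra_def space_F)
  from measurable_from_subalg[OF F_sub_bh measurable_from_subalg[OF this f]] show ?thesis .
qed

lemma J_bh: assumes "1 \<le> N" "s < u" "u \<le> T" "l < N" shows "J N u l \<in> measurable (bh N s) (count_space {..<N})"
proof (rule measurableI)
  show "J N u l w \<in> space (count_space {..<N})" if "w \<in> space (bh N s)" for w
    using measurable_space[OF J_measurable[OF assms(1,3,4)]] that by (simp add: space_bh)
  show "J N u l -` A \<inter> space (bh N s) \<in> sets (bh N s)" for A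
  proof -
    have "J N u l -` A \<inter> space (W N) \<in> {J N u l -` A \<inter> space (W N) | u l A. s < u \<and> u \<le> T \<and> l < N}"
      by (intro CollectI exI[of _ u] exI[of _ l] exI[of _ A] conjI refl assms)
    then show ?thesis unfolding space_bh sets_bh by (intro sigma_sets.Basic UnI1[OF UnI1[OF UnI2]])
  qed
qed

text \<open>The common density, with respect to counting measure, of the terminal indices (for
  \<open>t = T\<close>) and of the proposed indices.\<close>

definition index_q :: "nat \<Rightarrow> nat \<Rightarrow> 'w \<Rightarrow> nat \<Rightarrow> ennreal" where
  "index_q N t w j = ennreal (a t (\<xi> N t j w)) / ennreal (weight_sum N t w)"

lemma all_weights: assumes "1 \<le> N" shows "AE w in W N. 0 < HT N w \<longrightarrow> (\<forall>t\<le>T. \<forall>i<N. wt N t i w = a t (\<xi> N t i w))"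
proof -
  have "AE w in W N. \<forall>t. t \<le> T \<longrightarrow> 0 < H N t w \<longrightarrow> (\<forall>i<N. wt N t i w = a t (\<xi> N t i w))"
    unfolding AE_all_countable using weights_AE[OF assms] by auto
  then show ?thesis
  proof eventually_elim
    case (elim w)
    then show ?case using H_pos_le[of N "Suc T" w] by auto
  qed
qed

text \<open>All factors of a positive \<open>HT\<close> are positive, and the factor at time
  \<open>t\<close> is an average of the weights \<open>a t\<close> multiplied by adjustments; it
  would be 0 if all these weights were.\<close>

lemma HT_weight_sum: assumes "0 < HT N w" "t \<le> T" shows "0 < weight_sum N t w"
proof (rule ccontr)
  assume "\<not> 0 < weight_sum N t w"
  then have "weight_sum N t w = 0" using weight_sum_nonneg[of N t w] by simp
  then have "a t (\<xi> N t j w) = 0" if "j < N" for j using that by (simp add: weight_sum_def sum_nonneg_eq_0_iff a_nonneg)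
  then have "S N t w = 0" by (simp add: S_def)
  then show False using H_pos_mono[of N t w] H_pos_le[OF assms(1), of "Suc t"] assms(2) by simp
qed

text \<open>As \<open>\<theta>'\<close> equals 1 beyond \<open>T\<close>, the last factor of the
  product is the plain mean of the terminal weights. This is why the backward pass is weighted by
  \<open>H N (Suc T)\<close>: its last factor normalizes the terminal draw.\<close>

lemma HT_eq: "HT N w = avg N T (a T) (\<lambda>_ _. 1) w"
  by (simp add: H_Suc avg_def S_def \<theta>'_def)

lemma nn_integral_HT: "1 \<le> N \<Longrightarrow> (\<integral>\<^sup>+ w. ennreal (HT N w) \<partial>W N) = evid T"
  unfolding HT_eq evid_def by (rule avg_mean) (auto simp: a_nonneg)

lemma sum_index_q:
  assumes "0 < weight_sum N t w" "\<And>j. 0 \<le> c j"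
  shows "(\<Sum>j<N. ennreal (c j) * index_q N t w j) = ennreal ((\<Sum>j<N. a t (\<xi> N t j w) * c j) / weight_sum N t w)"
proof -
  have "(\<Sum>j<N. ennreal (c j) * index_q N t w j) = (\<Sum>j<N. ennreal (a t (\<xi> N t j w) * c j / weight_sum N t w))"
    using assms by (intro sum.cong refl)
      (simp add: index_q_def ennreal_times_divide ennreal_mult[symmetric] a_nonneg divide_ennreal mult.commute)
  also have "\<dots> = ennreal ((\<Sum>j<N. a t (\<xi> N t j w) * c j) / weight_sum N t w)"
    unfolding sum_divide_distrib using assms by (intro sum_ennreal) (simp add: a_nonneg)
  finally show ?thesis .
qed

lemma index_q_measurable: assumes "t \<le> T" shows "(\<lambda>p. index_q N t (fst p) (snd p)) \<in> borel_measurable (F N (Suc T) \<Otimes>\<^sub>M count_space {..<N})"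
proof -
  have [measurable]: "(\<lambda>p :: 'w \<times> nat. \<xi> N t (snd p) (fst p)) \<in> measurable (F N (Suc T) \<Otimes>\<^sub>M count_space {..<N}) borel"
    by (rule measurable_pick[where h="\<lambda>j p. \<xi> N t j (fst p)" and N=N, OF measurable_compose[OF measurable_fst xi_F] measurable_snd])
      (use assms in auto)
  have [measurable]: "weight_sum N t \<in> borel_measurable (F N (Suc T))" using assms by (intro weight_sum_measurable) auto
  show ?thesis unfolding index_q_def by measurable
qed

definition back_avg :: "nat \<Rightarrow> nat \<Rightarrow> ('w \<Rightarrow> 'x \<Rightarrow> real) \<Rightarrow> 'w \<Rightarrow> real" where
  "back_avg N t \<psi> w = HT N w * ((\<Sum>l<N. \<psi> w (\<xi> N t (J N t l w) w)) / N)"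

lemma terminal_law:
  assumes N: "1 \<le> N"
  shows "AE w in W N. w \<in> E N (Suc T) \<longrightarrow> 0 < (\<integral>\<^sup>+ j. ennreal (wt N T j w) \<partial>count_space {..<N}) \<and>
     law_prop_to (count_space {..<N}) (\<lambda>j. ennreal (wt N T j w)) = density (count_space {..<N}) (index_q N T w) \<and>
     (\<integral>\<^sup>+ j. index_q N T w j \<partial>count_space {..<N}) = 1"
  using all_weights[OF N]
proof eventually_elim
  case (elim w)
  show ?case
  proof
    assume "w \<in> E N (Suc T)"
    then have pos: "0 < HT N w" by simp
    then have wt: "wt N T j w = a T (\<xi> N T j w)" if "j < N" for j using elim that by auto
    have ws: "0 < weight_sum N T w" using HT_weight_sum[OF pos] by simp
    have i: "(\<integral>\<^sup>+ j. ennreal (wt N T j w) \<partial>count_space {..<N}) = ennreal (weight_sum N T w)"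
      using wt by (simp add: nn_integral_count_space_finite weight_sum_def a_nonneg sum_ennreal)
    have "law_prop_to (count_space {..<N}) (\<lambda>j. ennreal (wt N T j w)) = density (count_space {..<N}) (index_q N T w)"
      unfolding law_prop_to_def i by (rule density_cong) (auto simp: wt index_q_def AE_count_space)
    moreover have "(\<integral>\<^sup>+ j. index_q N T w j \<partial>count_space {..<N}) = 1"
      using sum_index_q[OF ws, of "\<lambda>_. 1"] ws by (simp add: nn_integral_count_space_finite weight_sum_def[symmetric])
    ultimately show "0 < (\<integral>\<^sup>+ j. ennreal (wt N T j w) \<partial>count_space {..<N}) \<and>
     law_prop_to (count_space {..<N}) (\<lambda>j. ennreal (wt N T j w)) = density (count_space {..<N}) (index_q N T w) \<and>
     (\<integral>\<^sup>+ j. index_q N T w j \<partial>count_space {..<N}) = 1" using i ws by simp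
  qed
qed

lemma terminal_draws:
  assumes N: "1 \<le> N"
  shows "cond_draws (W N) (F N (Suc T)) (E N (Suc T)) {..<N} (J N T) (count_space {..<N}) (\<lambda>w j. ennreal (wt N T j w)) (index_q N T)"
proof (intro cond_draws.intro prob_W[OF N] subalgebra_F[OF N] E_F[OF order_refl] terminal[OF N] terminal_law[OF N])
  show "sigma_finite_measure (count_space {..<N})" by (rule sigma_finite_measure_count_space_finite) simp
  show "(\<lambda>(w, j). index_q N T w j) \<in> borel_measurable (F N (Suc T) \<Otimes>\<^sub>M count_space {..<N})"
    using index_q_measurable[of T N] by (simp add: case_prod_beta')
qed simp

lemma HT_zero: "w \<in> space (W N) \<Longrightarrow> w \<notin> E N (Suc T) \<Longrightarrow> HT N w = 0"
  using H_nonneg[of N "Suc T" w] by simp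

lemma particle_at_measurable:
  assumes t: "t \<le> T" and \<psi>: "(\<lambda>p. \<psi> (fst p) (snd p)) \<in> borel_measurable (F N (Suc T) \<Otimes>\<^sub>M borel)"
  shows "(\<lambda>p. \<psi> (fst p) (\<xi> N t (snd p) (fst p)) :: real) \<in> borel_measurable (F N (Suc T) \<Otimes>\<^sub>M count_space {..<N})"
proof -
  have "(\<lambda>p :: 'w \<times> nat. \<xi> N t (snd p) (fst p)) \<in> measurable (F N (Suc T) \<Otimes>\<^sub>M count_space {..<N}) borel"
    by (rule measurable_pick[where h="\<lambda>j p. \<xi> N t j (fst p)" and N=N, OF measurable_compose[OF measurable_fst xi_F] measurable_snd])
      (use t in auto)
  from measurable_compose[OF measurable_Pair[OF measurable_fst this] \<psi>] show ?thesis by simp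
qed

text \<open>The conditional mean under the terminal draw has the weight sum as denominator, and the
  last factor of \<open>HT\<close> cancels it. What remains is the particle average with the
  function \<open>a T\<close>.\<close>

lemma back_avg_terminal:
  assumes N: "1 \<le> N"
    and \<psi>: "(\<lambda>p. \<psi> (fst p) (snd p)) \<in> borel_measurable (F N (Suc T) \<Otimes>\<^sub>M borel)" and \<psi>0: "\<And>w x. 0 \<le> \<psi> w x" "\<And>w x. \<psi> w x \<le> 1"
  shows "(\<integral>\<^sup>+ w. ennreal \<bar>back_avg N T \<psi> w - avg N T (a T) \<psi> w\<bar> \<partial>W N) \<le> ennreal (1 / sqrt N) * evid T"
    and "(\<integral>\<^sup>+ w. ennreal (back_avg N T \<psi> w) \<partial>W N) = (\<integral>\<^sup>+ w. ennreal (avg N T (a T) \<psi> w) \<partial>W N)"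
proof -
  let ?\<phi> = "\<lambda>p. \<psi> (fst p) (\<xi> N T (snd p) (fst p))"
  have \<phi>: "?\<phi> \<in> borel_measurable (F N (Suc T) \<Otimes>\<^sub>M count_space {..<N})" by (rule particle_at_measurable[OF order_refl \<psi>])
  have sub: "subalgebra (W N) (F N (Suc T))" using N by (intro subalgebra_F) auto
  have fin: "(\<integral>\<^sup>+ w. ennreal (HT N w) \<partial>W N) < \<infinity>" using nn_integral_HT[OF N] evid_finite[of T] by simp
  have e: "ennreal (HT N w) * (\<integral>\<^sup>+ j. ennreal (?\<phi> (w, j)) * index_q N T w j \<partial>count_space {..<N}) = ennreal (avg N T (a T) \<psi> w)"
    "HT N w * enn2real (\<integral>\<^sup>+ j. ennreal (?\<phi> (w, j)) * index_q N T w j \<partial>count_space {..<N}) = avg N T (a T) \<psi> w" for w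
  proof -
    have a: "0 \<le> avg N T (a T) \<psi> w" by (rule avg_nonneg) (auto simp: a_nonneg \<psi>0)
    show 1: "ennreal (HT N w) * (\<integral>\<^sup>+ j. ennreal (?\<phi> (w, j)) * index_q N T w j \<partial>count_space {..<N}) = ennreal (avg N T (a T) \<psi> w)"
    proof (cases "weight_sum N T w = 0")
      case True
      then have "a T (\<xi> N T j w) = 0" if "j < N" for j using that by (simp add: weight_sum_def sum_nonneg_eq_0_iff a_nonneg)
      then show ?thesis by (simp add: HT_eq avg_def)
    next
      case False
      then have ws: "0 < weight_sum N T w" using weight_sum_nonneg[of N T w] by simp
      have "HT N w = H N T w * (weight_sum N T w / N)" by (simp add: HT_eq avg_def weight_sum_def)
      then have "HT N w * ((\<Sum>j<N. a T (\<xi> N T j w) * \<psi> w (\<xi> N T j w)) / weight_sum N T w) = avg N T (a T) \<psi> w"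
        using ws by (simp add: avg_def)
      then show ?thesis using sum_index_q[OF ws, of "\<lambda>j. \<psi> w (\<xi> N T j w)"] \<psi>0
        by (simp add: nn_integral_count_space_finite ennreal_mult'[symmetric] H_nonneg)
    qed
    from arg_cong[OF 1, of enn2real] a H_nonneg[of N "Suc T" w]
    show "HT N w * enn2real (\<integral>\<^sup>+ j. ennreal (?\<phi> (w, j)) * index_q N T w j \<partial>count_space {..<N}) = avg N T (a T) \<psi> w"
      by (simp add: enn2real_mult)
  qed
  have "(\<integral>\<^sup>+ w. ennreal \<bar>back_avg N T \<psi> w - avg N T (a T) \<psi> w\<bar> \<partial>W N)
    = (\<integral>\<^sup>+ w. ennreal (HT N w * \<bar>(\<Sum>i<N. ?\<phi> (w, J N T i w)) / N - enn2real (\<integral>\<^sup>+ j. ennreal (?\<phi> (w, j)) * index_q N T w j \<partial>count_space {..<N})\<bar>) \<partial>W N)"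
  proof (rule nn_integral_cong)
    fix w
    have "\<bar>HT N w * x - HT N w * y\<bar> = HT N w * \<bar>x - y\<bar>" for x y
      using H_nonneg[of N "Suc T" w] by (simp add: right_diff_distrib[symmetric] abs_mult)
    then show "ennreal \<bar>back_avg N T \<psi> w - avg N T (a T) \<psi> w\<bar> = ennreal (HT N w * \<bar>(\<Sum>i<N. ?\<phi> (w, J N T i w)) / N - enn2real (\<integral>\<^sup>+ j. ennreal (?\<phi> (w, j)) * index_q N T w j \<partial>count_space {..<N})\<bar>)"
      unfolding e(2)[symmetric] back_avg_def by (simp only: fst_conv snd_conv)
  qed
  also have "\<dots> \<le> ennreal (1 / sqrt N) * (\<integral>\<^sup>+ w. ennreal (HT N w) \<partial>W N)"
    by (rule cond_draws_weak_law[OF terminal_draws[OF N] H_F' H_nonneg HT_zero fin N \<phi>])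
      (auto simp: \<psi>0)
  finally show "(\<integral>\<^sup>+ w. ennreal \<bar>back_avg N T \<psi> w - avg N T (a T) \<psi> w\<bar> \<partial>W N) \<le> ennreal (1 / sqrt N) * evid T"
    by (simp add: nn_integral_HT[OF N])
  have [measurable]: "HT N \<in> borel_measurable (W N)" using N by (intro H_measurable_W) auto
  have \<phi>J: "(\<lambda>w. ?\<phi> (w, J N T i w)) \<in> borel_measurable (W N)" if "i \<in> {..<N}" for i
    using measurable_compose[OF measurable_Pair[OF measurable_ident_subalgebra[OF sub] J_measurable[OF N order_refl]] \<phi>, of i] that by simp
  have each: "(\<integral>\<^sup>+ w. ennreal (HT N w) * ennreal (?\<phi> (w, J N T i w)) \<partial>W N) = (\<integral>\<^sup>+ w. ennreal (avg N T (a T) \<psi> w) \<partial>W N)" if "i < N" for i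
  proof -
    have "(\<lambda>w. ennreal (HT N w)) \<in> borel_measurable (F N (Suc T))" "(\<lambda>p. ennreal (?\<phi> p)) \<in> borel_measurable (F N (Suc T) \<Otimes>\<^sub>M count_space {..<N})"
      using \<phi> by measurable
    from cond_draws.nn_integral_weighted[OF terminal_draws[OF N] this(1) _ _ _ _ _ _ this(2), of "{}" i "\<lambda>_ _. 0"]
    have "(\<integral>\<^sup>+ w. ennreal (HT N w) * ennreal (?\<phi> (w, J N T i w)) \<partial>W N) = (\<integral>\<^sup>+ w. ennreal (HT N w) * (\<integral>\<^sup>+ j. ennreal (?\<phi> (w, j)) * index_q N T w j \<partial>count_space {..<N}) \<partial>W N)"
      using that HT_zero by simp
    then show ?thesis unfolding e(1) .
  qed
  show "(\<integral>\<^sup>+ w. ennreal (back_avg N T \<psi> w) \<partial>W N) = (\<integral>\<^sup>+ w. ennreal (avg N T (a T) \<psi> w) \<partial>W N)"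
    unfolding back_avg_def
    using nn_integral_weighted_avg_const[of N "HT N" "W N" "\<lambda>i w. \<psi> w (\<xi> N T (J N T i w) w)"] N \<phi>J each by (simp add: H_nonneg \<psi>0)
qed

end

section \<open>Counting trials and evaluating one accept-reject loop\<close>

lemma trials_first:
  assumes "accepted m \<sigma> \<xi> J V U s l n0 w" "\<And>k. k < n0 \<Longrightarrow> \<not> accepted m \<sigma> \<xi> J V U s l k w"
  shows "trials m \<sigma> \<xi> J V U s l w = enat (Suc n0)"
proof (rule antisym)
  show "trials m \<sigma> \<xi> J V U s l w \<le> enat (Suc n0)"
    unfolding trials_def by (rule INF_lower) (use assms in auto)
  show "enat (Suc n0) \<le> trials m \<sigma> \<xi> J V U s l w"
    unfolding trials_def by (rule INF_greatest) (use assms not_less in auto)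
qed

text \<open>Tail-sum formula: trial number \<open>k + 1\<close> takes place exactly if the first
  \<open>k\<close> proposals are rejected. The empty product counts the first trial, and a loop
  without acceptance gives infinity on both sides.\<close>

lemma ennreal_trials:
  "ennreal_of_enat (trials m \<sigma> \<xi> J V U s l w) = (\<Sum>k. \<Prod>j<k. if accepted m \<sigma> \<xi> J V U s l j w then 0 else 1)"
proof (cases "\<exists>n. accepted m \<sigma> \<xi> J V U s l n w")
  case True
  define n0 where "n0 = (LEAST n. accepted m \<sigma> \<xi> J V U s l n w)"
  have n0: "accepted m \<sigma> \<xi> J V U s l n0 w" "\<And>k. k < n0 \<Longrightarrow> \<not> accepted m \<sigma> \<xi> J V U s l k w"
    using True LeastI_ex[of "\<lambda>n. accepted m \<sigma> \<xi> J V U s l n w"] not_less_Least by (auto simp: n0_def)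
  have "(\<Sum>k. \<Prod>j<k. if accepted m \<sigma> \<xi> J V U s l j w then 0 else 1 :: ennreal) = (\<Sum>k\<in>{..n0}. \<Prod>j<k. if accepted m \<sigma> \<xi> J V U s l j w then 0 else 1)"
    by (rule suminf_finite) (use n0(1) in \<open>auto intro!: prod_zero bexI[of _ n0]\<close>)
  also have "\<dots> = (\<Sum>k\<in>{..n0}. 1)" by (intro sum.cong refl prod.neutral) (use n0(2) in auto)
  also have "\<dots> = ennreal_of_enat (enat (Suc n0))" by simp
  finally show ?thesis using trials_first[OF n0] by simp
next
  case False
  then have "trials m \<sigma> \<xi> J V U s l w = \<infinity>" by (simp add: trials_def top_enat_def)
  moreover have "(\<Sum>k. \<Prod>j<k. if accepted m \<sigma> \<xi> J V U s l j w then 0 else 1 :: ennreal) = (SUP n. of_nat n)"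
    using False by (simp add: suminf_eq_SUP)
  ultimately show ?thesis by (simp add: ennreal_SUP_of_nat_eq_top)
qed

context adapted_ffbsi begin

definition next_particle :: "nat \<Rightarrow> nat \<Rightarrow> nat \<Rightarrow> 'w \<Rightarrow> 'x" where
  "next_particle N s l w = \<xi> N (Suc s) (J N (Suc s) l w) w"

text \<open>This function and \<open>accept_val\<close> are shaped as the continuation factor
  \<open>\<phi>\<close> and the final value \<open>\<zeta>\<close> of
  \<open>cond_draws_stopped\<close>. The successor particle in them belongs to the history
  \<open>bh N s\<close>.\<close>

definition reject_ind :: "nat \<Rightarrow> nat \<Rightarrow> nat \<Rightarrow> 'w \<times> nat \<times> real \<Rightarrow> ennreal" where
  "reject_ind N s l = (\<lambda>(w, j, u). if u \<le> m (\<xi> N s j w) (next_particle N s l w) / \<sigma> then 0 else 1)"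

definition accept_val :: "nat \<Rightarrow> nat \<Rightarrow> ('w \<Rightarrow> 'x \<Rightarrow> real) \<Rightarrow> nat \<Rightarrow> 'w \<times> nat \<times> real \<Rightarrow> ennreal" where
  "accept_val N s \<psi> l = (\<lambda>(w, j, u). if u \<le> m (\<xi> N s j w) (next_particle N s l w) / \<sigma> then ennreal (\<psi> w (\<xi> N s j w)) else 0)"

abbreviation "acc N s l k w \<equiv> accepted m \<sigma> (\<xi> N) (J N) (V N) (U N) s l k w"
abbreviation "VU N s \<equiv> \<lambda>(l, k) w. (V N s l k w, U N s l k w)"
abbreviation "qs N s w \<equiv> \<lambda>(j :: nat, u :: real). index_q N s w j"
abbreviation "prop_space N \<equiv> count_space {..<N::nat} \<Otimes>\<^sub>M Unif"

lemma next_particle_bh: assumes N: "1 \<le> N" and s: "s < T" and l: "l < N" shows "next_particle N s l \<in> measurable (bh N s) borel"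
  unfolding next_particle_def[abs_def]
  by (rule measurable_pick[where N=N, OF F_bh[OF order_refl xi_F] J_bh[OF N]]) (use s l in auto)

lemma proposal_measurable: assumes "s < T" shows "(\<lambda>p. \<xi> N s (fst (snd p)) (fst p)) \<in> measurable (bh N s \<Otimes>\<^sub>M prop_space N) borel"
proof (rule measurable_pick[where N=N and h="\<lambda>j p. \<xi> N s j (fst p)"])
  show "(\<lambda>p. \<xi> N s j (fst p)) \<in> measurable (bh N s \<Otimes>\<^sub>M prop_space N) borel" if "j < N" for j
    using assms that by (intro measurable_compose[OF measurable_fst F_bh[OF order_refl xi_F]]) auto
  show "(\<lambda>p. fst (snd p)) \<in> measurable (bh N s \<Otimes>\<^sub>M prop_space N) (count_space {..<N})"
    by (rule measurable_compose[OF measurable_snd measurable_fst])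
qed

lemma uniform_coordinate: "(\<lambda>p. snd (snd p)) \<in> borel_measurable (L \<Otimes>\<^sub>M prop_space N)"
proof -
  have "(\<lambda>p. snd (snd p)) \<in> measurable (L \<Otimes>\<^sub>M prop_space N) Unif"
    by (rule measurable_compose[OF measurable_snd measurable_snd])
  then show ?thesis using measurable_cong_sets[of "L \<Otimes>\<^sub>M prop_space N" "L \<Otimes>\<^sub>M prop_space N" Unif borel] by simp
qed

lemma reject_ind_measurable:
  assumes "1 \<le> N" "s < T" "l < N"
  shows "reject_ind N s l \<in> borel_measurable (bh N s \<Otimes>\<^sub>M prop_space N)"
proof -
  note [measurable] = next_particle_bh[OF assms] proposal_measurable[OF assms(2), of N] uniform_coordinate[of "bh N s" N]
  show ?thesis unfolding reject_ind_def case_prod_beta' by measurable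
qed

lemma accept_val_measurable:
  assumes "1 \<le> N" "s < T" "l < N" and \<psi>: "(\<lambda>p. \<psi> (fst p) (snd p)) \<in> borel_measurable (F N (Suc T) \<Otimes>\<^sub>M borel)"
  shows "accept_val N s \<psi> l \<in> borel_measurable (bh N s \<Otimes>\<^sub>M prop_space N)"
proof -
  note [measurable] = next_particle_bh[OF assms(1-3)] proposal_measurable[OF assms(2), of N] uniform_coordinate[of "bh N s" N]
  have "(\<lambda>p. fst p) \<in> measurable (bh N s \<Otimes>\<^sub>M prop_space N) (F N (Suc T))"
    by (rule measurable_compose[OF measurable_fst measurable_ident_subalgebra[OF F_sub_bh]])
  from measurable_compose[OF measurable_Pair[OF this proposal_measurable[OF assms(2)]] \<psi>]
  have [measurable]: "(\<lambda>p. \<psi> (fst p) (\<xi> N s (fst (snd p)) (fst p))) \<in> borel_measurable (bh N s \<Otimes>\<^sub>M prop_space N)" by simp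
  show ?thesis unfolding accept_val_def case_prod_beta' by measurable
qed

lemma qs_measurable: assumes "s < T" shows "(\<lambda>(w, z). qs N s w z) \<in> borel_measurable (bh N s \<Otimes>\<^sub>M prop_space N)"
proof -
  have "(\<lambda>p. fst p) \<in> measurable (bh N s \<Otimes>\<^sub>M prop_space N) (F N (Suc T))"
    by (rule measurable_compose[OF measurable_fst measurable_ident_subalgebra[OF F_sub_bh]])
  from measurable_compose[OF measurable_Pair[OF this measurable_compose[OF measurable_snd measurable_fst]] index_q_measurable[of s N]]
  show ?thesis using assms by (simp add: case_prod_beta')
qed

lemma prop_space_sigma_finite: "sigma_finite_measure (prop_space N)"
proof -
  interpret sigma_finite_measure "count_space {..<N}" by (rule sigma_finite_measure_count_space_finite) simp
  interpret u: prob_space Unif by (rule prob_space_Unif)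
  interpret pair_sigma_finite "count_space {..<N}" Unif ..
  show ?thesis by unfold_locales
qed

lemma Unif_sigma_finite: "sigma_finite_measure Unif"
  using prob_space_imp_sigma_finite[OF prob_space_Unif] .

text \<open>The density depends on the index coordinate only, so the second coordinate stays uniform
  and integrates to 1; normalization is the matter of the index weights, which equal
  \<open>a s\<close> where \<open>HT\<close> is positive.\<close>

lemma proposal_law:
  assumes N: "1 \<le> N" and s: "s < T"
  shows "AE w in W N. w \<in> E N (Suc T) \<longrightarrow> 0 < (\<integral>\<^sup>+ z. (case z of (j, _) \<Rightarrow> ennreal (wt N s j w)) \<partial>prop_space N) \<and>
     law_prop_to (prop_space N) (\<lambda>(j, _). ennreal (wt N s j w)) = density (prop_space N) (qs N s w) \<and>
     (\<integral>\<^sup>+ z. qs N s w z \<partial>prop_space N) = 1"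
  using all_weights[OF N]
proof eventually_elim
  case (elim w)
  interpret u: prob_space Unif by (rule prob_space_Unif)
  show ?case
  proof
    assume "w \<in> E N (Suc T)"
    then have pos: "0 < HT N w" by simp
    then have wt: "wt N s j w = a s (\<xi> N s j w)" if "j < N" for j using elim that s by auto
    have ws: "0 < weight_sum N s w" using HT_weight_sum[OF pos] s by simp
    have cm: "(\<lambda>z. c (fst z)) \<in> borel_measurable (prop_space N)" for c :: "nat \<Rightarrow> ennreal"
      by (rule measurable_compose[OF measurable_fst]) simp
    have ci: "(\<integral>\<^sup>+ z. c (fst z) \<partial>prop_space N) = (\<Sum>j<N. c j)" for c :: "nat \<Rightarrow> ennreal"
      by (simp add: nn_integral_count_pair[OF Unif_sigma_finite cm] u.emeasure_space_1)
    have i: "(\<integral>\<^sup>+ z. (case z of (j, _) \<Rightarrow> ennreal (wt N s j w)) \<partial>prop_space N) = ennreal (weight_sum N s w)"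
      using ci[of "\<lambda>j. ennreal (wt N s j w)"] wt by (simp add: case_prod_beta' weight_sum_def a_nonneg sum_ennreal)
    have "law_prop_to (prop_space N) (\<lambda>(j, _). ennreal (wt N s j w)) = density (prop_space N) (qs N s w)"
      unfolding law_prop_to_def i
    proof (rule density_cong)
      show "(\<lambda>z. (case z of (j, _) \<Rightarrow> ennreal (wt N s j w)) / ennreal (weight_sum N s w)) \<in> borel_measurable (prop_space N)"
        using cm[of "\<lambda>j. ennreal (wt N s j w) / ennreal (weight_sum N s w)"] by (simp add: case_prod_beta')
      show "qs N s w \<in> borel_measurable (prop_space N)"
        using cm[of "index_q N s w"] by (simp add: case_prod_beta')
      show "AE z in prop_space N. (case z of (j, _) \<Rightarrow> ennreal (wt N s j w)) / ennreal (weight_sum N s w) = qs N s w z"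
        by (rule AE_I2) (auto simp: space_pair_measure wt index_q_def)
    qed
    moreover have "(\<integral>\<^sup>+ z. qs N s w z \<partial>prop_space N) = 1"
      using ci[of "index_q N s w"] sum_index_q[OF ws, of "\<lambda>_. 1"] ws by (simp add: case_prod_beta' weight_sum_def[symmetric])
    ultimately show "0 < (\<integral>\<^sup>+ z. (case z of (j, _) \<Rightarrow> ennreal (wt N s j w)) \<partial>prop_space N) \<and>
     law_prop_to (prop_space N) (\<lambda>(j, _). ennreal (wt N s j w)) = density (prop_space N) (qs N s w) \<and>
     (\<integral>\<^sup>+ z. qs N s w z \<partial>prop_space N) = 1" using i ws by simp
  qed
qed

lemma ratio_bounds: "0 \<le> m x x' / \<sigma>" "m x x' / \<sigma> \<le> 1"
  using trans_nonneg[of x x'] bounded[of x x'] sigma_pos by (auto simp: divide_le_eq)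

lemma Unif_borel: "measurable Unif L = measurable borel L"
  by (rule measurable_cong_sets) auto

lemma section_prop:
  assumes "\<phi> \<in> borel_measurable (bh N s \<Otimes>\<^sub>M prop_space N)" "w \<in> space (W N)"
  shows "(\<lambda>z. \<phi> (w, z)) \<in> borel_measurable (prop_space N)"
  using measurable_compose[OF measurable_Pair1'[of w "bh N s"] assms(1)] assms(2) by (simp add: space_bh)

lemma reject_ind_integral:
  assumes "1 \<le> N" "s < T" "l < N" "w \<in> space (W N)" and ws: "0 < weight_sum N s w"
  shows "(\<integral>\<^sup>+ z. reject_ind N s l (w, z) * qs N s w z \<partial>prop_space N) = ennreal (reject N s w (next_particle N s l w))"
proof -
  let ?x = "next_particle N s l w"
  have m: "(\<lambda>z. reject_ind N s l (w, z) * qs N s w z) \<in> borel_measurable (prop_space N)"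
    using section_prop[OF reject_ind_measurable[OF assms(1-3)] assms(4)] section_prop[OF qs_measurable[OF assms(2)] assms(4)] by simp
  have "(\<integral>\<^sup>+ z. reject_ind N s l (w, z) * qs N s w z \<partial>prop_space N) = (\<Sum>j<N. \<integral>\<^sup>+ u. (if u \<le> m (\<xi> N s j w) ?x / \<sigma> then 0 else 1) * index_q N s w j \<partial>Unif)"
    by (subst nn_integral_count_pair[OF Unif_sigma_finite m]) (simp add: reject_ind_def)
  also have "\<dots> = (\<Sum>j<N. ennreal (1 - m (\<xi> N s j w) ?x / \<sigma>) * index_q N s w j)"
    by (intro sum.cong refl, subst nn_integral_multc) (simp_all add: nn_integral_Unif_le(2)[OF ratio_bounds] Unif_borel)
  also have "\<dots> = ennreal ((\<Sum>j<N. a s (\<xi> N s j w) * (1 - m (\<xi> N s j w) ?x / \<sigma>)) / weight_sum N s w)"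
    by (rule sum_index_q[OF ws]) (simp add: ratio_bounds)
  also have "(\<Sum>j<N. a s (\<xi> N s j w) * (1 - m (\<xi> N s j w) ?x / \<sigma>)) = weight_sum N s w - kern_sum N s w ?x / \<sigma>"
    by (simp add: weight_sum_def kern_sum_def right_diff_distrib sum_subtractf sum_divide_distrib)
  also have "(weight_sum N s w - kern_sum N s w ?x / \<sigma>) / weight_sum N s w = reject N s w ?x"
    using ws sigma_pos by (simp add: reject_def diff_divide_distrib)
  finally show ?thesis .
qed

lemma accept_val_integral:
  assumes "1 \<le> N" "s < T" "l < N" "w \<in> space (W N)" and ws: "0 < weight_sum N s w"
    and \<psi>: "(\<lambda>p. \<psi> (fst p) (snd p)) \<in> borel_measurable (F N (Suc T) \<Otimes>\<^sub>M borel)" and \<psi>0: "\<And>x. 0 \<le> \<psi> w x"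
  shows "(\<integral>\<^sup>+ z. accept_val N s \<psi> l (w, z) * qs N s w z \<partial>prop_space N)
    = ennreal ((\<Sum>j<N. a s (\<xi> N s j w) * m (\<xi> N s j w) (next_particle N s l w) * \<psi> w (\<xi> N s j w)) / (\<sigma> * weight_sum N s w))"
proof -
  let ?x = "next_particle N s l w"
  have m: "(\<lambda>z. accept_val N s \<psi> l (w, z) * qs N s w z) \<in> borel_measurable (prop_space N)"
    using section_prop[OF accept_val_measurable[OF assms(1-3) \<psi>] assms(4)] section_prop[OF qs_measurable[OF assms(2)] assms(4)] by simp
  have "(\<integral>\<^sup>+ z. accept_val N s \<psi> l (w, z) * qs N s w z \<partial>prop_space N)
     = (\<Sum>j<N. \<integral>\<^sup>+ u. (if u \<le> m (\<xi> N s j w) ?x / \<sigma> then 1 else 0) * (ennreal (\<psi> w (\<xi> N s j w)) * index_q N s w j) \<partial>Unif)"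
    by (subst nn_integral_count_pair[OF Unif_sigma_finite m]) (auto simp: accept_val_def intro!: sum.cong nn_integral_cong)
  also have "\<dots> = (\<Sum>j<N. ennreal (m (\<xi> N s j w) ?x / \<sigma>) * (ennreal (\<psi> w (\<xi> N s j w)) * index_q N s w j))"
    by (intro sum.cong refl, subst nn_integral_multc) (simp_all add: nn_integral_Unif_le(1)[OF ratio_bounds] Unif_borel)
  also have "\<dots> = (\<Sum>j<N. ennreal (m (\<xi> N s j w) ?x / \<sigma> * \<psi> w (\<xi> N s j w)) * index_q N s w j)"
    by (simp only: ennreal_mult[OF ratio_bounds(1) \<psi>0] mult.assoc)
  also have "\<dots> = ennreal ((\<Sum>j<N. a s (\<xi> N s j w) * (m (\<xi> N s j w) ?x / \<sigma> * \<psi> w (\<xi> N s j w))) / weight_sum N s w)"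
    by (rule sum_index_q[OF ws]) (intro mult_nonneg_nonneg ratio_bounds \<psi>0)
  also have "(\<Sum>j<N. a s (\<xi> N s j w) * (m (\<xi> N s j w) ?x / \<sigma> * \<psi> w (\<xi> N s j w))) / weight_sum N s w
     = (\<Sum>j<N. a s (\<xi> N s j w) * m (\<xi> N s j w) ?x * \<psi> w (\<xi> N s j w)) / (\<sigma> * weight_sum N s w)"
    by (simp add: sum_divide_distrib mult.assoc)
  finally show ?thesis .
qed

text \<open>At a point where the kernel sum vanishes, every summand does, so \<open>Q\<close> gives
  no mass to such points and no new particle lands there. Acceptance probabilities at successors are
  therefore positive, which makes the loops end and the backward kernels genuine averages.\<close>

lemma kern_pos: assumes N: "1 \<le> N" shows "AE w in W N. 0 < HT N w \<longrightarrow> (\<forall>t<T. \<forall>i<N. 0 < kern_sum N t w (\<xi> N (Suc t) i w))"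
proof -
  have "AE w in W N. \<forall>t i. t < T \<and> i < N \<longrightarrow> 0 < H N (Suc t) w \<longrightarrow> 0 < kern_sum N t w (\<xi> N (Suc t) i w)"
    unfolding AE_all_countable
  proof (intro allI)
    fix t i
    show "AE w in W N. t < T \<and> i < N \<longrightarrow> 0 < H N (Suc t) w \<longrightarrow> 0 < kern_sum N t w (\<xi> N (Suc t) i w)"
    proof (cases "t < T \<and> i < N")
      case True
      then have t: "t < T" "i < N" by auto
      let ?\<phi> = "\<lambda>p. if kern_sum N t (fst p) (snd p) = 0 then 1 else 0 :: ennreal"
      note [measurable] = kern_sum_measurable[OF lessI, of N t]
      have \<phi>m: "?\<phi> \<in> borel_measurable (F N (Suc t) \<Otimes>\<^sub>M borel)" by measurable
      have sub: "subalgebra (W N) (F N (Suc t))" using t N by (intro subalgebra_F) auto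
      have [measurable]: "H N (Suc t) \<in> borel_measurable (W N)" using t N by (intro H_measurable_W) auto
      have xi: "\<xi> N (Suc t) i \<in> measurable (W N) borel" using t N by (intro xi_measurable) auto
      have "(\<lambda>w. ?\<phi> (w, \<xi> N (Suc t) i w)) \<in> borel_measurable (W N)"
        using measurable_compose[OF measurable_Pair[OF measurable_ident_subalgebra[OF sub] xi] \<phi>m] .
      then have mm: "(\<lambda>w. ennreal (H N (Suc t) w) * ?\<phi> (w, \<xi> N (Suc t) i w)) \<in> borel_measurable (W N)"
        by (rule borel_measurable_times_ennreal[rotated]) measurable
      have "Q t (\<lambda>x. ?\<phi> (w, x)) (\<xi> N t j w) = 0" if "j < N" for w j
      proof -
        have "ennreal (a t (\<xi> N t j w) * m (\<xi> N t j w) x * b (Suc t) x) * ?\<phi> (w, x) = 0" for x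
        proof (cases "kern_sum N t w x = 0")
          case True
          then have "a t (\<xi> N t j w) * m (\<xi> N t j w) x = 0"
            using that by (auto simp: kern_sum_def sum_nonneg_eq_0_iff a_nonneg trans_nonneg)
          then show ?thesis by (simp only: mult_zero_left ennreal_0)
        qed simp
        then show ?thesis unfolding Q_def by (simp only: nn_integral_const mult_zero_left)
      qed
      then have "(\<integral>\<^sup>+ w. ennreal (H N (Suc t) w) * ?\<phi> (w, \<xi> N (Suc t) i w) \<partial>W N) = 0"
        by (subst step_mean[OF N t \<phi>m]) simp
      then have "AE w in W N. ennreal (H N (Suc t) w) * ?\<phi> (w, \<xi> N (Suc t) i w) = 0"
        by (simp only: nn_integral_0_iff_AE[OF mm])
      then show ?thesis
      proof eventually_elim
        case (elim w)
        then show ?case using kern_sum_nonneg[of N t w "\<xi> N (Suc t) i w"] by (auto simp: ennreal_eq_0_iff split: if_splits)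
      qed
    qed auto
  qed
  then show ?thesis
  proof eventually_elim
    case (elim w)
    then show ?case using H_pos_le[of N "Suc T" w] by auto
  qed
qed

lemma reject_ind_VU: "reject_ind N s l (w, VU N s (l, k) w) = (if acc N s l k w then 0 else 1)"
  by (simp add: reject_ind_def accepted_def next_particle_def)

lemma accept_val_VU: "accept_val N s \<psi> l (w, VU N s (l, k) w) = (if acc N s l k w then ennreal (\<psi> w (\<xi> N s (V N s l k w) w)) else 0)"
  by (simp add: accept_val_def accepted_def next_particle_def)

end

section \<open>Survival frequencies and the law of the accepted indices\<close>

context adapted_ffbsi begin

definition survived :: "nat \<Rightarrow> nat \<Rightarrow> nat \<Rightarrow> nat \<Rightarrow> 'w \<Rightarrow> real" where
  "survived N s k l w = (\<Prod>j<k. if acc N s l j w then 0 else 1)"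

lemma survived_bounds: "0 \<le> survived N s k l w" "survived N s k l w \<le> 1"
  unfolding survived_def by (auto intro!: prod_nonneg prod_le_1)

lemma next_particle_in:
  assumes "1 \<le> N" "s < T" "l < N" "w \<in> space (W N)"
  shows "J N (Suc s) l w < N"
  using measurable_space[OF J_measurable[OF assms(1) _ assms(3)] assms(4), of "Suc s"] assms by simp

lemma E_bh: "E N (Suc T) \<in> sets (bh N s)"
  using E_F[OF order_refl, of N "Suc T"] F_sub_bh[of N s] by (auto simp: subalgebra_def)

lemma proposal_draws:
  assumes N: "1 \<le> N" and s: "s < T"
  shows "cond_draws (W N) (bh N s) (E N (Suc T)) ({..<N} \<times> UNIV) (VU N s) (prop_space N) (\<lambda>w (j, _). ennreal (wt N s j w)) (qs N s)"
  by (intro cond_draws.intro prob_W[OF N] subalgebra_bh[OF N] E_bh prop_space_sigma_finite qs_measurable[OF s] proposals[OF N s] proposal_law[OF N s])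

lemma HT_bh: "HT N \<in> borel_measurable (bh N s)"
  by (rule F_bh[OF order_refl H_F'])

lemma HT_finite: "1 \<le> N \<Longrightarrow> (\<integral>\<^sup>+ w. ennreal (HT N w) \<partial>W N) < \<infinity>"
  using nn_integral_HT evid_finite[of T] by simp

lemma survived_measurable:
  assumes N: "1 \<le> N" and s: "s < T" and l: "l < N"
  shows "survived N s k l \<in> borel_measurable (W N)"
proof -
  have m: "(\<lambda>w. reject_ind N s l (w, VU N s (l, j) w)) \<in> borel_measurable (W N)" for j
    using measurable_compose[OF measurable_Pair[OF measurable_ident_subalgebra[OF subalgebra_bh[OF N]] VU_measurable[OF N s l]] reject_ind_measurable[OF N s l]] by simp
  have "(\<lambda>w. \<Prod>j<k. enn2real (reject_ind N s l (w, VU N s (l, j) w))) \<in> borel_measurable (W N)"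
    using m by measurable
  then show ?thesis
    by (rule measurable_cong[THEN iffD1, rotated]) (auto simp: survived_def reject_ind_VU[simplified] intro!: prod.cong)
qed

lemma reject_next_bh:
  assumes N: "1 \<le> N" and s: "s < T" and l: "l < N"
    and \<psi>: "(\<lambda>p. \<psi> (fst p) (snd p)) \<in> borel_measurable (F N (Suc T) \<Otimes>\<^sub>M borel)"
  shows "(\<lambda>w. \<psi> w (next_particle N s l w) :: real) \<in> borel_measurable (bh N s)"
  using measurable_compose[OF measurable_Pair[OF measurable_ident_subalgebra[OF F_sub_bh] next_particle_bh[OF N s l]] \<psi>] by simp

lemma reject_ind_le_1: "reject_ind N s l z \<le> 1"
  by (simp add: reject_ind_def split: prod.splits)

lemma accept_val_le_1: "(\<And>w x. \<psi> w x \<le> 1) \<Longrightarrow> accept_val N s \<psi> l z \<le> 1"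
  by (simp add: accept_val_def split: prod.splits)

text \<open>Surviving \<open>k\<close> proposals is a loop stopped at the fixed number
  \<open>k\<close>: with \<open>\<zeta>\<close> the indicator of \<open>n = k\<close> both series
  reduce to one term, and the conditional mean is the \<open>k\<close>-th power of the rejection
  probability.\<close>

lemma survived_law:
  assumes N: "1 \<le> N" and s: "s < T"
  shows "(\<integral>\<^sup>+ w. ennreal \<bar>HT N w * ((\<Sum>l<N. survived N s k l w) / N) - back_avg N (Suc s) (\<lambda>w x. reject N s w x ^ k) w\<bar> \<partial>W N)
      \<le> ennreal (1 / sqrt N) * evid T" (is ?A)
    and "(\<integral>\<^sup>+ w. ennreal (HT N w * ((\<Sum>l<N. survived N s k l w) / N)) \<partial>W N) = (\<integral>\<^sup>+ w. ennreal (back_avg N (Suc s) (\<lambda>w x. reject N s w x ^ k) w) \<partial>W N)" (is ?B)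
proof -
  let ?\<epsilon> = "\<lambda>l w. reject N s w (next_particle N s l w) ^ k"
  have rm: "(\<lambda>p. reject N s (fst p) (snd p)) \<in> borel_measurable (F N (Suc T) \<Otimes>\<^sub>M borel)"
    using s by (intro reject_measurable) auto
  have \<epsilon>m: "?\<epsilon> l \<in> borel_measurable (bh N s)" if "l < N" for l
    using reject_next_bh[OF N s that rm] by measurable
  have \<epsilon>b: "0 \<le> ?\<epsilon> l w" "?\<epsilon> l w \<le> 1" for l w using reject_bounds by (auto intro: power_le_one)
  have single: "(\<Sum>n. u n * (if n = k then 1 else 0)) = u k" for u :: "nat \<Rightarrow> ennreal"
    by (subst suminf_finite[of "{k}"]) auto
  note wl = cond_draws_stopped_weak_law[OF proposal_draws[OF N s] HT_bh H_nonneg HT_zero HT_finite[OF N] N reject_ind_measurable[OF N s] reject_ind_le_1,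
      where \<zeta>="\<lambda>l n _. if n = k then 1 else 0" and y="survived N s k" and \<epsilon>="?\<epsilon>"]
  have yAE: "AE w in W N. 0 < HT N w \<longrightarrow> ennreal (survived N s k l w) = (\<Sum>n. (\<Prod>j<n. reject_ind N s l (w, VU N s (l, j) w)) * (if n = k then 1 else 0))" if "l < N" for l
  proof (intro AE_I2 impI)
    fix w
    have "ennreal (survived N s k l w) = (\<Prod>j<k. if acc N s l j w then 0 else 1)"
      unfolding survived_def by (subst prod_ennreal[symmetric]) (auto intro!: prod.cong)
    then show "ennreal (survived N s k l w) = (\<Sum>n. (\<Prod>j<n. reject_ind N s l (w, VU N s (l, j) w)) * (if n = k then 1 else 0))"
      unfolding reject_ind_VU single .
  qed
  have \<epsilon>AE: "AE w in W N. 0 < HT N w \<longrightarrow> ennreal (?\<epsilon> l w) = (\<Sum>n. (\<integral>\<^sup>+ z. reject_ind N s l (w, z) * qs N s w z \<partial>prop_space N) ^ n * (\<integral>\<^sup>+ z. (if n = k then 1 else 0) * qs N s w z \<partial>prop_space N))" if l: "l < N" for l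
    using proposal_law[OF N s] AE_space
  proof eventually_elim
    case (elim w)
    show ?case
    proof
      assume pos: "0 < HT N w"
      have 1: "(\<integral>\<^sup>+ z. (if n = k then 1 else 0) * qs N s w z \<partial>prop_space N) = (if n = k then 1 else 0)" for n
        using elim pos by simp
      have ws: "0 < weight_sum N s w" using HT_weight_sum[OF pos] s by simp
      show "ennreal (?\<epsilon> l w) = (\<Sum>n. (\<integral>\<^sup>+ z. reject_ind N s l (w, z) * qs N s w z \<partial>prop_space N) ^ n * (\<integral>\<^sup>+ z. (if n = k then 1 else 0) * qs N s w z \<partial>prop_space N))"
        unfolding 1 single reject_ind_integral[OF N s l elim(2) ws] using reject_bounds by (simp add: ennreal_power)
    qed
  qed
  have "(\<integral>\<^sup>+ w. ennreal (HT N w * \<bar>(\<Sum>l<N. survived N s k l w) / N - (\<Sum>l<N. ?\<epsilon> l w) / N\<bar>) \<partial>W N) \<le> ennreal (1 / sqrt N) * (\<integral>\<^sup>+ w. ennreal (HT N w) \<partial>W N)"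
    by (rule wl(1)) (use survived_measurable[OF N s] survived_bounds \<epsilon>m \<epsilon>b yAE \<epsilon>AE in auto)
  moreover have "ennreal (HT N w * \<bar>(\<Sum>l<N. survived N s k l w) / N - (\<Sum>l<N. ?\<epsilon> l w) / N\<bar>)
     = ennreal \<bar>HT N w * ((\<Sum>l<N. survived N s k l w) / N) - back_avg N (Suc s) (\<lambda>w x. reject N s w x ^ k) w\<bar>" for w
    using H_nonneg[of N "Suc T" w] unfolding back_avg_def next_particle_def
    by (simp only: right_diff_distrib[symmetric] abs_mult abs_of_nonneg)
  ultimately show ?A by (simp add: nn_integral_HT[OF N])
  have each: "(\<integral>\<^sup>+ w. ennreal (HT N w) * ennreal (survived N s k l w) \<partial>W N) = (\<integral>\<^sup>+ w. ennreal (HT N w) * ennreal (?\<epsilon> l w) \<partial>W N)" if "l < N" for l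
    by (rule wl(2)) (use survived_measurable[OF N s] survived_bounds \<epsilon>m \<epsilon>b yAE \<epsilon>AE that in auto)
  show ?B unfolding back_avg_def next_particle_def[symmetric]
    using nn_integral_weighted_avg[where \<phi>="survived N s k", OF N H_measurable_W[OF N order_refl] survived_measurable[OF N s] H_nonneg survived_bounds(1)]
      nn_integral_weighted_avg[OF N H_measurable_W[OF N order_refl] measurable_from_subalg[OF subalgebra_bh[OF N] \<epsilon>m] H_nonneg \<epsilon>b(1)]
    by (simp add: each)
qed

end

lemma suminf_ennreal_geometric:
  fixes \<rho> z :: real
  assumes "0 \<le> \<rho>" "\<rho> < 1" "0 \<le> z"
  shows "(\<Sum>n. ennreal \<rho> ^ n * ennreal z) = ennreal (z / (1 - \<rho>))"
proof -
  have "(\<lambda>n. \<rho> ^ n * z) sums (1 / (1 - \<rho>) * z)"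
    using assms by (intro sums_mult2 geometric_sums) auto
  then have "(\<Sum>n. ennreal (\<rho> ^ n * z)) = ennreal (1 / (1 - \<rho>) * z)"
    using assms by (intro suminf_ennreal_eq) auto
  then show ?thesis using assms by (simp add: ennreal_mult ennreal_power)
qed

context adapted_ffbsi begin

lemma proposal_pair_measurable:
  assumes N: "1 \<le> N" and s: "s < T" and l: "l < N" and \<phi>: "\<phi> \<in> borel_measurable (bh N s \<Otimes>\<^sub>M prop_space N)"
  shows "(\<lambda>w. \<phi> (w, VU N s (l, k) w)) \<in> borel_measurable (W N)"
  using measurable_compose[OF measurable_Pair[OF measurable_ident_subalgebra[OF subalgebra_bh[OF N]] VU_measurable[OF N s l]] \<phi>] by simp

text \<open>Correctness of accept-reject: the geometric series divides the mean accepted value by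
  the acceptance probability, the factor \<open>\<sigma> * weight_sum\<close> cancels, and the
  quotient is the backward kernel. Positivity of the kernel sum keeps the ratio of the series below
  1.\<close>

lemma index_expectation:
  assumes N: "1 \<le> N" and s: "s < T" and l: "l < N"
    and \<psi>: "(\<lambda>p. \<psi> (fst p) (snd p)) \<in> borel_measurable (F N (Suc T) \<Otimes>\<^sub>M borel)" and \<psi>0: "\<And>w x. 0 \<le> \<psi> w x"
  shows "AE w in W N. 0 < HT N w \<longrightarrow> (\<Sum>n. (\<integral>\<^sup>+ z. reject_ind N s l (w, z) * qs N s w z \<partial>prop_space N) ^ n * (\<integral>\<^sup>+ z. accept_val N s \<psi> l (w, z) * qs N s w z \<partial>prop_space N))
     = ennreal (back_mean N s \<psi> w (next_particle N s l w))"
  using kern_pos[OF N] AE_space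
proof eventually_elim
  case (elim w)
  show ?case
  proof
    assume pos: "0 < HT N w"
    have ws: "0 < weight_sum N s w" using HT_weight_sum[OF pos] s by simp
    let ?x = "next_particle N s l w"
    let ?z = "\<Sum>j<N. a s (\<xi> N s j w) * m (\<xi> N s j w) ?x * \<psi> w (\<xi> N s j w)"
    have k: "0 < kern_sum N s w ?x" using elim(1) pos s next_particle_in[OF N s l elim(2)] by (simp add: next_particle_def)
    have sw: "0 < \<sigma> * weight_sum N s w" using ws sigma_pos by simp
    have r: "1 - reject N s w ?x = kern_sum N s w ?x / (\<sigma> * weight_sum N s w)" by (simp add: reject_def)
    have "0 < kern_sum N s w ?x / (\<sigma> * weight_sum N s w)" using k sw by simp
    then have "reject N s w ?x < 1" using r by linarith
    moreover have "0 \<le> ?z / (\<sigma> * weight_sum N s w)"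
      by (intro divide_nonneg_pos[OF _ sw] sum_nonneg mult_nonneg_nonneg a_nonneg trans_nonneg \<psi>0)
    ultimately have "(\<Sum>n. ennreal (reject N s w ?x) ^ n * ennreal (?z / (\<sigma> * weight_sum N s w))) = ennreal (?z / (\<sigma> * weight_sum N s w) / (1 - reject N s w ?x))"
      by (intro suminf_ennreal_geometric reject_bounds)
    also have "?z / (\<sigma> * weight_sum N s w) / (1 - reject N s w ?x) = back_mean N s \<psi> w ?x"
      unfolding r back_mean_def using ws sigma_pos by simp
    finally show "(\<Sum>n. (\<integral>\<^sup>+ z. reject_ind N s l (w, z) * qs N s w z \<partial>prop_space N) ^ n * (\<integral>\<^sup>+ z. accept_val N s \<psi> l (w, z) * qs N s w z \<partial>prop_space N))
     = ennreal (back_mean N s \<psi> w ?x)"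
      unfolding reject_ind_integral[OF N s l elim(2) ws] accept_val_integral[OF N s l elim(2) ws \<psi> \<psi>0] .
  qed
qed

lemma back_mean_one: "0 < kern_sum N s w x \<Longrightarrow> back_mean N s (\<lambda>_ _. 1) w x = 1"
  by (simp add: back_mean_def kern_sum_def)

text \<open>With the value 1 on acceptance, the stopped value is the indicator that the loop ends.
  Its weighted mean equals the whole mass of \<open>HT\<close>, which is finite and can be
  subtracted, so the complement is null.\<close>

lemma trials_finite:
  assumes N: "1 \<le> N" and s: "s < T" and l: "l < N"
  shows "AE w in W N. 0 < HT N w \<longrightarrow> (\<exists>k. acc N s l k w)"
proof -
  let ?\<psi> = "\<lambda>(_ :: 'w) (_ :: 'x). 1 :: real"
  define Y where "Y l w = (\<Sum>n. (\<Prod>k<n. reject_ind N s l (w, VU N s (l, k) w)) * accept_val N s ?\<psi> l (w, VU N s (l, n) w))" for l w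
  define e where "e l w = (\<Sum>n. (\<integral>\<^sup>+ z. reject_ind N s l (w, z) * qs N s w z \<partial>prop_space N) ^ n * (\<integral>\<^sup>+ z. accept_val N s ?\<psi> l (w, z) * qs N s w z \<partial>prop_space N))" for l w
  have \<psi>m: "(\<lambda>p. ?\<psi> (fst p) (snd p)) \<in> borel_measurable (F N (Suc T) \<Otimes>\<^sub>M borel)" by simp
  have [measurable]: "HT N \<in> borel_measurable (W N)" by (rule H_measurable_W[OF N order_refl])
  have [measurable]: "Y l \<in> borel_measurable (W N)"
  proof -
    note [measurable] = proposal_pair_measurable[OF N s l reject_ind_measurable[OF N s l]] proposal_pair_measurable[OF N s l accept_val_measurable[OF N s l \<psi>m]]
    show ?thesis unfolding Y_def[abs_def] by measurable
  qed
  have "(\<lambda>w. ennreal (HT N w)) \<in> borel_measurable (bh N s)" using HT_bh[of N s] by measurable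
  from cond_draws_stopped(1)[OF proposal_draws[OF N s] this _ reject_ind_measurable[OF N s] reject_ind_le_1 accept_val_measurable[OF N s _ \<psi>m] accept_val_le_1 Y_def e_def l] HT_zero
  have 1: "(\<integral>\<^sup>+ w. ennreal (HT N w) * Y l w \<partial>W N) = (\<integral>\<^sup>+ w. ennreal (HT N w) * e l w \<partial>W N)" by simp
  have "(\<integral>\<^sup>+ w. ennreal (HT N w) * e l w \<partial>W N) = (\<integral>\<^sup>+ w. ennreal (HT N w) \<partial>W N)"
  proof (rule nn_integral_cong_AE)
    show "AE w in W N. ennreal (HT N w) * e l w = ennreal (HT N w)"
      using index_expectation[OF N s l \<psi>m zero_le_one] kern_pos[OF N] AE_space
    proof eventually_elim
      case (elim w)
      show ?case
      proof (cases "HT N w = 0")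
        case False
        then have pos: "0 < HT N w" using H_nonneg[of N "Suc T" w] by simp
        have "0 < kern_sum N s w (next_particle N s l w)"
          using elim(2) pos s next_particle_in[OF N s l elim(3)] by (simp add: next_particle_def)
        then show ?thesis using elim(1) pos by (simp add: e_def back_mean_one)
      qed simp
    qed
  qed
  then have 2: "(\<integral>\<^sup>+ w. ennreal (HT N w) * Y l w \<partial>W N) = (\<integral>\<^sup>+ w. ennreal (HT N w) \<partial>W N)" using 1 by simp
  have Y0: "Y l w = 1 \<and> (\<exists>k. acc N s l k w) \<or> Y l w = 0" for w
  proof (cases "\<exists>k. acc N s l k w")
    case True
    define n0 where "n0 = (LEAST n. acc N s l n w)"
    have n0: "acc N s l n0 w" "\<And>k. k < n0 \<Longrightarrow> \<not> acc N s l k w"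
      using True LeastI_ex[of "\<lambda>n. acc N s l n w"] not_less_Least by (auto simp: n0_def)
    then show ?thesis using True stopped_sum[of "\<lambda>n. acc N s l n w" n0 "\<lambda>_. ennreal 1", OF n0]
      unfolding Y_def reject_ind_VU accept_val_VU by simp
  next
    case False then show ?thesis unfolding Y_def reject_ind_VU accept_val_VU by simp
  qed
  have "(\<integral>\<^sup>+ w. ennreal (HT N w) \<partial>W N) = (\<integral>\<^sup>+ w. ennreal (HT N w) * Y l w + ennreal (HT N w) * (if Y l w = 0 then 1 else 0) \<partial>W N)"
  proof (rule nn_integral_cong)
    fix w
    show "ennreal (HT N w) = ennreal (HT N w) * Y l w + ennreal (HT N w) * (if Y l w = 0 then 1 else 0)"
      using Y0[of w] by (elim disjE) simp_all
  qed
  also have "\<dots> = (\<integral>\<^sup>+ w. ennreal (HT N w) * Y l w \<partial>W N) + (\<integral>\<^sup>+ w. ennreal (HT N w) * (if Y l w = 0 then 1 else 0) \<partial>W N)"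
    by (intro nn_integral_add) measurable
  finally have "(\<integral>\<^sup>+ w. ennreal (HT N w) \<partial>W N) + (\<integral>\<^sup>+ w. ennreal (HT N w) * (if Y l w = 0 then 1 else 0) \<partial>W N) = (\<integral>\<^sup>+ w. ennreal (HT N w) \<partial>W N) + 0"
    unfolding 2 by (simp only: add_0_right)
  then have "(\<integral>\<^sup>+ w. ennreal (HT N w) * (if Y l w = 0 then 1 else 0) \<partial>W N) = 0"
    unfolding ennreal_add_left_cancel using HT_finite[OF N] by (simp only: less_irrefl infinity_ennreal_def) auto
  then have "AE w in W N. ennreal (HT N w) * (if Y l w = 0 then 1 else 0) = 0"
    by (subst (asm) nn_integral_0_iff_AE) measurable
  then show ?thesis
  proof eventually_elim
    case (elim w)
    then show ?case using Y0[of w] by (auto simp: ennreal_eq_0_iff split: if_splits)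
  qed
qed

text \<open>The accepted index follows the backward kernel given all that was drawn before, so
  averaging \<open>\<psi>\<close> over the indices at time \<open>s\<close> amounts to averaging its
  backward mean over those at \<open>Suc s\<close>. Termination is used to identify \<open>J\<close>
  with the accepted proposal.\<close>

lemma index_law:
  assumes N: "1 \<le> N" and s: "s < T"
    and \<psi>: "(\<lambda>p. \<psi> (fst p) (snd p)) \<in> borel_measurable (F N s \<Otimes>\<^sub>M borel)" and \<psi>0: "\<And>w x. 0 \<le> \<psi> w x" "\<And>w x. \<psi> w x \<le> 1"
  shows "(\<integral>\<^sup>+ w. ennreal \<bar>back_avg N s \<psi> w - back_avg N (Suc s) (back_mean N s \<psi>) w\<bar> \<partial>W N) \<le> ennreal (1 / sqrt N) * evid T" (is ?A)
    and "(\<integral>\<^sup>+ w. ennreal (back_avg N s \<psi> w) \<partial>W N) = (\<integral>\<^sup>+ w. ennreal (back_avg N (Suc s) (back_mean N s \<psi>) w) \<partial>W N)" (is ?B)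
proof -
  let ?y = "\<lambda>l w. \<psi> w (\<xi> N s (J N s l w) w)"
  let ?\<epsilon> = "\<lambda>l w. back_mean N s \<psi> w (next_particle N s l w)"
  have s': "s \<le> Suc T" "Suc s \<le> Suc T" "s \<le> T" using s by auto
  note \<psi>' = F_pair_mono[OF s'(1) \<psi>]
  note bm = F_pair_mono[OF s'(2) back_mean_measurable[OF \<psi>]]
  have \<epsilon>m: "?\<epsilon> l \<in> borel_measurable (bh N s)" if "l < N" for l by (rule reject_next_bh[OF N s that bm])
  have \<epsilon>b: "0 \<le> ?\<epsilon> l w" "?\<epsilon> l w \<le> 1" for l w using back_mean_bounds \<psi>0 by blast+
  have ym: "?y l \<in> borel_measurable (W N)" if "l < N" for l
    using measurable_compose[OF measurable_Pair[OF measurable_ident_subalgebra[OF subalgebra_F[OF N order_refl]] J_measurable[OF N s'(3) that]] particle_at_measurable[OF s'(3) \<psi>']]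
    by simp
  note wl = cond_draws_stopped_weak_law[OF proposal_draws[OF N s] HT_bh H_nonneg HT_zero HT_finite[OF N] N reject_ind_measurable[OF N s] reject_ind_le_1,
      where \<zeta>="\<lambda>l n. accept_val N s \<psi> l" and y="?y" and \<epsilon>="?\<epsilon>"]
  have yAE: "AE w in W N. 0 < HT N w \<longrightarrow> ennreal (?y l w) = (\<Sum>n. (\<Prod>j<n. reject_ind N s l (w, VU N s (l, j) w)) * accept_val N s \<psi> l (w, VU N s (l, n) w))" if l: "l < N" for l
    using trials_finite[OF N s l] AE_space
  proof eventually_elim
    case (elim w)
    show ?case
    proof
      assume "0 < HT N w"
      then have ex: "\<exists>k. acc N s l k w" using elim by simp
      define n0 where "n0 = (LEAST n. acc N s l n w)"
      have n0: "acc N s l n0 w" "\<And>k. k < n0 \<Longrightarrow> \<not> acc N s l k w"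
        using ex LeastI_ex[of "\<lambda>n. acc N s l n w"] not_less_Least by (auto simp: n0_def)
      have "J N s l w = V N s l n0 w"
        by (rule fast_ffbsi.index_accepted[OF systems[OF N] s l elim(2) trials_first[OF n0]])
      then show "ennreal (?y l w) = (\<Sum>n. (\<Prod>j<n. reject_ind N s l (w, VU N s (l, j) w)) * accept_val N s \<psi> l (w, VU N s (l, n) w))"
        unfolding reject_ind_VU accept_val_VU
        using stopped_sum[of "\<lambda>n. acc N s l n w" n0 "\<lambda>n. ennreal (\<psi> w (\<xi> N s (V N s l n w) w))", OF n0] by simp
    qed
  qed
  have \<epsilon>AE: "AE w in W N. 0 < HT N w \<longrightarrow> ennreal (?\<epsilon> l w) = (\<Sum>n. (\<integral>\<^sup>+ z. reject_ind N s l (w, z) * qs N s w z \<partial>prop_space N) ^ n * (\<integral>\<^sup>+ z. accept_val N s \<psi> l (w, z) * qs N s w z \<partial>prop_space N))" if l: "l < N" for l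
    using index_expectation[OF N s l \<psi>' \<psi>0(1)] by eventually_elim simp
  have "(\<integral>\<^sup>+ w. ennreal (HT N w * \<bar>(\<Sum>l<N. ?y l w) / N - (\<Sum>l<N. ?\<epsilon> l w) / N\<bar>) \<partial>W N) \<le> ennreal (1 / sqrt N) * (\<integral>\<^sup>+ w. ennreal (HT N w) \<partial>W N)"
    by (rule wl(1)) (use accept_val_measurable[OF N s _ \<psi>'] accept_val_le_1 \<psi>0 ym \<epsilon>m \<epsilon>b yAE \<epsilon>AE in auto)
  moreover have "ennreal (HT N w * \<bar>(\<Sum>l<N. ?y l w) / N - (\<Sum>l<N. ?\<epsilon> l w) / N\<bar>)
     = ennreal \<bar>back_avg N s \<psi> w - back_avg N (Suc s) (back_mean N s \<psi>) w\<bar>" for w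
    using H_nonneg[of N "Suc T" w] unfolding back_avg_def next_particle_def
    by (simp only: right_diff_distrib[symmetric] abs_mult abs_of_nonneg)
  ultimately show ?A by (simp add: nn_integral_HT[OF N])
  have each: "(\<integral>\<^sup>+ w. ennreal (HT N w) * ennreal (?y l w) \<partial>W N) = (\<integral>\<^sup>+ w. ennreal (HT N w) * ennreal (?\<epsilon> l w) \<partial>W N)" if "l < N" for l
    by (rule wl(2)) (use accept_val_measurable[OF N s _ \<psi>'] accept_val_le_1 \<psi>0 ym \<epsilon>m \<epsilon>b yAE \<epsilon>AE that in auto)
  show ?B unfolding back_avg_def next_particle_def[symmetric]
    using nn_integral_weighted_avg[where \<phi>="?y", OF N H_measurable_W[OF N order_refl] ym H_nonneg \<psi>0(1)]
      nn_integral_weighted_avg[where \<phi>="?\<epsilon>", OF N H_measurable_W[OF N order_refl] measurable_from_subalg[OF subalgebra_bh[OF N] \<epsilon>m] H_nonneg \<epsilon>b(1)]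
    by (simp add: each)
qed

end

subsection \<open>The number of trials\<close>

lemma L1_limit_transfer:
  fixes X Y :: "nat \<Rightarrow> 'w \<Rightarrow> real"
  assumes X: "\<And>N. 1 \<le> N \<Longrightarrow> X N \<in> borel_measurable (W N)" and Y: "\<And>N. 1 \<le> N \<Longrightarrow> Y N \<in> borel_measurable (W N)"
    and c: "c < \<infinity>" and le: "\<And>N. 1 \<le> N \<Longrightarrow> (\<integral>\<^sup>+ w. ennreal \<bar>X N w - Y N w\<bar> \<partial>W N) \<le> ennreal (1 / sqrt (real N)) * c"
    and lim: "(\<lambda>N. \<integral>\<^sup>+ w. ennreal \<bar>Y N w - l\<bar> \<partial>W N) \<longlonglongrightarrow> 0"
  shows "(\<lambda>N. \<integral>\<^sup>+ w. ennreal \<bar>X N w - l\<bar> \<partial>W N) \<longlonglongrightarrow> 0"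
proof -
  let ?R = "\<lambda>N. ennreal (1 / sqrt (real N)) * c + (\<integral>\<^sup>+ w. ennreal \<bar>Y N w - l\<bar> \<partial>W N)"
  have "(\<lambda>N. inverse (sqrt (real N))) \<longlonglongrightarrow> 0"
    by (rule tendsto_inverse_0_at_top, intro filterlim_compose[OF sqrt_at_top] filterlim_real_sequentially)
  then have "(\<lambda>N. ennreal (1 / sqrt (real N))) \<longlonglongrightarrow> ennreal 0" by (intro tendsto_ennrealI) (simp add: inverse_eq_divide)
  then have "(\<lambda>N. ennreal (1 / sqrt (real N)) * c) \<longlonglongrightarrow> ennreal 0 * c"
    by (intro tendsto_mult_ennreal tendsto_const) (use c in auto)
  from tendsto_add[OF this lim] have R: "?R \<longlonglongrightarrow> 0" by simp
  show ?thesis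
  proof (rule tendsto_sandwich[OF _ _ tendsto_const R])
    show "\<forall>\<^sub>F N in sequentially. (\<integral>\<^sup>+ w. ennreal \<bar>X N w - l\<bar> \<partial>W N) \<le> ?R N"
    proof (rule eventually_sequentiallyI[of 1])
      fix N :: nat assume N: "1 \<le> N"
      note [measurable] = X[OF N] Y[OF N]
      have "(\<integral>\<^sup>+ w. ennreal \<bar>X N w - l\<bar> \<partial>W N) \<le> (\<integral>\<^sup>+ w. ennreal \<bar>X N w - Y N w\<bar> + ennreal \<bar>Y N w - l\<bar> \<partial>W N)"
        by (intro nn_integral_mono) (auto simp: ennreal_plus[symmetric] simp del: ennreal_plus intro!: ennreal_leI)
      also have "\<dots> = (\<integral>\<^sup>+ w. ennreal \<bar>X N w - Y N w\<bar> \<partial>W N) + (\<integral>\<^sup>+ w. ennreal \<bar>Y N w - l\<bar> \<partial>W N)"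
        by (intro nn_integral_add) measurable
      also have "\<dots> \<le> ?R N" by (intro add_right_mono le N)
      finally show "(\<integral>\<^sup>+ w. ennreal \<bar>X N w - l\<bar> \<partial>W N) \<le> ?R N" .
    qed
  qed auto
qed

lemma ennreal_of_enat_sum: "ennreal_of_enat (\<Sum>l\<in>A. f l) = (\<Sum>l\<in>A. ennreal_of_enat (f l))"
proof (induction A rule: infinite_finite_induct)
  case (insert x A)
  have "ennreal_of_enat (u + v) = ennreal_of_enat u + ennreal_of_enat v" for u v
    by (cases u; cases v) (auto simp: ennreal_of_enat_def)
  then show ?case using insert by simp
qed auto

context adapted_ffbsi begin

lemma back_avg_measurable:
  assumes N: "1 \<le> N" and t: "t \<le> T" and \<psi>: "(\<lambda>p. \<psi> (fst p) (snd p)) \<in> borel_measurable (F N t \<Otimes>\<^sub>M borel)"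
  shows "back_avg N t \<psi> \<in> borel_measurable (W N)"
proof -
  have [measurable]: "HT N \<in> borel_measurable (W N)" by (rule H_measurable_W[OF N order_refl])
  have [measurable]: "(\<lambda>w. \<psi> w (\<xi> N t (J N t l w) w)) \<in> borel_measurable (W N)" if "l \<in> {..<N}" for l
    using measurable_compose[OF measurable_Pair[OF measurable_ident_subalgebra[OF subalgebra_F[OF N order_refl]] J_measurable[OF N t]]
        particle_at_measurable[OF t F_pair_mono[OF le_SucI[OF t] \<psi>]], of l] that
    by simp
  show ?thesis unfolding back_avg_def[abs_def] by measurable
qed

lemma smooth_measurable_T:
  assumes "Suc s + n \<le> T"
  shows "(\<lambda>p. smooth N s k n (fst p) (snd p)) \<in> borel_measurable (F N (Suc T) \<Otimes>\<^sub>M borel)"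
  using F_pair_mono[OF le_SucI[OF assms] smooth_measurable] .

lemma smooth_range: "0 \<le> smooth N s k n w x" "smooth N s k n w x \<le> 1"
  using smooth_bounds by blast+

lemma future_real_T': "future_real T = a T"
  by (rule ext) (rule future_real_T)

text \<open>The induction descends from time \<open>T\<close>, where indices come directly from the
  terminal weights and the particle limit is known, to time \<open>s + 1\<close>, where
  \<open>smooth\<close> is the plain rejection power. Each step costs an error of order
  \<open>1 / sqrt N\<close>.\<close>

lemma back_avg_smooth_limit:
  assumes s: "s < T" and "Suc s + n \<le> T"
  shows "(\<lambda>N. \<integral>\<^sup>+ w. ennreal \<bar>back_avg N (Suc s + n) (smooth N s k n) w - enn2real (lim_survival s k)\<bar> \<partial>W N) \<longlonglongrightarrow> 0"
proof -
  define d where "d = T - Suc s"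
  have T: "T = Suc s + d" using s by (simp add: d_def)
  have "n \<le> d" using assms T by simp
  then show ?thesis
  proof (induction rule: inc_induct)
    case base
    have "Suc s + d \<le> T" using T by simp
    note sl = smooth_limit[OF s this, of k, folded T, unfolded future_real_T']
    show ?case unfolding T[symmetric]
    proof (rule L1_limit_transfer[OF _ _ _ _ sl])
      show "back_avg N T (smooth N s k d) \<in> borel_measurable (W N)" if "1 \<le> N" for N
        using smooth_measurable[of N s k d] T by (intro back_avg_measurable[OF that]) simp_all
      show "avg N T (a T) (smooth N s k d) \<in> borel_measurable (W N)" if "1 \<le> N" for N
        using smooth_measurable[of N s k d] T by (intro avg_measurable[OF that]) simp_all
      show "evid T < \<infinity>" by (rule evid_finite) simp
      show "(\<integral>\<^sup>+ w. ennreal \<bar>back_avg N T (smooth N s k d) w - avg N T (a T) (smooth N s k d) w\<bar> \<partial>W N) \<le> ennreal (1 / sqrt N) * evid T" if "1 \<le> N" for N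
        using T by (intro back_avg_terminal[OF that] smooth_measurable_T smooth_range) simp
    qed
  next
    case (step n)
    have t: "Suc s + n < T" using step.hyps T by simp
    show ?case
    proof (rule L1_limit_transfer[OF _ _ _ _ step.IH])
      show "back_avg N (Suc s + n) (smooth N s k n) \<in> borel_measurable (W N)" if "1 \<le> N" for N
        using smooth_measurable[of N s k n] t by (intro back_avg_measurable[OF that]) simp_all
      show "back_avg N (Suc s + Suc n) (smooth N s k (Suc n)) \<in> borel_measurable (W N)" if "1 \<le> N" for N
        using smooth_measurable[of N s k "Suc n"] t by (intro back_avg_measurable[OF that]) simp_all
      show "evid T < \<infinity>" by (rule evid_finite) simp
      show "(\<integral>\<^sup>+ w. ennreal \<bar>back_avg N (Suc s + n) (smooth N s k n) w - back_avg N (Suc s + Suc n) (smooth N s k (Suc n)) w\<bar> \<partial>W N) \<le> ennreal (1 / sqrt N) * evid T" if "1 \<le> N" for N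
        using index_law(1)[OF that t smooth_measurable smooth_range, of k] by simp
    qed
  qed
qed

text \<open>The same descent with exact means: every step preserves the weighted mean, and at time
  \<open>T\<close> it meets the value carried forward by \<open>smooth_mean\<close>.\<close>

lemma back_avg_smooth_mean:
  assumes N: "1 \<le> N" and s: "s < T" and "Suc s + n \<le> T"
  shows "(\<integral>\<^sup>+ w. ennreal (back_avg N (Suc s + n) (smooth N s k n) w) \<partial>W N) = cond_reject N s k"
proof -
  define d where "d = T - Suc s"
  have T: "T = Suc s + d" using s by (simp add: d_def)
  have "n \<le> d" using assms T by simp
  then show ?thesis
  proof (induction rule: inc_induct)
    case base
    have d: "Suc s + d \<le> T" using T by simp
    show ?case
      using back_avg_terminal(2)[OF N smooth_measurable_T[OF d] smooth_range, of k] smooth_mean[OF N s d, of k, folded T, unfolded future_real_T'] T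
      by simp
  next
    case (step n)
    have t: "Suc s + n < T" using step.hyps T by simp
    show ?case using index_law(2)[OF N t smooth_measurable smooth_range, of k] step.IH by simp
  qed
qed

definition survival :: "nat \<Rightarrow> nat \<Rightarrow> nat \<Rightarrow> 'w \<Rightarrow> real" where
  "survival N s k w = (\<Sum>l<N. survived N s k l w) / N"

lemma survival_nonneg: "0 \<le> survival N s k w"
  unfolding survival_def by (intro divide_nonneg_nonneg sum_nonneg survived_bounds) simp

lemma survival_measurable: assumes "1 \<le> N" "s < T" shows "survival N s k \<in> borel_measurable (W N)"
proof -
  have "(\<lambda>w. \<Sum>l<N. survived N s k l w) \<in> borel_measurable (W N)"
    using survived_measurable[OF assms] by (intro borel_measurable_sum) simp
  then show ?thesis unfolding survival_def[abs_def] by measurable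
qed

lemma survival_limit:
  assumes s: "s < T"
  shows "(\<lambda>N. \<integral>\<^sup>+ w. ennreal \<bar>HT N w * survival N s k w - enn2real (lim_survival s k)\<bar> \<partial>W N) \<longlonglongrightarrow> 0"
proof (rule L1_limit_transfer)
  show "(\<lambda>N. \<integral>\<^sup>+ w. ennreal \<bar>back_avg N (Suc s) (smooth N s k 0) w - enn2real (lim_survival s k)\<bar> \<partial>W N) \<longlonglongrightarrow> 0"
    using back_avg_smooth_limit[OF s, of 0 k] s by simp
  show "(\<lambda>w. HT N w * survival N s k w) \<in> borel_measurable (W N)" if "1 \<le> N" for N
    using survival_measurable[OF that s] H_measurable_W[OF that order_refl] by measurable
  show "back_avg N (Suc s) (smooth N s k 0) \<in> borel_measurable (W N)" if "1 \<le> N" for N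
    using smooth_measurable[of N s k 0] s by (intro back_avg_measurable[OF that]) simp_all
  show "evid T < \<infinity>" by (rule evid_finite) simp
  show "(\<integral>\<^sup>+ w. ennreal \<bar>HT N w * survival N s k w - back_avg N (Suc s) (smooth N s k 0) w\<bar> \<partial>W N) \<le> ennreal (1 / sqrt N) * evid T" if "1 \<le> N" for N
    using survived_law(1)[OF that s] by (simp add: survival_def)
qed

lemma survival_mean:
  assumes N: "1 \<le> N" and s: "s < T"
  shows "(\<integral>\<^sup>+ w. ennreal (HT N w * survival N s k w) \<partial>W N) = cond_reject N s k"
  using survived_law(2)[OF N s, of k] back_avg_smooth_mean[OF N s, of 0 k] s by (simp add: survival_def)

definition mean_trials :: "nat \<Rightarrow> nat \<Rightarrow> 'w \<Rightarrow> ennreal" where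
  "mean_trials s N w = ennreal_of_enat (total_trials N m \<sigma> (\<xi> N) (J N) (V N) (U N) s w) / of_nat N"

lemma mean_trials_eq:
  assumes "1 \<le> N" shows "mean_trials s N w = (\<Sum>k. ennreal (survival N s k w))"
proof -
  have e: "(\<Prod>j<k. if acc N s l j w then 0 else 1) = ennreal (survived N s k l w)" for k l
    unfolding survived_def by (subst prod_ennreal[symmetric]) (auto intro!: prod.cong)
  have t: "ennreal_of_enat (trials m \<sigma> (\<xi> N) (J N) (V N) (U N) s l w) = (\<Sum>k. ennreal (survived N s k l w))" for l
    unfolding ennreal_trials e ..
  have "ennreal_of_enat (total_trials N m \<sigma> (\<xi> N) (J N) (V N) (U N) s w) = (\<Sum>l<N. \<Sum>k. ennreal (survived N s k l w))"
    unfolding total_trials_def ennreal_of_enat_sum t ..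
  also have "\<dots> = (\<Sum>k. \<Sum>l<N. ennreal (survived N s k l w))"
    by (rule suminf_sum[symmetric]) (rule summableI)
  finally have "mean_trials s N w = (\<Sum>k. (\<Sum>l<N. ennreal (survived N s k l w)) / of_nat N)"
    unfolding mean_trials_def divide_ennreal_def by (simp only: ennreal_suminf_multc)
  moreover have "(\<Sum>l<N. ennreal (survived N s k l w)) / of_nat N = ennreal (survival N s k w)" for k
  proof -
    have "(\<Sum>l<N. ennreal (survived N s k l w)) = ennreal (\<Sum>l<N. survived N s k l w)"
      by (rule sum_ennreal) (rule survived_bounds)
    moreover have "0 \<le> (\<Sum>l<N. survived N s k l w)" by (intro sum_nonneg survived_bounds)
    ultimately show ?thesis using assms by (simp add: survival_def ennreal_of_nat_eq_real_of_nat divide_ennreal)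
  qed
  ultimately show ?thesis by simp
qed

text \<open>The partial sums of the survival frequencies serve as the lower approximations
  \<open>Y k\<close> of \<open>conv_in_prob_weighted\<close>. The argument closes because the bound
  on the exact means and the supremum of the limits are the same quantity, finite or not.\<close>

lemma mean_trials_conv:
  assumes s: "s < T" and supp: "predictive_support \<chi>0 \<nu> m G T s"
  shows "conv_in_prob W (mean_trials s) (ennreal \<sigma> * evid s * backward_mass \<nu> m G T s / evid T)"
proof -
  let ?Y = "\<lambda>k N w. \<Sum>i<k. survival N s i w" and ?l = "\<lambda>k. \<Sum>i<k. enn2real (lim_survival s i)"
  let ?L = "ennreal \<sigma> * evid s * backward_mass \<nu> m G T s"
  have "conv_in_prob W (mean_trials s) (?L / ennreal (Z T))"
  proof (rule conv_in_prob_weighted[where H=HT and Y="?Y" and l="?l", OF prob_W H_measurable_W[OF _ order_refl] H_nonneg])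
    show "mean_trials s N \<in> borel_measurable (W N)" if N: "1 \<le> N" for N
    proof -
      note [measurable] = survival_measurable[OF N s]
      have "(\<lambda>w. \<Sum>k. ennreal (survival N s k w)) \<in> borel_measurable (W N)" by measurable
      then show ?thesis by (simp add: mean_trials_eq[OF N, abs_def])
    qed
    show "?Y k N \<in> borel_measurable (W N)" if "1 \<le> N" for N k
      using survival_measurable[OF that s] by (intro borel_measurable_sum)
    show "0 \<le> ?Y k N w" for k N w by (intro sum_nonneg survival_nonneg)
    show "ennreal (?Y k N w) \<le> mean_trials s N w" if "1 \<le> N" for k N w
      unfolding mean_trials_eq[OF that]
      by (subst sum_ennreal[symmetric, OF survival_nonneg], rule sum_le_suminf) auto
    show "0 < Z T" by (rule Z_pos) simp
    show "(\<lambda>N. \<integral>\<^sup>+ w. ennreal \<bar>HT N w - Z T\<bar> \<partial>W N) \<longlonglongrightarrow> 0"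
    proof -
      have "(\<integral>\<^sup>+ z. ennreal (a T z) \<partial>target T) < \<infinity>" using evid_finite[of T] by (simp add: evid_def)
      from particle_lln[OF order_refl _ _ this] show ?thesis by (simp add: HT_eq Z_def evid_def a_nonneg)
    qed
    show "0 \<le> ?l k" for k by (intro sum_nonneg) simp
    show "(\<lambda>N. \<integral>\<^sup>+ w. ennreal \<bar>HT N w * ?Y k N w - ?l k\<bar> \<partial>W N) \<longlonglongrightarrow> 0" for k
    proof -
      have lim: "(\<lambda>N. \<Sum>i<k. \<integral>\<^sup>+ w. ennreal \<bar>HT N w * survival N s i w - enn2real (lim_survival s i)\<bar> \<partial>W N) \<longlonglongrightarrow> 0"
        using tendsto_sum[of "{..<k}" "\<lambda>i N. \<integral>\<^sup>+ w. ennreal \<bar>HT N w * survival N s i w - enn2real (lim_survival s i)\<bar> \<partial>W N" "\<lambda>_. 0"] survival_limit[OF s] by simp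
      show ?thesis
      proof (rule tendsto_sandwich[OF _ _ tendsto_const lim])
        show "\<forall>\<^sub>F N in sequentially. (\<integral>\<^sup>+ w. ennreal \<bar>HT N w * ?Y k N w - ?l k\<bar> \<partial>W N) \<le> (\<Sum>i<k. \<integral>\<^sup>+ w. ennreal \<bar>HT N w * survival N s i w - enn2real (lim_survival s i)\<bar> \<partial>W N)"
        proof (rule eventually_sequentiallyI[of 1])
          fix N :: nat assume N: "1 \<le> N"
          note [measurable] = survival_measurable[OF N s] H_measurable_W[OF N order_refl]
          have "(\<integral>\<^sup>+ w. ennreal \<bar>HT N w * ?Y k N w - ?l k\<bar> \<partial>W N) \<le> (\<integral>\<^sup>+ w. (\<Sum>i<k. ennreal \<bar>HT N w * survival N s i w - enn2real (lim_survival s i)\<bar>) \<partial>W N)"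
          proof (rule nn_integral_mono)
            fix w
            have "HT N w * ?Y k N w - ?l k = (\<Sum>i<k. HT N w * survival N s i w - enn2real (lim_survival s i))"
              by (simp add: sum_distrib_left sum_subtractf)
            then have "\<bar>HT N w * ?Y k N w - ?l k\<bar> \<le> (\<Sum>i<k. \<bar>HT N w * survival N s i w - enn2real (lim_survival s i)\<bar>)"
              by (simp only: sum_abs)
            then show "ennreal \<bar>HT N w * ?Y k N w - ?l k\<bar> \<le> (\<Sum>i<k. ennreal \<bar>HT N w * survival N s i w - enn2real (lim_survival s i)\<bar>)"
              by (subst sum_ennreal) (auto intro: ennreal_leI)
          qed
          also have "\<dots> = (\<Sum>i<k. \<integral>\<^sup>+ w. ennreal \<bar>HT N w * survival N s i w - enn2real (lim_survival s i)\<bar> \<partial>W N)"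
            by (rule nn_integral_sum) measurable
          finally show "(\<integral>\<^sup>+ w. ennreal \<bar>HT N w * ?Y k N w - ?l k\<bar> \<partial>W N) \<le> (\<Sum>i<k. \<integral>\<^sup>+ w. ennreal \<bar>HT N w * survival N s i w - enn2real (lim_survival s i)\<bar> \<partial>W N)" .
        qed
      qed auto
    qed
    have "ennreal (?l k) = (\<Sum>i<k. lim_survival s i)" for k
    proof -
      have "ennreal (?l k) = (\<Sum>i<k. ennreal (enn2real (lim_survival s i)))" by (rule sum_ennreal[symmetric]) simp
      also have "\<dots> = (\<Sum>i<k. lim_survival s i)" using lim_survival_finite[OF s] by (intro sum.cong refl ennreal_enn2real) simp
      finally show ?thesis .
    qed
    then show "?L = (SUP k. ennreal (?l k))" using lim_survival_SUP[OF s supp] by simp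
    show "(\<integral>\<^sup>+ w. ennreal (HT N w) * mean_trials s N w \<partial>W N) \<le> ?L" if N: "1 \<le> N" for N
    proof -
      note [measurable] = survival_measurable[OF N s] H_measurable_W[OF N order_refl]
      have "(\<integral>\<^sup>+ w. ennreal (HT N w) * mean_trials s N w \<partial>W N) = (\<integral>\<^sup>+ w. (\<Sum>k. ennreal (HT N w * survival N s k w)) \<partial>W N)"
        unfolding mean_trials_eq[OF N] ennreal_mult'[OF H_nonneg] ennreal_suminf_cmult ..
      also have "\<dots> = (\<Sum>k. \<integral>\<^sup>+ w. ennreal (HT N w * survival N s k w) \<partial>W N)"
        by (rule nn_integral_suminf) measurable
      also have "\<dots> = (SUP n. \<Sum>k<n. cond_reject N s k)"
        by (simp add: survival_mean[OF N s] suminf_eq_SUP)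
      also have "\<dots> \<le> ?L" by (rule SUP_least) (rule cond_reject_sum_le[OF N s])
      finally show ?thesis .
    qed
  qed
  then show ?thesis by (simp add: ennreal_Z)
qed

end

subsection \<open>The bootstrap and the fully adapted filter\<close>

context hidden_markov_model begin

lemma unnorm_filter_one_step:
  "unnorm_filter \<chi>0 Mk G t (\<lambda>x. \<integral>\<^sup>+ x'. ennreal (G (Suc t) x') * f x' \<partial>Mk x) = unnorm_filter \<chi>0 Mk G (Suc t) f"
proof -
  have "path_int Mk G t (Suc t - t) f = (\<lambda>x. \<integral>\<^sup>+ x'. ennreal (G (Suc t) x') * f x' \<partial>Mk x)"
    by (rule ext) (simp add: Suc_diff_le)
  then show ?thesis using unnorm_filter_path[of t "Suc t" f] by simp
qed

text \<open>The constant is the mass of the preceding unnormalized filter, and 1 at time 0. It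
  occurs twice in \<open>alpha\<close> and cancels; being a positive real, it does so also in
  extended arithmetic.\<close>

lemma pred_dist_lik:
  assumes "s \<le> T"
  shows "\<exists>c>0. \<forall>f. pred_dist \<chi>0 Mk G s (\<lambda>x. ennreal (G s x) * f x) = unnorm_filter \<chi>0 Mk G s f / ennreal c"
proof (cases s)
  case 0
  show ?thesis by (rule exI[of _ 1]) (simp add: 0 unnorm_filter_def divide_ennreal_def)
next
  case (Suc t)
  then have t: "t \<le> T" using assms by simp
  obtain c where c: "unnorm_filter \<chi>0 Mk G t (\<lambda>_. 1) = ennreal c" "0 < c"
    using evidence_pos'[OF t] evidence_finite[OF t] by (cases "unnorm_filter \<chi>0 Mk G t (\<lambda>_. 1)") auto
  show ?thesis
    using c(2) by (intro exI[of _ c]) (simp add: Suc filter_dist_def c(1) unnorm_filter_one_step)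
qed

lemma evidence_real:
  assumes "t \<le> T" obtains z where "unnorm_filter \<chi>0 Mk G t (\<lambda>_. 1) = ennreal z" "0 < z"
  using evidence_pos'[OF assms] evidence_finite[OF assms] by (cases "unnorm_filter \<chi>0 Mk G t (\<lambda>_. 1)") auto

text \<open>Division by a positive real is turned into multiplication, which can be rearranged
  freely even if the backward mass is infinite.\<close>

lemma ennreal_divide_real: "0 < r \<Longrightarrow> x / ennreal r = x * ennreal (1 / r)"
  by (simp add: divide_ennreal_def inverse_ennreal inverse_eq_divide)

lemma alpha_eq:
  assumes "s \<le> T"
  shows "alpha \<chi>0 \<nu> m G T \<sigma> s = ennreal \<sigma> * unnorm_filter \<chi>0 Mk G s (\<lambda>_. 1) * backward_mass \<nu> m G T s / unnorm_filter \<chi>0 Mk G T (\<lambda>_. 1)"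
proof -
  obtain z where z: "unnorm_filter \<chi>0 Mk G s (\<lambda>_. 1) = ennreal z" "0 < z" using evidence_real[OF assms] .
  obtain e where e: "unnorm_filter \<chi>0 Mk G T (\<lambda>_. 1) = ennreal e" "0 < e" using evidence_real[OF order_refl] .
  obtain c where c: "0 < c" "\<And>f. pred_dist \<chi>0 Mk G s (\<lambda>x. ennreal (G s x) * f x) = unnorm_filter \<chi>0 Mk G s f / ennreal c"
    using pred_dist_lik[OF assms] by blast
  have 1: "pred_dist \<chi>0 Mk G s (\<lambda>x. ennreal (G s x)) = ennreal (z / c)"
    using c(2)[of "\<lambda>_. 1"] z c(1) by (simp add: divide_ennreal)
  have 2: "pred_dist \<chi>0 Mk G s (\<lambda>x. ennreal (G s x) * path_int Mk G s (T - s) (\<lambda>_. 1) x) = ennreal (e / c)"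
    using c(2)[of "path_int Mk G s (T - s) (\<lambda>_. 1)"] unnorm_filter_path[OF assms, of "\<lambda>_. 1"] e c(1)
    by (simp add: divide_ennreal)
  have "ennreal (z / c) * (backward_mass \<nu> m G T s / ennreal (e / c)) = ennreal z * backward_mass \<nu> m G T s / ennreal e"
  proof -
    have "ennreal (z / c) * (backward_mass \<nu> m G T s / ennreal (e / c)) = ennreal (z / c) * ennreal (c / e) * backward_mass \<nu> m G T s"
      using e c by (subst ennreal_divide_real) (auto simp: mult_ac)
    also have "ennreal (z / c) * ennreal (c / e) = ennreal z * ennreal (1 / e)"
      using z e c by (simp add: ennreal_mult[symmetric])
    finally show ?thesis using e by (subst (2) ennreal_divide_real) (auto simp: mult_ac)
  qed
  from this[unfolded ennreal_times_divide[symmetric]] show ?thesis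
    unfolding alpha_def Let_def 1 2 z(1) e(1) by (simp only: mult.assoc ennreal_times_divide[symmetric])
qed

text \<open>The right-hand side is that of \<open>alpha_eq\<close>, so the two limits coincide and
  one convergence result serves both filters.\<close>

lemma beta_eq:
  assumes "s \<le> T"
  shows "beta \<chi>0 \<nu> m G T \<sigma> s = ennreal \<sigma> * unnorm_filter \<chi>0 Mk G s (\<lambda>_. 1) * backward_mass \<nu> m G T s / unnorm_filter \<chi>0 Mk G T (\<lambda>_. 1)"
proof -
  obtain z where z: "unnorm_filter \<chi>0 Mk G s (\<lambda>_. 1) = ennreal z" "0 < z" using evidence_real[OF assms] .
  obtain e where e: "unnorm_filter \<chi>0 Mk G T (\<lambda>_. 1) = ennreal e" "0 < e" using evidence_real[OF order_refl] .
  have 2: "filter_dist \<chi>0 Mk G s (path_int Mk G s (T - s) (\<lambda>_. 1)) = ennreal (e / z)"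
    unfolding filter_dist_def unnorm_filter_path[OF assms] z(1) e(1) using z e by (simp add: divide_ennreal)
  have "backward_mass \<nu> m G T s / ennreal (e / z) = ennreal z * backward_mass \<nu> m G T s / ennreal e"
  proof -
    have "backward_mass \<nu> m G T s / ennreal (e / z) = ennreal (z / e) * backward_mass \<nu> m G T s"
      using e z by (subst ennreal_divide_real) (auto simp: mult_ac)
    also have "ennreal (z / e) = ennreal z * ennreal (1 / e)"
      using z e by (simp add: ennreal_mult[symmetric])
    finally show ?thesis using e by (subst (2) ennreal_divide_real) (auto simp: mult_ac)
  qed
  from this[unfolded ennreal_times_divide[symmetric]] show ?thesis
    unfolding beta_def Let_def 2 z(1) e(1) by (simp only: mult.assoc ennreal_times_divide[symmetric])
qed

section \<open>Finiteness of the limits\<close>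

lemma path_int_bounded:
  assumes bounded: "\<And>x x'. m x x' \<le> \<sigma>" and fin: "\<And>u. u \<le> T \<Longrightarrow> (\<integral>\<^sup>+ x. ennreal (G u x) \<partial>\<nu>) < \<infinity>"
  shows "s + n \<le> T \<Longrightarrow> \<exists>C<\<infinity>. \<forall>x. path_int Mk G s n (\<lambda>_. 1) x \<le> C"
proof (induction n arbitrary: s)
  case 0 then show ?case by (intro exI[of _ 1]) auto
next
  case (Suc n)
  then obtain C where C: "C < \<infinity>" "\<And>x. path_int Mk G (Suc s) n (\<lambda>_. 1) x \<le> C" by force
  have [measurable]: "path_int Mk G (Suc s) n (\<lambda>_. 1) \<in> borel_measurable borel" by (rule path_int_measurable) simp
  \<comment> \<open>Bounding the transition density by \<open>\<sigma>\<close> leaves one integral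
    of the likelihood against \<open>\<nu>\<close> per step, independent of the starting
    point.\<close>
  have "path_int Mk G s (Suc n) (\<lambda>_. 1) x \<le> ennreal \<sigma> * (\<integral>\<^sup>+ x'. ennreal (G (Suc s) x') \<partial>\<nu>) * C" for x
  proof -
    have "path_int Mk G s (Suc n) (\<lambda>_. 1) x = (\<integral>\<^sup>+ x'. ennreal (m x x') * (ennreal (G (Suc s) x') * path_int Mk G (Suc s) n (\<lambda>_. 1) x') \<partial>\<nu>)"
      by (simp add: nn_integral_Mk)
    also have "\<dots> \<le> (\<integral>\<^sup>+ x'. ennreal \<sigma> * (ennreal (G (Suc s) x') * C) \<partial>\<nu>)"
      by (intro nn_integral_mono mult_mono ennreal_leI bounded C) auto
    also have "\<dots> = ennreal \<sigma> * (\<integral>\<^sup>+ x'. ennreal (G (Suc s) x') \<partial>\<nu>) * C"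
      by (simp add: nn_integral_cmult nn_integral_multc mult.assoc)
    finally show ?thesis .
  qed
  moreover have "ennreal \<sigma> * (\<integral>\<^sup>+ x'. ennreal (G (Suc s) x') \<partial>\<nu>) * C < \<infinity>"
    using fin[of "Suc s"] C Suc.prems by (simp add: ennreal_mult_less_top)
  ultimately show ?case by blast
qed

lemma backward_mass_finite:
  assumes bounded: "\<And>x x'. m x x' \<le> \<sigma>" and fin: "\<And>u. u \<le> T \<Longrightarrow> (\<integral>\<^sup>+ x. ennreal (G u x) \<partial>\<nu>) < \<infinity>" and s: "s < T"
  shows "backward_mass \<nu> m G T s < \<infinity>"
proof -
  obtain C where C: "C < \<infinity>" "\<And>x. path_int Mk G (Suc s) (T - Suc s) (\<lambda>_. 1) x \<le> C"
    using path_int_bounded[OF bounded fin, of "Suc s" "T - Suc s"] s by auto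
  have "backward_mass \<nu> m G T s \<le> (\<integral>\<^sup>+ x. ennreal (G (Suc s) x) * C \<partial>\<nu>)"
    unfolding backward_mass_def by (intro nn_integral_mono mult_left_mono C) simp
  also have "\<dots> = (\<integral>\<^sup>+ x. ennreal (G (Suc s) x) \<partial>\<nu>) * C" by (rule nn_integral_multc) measurable
  also have "\<dots> < \<infinity>" using fin[of "Suc s"] s C by (simp add: ennreal_mult_less_top)
  finally show ?thesis .
qed

lemma limit_finite:
  assumes "\<And>x x'. m x x' \<le> \<sigma>" "\<And>u. u \<le> T \<Longrightarrow> (\<integral>\<^sup>+ x. ennreal (G u x) \<partial>\<nu>) < \<infinity>" "s < T"
  shows "ennreal \<sigma> * unnorm_filter \<chi>0 Mk G s (\<lambda>_. 1) * backward_mass \<nu> m G T s / unnorm_filter \<chi>0 Mk G T (\<lambda>_. 1) < \<infinity>"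
proof -
  obtain e where e: "unnorm_filter \<chi>0 Mk G T (\<lambda>_. 1) = ennreal e" "0 < e" using evidence_real[OF order_refl] .
  show ?thesis
    using backward_mass_finite[OF assms] evidence_finite[of s] assms(3) unfolding e(1) ennreal_divide_real[OF e(2)]
    by (simp add: ennreal_mult_less_top)
qed

section \<open>The two filters as instances of the common frame\<close>

lemma bootstrap_adapted:
  fixes W :: "nat \<Rightarrow> 'w measure"
  assumes bounded: "\<And>x x'. m x x' \<le> \<sigma>"
    and systems: "\<And>N. 1 \<le> N \<Longrightarrow> fast_ffbsi \<chi>0 \<nu> m g y T \<sigma> \<chi>0 (\<lambda>t x. 1) (\<lambda>t. m) N (W N) (\<xi> N) (I N) (J N) (V N) (U N)"
  shows "adapted_ffbsi \<chi>0 \<nu> m g y T \<sigma> \<chi>0 (\<lambda>t x. 1) (\<lambda>t. m) G (\<lambda>_ _. 1) W \<xi> I J V U"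
proof (intro adapted_ffbsi.intro adapted_ffbsi_axioms.intro)
  interpret chi: prob_space \<chi>0 by (rule init_prob)
  have "AE x in \<chi>0. 1 = RN_deriv \<chi>0 \<chi>0 x"
    by (rule chi.RN_deriv_unique) (auto simp: density_1)
  then show "AE x in \<chi>0. enn2real (RN_deriv \<chi>0 \<chi>0 x) * G 0 x = G 0 x"
    by eventually_elim (metis enn2real_1 mult_1)
  show "\<chi>0 = density \<chi>0 (\<lambda>x. ennreal 1)" by (simp add: density_1)
qed (use systems bounded G_nonneg in \<open>auto intro: hidden_markov_model_axioms\<close>)

lemma fully_adapted_adapted:
  fixes W :: "nat \<Rightarrow> 'w measure"
  assumes bounded: "\<And>x x'. m x x' \<le> \<sigma>"
    and systems: "\<And>N. 1 \<le> N \<Longrightarrow> fast_ffbsi \<chi>0 \<nu> m g y T \<sigma> (fa_init \<chi>0 G) (fa_adj \<nu> m G) (fa_prop \<nu> m G) N (W N) (\<xi> N) (I N) (J N) (V N) (U N)"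
    and c: "c = enn2real (\<integral>\<^sup>+ x. ennreal (G 0 x) \<partial>\<chi>0)"
  shows "adapted_ffbsi \<chi>0 \<nu> m g y T \<sigma> (fa_init \<chi>0 G) (fa_adj \<nu> m G) (fa_prop \<nu> m G)
    (\<lambda>t _. if t = 0 then c else 1) (\<lambda>t x. if t = 0 then G 0 x / c else G t x) W \<xi> I J V U"
proof (intro adapted_ffbsi.intro adapted_ffbsi_axioms.intro)
  interpret chi: prob_space \<chi>0 by (rule init_prob)
  have pf: "auxiliary_particle_filter \<chi>0 \<nu> m g y T (fa_init \<chi>0 G) (fa_adj \<nu> m G) (fa_prop \<nu> m G) 1 (W 1) (\<xi> 1) (I 1)"
    by (rule fast_ffbsi.axioms(1)[OF systems]) simp
  interpret rho: prob_space "fa_init \<chi>0 G" by (rule auxiliary_particle_filter.instr_prob[OF pf])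
  have "unnorm_filter \<chi>0 Mk G 0 (\<lambda>_. 1) = (\<integral>\<^sup>+ x. ennreal (G 0 x) \<partial>\<chi>0)" by (simp add: unnorm_filter_def)
  then have ci: "(\<integral>\<^sup>+ x. ennreal (G 0 x) \<partial>\<chi>0) = ennreal c" and cpos: "0 < c"
    using evidence_pos'[of 0] evidence_finite[of 0] by (auto simp: c less_top enn2real_positive_iff)
  have init: "fa_init \<chi>0 G = density \<chi>0 (\<lambda>x. ennreal (G 0 x / c))"
    unfolding fa_init_def law_prop_to_def ci using cpos by (simp add: divide_ennreal G_nonneg)
  show "fa_init \<chi>0 G = density \<chi>0 (\<lambda>x. ennreal (if 0 = (0::nat) then G 0 x / c else G 0 x))" using init by simp
  \<comment> \<open>Domination of \<open>\<chi>0\<close> by an initial law with density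
    \<open>G 0 / c\<close> forces \<open>G 0\<close> to be positive almost everywhere under
    \<open>\<chi>0\<close>. The Radon-Nikodym derivative is then \<open>c / G 0\<close>, and the
    initial weights are constantly \<open>c\<close>.\<close>
  have ac: "absolutely_continuous (fa_init \<chi>0 G) \<chi>0" by (rule auxiliary_particle_filter.instr_dominates[OF pf])
  have srho[measurable_cong]: "sets (fa_init \<chi>0 G) = sets borel" unfolding init by (simp add: init_sets)
  have "AE x in fa_init \<chi>0 G. G 0 x \<noteq> 0"
    unfolding init by (subst AE_density) auto
  then have rpos: "AE x in fa_init \<chi>0 G. 0 < G 0 x" by eventually_elim (metis G_nonneg order_le_less)
  have "AE x in \<chi>0. 0 < G 0 x"
    by (rule absolutely_continuous_AE[OF _ ac rpos]) (simp add: srho init_sets)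
  then have "density (fa_init \<chi>0 G) (\<lambda>x. ennreal (c / G 0 x)) = density \<chi>0 (\<lambda>_. 1)"
    unfolding init using cpos
    by (subst density_density_eq) (auto intro!: density_cong elim!: eventually_mono simp: ennreal_mult[symmetric])
  then have "AE x in fa_init \<chi>0 G. ennreal (c / G 0 x) = RN_deriv (fa_init \<chi>0 G) \<chi>0 x"
    by (intro rho.RN_deriv_unique) (auto simp: density_1)
  with rpos show "AE x in fa_init \<chi>0 G. enn2real (RN_deriv (fa_init \<chi>0 G) \<chi>0 x) * G 0 x = (if 0 = (0::nat) then c else 1)"
  proof eventually_elim
    case (elim x)
    then show ?case using cpos by (simp flip: elim(2))
  qed
  show "fa_adj \<nu> m G t x * fa_prop \<nu> m G t x x' = m x x' * (if t = 0 then G 0 x' / c else G t x')" if "1 \<le> t" "t \<le> T" for t x x'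
    using auxiliary_particle_filter.adj_pos[OF pf that, of x] that by (simp add: fa_prop_def)
  show "(\<lambda>x. if t = 0 then G 0 x / c else G t x) \<in> borel_measurable borel" for t
    by (cases "t = 0") simp_all
  show "0 \<le> (if t = 0 then c else 1)" for t :: nat using cpos by simp
  show "0 \<le> (if t = 0 then G 0 x / c else G t x)" for t x using cpos G_nonneg by simp
  show "G t x = (if t = 0 then c else 1) * (if t = 0 then G 0 x / c else G t x)" for t x using cpos by simp
qed (use systems bounded in \<open>auto intro: hidden_markov_model_axioms\<close>)

end

theorem proposition1:
  fixes \<chi>0 \<nu> :: "'x::polish_space measure"
    and m :: "'x \<Rightarrow> 'x \<Rightarrow> real"
    and g :: "'x \<Rightarrow> 'y::polish_space \<Rightarrow> real"
    and y :: "nat \<Rightarrow> 'y"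
    and T s :: nat
    and \<sigma> :: real
    and W :: "nat \<Rightarrow> 'w measure"
    and \<xi> :: "nat \<Rightarrow> nat \<Rightarrow> nat \<Rightarrow> 'w \<Rightarrow> 'x"
    and I J :: "nat \<Rightarrow> nat \<Rightarrow> nat \<Rightarrow> 'w \<Rightarrow> nat"
    and V :: "nat \<Rightarrow> nat \<Rightarrow> nat \<Rightarrow> nat \<Rightarrow> 'w \<Rightarrow> nat"
    and U :: "nat \<Rightarrow> nat \<Rightarrow> nat \<Rightarrow> nat \<Rightarrow> 'w \<Rightarrow> real"
  assumes hmm: "hidden_markov_model \<chi>0 \<nu> m g y T"
    and bounded: "\<And>x x'. m x x' \<le> \<sigma>"
    and time: "s < T"
  shows
    "(predictive_support \<chi>0 \<nu> m (obs_lik g y) T s \<longrightarrow>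
       ((\<forall>N\<ge>1. fast_ffbsi \<chi>0 \<nu> m g y T \<sigma> \<chi>0 (\<lambda>t x. 1) (\<lambda>t. m)
                 N (W N) (\<xi> N) (I N) (J N) (V N) (U N)) \<longrightarrow>
          conv_in_prob W
            (\<lambda>N w. ennreal_of_enat (total_trials N m \<sigma> (\<xi> N) (J N) (V N) (U N) s w) / of_nat N)
            (alpha \<chi>0 \<nu> m (obs_lik g y) T \<sigma> s)) \<and>
       ((\<forall>N\<ge>1. fast_ffbsi \<chi>0 \<nu> m g y T \<sigma> (fa_init \<chi>0 (obs_lik g y))
                 (fa_adj \<nu> m (obs_lik g y)) (fa_prop \<nu> m (obs_lik g y))
                 N (W N) (\<xi> N) (I N) (J N) (V N) (U N)) \<longrightarrow>
          conv_in_prob W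
            (\<lambda>N w. ennreal_of_enat (total_trials N m \<sigma> (\<xi> N) (J N) (V N) (U N) s w) / of_nat N)
            (beta \<chi>0 \<nu> m (obs_lik g y) T \<sigma> s))) \<and>
     ((\<forall>u\<le>T. (\<integral>\<^sup>+ x. ennreal (obs_lik g y u x) \<partial>\<nu>) < \<infinity>) \<longrightarrow>
       alpha \<chi>0 \<nu> m (obs_lik g y) T \<sigma> s < \<infinity> \<and> beta \<chi>0 \<nu> m (obs_lik g y) T \<sigma> s < \<infinity>)"
proof -
  interpret hidden_markov_model \<chi>0 \<nu> m g y T by (rule hmm)
  have s: "s \<le> T" using time by simp
  \<comment> \<open>The limit is stated with the unnormalized filter, which does not refer to the
    factorization, so that the same formula covers both instances.\<close>
  have core: "conv_in_prob W
      (\<lambda>N w. ennreal_of_enat (total_trials N m \<sigma> (\<xi> N) (J N) (V N) (U N) s w) / of_nat N)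
      (ennreal \<sigma> * unnorm_filter \<chi>0 Mk G s (\<lambda>_. 1) * backward_mass \<nu> m G T s / unnorm_filter \<chi>0 Mk G T (\<lambda>_. 1))"
    if "predictive_support \<chi>0 \<nu> m G T s" "adapted_ffbsi \<chi>0 \<nu> m g y T \<sigma> \<rho>0 \<theta> p a b W \<xi> I J V U" for \<rho>0 \<theta> p a b
  proof -
    interpret A: adapted_ffbsi \<chi>0 \<nu> m g y T \<sigma> \<rho>0 \<theta> p a b W \<xi> I J V U by (rule that(2))
    show ?thesis using A.mean_trials_conv[OF time that(1)]
      by (simp add: A.evid_eq[OF s] A.evid_eq[OF order_refl] A.mean_trials_def[abs_def])
  qed
  show ?thesis
    unfolding alpha_eq[OF s] beta_eq[OF s]
    using core bootstrap_adapted[OF bounded] fully_adapted_adapted[OF bounded _ refl] limit_finite[OF bounded _ time]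
    by blast
qed

end
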